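(* For every $\eta>0$ and every polynomial function $\psi:(0,1)\to(0,1)$, there exists $\delta>0$ such that the following holds for every $3$-graph $\mathcal{H}$. There is a subset $U\subseteq V(\mathcal{H})$ and a graph $G$ with vertex set $U$ such that $|U|\geq\delta|V(\mathcal{H})|$, $e(G)\geq\delta|U|^2$, and $\mathcal{H}[U,G]$ is $(\eta,\psi)$-quasirandom. Moreover, we may take $1/\delta\leq\mathrm{twr}\bigl(2^{2^{\mathrm{poly}(1/\eta)}}\bigr)$.
   Context: A 3-graph is a 3-uniform hypergraph. $e(G)$ is the number of edges of $G$ and $\Delta(G)$ its set of triangles. $\mathcal{H}[U,G]$ is the 3-graph with vertex set $U$ whose hyperedges are the hyperedges of $\mathcal{H}$ lying in $\Delta(G)$. Graph quasirandomness: for vertex sets $X,Y$ of a graph $G$, $d_G(X,Y)=|\{(x,y)\in X\times Y: xy\in E(G)\}|/(|X||Y|)$. A function $f:X\times Y\to[-1,1]$ is $\alpha$-quasirandom if $\sum_{x,x'\in X}\sum_{y,y'\in Y}f(x,y)f(x',y)f(x,y')f(x',y')\le\alpha|X|^2|Y|^2$. The pair $(X,Y)$ is $\alpha$-quasirandom in $G$ if $f(x,y)=\mathbf{1}_{xy\in E(G)}-d_G(X,Y)$ is. A tripartite graph with parts $X,Y,Z$ is $\alpha$-quasirandom if each of the three pairs of parts is; its product density is $\delta(G)=d_G(X,Y)d_G(X,Z)d_G(Y,Z)$. Tripartite chains: a tripartite chain $(G,\mathcal{H})$ with parts $X,Y,Z$ consists of a tripartite graph $G$ and a tripartite 3-graph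 $\mathcal{H}$ with these parts and $E(\mathcal{H})\subseteq\Delta(G)$; $d(\mathcal{H}\mid G)=|E(\mathcal{H})|/|\Delta(G)|$ (with $0/0=0$). $\mathcal{H}$ is $\eta$-quasirandom relative to $G$ if, with $f(x,y,z)=(\mathbf{1}_{xyz\in E(\mathcal{H})}-d(\mathcal{H}\mid G))\mathbf{1}_{xyz\in\Delta(G)}$, the sum over $x,x'\in X$, $y,y'\in Y$, $z,z'\in Z$ of the product of the eight values $f(u,v,w)$, $u\in\{x,x'\},v\in\{y,y'\},w\in\{z,z'\}$ (one factor for each of the $8$ choices of symbols), is at most $\eta\,\delta(G)^4|X|^2|Y|^2|Z|^2$. The chain is $(\eta,\psi)$-quasirandom if $\mathcal{H}$ is $\eta$-quasirandom relative to $G$ and $G$ is $\psi(\delta(G))$-quasirandom. $\mathcal{H}[U,G]$ is called $(\eta,\psi)$-quasirandom if the following tripartite chain is: the parts are three disjoint copies $U^1,U^2,U^3$ of $U$; for $a\ne b$ the vertices $x\in U^a$, $y\in U^b$ are adjacent iff $xy\in E(G)$; and the hyperedges are the triples $(x,y,z)\in U^1\times U^2\times U^3$ corresponding to hyperedges of $\mathcal{H}[U,G]$. Here $\mathrm{poly}(1/\eta)$ denotes a quantity bounded by a polynomial in $1/\eta$, with $\psi$ regarded as fixed. Tower function: $\mathrm{twr}(0)=1$, $\mathrm{twr}(x+1)=2^{\mathrm{twr}(x)}$ for $x\ge0$ (non-integer arguments may be rounded up).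
   Formalization: The claim is proved for every 3-graph with at least 1/δ vertices (same δ, same tower bound) rather than for every 3-graph, since it fails for small ones, e.g. a single vertex, where no nonempty U carries a graph with an edge. *)

theory Defs
  imports Complex_Main "HOL-Computational_Algebra.Polynomial" "HOL-Library.FuncSet"
begin

section \<open>Graphs and 3-graphs\<close>

record 'a hgraph =
  vertices :: "'a set"
  edges :: "'a set set"

definition uniform_hgraph :: "nat \<Rightarrow> 'a hgraph \<Rightarrow> bool" where
  "uniform_hgraph k H \<longleftrightarrow>
     finite (vertices H) \<and> (\<forall>e\<in>edges H. e \<subseteq> vertices H \<and> card e = k)"

abbreviation simple_graph :: "'a hgraph \<Rightarrow> bool" where
  "simple_graph \<equiv> uniform_hgraph 2"

abbreviation three_graph :: "'a hgraph \<Rightarrow> bool" where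
  "three_graph \<equiv> uniform_hgraph 3"

definition triangles :: "'a hgraph \<Rightarrow> 'a set set" where
  "triangles G =
     {T. T \<subseteq> vertices G \<and> card T = 3 \<and> (\<forall>x\<in>T. \<forall>y\<in>T. x \<noteq> y \<longrightarrow> {x, y} \<in> edges G)}"

text \<open>The 3-graph written \<open>H[U,G]\<close>; it is only used when \<open>U\<close> is the vertex set of \<open>G\<close>.\<close>

definition restrict_to :: "'a hgraph \<Rightarrow> 'a set \<Rightarrow> 'a hgraph \<Rightarrow> 'a hgraph" where
  "restrict_to H U G = \<lparr>vertices = U, edges = edges H \<inter> triangles G\<rparr>"

section \<open>Quasirandom graphs\<close>

definition density :: "'a hgraph \<Rightarrow> 'a set \<Rightarrow> 'a set \<Rightarrow> real" where
  "density G X Y =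
     real (card {(x, y). x \<in> X \<and> y \<in> Y \<and> {x, y} \<in> edges G}) / (real (card X) * real (card Y))"

definition quasirandom_fun ::
  "real \<Rightarrow> 'a set \<Rightarrow> 'b set \<Rightarrow> ('a \<Rightarrow> 'b \<Rightarrow> real) \<Rightarrow> bool" where
  "quasirandom_fun \<alpha> X Y f \<longleftrightarrow>
     (\<Sum>x\<in>X. \<Sum>x'\<in>X. \<Sum>y\<in>Y. \<Sum>y'\<in>Y. f x y * f x' y * f x y' * f x' y')
       \<le> \<alpha> * real (card X) ^ 2 * real (card Y) ^ 2"

definition quasirandom_pair :: "real \<Rightarrow> 'a hgraph \<Rightarrow> 'a set \<Rightarrow> 'a set \<Rightarrow> bool" where
  "quasirandom_pair \<alpha> G X Y \<longleftrightarrow>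
     quasirandom_fun \<alpha> X Y (\<lambda>x y. of_bool ({x, y} \<in> edges G) - density G X Y)"

definition quasirandom_tripartite ::
  "real \<Rightarrow> 'a hgraph \<Rightarrow> 'a set \<Rightarrow> 'a set \<Rightarrow> 'a set \<Rightarrow> bool" where
  "quasirandom_tripartite \<alpha> G X Y Z \<longleftrightarrow>
     quasirandom_pair \<alpha> G X Y \<and> quasirandom_pair \<alpha> G X Z \<and> quasirandom_pair \<alpha> G Y Z"

definition product_density :: "'a hgraph \<Rightarrow> 'a set \<Rightarrow> 'a set \<Rightarrow> 'a set \<Rightarrow> real" where
  "product_density G X Y Z = density G X Y * density G X Z * density G Y Z"

section \<open>Tripartite chains\<close>

definition tripartite :: "'a set \<Rightarrow> 'a set \<Rightarrow> 'a set \<Rightarrow> 'a hgraph \<Rightarrow> bool" where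
  "tripartite X Y Z F \<longleftrightarrow>
     X \<inter> Y = {} \<and> X \<inter> Z = {} \<and> Y \<inter> Z = {} \<and> vertices F = X \<union> Y \<union> Z \<and>
     (\<forall>e\<in>edges F. \<forall>P\<in>{X, Y, Z}. card (e \<inter> P) \<le> 1)"

definition tripartite_chain ::
  "'a hgraph \<Rightarrow> 'a hgraph \<Rightarrow> 'a set \<Rightarrow> 'a set \<Rightarrow> 'a set \<Rightarrow> bool" where
  "tripartite_chain G H X Y Z \<longleftrightarrow>
     simple_graph G \<and> three_graph H \<and> tripartite X Y Z G \<and> tripartite X Y Z H \<and>
     edges H \<subseteq> triangles G"

definition rel_density :: "'a hgraph \<Rightarrow> 'a hgraph \<Rightarrow> real" where
  "rel_density H G = real (card (edges H)) / real (card (triangles G))"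

definition rel_balanced :: "'a hgraph \<Rightarrow> 'a hgraph \<Rightarrow> 'a \<Rightarrow> 'a \<Rightarrow> 'a \<Rightarrow> real" where
  "rel_balanced H G x y z =
     (of_bool ({x, y, z} \<in> edges H) - rel_density H G) * of_bool ({x, y, z} \<in> triangles G)"

definition rel_quasirandom ::
  "real \<Rightarrow> 'a hgraph \<Rightarrow> 'a hgraph \<Rightarrow> 'a set \<Rightarrow> 'a set \<Rightarrow> 'a set \<Rightarrow> bool" where
  "rel_quasirandom \<eta> H G X Y Z \<longleftrightarrow>
     (let f = rel_balanced H G in
       (\<Sum>x\<in>X. \<Sum>x'\<in>X. \<Sum>y\<in>Y. \<Sum>y'\<in>Y. \<Sum>z\<in>Z. \<Sum>z'\<in>Z.
          f x y z * f x y z' * f x y' z * f x y' z' *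
          f x' y z * f x' y z' * f x' y' z * f x' y' z')
       \<le> \<eta> * product_density G X Y Z ^ 4 *
           real (card X) ^ 2 * real (card Y) ^ 2 * real (card Z) ^ 2)"

definition quasirandom_chain ::
  "real \<Rightarrow> (real \<Rightarrow> real) \<Rightarrow> 'a hgraph \<Rightarrow> 'a hgraph \<Rightarrow> 'a set \<Rightarrow> 'a set \<Rightarrow> 'a set \<Rightarrow> bool" where
  "quasirandom_chain \<eta> \<psi> G H X Y Z \<longleftrightarrow>
     tripartite_chain G H X Y Z \<and> rel_quasirandom \<eta> H G X Y Z \<and>
     quasirandom_tripartite (\<psi> (product_density G X Y Z)) G X Y Z"

section \<open>The chain on three copies of a vertex set\<close>

definition copy :: "'a set \<Rightarrow> nat \<Rightarrow> ('a \<times> nat) set" where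
  "copy U a = U \<times> {a}"

definition copies_graph :: "'a hgraph \<Rightarrow> ('a \<times> nat) hgraph" where
  "copies_graph G =
     \<lparr>vertices = copy (vertices G) 1 \<union> copy (vertices G) 2 \<union> copy (vertices G) 3,
      edges = {{(x, a), (y, b)} | x y a b.
                 a \<in> {1, 2, 3} \<and> b \<in> {1, 2, 3} \<and> a \<noteq> b \<and> {x, y} \<in> edges G}\<rparr>"

definition copies_three_graph :: "'a hgraph \<Rightarrow> ('a \<times> nat) hgraph" where
  "copies_three_graph H =
     \<lparr>vertices = copy (vertices H) 1 \<union> copy (vertices H) 2 \<union> copy (vertices H) 3,
      edges = {{(x, 1), (y, 2), (z, 3)} | x y z. {x, y, z} \<in> edges H}\<rparr>"

definition quasirandom_restriction ::
  "real \<Rightarrow> (real \<Rightarrow> real) \<Rightarrow> 'a hgraph \<Rightarrow> 'a set \<Rightarrow> 'a hgraph \<Rightarrow> bool" where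
  "quasirandom_restriction \<eta> \<psi> H U G \<longleftrightarrow>
     quasirandom_chain \<eta> \<psi> (copies_graph G) (copies_three_graph (restrict_to H U G))
       (copy U 1) (copy U 2) (copy U 3)"

text \<open>The conjunct \<^const>\<open>tripartite_chain\<close> in \<^const>\<open>quasirandom_chain\<close> is automatic here.\<close>

lemma card_insert3_eq_3:
  assumes "card {x, y, z} = 3"
  shows "x \<noteq> y \<and> x \<noteq> z \<and> y \<noteq> z"
  using assms by (auto simp: card_insert_if split: if_splits)

lemma tripartite_chain_copies:
  assumes G: "simple_graph G" "vertices G = U"
  shows "tripartite_chain (copies_graph G) (copies_three_graph (restrict_to H U G))
           (copy U 1) (copy U 2) (copy U 3)"
proof -
  have fin: "finite U" using G by (auto simp: uniform_hgraph_def)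
  have sub: "x \<in> U \<and> y \<in> U" if "{x, y} \<in> edges G" for x y
    using that G by (auto simp: uniform_hgraph_def)
  have "simple_graph (copies_graph G)"
    using fin sub G(2) by (fastforce simp: uniform_hgraph_def copies_graph_def copy_def)
  moreover have "three_graph (copies_three_graph (restrict_to H U G))"
    using fin G(2)
    by (auto simp: uniform_hgraph_def copies_three_graph_def copy_def restrict_to_def
        triangles_def)
  moreover have "tripartite (copy U 1) (copy U 2) (copy U 3) (copies_graph G)"
    using G(2) by (auto simp: tripartite_def copies_graph_def copy_def Int_insert_left)
  moreover have "tripartite (copy U 1) (copy U 2) (copy U 3)
      (copies_three_graph (restrict_to H U G))"
    by (auto simp: tripartite_def copies_three_graph_def restrict_to_def copy_def
        Int_insert_left)
  moreover have "e \<in> triangles (copies_graph G)"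
    if e': "e \<in> edges (copies_three_graph (restrict_to H U G))" for e
  proof -
    obtain x y z where e: "e = {(x, 1), (y, 2), (z, 3)}" and t: "{x, y, z} \<in> triangles G"
      using e' by (auto simp: copies_three_graph_def restrict_to_def)
    have "x \<noteq> y \<and> x \<noteq> z \<and> y \<noteq> z"
      using t by (intro card_insert3_eq_3) (simp add: triangles_def)
    then have g: "{x, y} \<in> edges G" "{x, z} \<in> edges G" "{y, z} \<in> edges G"
      using t by (auto simp: triangles_def)
    have c: "{(u, a), (v, b)} \<in> edges (copies_graph G)"
      if "{u, v} \<in> edges G" "a \<in> {1, 2, 3}" "b \<in> {1, 2, 3}" "a \<noteq> b" for u v a b
      using that unfolding copies_graph_def by simp blast
    show ?thesis
      unfolding triangles_def e
      using c[OF g(1), of 1 2] c[OF g(2), of 1 3] c[OF g(3), of 2 3] sub[OF g(1)] sub[OF g(3)] G(2)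
      by (auto simp: insert_commute) (auto simp: copies_graph_def copy_def)
  qed
  ultimately show ?thesis
    by (auto simp: tripartite_chain_def)
qed

section \<open>The tower function\<close>

fun twr_nat :: "nat \<Rightarrow> real" where
  "twr_nat 0 = 1"
| "twr_nat (Suc n) = 2 powr twr_nat n"

definition twr :: "real \<Rightarrow> real" where
  "twr x = twr_nat (nat \<lceil>x\<rceil>)"

end

(*
A Ramsey argument on top of a hypergraph regularity argument that keeps a single cell of the
partition. Split V(H) into t parts and colour the pairs of vertices. Alternately shrink all parts to
pieces of equal size until every colour class between two parts is cut-regular, and refine the
colouring until H minus its average over equally coloured triangles has small cut norm. The mean
square of that average over all triples of parts is bounded and essentially never drops, so after
poly(t, 1/eta) rounds a refinement hardly changes it. A round costs boundedly many exponentials,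
whence the tower. Now read one colour per pair of parts off a random tuple of vertices: on the
triangles in the chosen colours, H is a constant plus a part small in L^1 plus a part small in cut
norm, for each triple of parts. As t is a Ramsey number for triples, doubly exponential in
poly(1/eta), there are m = O(1/eta) parts for which the constants almost agree. U is their union. The
chosen colour classes are scaled to a common density, the parts are filled with the same density,
and this weighted graph is rounded to G. In the octahedron sum only one of the eight factors is
decomposed as above: the other seven annihilate its cut-norm part, and the rest is estimated by
counting the nine edges outside the triangle of that factor.
*)

theory Submission
  imports Defs "HOL-Analysis.Convex"
begin

section \<open>Averages over the cells of a partition\<close>

text \<open>The obstacle is the order in which the errors must be small. A chosen colour class may
  have density as low as \<open>1 / (4 * t ^ 2 * K)\<close> with \<open>K\<close> colours, and
  everything on its triangles is measured against powers of that density; but refining a colouring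
  until \<open>h\<close> is regular multiplies \<open>K\<close> by an exponential. Hence two
  colourings: the graph is built from a coarse \<open>\<chi>\<close> with \<open>K\<close> colours,
  while the cut-norm error belongs to a refinement \<open>\<chi>'\<close> and can be made smaller
  than any fixed power of \<open>1 / K\<close>. The price is the difference of the two averages. It
  is controlled only in mean square, by an energy gap whose bound does not involve \<open>K\<close>,
  and this suffices because only its average over the chosen triangles matters. Passing to one box
  keeps a round cheap: failures of graph regularity divide the size of the parts but never multiply
  their number. All thresholds of a round are powers of one number \<open>y\<close>, and the next
  round has \<open>2 ^ (y ^ C)\<close> in its place. The number of rounds is polynomial in
  \<open>t\<close> and \<open>1 / \<eta>\<close>, which is the source of the tower height. The
  function \<open>\<psi>\<close> enters only through a bound \<open>c * x ^ a \<le> \<psi> x\<close>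
  for \<open>0 < x \<le> 1 / 2\<close>.\<close>

definition cavg :: "'b set \<Rightarrow> ('b \<Rightarrow> 'k) \<Rightarrow> ('b \<Rightarrow> real) \<Rightarrow> 'b \<Rightarrow> real" where
  "cavg \<Omega> key f \<omega> =
     (\<Sum>w\<in>{w\<in>\<Omega>. key w = key \<omega>}. f w) / real (card {w\<in>\<Omega>. key w = key \<omega>})"

lemma cavg_cong: "key \<omega> = key \<omega>' \<Longrightarrow> cavg \<Omega> key f \<omega> = cavg \<Omega> key f \<omega>'"
  by (simp add: cavg_def)

lemma cavg_bounds:
  assumes "\<And>w. w \<in> \<Omega> \<Longrightarrow> 0 \<le> f w \<and> f w \<le> 1"
  shows "0 \<le> cavg \<Omega> key f \<omega>" "cavg \<Omega> key f \<omega> \<le> 1"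
proof -
  show "0 \<le> cavg \<Omega> key f \<omega>"
    unfolding cavg_def by (intro divide_nonneg_nonneg sum_nonneg) (use assms in auto)
  have "(\<Sum>w\<in>{w\<in>\<Omega>. key w = key \<omega>}. f w) \<le> (\<Sum>w\<in>{w\<in>\<Omega>. key w = key \<omega>}. 1)"
    by (rule sum_mono) (use assms in auto)
  thus "cavg \<Omega> key f \<omega> \<le> 1"
    by (auto simp: cavg_def divide_le_eq)
qed

text \<open>\<open>cavg\<close> is a conditional expectation: a test function that is constant on
  the cells does not see the averaging. The double sum spreads each value
  \<open>f w * \<phi> w\<close> evenly over the cell of \<open>w\<close>, and swapping the sums
  collects it again.\<close>

lemma cavg_project:
  assumes fin: "finite \<Omega>"
    and meas: "\<And>v w. v \<in> \<Omega> \<Longrightarrow> w \<in> \<Omega> \<Longrightarrow> key v = key w \<Longrightarrow> \<phi> v = \<phi> w"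
  shows "(\<Sum>\<omega>\<in>\<Omega>. cavg \<Omega> key f \<omega> * \<phi> \<omega>) = (\<Sum>\<omega>\<in>\<Omega>. f \<omega> * \<phi> \<omega>)"
proof -
  let ?c = "\<lambda>\<omega>. {w\<in>\<Omega>. key w = key \<omega>}"
  have "(\<Sum>\<omega>\<in>\<Omega>. cavg \<Omega> key f \<omega> * \<phi> \<omega>)
      = (\<Sum>\<omega>\<in>\<Omega>. \<Sum>w\<in>\<Omega>. if key w = key \<omega> then f w * \<phi> w / real (card (?c w)) else 0)"
  proof (rule sum.cong[OF refl])
    fix \<omega> assume w: "\<omega> \<in> \<Omega>"
    have "cavg \<Omega> key f \<omega> * \<phi> \<omega> = (\<Sum>w\<in>?c \<omega>. f w * \<phi> \<omega> / real (card (?c \<omega>)))"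
      unfolding cavg_def by (simp add: sum_divide_distrib sum_distrib_right)
    also have "\<dots> = (\<Sum>w\<in>?c \<omega>. f w * \<phi> w / real (card (?c w)))"
    proof (rule sum.cong[OF refl])
      fix v assume v: "v \<in> ?c \<omega>"
      hence "\<phi> v = \<phi> \<omega>" using w by (intro meas) auto
      moreover have "?c v = ?c \<omega>" using v by auto
      ultimately show "f v * \<phi> \<omega> / real (card (?c \<omega>)) = f v * \<phi> v / real (card (?c v))" by simp
    qed
    also have "\<dots> = (\<Sum>w\<in>\<Omega>. if key w = key \<omega> then f w * \<phi> w / real (card (?c w)) else 0)"
      by (rule sum.inter_filter[OF fin])
    finally show "cavg \<Omega> key f \<omega> * \<phi> \<omega> = \<dots>" .
  qed
  also have "\<dots> = (\<Sum>w\<in>\<Omega>. \<Sum>\<omega>\<in>\<Omega>. if key w = key \<omega> then f w * \<phi> w / real (card (?c w)) else 0)"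
    by (rule sum.swap)
  also have "\<dots> = (\<Sum>w\<in>\<Omega>. f w * \<phi> w)"
  proof (rule sum.cong[OF refl])
    fix w assume w: "w \<in> \<Omega>"
    have "?c w \<noteq> {}" using w by auto
    hence c: "real (card (?c w)) \<noteq> 0" using fin by simp
    have "(\<Sum>\<omega>\<in>\<Omega>. if key w = key \<omega> then f w * \<phi> w / real (card (?c w)) else 0)
        = (\<Sum>\<omega>\<in>\<Omega>. if key \<omega> = key w then f w * \<phi> w / real (card (?c w)) else 0)"
      by (rule sum.cong) auto
    also have "\<dots> = (\<Sum>\<omega>\<in>?c w. f w * \<phi> w / real (card (?c w)))"
      using fin by (simp only: sum.inter_filter)
    also have "\<dots> = f w * \<phi> w" using c by simp
    finally show "(\<Sum>\<omega>\<in>\<Omega>. if key w = key \<omega> then f w * \<phi> w / real (card (?c w)) else 0)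
        = f w * \<phi> w" .
  qed
  finally show ?thesis .
qed

text \<open>Left unnormalised, so that the energies over disjoint pieces of \<open>\<Omega>\<close>
  add up. The normalisation by the block size enters in \<open>triple_energy\<close> and
  \<open>pair_energy\<close>.\<close>

definition energy :: "'b set \<Rightarrow> ('b \<Rightarrow> 'k) \<Rightarrow> ('b \<Rightarrow> real) \<Rightarrow> real" where
  "energy \<Omega> key f = (\<Sum>\<omega>\<in>\<Omega>. (cavg \<Omega> key f \<omega>)\<^sup>2)"

lemma energy_nonneg: "0 \<le> energy \<Omega> key f"
  by (simp add: energy_def sum_nonneg)

lemma energy_le_card:
  assumes "\<And>w. w \<in> \<Omega> \<Longrightarrow> 0 \<le> f w \<and> f w \<le> 1"
  shows "energy \<Omega> key f \<le> real (card \<Omega>)"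
proof -
  have "(cavg \<Omega> key f \<omega>)\<^sup>2 \<le> 1" for \<omega>
    using cavg_bounds[OF assms, where key=key and \<omega>=\<omega>] by (simp add: power_le_one)
  hence "energy \<Omega> key f \<le> (\<Sum>\<omega>\<in>\<Omega>. 1)"
    unfolding energy_def by (intro sum_mono)
  thus ?thesis by simp
qed

definition refines :: "'b set \<Rightarrow> ('b \<Rightarrow> 'l) \<Rightarrow> ('b \<Rightarrow> 'k) \<Rightarrow> bool" where
  "refines \<Omega> key' key \<longleftrightarrow> (\<forall>v\<in>\<Omega>. \<forall>w\<in>\<Omega>. key' v = key' w \<longrightarrow> key v = key w)"

text \<open>The coarse average is constant on the cells of both partitions, so its inner product
  with the fine average and with itself both equal its inner product with \<open>f\<close>.\<close>

lemma energy_pythagoras: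
  assumes fin: "finite \<Omega>" and ref: "refines \<Omega> key' key"
  shows "(\<Sum>\<omega>\<in>\<Omega>. (cavg \<Omega> key' f \<omega> - cavg \<Omega> key f \<omega>)\<^sup>2) = energy \<Omega> key' f - energy \<Omega> key f"
proof -
  let ?u = "cavg \<Omega> key' f" and ?v = "cavg \<Omega> key f"
  have 1: "(\<Sum>\<omega>\<in>\<Omega>. ?u \<omega> * ?v \<omega>) = (\<Sum>\<omega>\<in>\<Omega>. f \<omega> * ?v \<omega>)"
    by (rule cavg_project[OF fin]) (use ref in \<open>auto simp: refines_def intro: cavg_cong\<close>)
  have 2: "(\<Sum>\<omega>\<in>\<Omega>. ?v \<omega> * ?v \<omega>) = (\<Sum>\<omega>\<in>\<Omega>. f \<omega> * ?v \<omega>)"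
    by (rule cavg_project[OF fin]) (auto intro: cavg_cong)
  have "(\<Sum>\<omega>\<in>\<Omega>. (?u \<omega> - ?v \<omega>)\<^sup>2)
      = (\<Sum>\<omega>\<in>\<Omega>. (?u \<omega>)\<^sup>2 + (?v \<omega> * ?v \<omega>) - 2 * (?u \<omega> * ?v \<omega>))"
    by (rule sum.cong) (auto simp: power2_eq_square algebra_simps)
  also have "\<dots> = (\<Sum>\<omega>\<in>\<Omega>. (?u \<omega>)\<^sup>2) + (\<Sum>\<omega>\<in>\<Omega>. ?v \<omega> * ?v \<omega>) - 2 * (\<Sum>\<omega>\<in>\<Omega>. ?u \<omega> * ?v \<omega>)"
    by (simp add: sum.distrib sum_subtractf sum_distrib_left)
  also have "\<dots> = (\<Sum>\<omega>\<in>\<Omega>. (?u \<omega>)\<^sup>2) - (\<Sum>\<omega>\<in>\<Omega>. ?v \<omega> * ?v \<omega>)"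
    using 1 2 by simp
  finally show ?thesis by (simp add: energy_def power2_eq_square)
qed

lemma energy_mono:
  assumes "finite \<Omega>" "refines \<Omega> key' key"
  shows "energy \<Omega> key f \<le> energy \<Omega> key' f"
proof -
  have "0 \<le> (\<Sum>\<omega>\<in>\<Omega>. (cavg \<Omega> key' f \<omega> - cavg \<Omega> key f \<omega>)\<^sup>2)" by (rule sum_nonneg) simp
  thus ?thesis using energy_pythagoras[OF assms, of f] by simp
qed

text \<open>The engine of both regularity arguments: if the balanced function correlates with a test
  function visible to \<open>key'\<close>, then by Cauchy-Schwarz the two averages differ in mean
  square. It is applied to rectangles for pairs of parts and to \<open>ind3 S\<close> for
  triples.\<close>

lemma energy_increment:
  assumes fin: "finite \<Omega>" and ref: "refines \<Omega> key' key"
    and meas: "\<And>v w. v \<in> \<Omega> \<Longrightarrow> w \<in> \<Omega> \<Longrightarrow> key' v = key' w \<Longrightarrow> \<phi> v = \<phi> w"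
    and bd: "\<And>v. v \<in> \<Omega> \<Longrightarrow> \<bar>\<phi> v\<bar> \<le> 1"
  shows "(\<Sum>\<omega>\<in>\<Omega>. (f \<omega> - cavg \<Omega> key f \<omega>) * \<phi> \<omega>)\<^sup>2
       \<le> real (card \<Omega>) * (energy \<Omega> key' f - energy \<Omega> key f)"
proof -
  have "(\<Sum>\<omega>\<in>\<Omega>. (f \<omega> - cavg \<Omega> key f \<omega>) * \<phi> \<omega>)
      = (\<Sum>\<omega>\<in>\<Omega>. (cavg \<Omega> key' f \<omega> - cavg \<Omega> key f \<omega>) * \<phi> \<omega>)"
    using cavg_project[OF fin meas, where f=f and key=key'] by (simp add: left_diff_distrib sum_subtractf)
  hence "(\<Sum>\<omega>\<in>\<Omega>. (f \<omega> - cavg \<Omega> key f \<omega>) * \<phi> \<omega>)\<^sup>2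
      = (\<Sum>\<omega>\<in>\<Omega>. (cavg \<Omega> key' f \<omega> - cavg \<Omega> key f \<omega>) * \<phi> \<omega>)\<^sup>2" by simp
  also have "\<dots> \<le> (\<Sum>\<omega>\<in>\<Omega>. (cavg \<Omega> key' f \<omega> - cavg \<Omega> key f \<omega>)\<^sup>2) * (\<Sum>\<omega>\<in>\<Omega>. (\<phi> \<omega>)\<^sup>2)"
    by (rule Cauchy_Schwarz_ineq_sum)
  also have "\<dots> \<le> (\<Sum>\<omega>\<in>\<Omega>. (cavg \<Omega> key' f \<omega> - cavg \<Omega> key f \<omega>)\<^sup>2) * (\<Sum>\<omega>\<in>\<Omega>. 1)"
    by (intro mult_left_mono sum_mono sum_nonneg) (use bd in \<open>auto simp: abs_square_le_1\<close>)
  finally show ?thesis using energy_pythagoras[OF fin ref, of f] by (simp add: mult.commute)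
qed

lemma energy_cells:
  assumes fin: "finite \<Omega>"
  shows "energy \<Omega> (\<lambda>\<omega>. (key \<omega>, cell \<omega>)) f
       = (\<Sum>b\<in>cell ` \<Omega>. energy {\<omega>\<in>\<Omega>. cell \<omega> = b} key f)"
proof -
  have "(\<Sum>b\<in>cell ` \<Omega>. energy {\<omega>\<in>\<Omega>. cell \<omega> = b} key f)
     = (\<Sum>b\<in>cell ` \<Omega>. \<Sum>\<omega>\<in>{\<omega>\<in>\<Omega>. cell \<omega> = b}. (cavg \<Omega> (\<lambda>\<omega>. (key \<omega>, cell \<omega>)) f \<omega>)\<^sup>2)"
    unfolding energy_def
  proof (intro sum.cong refl)
    fix b \<omega> assume "\<omega> \<in> {\<omega>\<in>\<Omega>. cell \<omega> = b}"
    hence "{w \<in> {\<omega> \<in> \<Omega>. cell \<omega> = b}. key w = key \<omega>} = {w \<in> \<Omega>. (key w, cell w) = (key \<omega>, cell \<omega>)}"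
      by auto
    thus "(cavg {\<omega> \<in> \<Omega>. cell \<omega> = b} key f \<omega>)\<^sup>2 = (cavg \<Omega> (\<lambda>\<omega>. (key \<omega>, cell \<omega>)) f \<omega>)\<^sup>2"
      by (simp add: cavg_def)
  qed
  also have "\<dots> = energy \<Omega> (\<lambda>\<omega>. (key \<omega>, cell \<omega>)) f"
    unfolding energy_def by (rule sum.group) (use fin in auto)
  finally show ?thesis by simp
qed

text \<open>Averaging inside each cell separately is averaging over the common refinement of
  \<open>key\<close> and \<open>cell\<close>, which can only raise the energy.\<close>

lemma energy_superadditive:
  assumes "finite \<Omega>"
  shows "energy \<Omega> key f \<le> (\<Sum>b\<in>cell ` \<Omega>. energy {\<omega>\<in>\<Omega>. cell \<omega> = b} key f)"
  using energy_mono[OF assms, of "\<lambda>\<omega>. (key \<omega>, cell \<omega>)" key f]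
  by (simp add: energy_cells[OF assms] refines_def)

section \<open>Marginals of a uniformly random tuple\<close>

lemma sum_PiE_split:
  fixes F :: "('i \<Rightarrow> 'x) \<Rightarrow> real"
  assumes "finite I" "i \<in> I" "\<And>i. i \<in> I \<Longrightarrow> finite (S i)"
  shows "(\<Sum>x\<in>Pi\<^sub>E I S. F x) = (\<Sum>a\<in>S i. \<Sum>x\<in>Pi\<^sub>E (I - {i}) S. F (x(i := a)))"
proof -
  have I: "I = insert i (I - {i})" using assms by auto
  have inj: "inj_on (\<lambda>(y, g). g(i := y)) (S i \<times> Pi\<^sub>E (I - {i}) S)"
    by (rule inj_combinator) simp
  have "(\<Sum>x\<in>Pi\<^sub>E I S. F x) = (\<Sum>x\<in>Pi\<^sub>E (insert i (I - {i})) S. F x)" using I by simp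
  also have "\<dots> = (\<Sum>p\<in>S i \<times> Pi\<^sub>E (I - {i}) S. F ((\<lambda>(y, g). g(i := y)) p))"
    unfolding PiE_insert_eq by (subst sum.reindex[OF inj]) simp
  also have "\<dots> = (\<Sum>a\<in>S i. \<Sum>x\<in>Pi\<^sub>E (I - {i}) S. F (x(i := a)))"
    by (simp add: sum.cartesian_product case_prod_unfold)
  finally show ?thesis .
qed

lemma card_PiE_const:
  assumes "finite I" "\<And>i. i \<in> I \<Longrightarrow> card (S i) = s"
  shows "card (Pi\<^sub>E I S) = s ^ card I"
  using assms by (simp add: card_PiE)

text \<open>Two coordinates of a uniformly random tuple are uniform and independent. The factor
  \<open>real s ^ 2\<close> on the left keeps the identity free of division and of truncated
  exponents. It serves twice: for random labels in \<open>chunk_step\<close> and for random vertices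
  in \<open>selection\<close>.\<close>

lemma sum_PiE_marginal2:
  fixes F :: "'x \<Rightarrow> 'x \<Rightarrow> real"
  assumes fin: "finite I" and ij: "i \<in> I" "j \<in> I" "i \<noteq> j"
    and S: "\<And>i. i \<in> I \<Longrightarrow> finite (S i) \<and> card (S i) = s"
  shows "real s ^ 2 * (\<Sum>x\<in>Pi\<^sub>E I S. F (x i) (x j)) = real s ^ card I * (\<Sum>a\<in>S i. \<Sum>b\<in>S j. F a b)"
proof -
  have c: "card (Pi\<^sub>E (I - {i} - {j}) S) = s ^ (card I - 2)"
    using fin ij S by (subst card_PiE_const) (auto simp: card_Diff_singleton_if numeral_2_eq_2)
  have "card {i, j} \<le> card I" by (rule card_mono) (use fin ij in auto)
  hence I: "card I \<ge> 2" using ij by simp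
  have "(\<Sum>x\<in>Pi\<^sub>E I S. F (x i) (x j)) = (\<Sum>a\<in>S i. \<Sum>x\<in>Pi\<^sub>E (I - {i}) S. F a (x j))"
    using ij S fin by (subst sum_PiE_split[of I i]) auto
  also have "\<dots> = (\<Sum>a\<in>S i. \<Sum>b\<in>S j. \<Sum>x\<in>Pi\<^sub>E (I - {i} - {j}) S. F a b)"
    using ij S fin by (intro sum.cong refl) (subst sum_PiE_split[of "I - {i}" j], auto)
  also have "\<dots> = real s ^ (card I - 2) * (\<Sum>a\<in>S i. \<Sum>b\<in>S j. F a b)"
    by (simp add: c sum_distrib_left)
  finally have "real s ^ 2 * (\<Sum>x\<in>Pi\<^sub>E I S. F (x i) (x j))
     = (real s ^ 2 * real s ^ (card I - 2)) * (\<Sum>a\<in>S i. \<Sum>b\<in>S j. F a b)" by simp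
  also have "real s ^ 2 * real s ^ (card I - 2) = real s ^ card I"
    using I by (metis le_add_diff_inverse power_add)
  finally show ?thesis .
qed

lemma sum_PiE_marginal3:
  fixes F :: "'x \<Rightarrow> 'x \<Rightarrow> 'x \<Rightarrow> real"
  assumes fin: "finite I" and ij: "i \<in> I" "j \<in> I" "k \<in> I" "i \<noteq> j" "j \<noteq> k" "i \<noteq> k"
    and S: "\<And>i. i \<in> I \<Longrightarrow> finite (S i) \<and> card (S i) = s"
  shows "real s ^ 3 * (\<Sum>x\<in>Pi\<^sub>E I S. F (x i) (x j) (x k))
       = real s ^ card I * (\<Sum>a\<in>S i. \<Sum>b\<in>S j. \<Sum>c\<in>S k. F a b c)"
proof -
  have I: "card I = Suc (card (I - {i}))" by (rule card.remove[OF fin ij(1)])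
  define G where "G a = (\<Sum>x\<in>Pi\<^sub>E (I - {i}) S. F a (x j) (x k))" for a
  define G' where "G' a = (\<Sum>b\<in>S j. \<Sum>c\<in>S k. F a b c)" for a
  have G: "real s ^ 2 * G a = real s ^ card (I - {i}) * G' a" for a
    unfolding G_def G'_def by (rule sum_PiE_marginal2) (use ij S fin in auto)
  have "(\<Sum>x\<in>Pi\<^sub>E I S. F (x i) (x j) (x k))
      = (\<Sum>a\<in>S i. \<Sum>x\<in>Pi\<^sub>E (I - {i}) S. F ((x(i := a)) i) ((x(i := a)) j) ((x(i := a)) k))"
    by (rule sum_PiE_split) (use ij S fin in auto)
  also have "\<dots> = (\<Sum>a\<in>S i. G a)"
    using ij by (simp add: G_def)
  finally have "real s ^ 3 * (\<Sum>x\<in>Pi\<^sub>E I S. F (x i) (x j) (x k)) = real s ^ 3 * (\<Sum>a\<in>S i. G a)"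
    by (simp only:)
  also have "\<dots> = real s * (\<Sum>a\<in>S i. real s ^ 2 * G a)"
    by (simp add: sum_distrib_left[symmetric] power3_eq_cube power2_eq_square)
  also have "\<dots> = real s * (\<Sum>a\<in>S i. real s ^ card (I - {i}) * G' a)"
    by (simp only: G)
  also have "\<dots> = real s ^ Suc (card (I - {i})) * (\<Sum>a\<in>S i. G' a)"
    by (simp add: sum_distrib_left[symmetric])
  finally show ?thesis unfolding G'_def I[symmetric] .
qed

section \<open>Graph regularity by passing to boxes\<close>

text \<open>List the elements of \<open>P\<close> before all others and cut the list into
  consecutive runs of length \<open>s\<close>: only the run containing position
  \<open>card P\<close> can mix \<open>P\<close> with its complement.\<close>

lemma equipartition_respecting:
  assumes fin: "finite Y" and cY: "card Y = q * s" and s: "s > 0" and P: "P \<subseteq> Y"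
  shows "\<exists>lab l0. (\<forall>x\<in>Y. lab x < q) \<and> (\<forall>l<q. card {x\<in>Y. lab x = l} = s) \<and>
     (\<forall>x\<in>Y. \<forall>y\<in>Y. lab x = lab y \<longrightarrow> lab x \<noteq> (l0::nat) \<longrightarrow> (x \<in> P \<longleftrightarrow> y \<in> P))"
proof -
  have finP: "finite P" "finite (Y - P)" using fin P finite_subset by auto
  obtain f where f: "bij_betw f P {..<card P}"
    using ex_bij_betw_finite_nat[OF finP(1)] atLeast0LessThan by auto
  have "card (Y - P) = card {card P..<card Y}" using P finP fin by (simp add: card_Diff_subset)
  then obtain g where g: "bij_betw g (Y - P) {card P..<card Y}"
    using finite_same_card_bij[OF finP(2)] by blast
  have PY: "card P \<le> card Y" by (rule card_mono[OF fin P])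
  define b where "b x = (if x \<in> P then f x else g x)" for x
  have b: "bij_betw b (P \<union> (Y - P)) ({..<card P} \<union> {card P..<card Y})"
    unfolding b_def
    by (rule bij_betw_disjoint_Un) (use f g in \<open>auto simp: bij_betw_def\<close>)
  have b: "bij_betw b Y {..<card Y}"
  proof -
    have "P \<union> (Y - P) = Y" "{..<card P} \<union> {card P..<card Y} = {..<card Y}" using P PY by auto
    thus ?thesis using b by simp
  qed
  have bP: "x \<in> P \<longleftrightarrow> b x < card P" if "x \<in> Y" for x
  proof (cases "x \<in> P")
    case True
    thus ?thesis using bij_betwE[OF f] by (simp add: b_def)
  next
    case False
    hence "card P \<le> g x" using that bij_betwE[OF g] by auto
    thus ?thesis using False by (simp add: b_def)
  qed
  have b1: "b x < q * s" if "x \<in> Y" for x using bij_betwE[OF b] that cY by auto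
  have 1: "b x div s < q" if "x \<in> Y" for x
    using b1[OF that] s by (simp add: less_mult_imp_div_less)
  have 2: "card {x\<in>Y. b x div s = l} = s" if l: "l < q" for l
  proof -
    have iff: "(n div s = l) \<longleftrightarrow> (l * s \<le> n \<and> n < l * s + s)" for n
    proof -
      have "n div s = l \<longleftrightarrow> l \<le> n div s \<and> n div s < Suc l" by auto
      also have "\<dots> \<longleftrightarrow> (l * s \<le> n \<and> n < l * s + s)"
        using s by (simp add: less_eq_div_iff_mult_less_eq div_less_iff_less_mult add.commute)
      finally show ?thesis .
    qed
    have "(l + 1) * s \<le> q * s" using l by (intro mult_right_mono) auto
    hence sub: "{l*s..<l*s+s} \<subseteq> {..<card Y}" using cY by auto
    have "b ` {x\<in>Y. b x div s = l} = {l*s..<l*s+s}"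
    proof
      show "b ` {x\<in>Y. b x div s = l} \<subseteq> {l*s..<l*s+s}" by (auto simp: iff)
      show "{l*s..<l*s+s} \<subseteq> b ` {x\<in>Y. b x div s = l}"
      proof
        fix n assume n: "n \<in> {l*s..<l*s+s}"
        hence "n \<in> b ` Y" using sub b unfolding bij_betw_def by blast
        then obtain x where "x \<in> Y" "b x = n" by blast
        thus "n \<in> b ` {x\<in>Y. b x div s = l}" using n by (auto simp: iff)
      qed
    qed
    moreover have "inj_on b {x\<in>Y. b x div s = l}"
      by (rule inj_on_subset[OF bij_betw_imp_inj_on[OF b]]) auto
    ultimately have "card {x\<in>Y. b x div s = l} = card {l * s..<l * s + s}"
      using card_image by fastforce
    thus ?thesis by simp
  qed
  have 3: "(x \<in> P \<longleftrightarrow> y \<in> P)"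
    if xy: "x \<in> Y" "y \<in> Y" "b x div s = b y div s" "b x div s \<noteq> card P div s" for x y
  proof -
    have "(b v < card P) \<longleftrightarrow> (b v div s < card P div s)" if "b v div s \<noteq> card P div s" for v
    proof
      show "b v div s < card P div s" if "b v < card P"
        using that \<open>b v div s \<noteq> card P div s\<close> div_le_mono[of "b v" "card P" s] by simp
      show "b v < card P" if "b v div s < card P div s"
        using that div_le_mono[of "card P" "b v" s] by linarith
    qed
    from this[of x] this[of y] show ?thesis using bP[OF xy(1)] bP[OF xy(2)] xy(3,4) by simp
  qed
  show ?thesis
    by (intro exI[of _ "\<lambda>x. b x div s"] exI[of _ "card P div s"] conjI ballI allI impI 1 2 3)
qed

definition box_cell :: "('a \<Rightarrow> 'l) \<Rightarrow> ('a \<Rightarrow> 'l) \<Rightarrow> 'a \<times> 'a \<Rightarrow> 'l \<times> 'l" where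
  "box_cell f g = (\<lambda>(x, y). (f x, g y))"

lemma energy_boxes2:
  fixes A B :: "'a set"
  assumes fin: "finite A" "finite B"
    and f: "\<And>x. x \<in> A \<Longrightarrow> f x < (q::nat)" and g: "\<And>x. x \<in> B \<Longrightarrow> g x < q"
  shows "energy (A \<times> B) (\<lambda>\<omega>. (key \<omega>, box_cell f g \<omega>)) F
     = (\<Sum>l<q. \<Sum>m<q. energy ({x\<in>A. f x = l} \<times> {x\<in>B. g x = m}) key F)"
proof -
  have "energy (A \<times> B) (\<lambda>\<omega>. (key \<omega>, box_cell f g \<omega>)) F
     = (\<Sum>b\<in>box_cell f g ` (A \<times> B). energy {\<omega>\<in>A \<times> B. box_cell f g \<omega> = b} key F)"
    by (rule energy_cells) (use fin in auto)
  also have "\<dots> = (\<Sum>b\<in>{..<q} \<times> {..<q}. energy {\<omega>\<in>A \<times> B. box_cell f g \<omega> = b} key F)"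
  proof (rule sum.mono_neutral_left)
    show "\<forall>b\<in>{..<q} \<times> {..<q} - box_cell f g ` (A \<times> B).
        energy {\<omega> \<in> A \<times> B. box_cell f g \<omega> = b} key F = 0"
    proof
      fix b assume "b \<in> {..<q} \<times> {..<q} - box_cell f g ` (A \<times> B)"
      hence "{\<omega> \<in> A \<times> B. box_cell f g \<omega> = b} = {}" by blast
      thus "energy {\<omega> \<in> A \<times> B. box_cell f g \<omega> = b} key F = 0" by (simp only: energy_def sum.empty)
    qed
  qed (use f g in \<open>auto simp: box_cell_def\<close>)
  also have "\<dots> = (\<Sum>l<q. \<Sum>m<q. energy ({x\<in>A. f x = l} \<times> {x\<in>B. g x = m}) key F)"
    unfolding sum.cartesian_product
  proof (rule sum.cong[OF refl])
    fix b assume "b \<in> {..<q} \<times> {..<q}"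
    have "{\<omega> \<in> A \<times> B. box_cell f g \<omega> = b} = {x \<in> A. f x = fst b} \<times> {x \<in> B. g x = snd b}"
      by (auto simp: box_cell_def)
    thus "energy {\<omega> \<in> A \<times> B. box_cell f g \<omega> = b} key F =
         (case b of (l, m) \<Rightarrow> energy ({x \<in> A. f x = l} \<times> {x \<in> B. g x = m}) key F)"
      by (simp add: case_prod_unfold)
  qed
  finally show ?thesis .
qed

lemma energy_boxes2_ge:
  fixes A B :: "'a set"
  assumes fin: "finite A" "finite B"
    and f: "\<And>x. x \<in> A \<Longrightarrow> f x < (q::nat)" and g: "\<And>x. x \<in> B \<Longrightarrow> g x < q"
  shows "energy (A \<times> B) key F
     \<le> (\<Sum>l<q. \<Sum>m<q. energy ({x\<in>A. f x = l} \<times> {x\<in>B. g x = m}) key F)"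
proof -
  have "energy (A \<times> B) key F \<le> energy (A \<times> B) (\<lambda>\<omega>. (key \<omega>, box_cell f g \<omega>)) F"
    by (rule energy_mono) (use fin in \<open>auto simp: refines_def\<close>)
  thus ?thesis using energy_boxes2[OF fin f g, where key=key and F=F] by simp
qed

lemma energy_boxes3_ge:
  assumes fin: "finite A" "finite B" "finite C"
    and f: "\<And>x. x \<in> A \<Longrightarrow> f x < (q::nat)" and g: "\<And>x. x \<in> B \<Longrightarrow> g x < q"
    and h: "\<And>x. x \<in> C \<Longrightarrow> h x < q"
  shows "energy (A \<times> B \<times> C) key F
     \<le> (\<Sum>l<q. \<Sum>m<q. \<Sum>n<q.
          energy ({x\<in>A. f x = l} \<times> {x\<in>B. g x = m} \<times> {x\<in>C. h x = n}) key F)"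
proof -
  define cell where "cell = (\<lambda>(x, y, z). (f x, g y, h z))"
  have "energy (A \<times> B \<times> C) key F
     \<le> (\<Sum>b\<in>cell ` (A \<times> B \<times> C). energy {\<omega>\<in>A \<times> B \<times> C. cell \<omega> = b} key F)"
    by (rule energy_superadditive) (use fin in auto)
  also have "\<dots> \<le> (\<Sum>b\<in>{..<q} \<times> {..<q} \<times> {..<q}. energy {\<omega>\<in>A \<times> B \<times> C. cell \<omega> = b} key F)"
    by (rule sum_mono2) (use f g h in \<open>auto simp: cell_def energy_nonneg\<close>)
  also have "\<dots> = (\<Sum>l<q. \<Sum>m<q. \<Sum>n<q.
          energy ({x\<in>A. f x = l} \<times> {x\<in>B. g x = m} \<times> {x\<in>C. h x = n}) key F)"
    unfolding sum.cartesian_product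
  proof (rule sum.cong[OF refl])
    fix b assume "b \<in> {..<q} \<times> {..<q} \<times> {..<q}"
    obtain l m n where b: "b = (l, m, n)" by (cases b) auto
    have "{\<omega> \<in> A \<times> B \<times> C. cell \<omega> = b} = {x\<in>A. f x = l} \<times> {x\<in>B. g x = m} \<times> {x\<in>C. h x = n}"
      by (auto simp: cell_def b)
    thus "energy {\<omega> \<in> A \<times> B \<times> C. cell \<omega> = b} key F =
         (case b of (l, m, n) \<Rightarrow>
            energy ({x\<in>A. f x = l} \<times> {x\<in>B. g x = m} \<times> {x\<in>C. h x = n}) key F)"
      by (simp add: b)
  qed
  finally show ?thesis .
qed

definition dens :: "('a \<Rightarrow> 'a \<Rightarrow> real) \<Rightarrow> 'a set \<Rightarrow> 'a set \<Rightarrow> real" where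
  "dens F A B = (\<Sum>x\<in>A. \<Sum>y\<in>B. F x y) / (real (card A) * real (card B))"

definition cut_small :: "real \<Rightarrow> ('a \<Rightarrow> 'a \<Rightarrow> real) \<Rightarrow> 'a set \<Rightarrow> 'a set \<Rightarrow> bool" where
  "cut_small \<epsilon> F A B \<longleftrightarrow>
     (\<forall>P\<subseteq>A. \<forall>Q\<subseteq>B. \<bar>\<Sum>x\<in>P. \<Sum>y\<in>Q. F x y\<bar> \<le> \<epsilon> * real (card A) * real (card B))"

lemma cavg_trivial_key:
  "cavg (A \<times> B) (\<lambda>_. ()) (\<lambda>(x, y). F x y) \<omega> = dens F A B"
  by (simp add: cavg_def dens_def sum.cartesian_product card_cartesian_product)

lemma sum_rectangle_Diff_le:
  assumes fin: "finite A" "finite B" and sub: "P' \<subseteq> P" "P \<subseteq> A" "Q' \<subseteq> Q" "Q \<subseteq> B"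
    and cP: "real (card (P - P')) \<le> \<beta> * real (card A)" and cQ: "real (card (Q - Q')) \<le> \<beta> * real (card B)"
    and F: "\<And>x y. x \<in> A \<Longrightarrow> y \<in> B \<Longrightarrow> \<bar>F x y\<bar> \<le> (1::real)"
  shows "\<bar>(\<Sum>x\<in>P. \<Sum>y\<in>Q. F x y) - (\<Sum>x\<in>P'. \<Sum>y\<in>Q'. F x y)\<bar> \<le> 2 * \<beta> * real (card A) * real (card B)"
proof -
  have finP: "finite P" "finite Q" using fin sub finite_subset by metis+
  have fin': "finite P'" "finite Q'" using finP sub finite_subset by metis+
  have 1: "(\<Sum>x\<in>P. \<Sum>y\<in>Q. F x y) = (\<Sum>x\<in>P'. \<Sum>y\<in>Q. F x y) + (\<Sum>x\<in>P - P'. \<Sum>y\<in>Q. F x y)"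
    using sum.subset_diff[OF sub(1) finP(1)] by (simp add: add.commute)
  have 2: "(\<Sum>x\<in>P'. \<Sum>y\<in>Q. F x y) = (\<Sum>x\<in>P'. \<Sum>y\<in>Q'. F x y) + (\<Sum>x\<in>P'. \<Sum>y\<in>Q - Q'. F x y)"
    by (subst sum.distrib[symmetric], rule sum.cong[OF refl],
        subst sum.subset_diff[OF sub(3) finP(2)]) (rule add.commute)
  have bd: "\<bar>\<Sum>x\<in>S. \<Sum>y\<in>T. F x y\<bar> \<le> real (card S) * real (card T)" if "S \<subseteq> A" "T \<subseteq> B" for S T
  proof -
    have "\<bar>\<Sum>x\<in>S. \<Sum>y\<in>T. F x y\<bar> \<le> (\<Sum>x\<in>S. \<Sum>y\<in>T. 1)"
      by (rule order_trans[OF sum_abs], rule sum_mono, rule order_trans[OF sum_abs], rule sum_mono)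
        (use F that in auto)
    thus ?thesis by simp
  qed
  have cQA: "real (card Q) \<le> real (card B)" "real (card P') \<le> real (card A)"
    using sub fin by (auto intro!: card_mono)
  have "\<bar>\<Sum>x\<in>P - P'. \<Sum>y\<in>Q. F x y\<bar> \<le> real (card (P - P')) * real (card Q)"
    by (rule bd) (use sub in auto)
  also have "\<dots> \<le> (\<beta> * real (card A)) * real (card B)"
    by (intro mult_mono cP cQA) (use cP in \<open>auto intro: order_trans[OF of_nat_0_le_iff]\<close>)
  finally have 3: "\<bar>\<Sum>x\<in>P - P'. \<Sum>y\<in>Q. F x y\<bar> \<le> (\<beta> * real (card A)) * real (card B)" .
  have "\<bar>\<Sum>x\<in>P'. \<Sum>y\<in>Q - Q'. F x y\<bar> \<le> real (card P') * real (card (Q - Q'))"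
    by (rule bd) (use sub in auto)
  also have "\<dots> \<le> real (card A) * (\<beta> * real (card B))"
    by (intro mult_mono cQ cQA) auto
  finally show ?thesis using 1 2 3 by (simp add: algebra_simps)
qed

text \<open>Cells that meet both a side of the cut and its complement (at most one per side, namely \<open>lf\<close>
  and \<open>lg\<close>) are dropped from the cut, which costs at most \<open>2 / q\<close> of the total.\<close>

lemma irregular_pair_gain:
  fixes F :: "'a \<Rightarrow> 'a \<Rightarrow> real"
  assumes fin: "finite A" "finite B" and cA: "card A = q * s" and cB: "card B = q * s" and s: "s > 0"
    and F: "\<And>x y. x \<in> A \<Longrightarrow> y \<in> B \<Longrightarrow> 0 \<le> F x y \<and> F x y \<le> 1"
    and PQ: "P \<subseteq> A" "Q \<subseteq> B"
    and irr: "\<bar>\<Sum>x\<in>P. \<Sum>y\<in>Q. F x y - dens F A B\<bar> > \<epsilon> * real (card A) * real (card B)"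
    and eps: "\<epsilon> > 0" "real q * \<epsilon> \<ge> 4"
    and f: "\<And>x. x \<in> A \<Longrightarrow> f x < q" "\<And>l. l < q \<Longrightarrow> card {x\<in>A. f x = l} = s"
      "\<And>x y. x \<in> A \<Longrightarrow> y \<in> A \<Longrightarrow> f x = f y \<Longrightarrow> f x \<noteq> lf \<Longrightarrow> (x \<in> P \<longleftrightarrow> y \<in> P)"
    and g: "\<And>x. x \<in> B \<Longrightarrow> g x < q" "\<And>l. l < q \<Longrightarrow> card {x\<in>B. g x = l} = s"
      "\<And>x y. x \<in> B \<Longrightarrow> y \<in> B \<Longrightarrow> g x = g y \<Longrightarrow> g x \<noteq> lg \<Longrightarrow> (x \<in> Q \<longleftrightarrow> y \<in> Q)"
  shows "energy (A \<times> B) (\<lambda>_. ()) (\<lambda>(x, y). F x y) + \<epsilon>\<^sup>2 / 4 * (real (card A) * real (card B))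
     \<le> (\<Sum>l<q. \<Sum>m<q. energy ({x\<in>A. f x = l} \<times> {x\<in>B. g x = m}) (\<lambda>_. ()) (\<lambda>(x, y). F x y))"
proof -
  let ?d = "dens F A B" and ?F = "\<lambda>(x, y). F x y"
  define P' where "P' = {x\<in>P. f x \<noteq> lf}"
  define Q' where "Q' = {x\<in>Q. g x \<noteq> lg}"
  have q: "q > 0" using eps by (cases q) auto
  have d: "0 \<le> ?d" "?d \<le> 1"
  proof -
    have "cavg (A \<times> B) (\<lambda>_. ()) ?F \<omega> = ?d" for \<omega> by (rule cavg_trivial_key)
    moreover have "0 \<le> cavg (A \<times> B) (\<lambda>_. ()) ?F \<omega>" "cavg (A \<times> B) (\<lambda>_. ()) ?F \<omega> \<le> 1" for \<omega>
      by (rule cavg_bounds; use F in auto)+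
    ultimately show "0 \<le> ?d" "?d \<le> 1" by simp_all
  qed
  \<comment> \<open>The exceptional label may lie outside the range: for \<open>P = Y\<close>,
    \<open>equipartition_respecting\<close> returns \<open>l0 = q\<close>, and that fibre is
    empty.\<close>
  have mixed: "real (card {x\<in>Y. f x = l}) \<le> (1 / real q) * real (card Y)"
    if "card Y = q * s" "\<And>x. x \<in> Y \<Longrightarrow> f x < q" "\<And>l. l < q \<Longrightarrow> card {x\<in>Y. f x = l} = s"
    for Y :: "'a set" and f l
  proof (cases "l < q")
    case False
    hence "{x\<in>Y. f x = l} = {}" using that by auto
    thus ?thesis by (simp only: card.empty) auto
  qed (use that q in simp)
  have cP: "real (card (P - P')) \<le> (1 / real q) * real (card A)"
  proof -
    have "card (P - P') \<le> card {x\<in>A. f x = lf}"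
      by (rule card_mono) (use PQ fin in \<open>auto simp: P'_def\<close>)
    thus ?thesis using mixed[OF cA f(1,2), of lf] by linarith
  qed
  have cQ: "real (card (Q - Q')) \<le> (1 / real q) * real (card B)"
  proof -
    have "card (Q - Q') \<le> card {x\<in>B. g x = lg}"
      by (rule card_mono) (use PQ fin in \<open>auto simp: Q'_def\<close>)
    thus ?thesis using mixed[OF cB g(1,2), of lg] by linarith
  qed
  let ?N = "real (card A) * real (card B)"
  have N: "?N > 0" using cA cB s q by simp
  have "\<bar>(\<Sum>x\<in>P. \<Sum>y\<in>Q. F x y - ?d) - (\<Sum>x\<in>P'. \<Sum>y\<in>Q'. F x y - ?d)\<bar>
     \<le> 2 * (1 / real q) * real (card A) * real (card B)"
  proof (rule sum_rectangle_Diff_le[OF fin _ PQ(1) _ PQ(2) cP cQ])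
    show "\<bar>F x y - ?d\<bar> \<le> 1" if "x \<in> A" "y \<in> B" for x y
      using F[OF that] d by (simp add: abs_le_iff)
  qed (auto simp: P'_def Q'_def)
  also have "\<dots> \<le> \<epsilon> / 2 * ?N"
  proof -
    \<comment> \<open>The bound \<open>4 \<le> real q * \<epsilon>\<close> makes the trimming cost
      at most half of the irregularity.\<close>
    have "2 * (1 / real q) \<le> \<epsilon> / 2" using eps q by (simp add: field_simps)
    hence "2 * (1 / real q) * ?N \<le> \<epsilon> / 2 * ?N" using N by (intro mult_right_mono) auto
    thus ?thesis by (simp add: mult.assoc)
  qed
  finally have big: "\<epsilon> / 2 * ?N \<le> \<bar>\<Sum>x\<in>P'. \<Sum>y\<in>Q'. F x y - ?d\<bar>"
  proof -
    assume a: "\<bar>(\<Sum>x\<in>P. \<Sum>y\<in>Q. F x y - ?d) - (\<Sum>x\<in>P'. \<Sum>y\<in>Q'. F x y - ?d)\<bar> \<le> \<epsilon> / 2 * ?N"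
    have "\<bar>\<Sum>x\<in>P. \<Sum>y\<in>Q. F x y - ?d\<bar> > \<epsilon> * ?N" using irr by (simp only: mult.assoc)
    moreover have "\<epsilon> * ?N = \<epsilon> / 2 * ?N + \<epsilon> / 2 * ?N" by simp
    ultimately show ?thesis using a by linarith
  qed
  \<comment> \<open>The trimmed rectangle is a union of boxes, so its indicator is constant on the
    cells of the box partition. Half of the deviation survives the trimming, which yields the gain
    \<open>\<epsilon>\<^sup>2 / 4\<close>.\<close>
  define \<phi> where "\<phi> = (\<lambda>(x, y). of_bool (x \<in> P' \<and> y \<in> Q') :: real)"
  let ?key = "\<lambda>\<omega>. ((), box_cell f g \<omega>)"
  have eq: "(\<Sum>\<omega>\<in>A\<times>B. (?F \<omega> - cavg (A\<times>B) (\<lambda>_. ()) ?F \<omega>) * \<phi> \<omega>) = (\<Sum>x\<in>P'. \<Sum>y\<in>Q'. F x y - ?d)"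
  proof -
    have "(\<Sum>\<omega>\<in>A\<times>B. (?F \<omega> - cavg (A\<times>B) (\<lambda>_. ()) ?F \<omega>) * \<phi> \<omega>)
       = (\<Sum>\<omega>\<in>A\<times>B. if \<omega> \<in> P' \<times> Q' then ?F \<omega> - ?d else 0)"
      unfolding cavg_trivial_key by (rule sum.cong) (auto simp: \<phi>_def)
    also have "\<dots> = (\<Sum>\<omega>\<in>(A\<times>B) \<inter> (P' \<times> Q'). ?F \<omega> - ?d)"
      by (rule sum.inter_restrict[symmetric]) (use fin in auto)
    also have "(A\<times>B) \<inter> (P' \<times> Q') = P' \<times> Q'" using PQ by (auto simp: P'_def Q'_def)
    finally show ?thesis by (simp add: sum.cartesian_product case_prod_unfold)
  qed
  have "(\<epsilon> / 2 * ?N)\<^sup>2 \<le> (\<Sum>\<omega>\<in>A\<times>B. (?F \<omega> - cavg (A\<times>B) (\<lambda>_. ()) ?F \<omega>) * \<phi> \<omega>)\<^sup>2"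
    unfolding eq using big N eps by (subst abs_le_square_iff[symmetric]) (simp add: abs_mult)
  also have "\<dots> \<le> real (card (A \<times> B)) *
       (energy (A\<times>B) ?key ?F - energy (A\<times>B) (\<lambda>_. ()) ?F)"
  proof (rule energy_increment)
    show "\<phi> v = \<phi> w" if "v \<in> A \<times> B" "w \<in> A \<times> B" "?key v = ?key w" for v w
    proof -
      obtain x y x' y' where vw: "v = (x, y)" "w = (x', y')" by fastforce
      have "x \<in> P' \<longleftrightarrow> x' \<in> P'" "y \<in> Q' \<longleftrightarrow> y' \<in> Q'"
        using that f(3)[of x x'] g(3)[of y y'] by (auto simp: vw P'_def Q'_def box_cell_def)
      thus ?thesis by (simp add: \<phi>_def vw)
    qed
  qed (use fin in \<open>auto simp: refines_def \<phi>_def\<close>)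
  finally have "\<epsilon>\<^sup>2 / 4 * ?N * ?N \<le> (energy (A\<times>B) ?key ?F - energy (A\<times>B) (\<lambda>_. ()) ?F) * ?N"
    by (simp add: power2_eq_square card_cartesian_product mult_ac)
  hence "\<epsilon>\<^sup>2 / 4 * ?N \<le> energy (A\<times>B) ?key ?F - energy (A\<times>B) (\<lambda>_. ()) ?F"
    by (rule mult_right_le_imp_le) (use N in simp)
  thus ?thesis using energy_boxes2[OF fin f(1) g(1), where key="\<lambda>_. ()" and F="?F"] by simp
qed

section \<open>Energies of a system of parts\<close>

definition pairs :: "nat \<Rightarrow> (nat \<times> nat) set" where
  "pairs t = {(i, j). i < t \<and> j < t \<and> i \<noteq> j}"

definition triples :: "nat \<Rightarrow> (nat \<times> nat \<times> nat) set" where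
  "triples t = {(i, j, k). i < t \<and> j < t \<and> k < t \<and> i \<noteq> j \<and> j \<noteq> k \<and> i \<noteq> k}"

lemma finite_pairs: "finite (pairs t)"
  by (rule finite_subset[of _ "{..<t} \<times> {..<t}"]) (auto simp: pairs_def)

lemma finite_triples: "finite (triples t)"
  by (rule finite_subset[of _ "{..<t} \<times> {..<t} \<times> {..<t}"]) (auto simp: triples_def)

lemma card_pairs_le: "card (pairs t) \<le> t ^ 2"
proof -
  have "card (pairs t) \<le> card ({..<t} \<times> {..<t})" by (rule card_mono) (auto simp: pairs_def)
  thus ?thesis by (simp add: card_cartesian_product power2_eq_square)
qed

lemma card_triples_le: "card (triples t) \<le> t ^ 3"
proof -
  have "card (triples t) \<le> card ({..<t} \<times> {..<t} \<times> {..<t})"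
    by (rule card_mono) (auto simp: triples_def)
  thus ?thesis by (simp add: card_cartesian_product power3_eq_cube)
qed

definition tri :: "('a set \<Rightarrow> real) \<Rightarrow> 'a \<times> 'a \<times> 'a \<Rightarrow> real" where
  "tri h = (\<lambda>(x, y, z). h {x, y, z})"

definition key3 :: "('a set \<Rightarrow> nat) \<Rightarrow> 'a \<times> 'a \<times> 'a \<Rightarrow> nat \<times> nat \<times> nat" where
  "key3 \<chi> = (\<lambda>(x, y, z). (\<chi> {x, y}, \<chi> {y, z}, \<chi> {x, z}))"

definition col :: "('a set \<Rightarrow> nat) \<Rightarrow> nat \<Rightarrow> 'a \<Rightarrow> 'a \<Rightarrow> real" where
  "col \<chi> a x y = of_bool (\<chi> {x, y} = a)"

text \<open>Division by \<open>real s ^ 3\<close> makes systems with parts of different sizes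
  comparable: the value is at most \<open>t ^ 3\<close> however far the parts have been
  shrunk.\<close>

definition triple_energy :: "nat \<Rightarrow> nat \<Rightarrow> (nat \<Rightarrow> 'a set) \<Rightarrow> ('a set \<Rightarrow> nat) \<Rightarrow> ('a set \<Rightarrow> real) \<Rightarrow> real" where
  "triple_energy t s Y \<chi> h =
     (\<Sum>(i, j, k)\<in>triples t. energy (Y i \<times> Y j \<times> Y k) (key3 \<chi>) (tri h)) / real s ^ 3"

text \<open>With the trivial key every average is a density, so this is the index of Szemeredi's
  regularity lemma, summed over the colours.\<close>

definition pair_energy :: "nat \<Rightarrow> nat \<Rightarrow> (nat \<Rightarrow> 'a set) \<Rightarrow> ('a set \<Rightarrow> nat) \<Rightarrow> nat \<Rightarrow> real" where
  "pair_energy t s Y \<chi> K =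
     (\<Sum>(i, j)\<in>pairs t. \<Sum>a<K. energy (Y i \<times> Y j) (\<lambda>_. ()) (\<lambda>(x, y). col \<chi> a x y)) / real s ^ 2"

lemma pair_energy_bounds:
  assumes Y: "\<And>i. i < t \<Longrightarrow> finite (Y i) \<and> card (Y i) = s" and s: "s > 0"
  shows "0 \<le> pair_energy t s Y \<chi> K" "pair_energy t s Y \<chi> K \<le> real t ^ 2 * real K"
proof -
  show "0 \<le> pair_energy t s Y \<chi> K"
    unfolding pair_energy_def by (intro divide_nonneg_nonneg sum_nonneg) (auto intro!: sum_nonneg energy_nonneg)
  have "(\<Sum>(i, j)\<in>pairs t. \<Sum>a<K. energy (Y i \<times> Y j) (\<lambda>_. ()) (\<lambda>(x, y). col \<chi> a x y))
     \<le> (\<Sum>(i, j)\<in>pairs t. real K * real s ^ 2)"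
  proof (rule sum_mono, clarify)
    fix i j assume ij: "(i, j) \<in> pairs t"
    have "(\<Sum>a<K. energy (Y i \<times> Y j) (\<lambda>_. ()) (\<lambda>(x, y). col \<chi> a x y)) \<le> (\<Sum>a<K. real (card (Y i \<times> Y j)))"
      by (intro sum_mono energy_le_card) (auto simp: col_def)
    thus "(\<Sum>a<K. energy (Y i \<times> Y j) (\<lambda>_. ()) (\<lambda>(x, y). col \<chi> a x y)) \<le> real K * real s ^ 2"
      using ij Y by (simp add: pairs_def card_cartesian_product power2_eq_square)
  qed
  also have "\<dots> = real (card (pairs t)) * (real K * real s ^ 2)" by simp
  also have "\<dots> \<le> real (t ^ 2) * (real K * real s ^ 2)"
    by (intro mult_right_mono of_nat_mono card_pairs_le) auto
  finally show "pair_energy t s Y \<chi> K \<le> real t ^ 2 * real K"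
    using s by (simp add: pair_energy_def divide_le_eq mult.assoc)
qed

lemma triple_energy_bounds:
  assumes Y: "\<And>i. i < t \<Longrightarrow> finite (Y i) \<and> card (Y i) = s" and s: "s > 0"
    and h: "\<And>e. 0 \<le> h e \<and> h e \<le> 1"
  shows "0 \<le> triple_energy t s Y \<chi> h" "triple_energy t s Y \<chi> h \<le> real t ^ 3"
proof -
  show "0 \<le> triple_energy t s Y \<chi> h"
    unfolding triple_energy_def
    by (intro divide_nonneg_nonneg sum_nonneg) (auto intro!: energy_nonneg)
  have "(\<Sum>(i, j, k)\<in>triples t. energy (Y i \<times> Y j \<times> Y k) (key3 \<chi>) (tri h))
     \<le> (\<Sum>(i, j, k)\<in>triples t. real s ^ 3)"
  proof (rule sum_mono, clarify)
    fix i j k assume ij: "(i, j, k) \<in> triples t"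
    have "energy (Y i \<times> Y j \<times> Y k) (key3 \<chi>) (tri h) \<le> real (card (Y i \<times> Y j \<times> Y k))"
      by (intro energy_le_card) (auto simp: tri_def h)
    thus "energy (Y i \<times> Y j \<times> Y k) (key3 \<chi>) (tri h) \<le> real s ^ 3"
      using ij Y by (simp add: triples_def card_cartesian_product power3_eq_cube)
  qed
  also have "\<dots> = real (card (triples t)) * real s ^ 3" by simp
  also have "\<dots> \<le> real (t ^ 3) * real s ^ 3"
    by (intro mult_right_mono of_nat_mono card_triples_le) auto
  finally show "triple_energy t s Y \<chi> h \<le> real t ^ 3"
    using s by (simp add: triple_energy_def divide_le_eq mult.assoc)
qed

text \<open>Every part is cut into \<open>q\<close> equal pieces and one piece per part is chosen at
  random. In expectation the normalised triple energy does not drop, since splitting into boxes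
  never lowers the total energy, and the pair energy gains \<open>\<epsilon>\<^sup>2 / 4\<close>
  from the irregular pair. Both effects are combined into one weighted sum, so a choice that reaches
  its mean serves both.\<close>

lemma chunk_step:
  assumes Y: "\<And>i. i < t \<Longrightarrow> finite (Y i) \<and> card (Y i) = q * s" and s: "s > 0"
    and ij: "(i0, j0) \<in> pairs t" and a0: "a0 < K"
    and irr: "\<not> cut_small \<epsilon> (\<lambda>x y. col \<chi> a0 x y - dens (col \<chi> a0) (Y i0) (Y j0)) (Y i0) (Y j0)"
    and eps: "\<epsilon> > 0" "real q * \<epsilon> \<ge> 4" and lam: "\<theta> \<ge> 0"
  shows "\<exists>Y'. (\<forall>i<t. Y' i \<subseteq> Y i \<and> card (Y' i) = s) \<and>
     triple_energy t (q * s) Y \<chi> h + \<theta> * pair_energy t (q * s) Y \<chi> K + \<theta> * \<epsilon>\<^sup>2 / 4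
       \<le> triple_energy t s Y' \<chi> h + \<theta> * pair_energy t s Y' \<chi> K"
proof -
  have q: "q > 0" using eps by (cases q) auto
  have i0: "i0 < t" "j0 < t" "i0 \<noteq> j0" using ij by (auto simp: pairs_def)
  obtain P Q where PQ: "P \<subseteq> Y i0" "Q \<subseteq> Y j0" and big:
    "\<bar>\<Sum>x\<in>P. \<Sum>y\<in>Q. col \<chi> a0 x y - dens (col \<chi> a0) (Y i0) (Y j0)\<bar>
       > \<epsilon> * real (card (Y i0)) * real (card (Y j0))"
    using irr by (auto simp: cut_small_def not_le)
  \<comment> \<open>Only the two parts of the irregular pair have a set to respect; the empty set
    makes the equipartition of any other part arbitrary.\<close>
  define R where "R i = (if i = i0 then P else if i = j0 then Q else {})" for i
  define good where "good i lab l0 \<longleftrightarrow> (\<forall>x\<in>Y i. lab x < q) \<and> (\<forall>l<q. card {x\<in>Y i. lab x = l} = s) \<and>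
     (\<forall>x\<in>Y i. \<forall>y\<in>Y i. lab x = lab y \<longrightarrow> lab x \<noteq> (l0::nat) \<longrightarrow> (x \<in> R i \<longleftrightarrow> y \<in> R i))"
    for i lab l0
  have "\<forall>i. \<exists>p. i < t \<longrightarrow> good i (fst p) (snd p)"
  proof
    fix i
    have "R i \<subseteq> Y i" using PQ by (auto simp: R_def)
    hence "i < t \<Longrightarrow> \<exists>lab l0. good i lab l0"
      unfolding good_def using Y[of i] s by (intro equipartition_respecting) auto
    thus "\<exists>p. i < t \<longrightarrow> good i (fst p) (snd p)" by fastforce
  qed
  then obtain pp where "\<And>i. i < t \<Longrightarrow> good i (fst (pp i)) (snd (pp i))" by metis
  then obtain lab l0 where good: "\<And>i. i < t \<Longrightarrow> good i (lab i) (l0 i)"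
    using that[of "\<lambda>i. fst (pp i)" "\<lambda>i. snd (pp i)"] by blast
  have lab: "\<And>i x. i < t \<Longrightarrow> x \<in> Y i \<Longrightarrow> lab i x < q"
     "\<And>i l. i < t \<Longrightarrow> l < q \<Longrightarrow> card {x\<in>Y i. lab i x = l} = s"
    using good by (auto simp: good_def)
  have lab3: "x \<in> R i \<longleftrightarrow> y \<in> R i"
    if "i < t" "x \<in> Y i" "y \<in> Y i" "lab i x = lab i y" "lab i x \<noteq> l0 i" for i x y
    using good[OF that(1)] that unfolding good_def by blast
  define Z where "Z i l = {x\<in>Y i. lab i x = l}" for i l
  define \<Lambda> where "\<Lambda> = Pi\<^sub>E {..<t} (\<lambda>_. {..<q})"
  define en3 where "en3 = (\<lambda>A B C. energy (A \<times> B \<times> C) (key3 \<chi>) (tri h))"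
  define en2 where "en2 = (\<lambda>a A B. energy (A \<times> B) (\<lambda>_. ()) (\<lambda>(x, y). col \<chi> a x y))"
  let ?w = "real q ^ t"
  have cardL: "real (card \<Lambda>) = ?w" unfolding \<Lambda>_def by (subst card_PiE_const[where s=q]) auto
  have finL: "finite \<Lambda>" unfolding \<Lambda>_def by (rule finite_PiE) auto
  have neL: "\<Lambda> \<noteq> {}" using cardL q by auto
  have tri_avg: "?w * en3 (Y i) (Y j) (Y k) / real (q * s) ^ 3
      \<le> (\<Sum>\<mu>\<in>\<Lambda>. en3 (Z i (\<mu> i)) (Z j (\<mu> j)) (Z k (\<mu> k))) / real s ^ 3"
    if "(i, j, k) \<in> triples t" for i j k
  proof -
    have t: "i < t" "j < t" "k < t" "i \<noteq> j" "j \<noteq> k" "i \<noteq> k" using that by (auto simp: triples_def)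
    have "real q ^ 3 * (\<Sum>\<mu>\<in>\<Lambda>. en3 (Z i (\<mu> i)) (Z j (\<mu> j)) (Z k (\<mu> k)))
       = real q ^ card {..<t} * (\<Sum>l<q. \<Sum>m<q. \<Sum>n<q. en3 (Z i l) (Z j m) (Z k n))"
      unfolding \<Lambda>_def
      by (rule sum_PiE_marginal3[of "{..<t}" i j k "\<lambda>_. {..<q}" q "\<lambda>l m n. en3 (Z i l) (Z j m) (Z k n)"])
        (use t in auto)
    moreover have "en3 (Y i) (Y j) (Y k) \<le> (\<Sum>l<q. \<Sum>m<q. \<Sum>n<q. en3 (Z i l) (Z j m) (Z k n))"
      unfolding en3_def Z_def by (rule energy_boxes3_ge) (use Y lab t in auto)
    hence "?w * en3 (Y i) (Y j) (Y k) \<le> ?w * (\<Sum>l<q. \<Sum>m<q. \<Sum>n<q. en3 (Z i l) (Z j m) (Z k n))"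
      by (rule mult_left_mono) simp
    ultimately have "?w * en3 (Y i) (Y j) (Y k)
        \<le> real q ^ 3 * (\<Sum>\<mu>\<in>\<Lambda>. en3 (Z i (\<mu> i)) (Z j (\<mu> j)) (Z k (\<mu> k)))" by simp
    thus ?thesis using q s by (simp add: field_simps power_mult_distrib)
  qed
  \<comment> \<open>The whole gain sits at one ordered pair and one colour; all other summands just
    do not decrease on average.\<close>
  define gain where "gain i j a = (if (i, j) = (i0, j0) \<and> a = a0 then \<epsilon>\<^sup>2 / 4 else 0)" for i j a
  have pair_avg: "?w * (en2 a (Y i) (Y j) / real (q * s) ^ 2 + gain i j a)
      \<le> (\<Sum>\<mu>\<in>\<Lambda>. en2 a (Z i (\<mu> i)) (Z j (\<mu> j))) / real s ^ 2"
    if "(i, j) \<in> pairs t" for i j a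
  proof -
    have t: "i < t" "j < t" "i \<noteq> j" using that by (auto simp: pairs_def)
    have 1: "real q ^ 2 * (\<Sum>\<mu>\<in>\<Lambda>. en2 a (Z i (\<mu> i)) (Z j (\<mu> j)))
       = real q ^ card {..<t} * (\<Sum>l<q. \<Sum>m<q. en2 a (Z i l) (Z j m))"
      unfolding \<Lambda>_def
      by (rule sum_PiE_marginal2[of "{..<t}" i j "\<lambda>_. {..<q}" q "\<lambda>l m. en2 a (Z i l) (Z j m)"])
        (use t in auto)
    have 2: "en2 a (Y i) (Y j) + gain i j a * real (q * s) ^ 2 \<le> (\<Sum>l<q. \<Sum>m<q. en2 a (Z i l) (Z j m))"
    proof (cases "(i, j) = (i0, j0) \<and> a = a0")
      case True
      have "en2 a0 (Y i0) (Y j0) + \<epsilon>\<^sup>2 / 4 * (real (card (Y i0)) * real (card (Y j0)))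
         \<le> (\<Sum>l<q. \<Sum>m<q. en2 a0 (Z i0 l) (Z j0 m))"
        unfolding en2_def Z_def
      proof (rule irregular_pair_gain[where s=s and P=P and Q=Q and lf="l0 i0" and lg="l0 j0"])
        show "x \<in> P \<longleftrightarrow> y \<in> P" if "x \<in> Y i0" "y \<in> Y i0" "lab i0 x = lab i0 y" "lab i0 x \<noteq> l0 i0" for x y
          using lab3[OF i0(1) that] by (simp add: R_def)
        show "x \<in> Q \<longleftrightarrow> y \<in> Q" if "x \<in> Y j0" "y \<in> Y j0" "lab j0 x = lab j0 y" "lab j0 x \<noteq> l0 j0" for x y
          using lab3[OF i0(2) that] i0 by (simp add: R_def)
        show "\<bar>\<Sum>x\<in>P. \<Sum>y\<in>Q. col \<chi> a0 x y - dens (col \<chi> a0) (Y i0) (Y j0)\<bar>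
           > \<epsilon> * real (card (Y i0)) * real (card (Y j0))" by (rule big)
        show "0 \<le> col \<chi> a0 x y \<and> col \<chi> a0 x y \<le> 1" for x y by (simp add: col_def)
      qed (use Y i0 s PQ eps lab in auto)
      thus ?thesis using True Y i0 by (simp add: gain_def power2_eq_square)
    next
      case False
      hence "gain i j a = 0" by (auto simp: gain_def)
      moreover have "en2 a (Y i) (Y j) \<le> (\<Sum>l<q. \<Sum>m<q. en2 a (Z i l) (Z j m))"
        unfolding en2_def Z_def by (rule energy_boxes2_ge) (use Y lab t in auto)
      ultimately show ?thesis by simp
    qed
    have "?w * (en2 a (Y i) (Y j) + gain i j a * real (q * s) ^ 2)
       \<le> ?w * (\<Sum>l<q. \<Sum>m<q. en2 a (Z i l) (Z j m))"
      by (rule mult_left_mono[OF 2]) simp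
    hence "?w * (en2 a (Y i) (Y j) + gain i j a * real (q * s) ^ 2)
        \<le> real q ^ 2 * (\<Sum>\<mu>\<in>\<Lambda>. en2 a (Z i (\<mu> i)) (Z j (\<mu> j)))" using 1 by simp
    hence "?w * (en2 a (Y i) (Y j) + gain i j a * real (q * s) ^ 2) / real (q * s) ^ 2
        \<le> real q ^ 2 * (\<Sum>\<mu>\<in>\<Lambda>. en2 a (Z i (\<mu> i)) (Z j (\<mu> j))) / real (q * s) ^ 2"
      by (rule divide_right_mono) simp
    also have "\<dots> = (\<Sum>\<mu>\<in>\<Lambda>. en2 a (Z i (\<mu> i)) (Z j (\<mu> j))) / real s ^ 2"
      using q by (simp add: power_mult_distrib)
    also have "?w * (en2 a (Y i) (Y j) + gain i j a * real (q * s) ^ 2) / real (q * s) ^ 2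
       = ?w * (en2 a (Y i) (Y j) / real (q * s) ^ 2 + gain i j a)"
    proof -
      have "real (q * s) ^ 2 \<noteq> 0" using q s by simp
      thus ?thesis by (metis add_divide_distrib nonzero_mult_div_cancel_right times_divide_eq_right)
    qed
    finally show ?thesis .
  qed
  define Y' where "Y' \<mu> = (\<lambda>i. Z i (\<mu> i))" for \<mu>
  have T: "?w * triple_energy t (q * s) Y \<chi> h \<le> (\<Sum>\<mu>\<in>\<Lambda>. triple_energy t s (Y' \<mu>) \<chi> h)"
  proof -
    have "?w * triple_energy t (q * s) Y \<chi> h
      = (\<Sum>(i, j, k)\<in>triples t. ?w * en3 (Y i) (Y j) (Y k) / real (q * s) ^ 3)"
      by (simp add: triple_energy_def en3_def sum_divide_distrib sum_distrib_left case_prod_unfold)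
    also have "\<dots> \<le> (\<Sum>(i, j, k)\<in>triples t. (\<Sum>\<mu>\<in>\<Lambda>. en3 (Z i (\<mu> i)) (Z j (\<mu> j)) (Z k (\<mu> k))) / real s ^ 3)"
      by (rule sum_mono) (use tri_avg in auto)
    also have "\<dots> = (\<Sum>p\<in>triples t. \<Sum>\<mu>\<in>\<Lambda>. (case p of (i,j,k) \<Rightarrow> en3 (Z i (\<mu> i)) (Z j (\<mu> j)) (Z k (\<mu> k))) / real s ^ 3)"
      by (simp add: sum_divide_distrib case_prod_unfold)
    also have "\<dots> = (\<Sum>\<mu>\<in>\<Lambda>. \<Sum>p\<in>triples t. (case p of (i,j,k) \<Rightarrow> en3 (Z i (\<mu> i)) (Z j (\<mu> j)) (Z k (\<mu> k))) / real s ^ 3)"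
      by (rule sum.swap)
    also have "\<dots> = (\<Sum>\<mu>\<in>\<Lambda>. triple_energy t s (Y' \<mu>) \<chi> h)"
      by (simp add: triple_energy_def en3_def Y'_def sum_divide_distrib)
    finally show ?thesis .
  qed
  have D: "?w * (pair_energy t (q * s) Y \<chi> K + \<epsilon>\<^sup>2 / 4) \<le> (\<Sum>\<mu>\<in>\<Lambda>. pair_energy t s (Y' \<mu>) \<chi> K)"
  proof -
    have "(\<Sum>(i, j)\<in>pairs t. \<Sum>a<K. gain i j a)
        = (\<Sum>p\<in>pairs t. if p = (i0, j0) then \<Sum>a<K. if a = a0 then \<epsilon>\<^sup>2 / 4 else 0 else 0)"
    proof (rule sum.cong[OF refl])
      fix p
      show "(case p of (i, j) \<Rightarrow> \<Sum>a<K. gain i j a)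
         = (if p = (i0, j0) then \<Sum>a<K. if a = a0 then \<epsilon>\<^sup>2 / 4 else 0 else 0)"
      proof (cases "p = (i0, j0)")
        case False
        hence "gain (fst p) (snd p) a = 0" for a by (auto simp: gain_def)
        thus ?thesis using False by (simp add: case_prod_unfold)
      qed (simp add: gain_def)
    qed
    also have "\<dots> = \<epsilon>\<^sup>2 / 4" using ij a0 finite_pairs by (simp add: sum.delta)
    finally have g: "(\<Sum>(i, j)\<in>pairs t. \<Sum>a<K. gain i j a) = \<epsilon>\<^sup>2 / 4" .
    have "pair_energy t (q * s) Y \<chi> K + \<epsilon>\<^sup>2 / 4
      = (\<Sum>(i, j)\<in>pairs t. \<Sum>a<K. en2 a (Y i) (Y j) / real (q * s) ^ 2 + gain i j a)"
      unfolding g[symmetric]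
      by (simp add: pair_energy_def en2_def sum_divide_distrib sum.distrib case_prod_unfold)
    hence "?w * (pair_energy t (q * s) Y \<chi> K + \<epsilon>\<^sup>2 / 4)
      = (\<Sum>(i, j)\<in>pairs t. \<Sum>a<K. ?w * (en2 a (Y i) (Y j) / real (q * s) ^ 2 + gain i j a))"
      by (simp add: sum_distrib_left case_prod_unfold)
    also have "\<dots> \<le> (\<Sum>(i, j)\<in>pairs t. \<Sum>a<K. (\<Sum>\<mu>\<in>\<Lambda>. en2 a (Z i (\<mu> i)) (Z j (\<mu> j))) / real s ^ 2)"
      by (rule sum_mono, clarify, rule sum_mono) (use pair_avg in auto)
    also have "\<dots> = (\<Sum>p\<in>pairs t. \<Sum>\<mu>\<in>\<Lambda>. \<Sum>a<K. en2 a (Z (fst p) (\<mu> (fst p))) (Z (snd p) (\<mu> (snd p))) / real s ^ 2)"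
      unfolding sum_divide_distrib case_prod_unfold by (rule sum.cong[OF refl], rule sum.swap)
    also have "\<dots> = (\<Sum>\<mu>\<in>\<Lambda>. \<Sum>p\<in>pairs t. \<Sum>a<K. en2 a (Z (fst p) (\<mu> (fst p))) (Z (snd p) (\<mu> (snd p))) / real s ^ 2)"
      by (rule sum.swap)
    also have "\<dots> = (\<Sum>\<mu>\<in>\<Lambda>. pair_energy t s (Y' \<mu>) \<chi> K)"
      by (simp add: pair_energy_def en2_def Y'_def sum_divide_distrib case_prod_unfold)
    finally show ?thesis .
  qed
  let ?V = "triple_energy t (q * s) Y \<chi> h + \<theta> * pair_energy t (q * s) Y \<chi> K + \<theta> * \<epsilon>\<^sup>2 / 4"
  let ?U = "\<lambda>\<mu>. triple_energy t s (Y' \<mu>) \<chi> h + \<theta> * pair_energy t s (Y' \<mu>) \<chi> K"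
  have "?w * ?V = ?w * triple_energy t (q * s) Y \<chi> h + \<theta> * (?w * (pair_energy t (q * s) Y \<chi> K + \<epsilon>\<^sup>2 / 4))"
    by (simp add: algebra_simps)
  also have "\<dots> \<le> (\<Sum>\<mu>\<in>\<Lambda>. triple_energy t s (Y' \<mu>) \<chi> h) + \<theta> * (\<Sum>\<mu>\<in>\<Lambda>. pair_energy t s (Y' \<mu>) \<chi> K)"
    by (intro add_mono T mult_left_mono D lam)
  also have "\<dots> = (\<Sum>\<mu>\<in>\<Lambda>. ?U \<mu>)" by (simp add: sum.distrib sum_distrib_left)
  finally have avg: "(\<Sum>\<mu>\<in>\<Lambda>. ?V) \<le> (\<Sum>\<mu>\<in>\<Lambda>. ?U \<mu>)" by (simp add: cardL)
  obtain \<mu> where \<mu>: "\<mu> \<in> \<Lambda>" "?V \<le> ?U \<mu>"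
  proof -
    have "\<exists>\<mu>\<in>\<Lambda>. ?V \<le> ?U \<mu>"
    proof (rule ccontr)
      assume "\<not> ?thesis"
      hence "(\<Sum>\<mu>\<in>\<Lambda>. ?U \<mu>) < (\<Sum>\<mu>\<in>\<Lambda>. ?V)"
        by (intro sum_strict_mono finL neL) (auto simp: not_le)
      thus False using avg by simp
    qed
    thus ?thesis using that by blast
  qed
  have "Y' \<mu> i \<subseteq> Y i \<and> card (Y' \<mu> i) = s" if "i < t" for i
    using \<mu>(1) that lab(2)[OF that] by (auto simp: Y'_def Z_def \<Lambda>_def PiE_def Pi_def)
  thus ?thesis using \<mu>(2) by blast
qed

definition regular_system :: "nat \<Rightarrow> real \<Rightarrow> (nat \<Rightarrow> 'a set) \<Rightarrow> ('a set \<Rightarrow> nat) \<Rightarrow> nat \<Rightarrow> bool" where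
  "regular_system t \<epsilon> Y \<chi> K \<longleftrightarrow> (\<forall>(i, j)\<in>pairs t. \<forall>a<K.
     cut_small \<epsilon> (\<lambda>x y. col \<chi> a x y - dens (col \<chi> a) (Y i) (Y j)) (Y i) (Y j))"

text \<open>The triple energy plus \<open>\<theta>\<close> times the pair energy never exceeds
  \<open>t ^ 3 + \<theta> * (t ^ 2 * K)\<close>, and each irregular pair raises it by
  \<open>\<theta> * \<epsilon>\<^sup>2 / 4\<close>. The second premise thus leaves room for fewer
  than \<open>L\<close> such steps, and the part size \<open>q ^ L * s\<close> allows that many
  exact divisions by \<open>q\<close>.\<close>

lemma regularize_aux:
  assumes s: "s > 0" and eps: "\<epsilon> > 0" "real q * \<epsilon> \<ge> 4" and lam: "\<theta> \<ge> 0"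
    and h: "\<And>e. 0 \<le> h e \<and> h e \<le> 1"
  shows "(\<And>i. i < t \<Longrightarrow> finite (Y i) \<and> card (Y i) = q ^ L * s) \<Longrightarrow>
     real t ^ 3 + \<theta> * (real t ^ 2 * real K) - real L * (\<theta> * \<epsilon>\<^sup>2 / 4)
       < triple_energy t (q ^ L * s) Y \<chi> h + \<theta> * pair_energy t (q ^ L * s) Y \<chi> K \<Longrightarrow>
     \<exists>Y' l. l \<le> L \<and> (\<forall>i<t. Y' i \<subseteq> Y i \<and> card (Y' i) = q ^ l * s) \<and> regular_system t \<epsilon> Y' \<chi> K \<and>
       triple_energy t (q ^ L * s) Y \<chi> h + \<theta> * pair_energy t (q ^ L * s) Y \<chi> K
        \<le> triple_energy t (q ^ l * s) Y' \<chi> h + \<theta> * pair_energy t (q ^ l * s) Y' \<chi> K"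
proof (induction L arbitrary: Y)
  case 0
  have "triple_energy t s Y \<chi> h \<le> real t ^ 3" "pair_energy t s Y \<chi> K \<le> real t ^ 2 * real K"
    using 0(1) s h triple_energy_bounds(2)[of t Y s h \<chi>] pair_energy_bounds(2)[of t Y s \<chi> K] by auto
  hence "triple_energy t s Y \<chi> h + \<theta> * pair_energy t s Y \<chi> K \<le> real t ^ 3 + \<theta> * (real t ^ 2 * real K)"
    using lam by (intro add_mono mult_left_mono) auto
  thus ?case using 0(2) by simp
next
  case (Suc L)
  have q: "q > 0" using eps by (cases q) auto
  show ?case
  proof (cases "regular_system t \<epsilon> Y \<chi> K")
    case True
    thus ?thesis using Suc.prems by (intro exI[of _ Y] exI[of _ "Suc L"]) auto
  next
    case False
    then obtain i j a where ija: "(i, j) \<in> pairs t" "a < K"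
      "\<not> cut_small \<epsilon> (\<lambda>x y. col \<chi> a x y - dens (col \<chi> a) (Y i) (Y j)) (Y i) (Y j)"
      by (auto simp: regular_system_def)
    have qq: "q ^ Suc L * s = q * (q ^ L * s)" by simp
    have sL: "q ^ L * s > 0" using q s by simp
    have cY: "finite (Y i) \<and> card (Y i) = q * (q ^ L * s)" if "i < t" for i
      using Suc.prems(1)[OF that] by (simp add: mult.assoc)
    obtain Y1 where Y1: "\<forall>i<t. Y1 i \<subseteq> Y i \<and> card (Y1 i) = q ^ L * s"
      "triple_energy t (q ^ Suc L * s) Y \<chi> h + \<theta> * pair_energy t (q ^ Suc L * s) Y \<chi> K + \<theta> * \<epsilon>\<^sup>2 / 4
       \<le> triple_energy t (q ^ L * s) Y1 \<chi> h + \<theta> * pair_energy t (q ^ L * s) Y1 \<chi> K"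
      using chunk_step[OF cY sL ija eps lam, of h] unfolding qq by blast
    have f1: "finite (Y1 i) \<and> card (Y1 i) = q ^ L * s" if "i < t" for i
      using Y1(1) Suc.prems(1) that finite_subset by blast
    have "real t ^ 3 + \<theta> * (real t ^ 2 * real K) - real L * (\<theta> * \<epsilon>\<^sup>2 / 4)
       < triple_energy t (q ^ L * s) Y1 \<chi> h + \<theta> * pair_energy t (q ^ L * s) Y1 \<chi> K"
    proof -
      have "real (Suc L) * (\<theta> * \<epsilon>\<^sup>2 / 4) = real L * (\<theta> * \<epsilon>\<^sup>2 / 4) + \<theta> * \<epsilon>\<^sup>2 / 4"
        by (simp only: of_nat_Suc distrib_right mult_1_left)
      thus ?thesis using Y1(2) Suc.prems(2) by linarith
    qed
    from Suc.IH[OF f1 this] obtain Y' l where Y': "l \<le> L"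
      "\<forall>i<t. Y' i \<subseteq> Y1 i \<and> card (Y' i) = q ^ l * s" "regular_system t \<epsilon> Y' \<chi> K"
      "triple_energy t (q ^ L * s) Y1 \<chi> h + \<theta> * pair_energy t (q ^ L * s) Y1 \<chi> K
        \<le> triple_energy t (q ^ l * s) Y' \<chi> h + \<theta> * pair_energy t (q ^ l * s) Y' \<chi> K"
      by blast
    have "0 \<le> \<theta> * \<epsilon>\<^sup>2 / 4" using lam by simp
    hence "triple_energy t (q ^ Suc L * s) Y \<chi> h + \<theta> * pair_energy t (q ^ Suc L * s) Y \<chi> K
        \<le> triple_energy t (q ^ l * s) Y' \<chi> h + \<theta> * pair_energy t (q ^ l * s) Y' \<chi> K"
      using Y1(2) Y'(4) by linarith
    moreover have "\<forall>i<t. Y' i \<subseteq> Y i \<and> card (Y' i) = q ^ l * s" using Y1(1) Y'(2) by blast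
    ultimately show ?thesis using Y'(1,3) by (intro exI[of _ Y'] exI[of _ l]) auto
  qed
qed

text \<open>The weight \<open>\<theta>\<close> of the pair energy bounds the triple energy that may be lost in exchange for
  regularity.\<close>

lemma regularize:
  assumes s: "s > 0" and eps: "\<epsilon> > 0" "real q * \<epsilon> \<ge> 4" and lam: "\<theta> > 0"
    and h: "\<And>e. 0 \<le> h e \<and> h e \<le> 1"
    and Y: "\<And>i. i < t \<Longrightarrow> finite (Y i) \<and> card (Y i) = q ^ L * s"
    and L: "real t ^ 3 + \<theta> * (real t ^ 2 * real K) < real L * (\<theta> * \<epsilon>\<^sup>2 / 4)"
  shows "\<exists>Y' l. l \<le> L \<and> (\<forall>i<t. Y' i \<subseteq> Y i \<and> card (Y' i) = q ^ l * s) \<and> regular_system t \<epsilon> Y' \<chi> K \<and>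
       triple_energy t (q ^ L * s) Y \<chi> h - \<theta> * (real t ^ 2 * real K) \<le> triple_energy t (q ^ l * s) Y' \<chi> h"
proof -
  have q: "q > 0" using eps by (cases q) auto
  have sL: "q ^ l * s > 0" for l using q s by simp
  have nn: "0 \<le> triple_energy t (q ^ L * s) Y \<chi> h" "0 \<le> pair_energy t (q ^ L * s) Y \<chi> K"
    using triple_energy_bounds(1)[OF Y sL h] pair_energy_bounds(1)[OF Y sL] by auto
  hence "0 \<le> \<theta> * pair_energy t (q ^ L * s) Y \<chi> K" using lam by simp
  hence "real t ^ 3 + \<theta> * (real t ^ 2 * real K) - real L * (\<theta> * \<epsilon>\<^sup>2 / 4)
       < triple_energy t (q ^ L * s) Y \<chi> h + \<theta> * pair_energy t (q ^ L * s) Y \<chi> K"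
    using nn(1) L by linarith
  from regularize_aux[OF s eps less_imp_le[OF lam] h Y this]
  obtain Y' l where Y': "l \<le> L"
      "\<forall>i<t. Y' i \<subseteq> Y i \<and> card (Y' i) = q ^ l * s" "regular_system t \<epsilon> Y' \<chi> K"
      "triple_energy t (q ^ L * s) Y \<chi> h + \<theta> * pair_energy t (q ^ L * s) Y \<chi> K
        \<le> triple_energy t (q ^ l * s) Y' \<chi> h + \<theta> * pair_energy t (q ^ l * s) Y' \<chi> K"
    by blast
  have "finite (Y' i) \<and> card (Y' i) = q ^ l * s" if "i < t" for i
    using Y'(2) Y that finite_subset by blast
  hence "pair_energy t (q ^ l * s) Y' \<chi> K \<le> real t ^ 2 * real K"
    by (rule pair_energy_bounds(2)[OF _ sL])
  hence "\<theta> * pair_energy t (q ^ l * s) Y' \<chi> K \<le> \<theta> * (real t ^ 2 * real K)" using lam by simp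
  hence "triple_energy t (q ^ L * s) Y \<chi> h - \<theta> * (real t ^ 2 * real K) \<le> triple_energy t (q ^ l * s) Y' \<chi> h"
    using Y'(4) \<open>0 \<le> \<theta> * pair_energy t (q ^ L * s) Y \<chi> K\<close> by linarith
  thus ?thesis using Y' by blast
qed

section \<open>Refining the colouring of pairs\<close>

text \<open>As the parts are disjoint, a single set of unordered pairs encodes a set of edges for each of
  the three pairs of parts.\<close>

definition ind3 :: "'a set set \<Rightarrow> 'a \<times> 'a \<times> 'a \<Rightarrow> real" where
  "ind3 S = (\<lambda>(x, y, z). of_bool ({x, y} \<in> S \<and> {y, z} \<in> S \<and> {x, z} \<in> S))"

text \<open>The tests of this cut norm restrict all three sides of a triple. Tests on the vertices
  alone would be too weak, because the other seven octahedron factors are functions of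
  sides.\<close>

definition hyper_regular ::
  "nat \<Rightarrow> nat \<Rightarrow> real \<Rightarrow> (nat \<Rightarrow> 'a set) \<Rightarrow> ('a set \<Rightarrow> nat) \<Rightarrow> ('a set \<Rightarrow> real) \<Rightarrow> bool" where
  "hyper_regular t s \<epsilon> Y \<chi> h \<longleftrightarrow> (\<forall>(i, j, k)\<in>triples t. \<forall>S.
     \<bar>\<Sum>\<omega>\<in>Y i \<times> Y j \<times> Y k.
        (tri h \<omega> - cavg (Y i \<times> Y j \<times> Y k) (key3 \<chi>) (tri h) \<omega>) * ind3 S \<omega>\<bar> \<le> \<epsilon> * real s ^ 3)"

text \<open>Stated for all sets rather than for pairs inside the parts, so that it gives
  \<open>refines\<close> on every block at once.\<close>

definition finer :: "('a set \<Rightarrow> nat) \<Rightarrow> ('a set \<Rightarrow> nat) \<Rightarrow> bool" where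
  "finer \<chi>' \<chi> \<longleftrightarrow> (\<forall>e e'. \<chi>' e = \<chi>' e' \<longrightarrow> \<chi> e = \<chi> e')"

lemma finer_refines: "finer \<chi>' \<chi> \<Longrightarrow> refines \<Omega> (key3 \<chi>') (key3 \<chi>)"
  unfolding refines_def
proof (intro ballI impI)
  fix v w assume f: "finer \<chi>' \<chi>" and k: "key3 \<chi>' v = key3 \<chi>' w"
  have F: "\<chi> e = \<chi> e'" if "\<chi>' e = \<chi>' e'" for e e' using f that unfolding finer_def by blast
  obtain x y z x' y' z' where vw: "v = (x, y, z)" "w = (x', y', z')" by (metis prod_cases3)
  have "\<chi> {x, y} = \<chi> {x', y'}" "\<chi> {y, z} = \<chi> {y', z'}" "\<chi> {x, z} = \<chi> {x', z'}"
    by (rule F, use k in \<open>simp add: key3_def vw\<close>)+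
  thus "key3 \<chi> v = key3 \<chi> w" by (simp add: key3_def vw)
qed

text \<open>Each colour is split according to membership in the violating set \<open>S\<close>. Then
  \<open>ind3 S\<close> is constant on the new cells, so \<open>energy_increment\<close> applies to
  the bad triple, and no other triple loses energy. The vertex sets stay fixed; only the bound on
  the number of colours doubles.\<close>

lemma colour_step:
  assumes Y: "\<And>i. i < t \<Longrightarrow> finite (Y i) \<and> card (Y i) = s" and s: "s > 0" and eps: "\<epsilon> > 0"
    and irr: "\<not> hyper_regular t s \<epsilon> Y \<chi> h" and \<chi>: "\<And>e. \<chi> e < K"
  shows "\<exists>\<chi>'. finer \<chi>' \<chi> \<and> (\<forall>e. \<chi>' e < 2 * K) \<and>
      triple_energy t s Y \<chi> h + \<epsilon>\<^sup>2 \<le> triple_energy t s Y \<chi>' h"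
proof -
  obtain i j k S where ijk: "(i, j, k) \<in> triples t" and big:
    "\<bar>\<Sum>\<omega>\<in>Y i \<times> Y j \<times> Y k.
        (tri h \<omega> - cavg (Y i \<times> Y j \<times> Y k) (key3 \<chi>) (tri h) \<omega>) * ind3 S \<omega>\<bar> > \<epsilon> * real s ^ 3"
  proof -
    define P where "P i j k S \<longleftrightarrow> \<bar>\<Sum>\<omega>\<in>Y i \<times> Y j \<times> Y k.
        (tri h \<omega> - cavg (Y i \<times> Y j \<times> Y k) (key3 \<chi>) (tri h) \<omega>) * ind3 S \<omega>\<bar> \<le> \<epsilon> * real s ^ 3" for i j k S
    have "\<not> (\<forall>(i, j, k)\<in>triples t. \<forall>S. P i j k S)"
      using irr by (simp only: hyper_regular_def P_def not_False_eq_True)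
    then obtain i j k S where "(i, j, k) \<in> triples t" "\<not> P i j k S" by blast
    thus ?thesis using that by (simp only: P_def not_le)
  qed
  define \<chi>' where "\<chi>' e = 2 * \<chi> e + of_bool (e \<in> S)" for e
  have S: "e \<in> S \<longleftrightarrow> e' \<in> S" and fin: "\<chi> e = \<chi> e'" if "\<chi>' e = \<chi>' e'" for e e'
    using that unfolding \<chi>'_def by (cases "e \<in> S"; cases "e' \<in> S"; simp; presburger)+
  have finer: "finer \<chi>' \<chi>" unfolding finer_def by (intro allI impI fin)
  let ?\<Omega> = "Y i \<times> Y j \<times> Y k"
  have t: "i < t" "j < t" "k < t" using ijk by (auto simp: triples_def)
  have cO: "real (card ?\<Omega>) = real s ^ 3" using t Y by (simp add: card_cartesian_product power3_eq_cube)
  have "(\<epsilon> * real s ^ 3)\<^sup>2 \<le> (\<Sum>\<omega>\<in>?\<Omega>. (tri h \<omega> - cavg ?\<Omega> (key3 \<chi>) (tri h) \<omega>) * ind3 S \<omega>)\<^sup>2"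
    using big eps by (subst abs_le_square_iff[symmetric]) (simp add: abs_mult)
  also have "\<dots> \<le> real (card ?\<Omega>) * (energy ?\<Omega> (key3 \<chi>') (tri h) - energy ?\<Omega> (key3 \<chi>) (tri h))"
  proof (rule energy_increment[OF _ finer_refines[OF finer]])
    show "finite ?\<Omega>" using t Y by auto
    show "ind3 S v = ind3 S w" if "key3 \<chi>' v = key3 \<chi>' w" for v w
    proof -
      obtain x y z x' y' z' where vw: "v = (x, y, z)" "w = (x', y', z')" by (metis prod_cases3)
      have "{x, y} \<in> S \<longleftrightarrow> {x', y'} \<in> S" "{y, z} \<in> S \<longleftrightarrow> {y', z'} \<in> S"
        "{x, z} \<in> S \<longleftrightarrow> {x', z'} \<in> S"
        by (rule S, use that in \<open>simp add: key3_def vw\<close>)+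
      thus ?thesis by (simp only: ind3_def vw prod.case)
    qed
    show "\<bar>ind3 S v\<bar> \<le> 1" for v by (auto simp: ind3_def split: prod.splits)
  qed
  finally have "real s ^ 3 * (\<epsilon>\<^sup>2 * real s ^ 3)
      \<le> real s ^ 3 * (energy ?\<Omega> (key3 \<chi>') (tri h) - energy ?\<Omega> (key3 \<chi>) (tri h))"
    unfolding cO by (simp add: power2_eq_square mult_ac)
  hence gain: "\<epsilon>\<^sup>2 * real s ^ 3 \<le> energy ?\<Omega> (key3 \<chi>') (tri h) - energy ?\<Omega> (key3 \<chi>) (tri h)"
    by (rule mult_left_le_imp_le) (use s in simp)
  have "(\<Sum>p\<in>triples t. case p of (i, j, k) \<Rightarrow> energy (Y i \<times> Y j \<times> Y k) (key3 \<chi>) (tri h)) + \<epsilon>\<^sup>2 * real s ^ 3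
      = (\<Sum>p\<in>triples t. (case p of (i, j, k) \<Rightarrow> energy (Y i \<times> Y j \<times> Y k) (key3 \<chi>) (tri h))
           + (if p = (i, j, k) then \<epsilon>\<^sup>2 * real s ^ 3 else 0))"
    using ijk finite_triples by (simp add: sum.distrib sum.delta)
  also have "\<dots> \<le> (\<Sum>p\<in>triples t. case p of (i, j, k) \<Rightarrow> energy (Y i \<times> Y j \<times> Y k) (key3 \<chi>') (tri h))"
  proof (rule sum_mono)
    fix p assume p: "p \<in> triples t"
    show "(case p of (i, j, k) \<Rightarrow> energy (Y i \<times> Y j \<times> Y k) (key3 \<chi>) (tri h))
           + (if p = (i, j, k) then \<epsilon>\<^sup>2 * real s ^ 3 else 0)
      \<le> (case p of (i, j, k) \<Rightarrow> energy (Y i \<times> Y j \<times> Y k) (key3 \<chi>') (tri h))"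
    proof (cases "p = (i, j, k)")
      case True thus ?thesis using gain by simp
    next
      case False
      thus ?thesis using p Y
        by (auto simp: triples_def split: prod.splits intro!: energy_mono finer_refines finer)
    qed
  qed
  finally have "((\<Sum>p\<in>triples t. case p of (i, j, k) \<Rightarrow> energy (Y i \<times> Y j \<times> Y k) (key3 \<chi>) (tri h))
        + \<epsilon>\<^sup>2 * real s ^ 3) / real s ^ 3
     \<le> (\<Sum>p\<in>triples t. case p of (i, j, k) \<Rightarrow> energy (Y i \<times> Y j \<times> Y k) (key3 \<chi>') (tri h)) / real s ^ 3"
    by (rule divide_right_mono) simp
  hence "triple_energy t s Y \<chi> h + \<epsilon>\<^sup>2 \<le> triple_energy t s Y \<chi>' h"
    using s by (simp add: triple_energy_def add_divide_distrib)
  moreover have "\<chi>' e < 2 * K" for e using \<chi>[of e] by (auto simp: \<chi>'_def)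
  ultimately show ?thesis using finer by blast
qed

lemma finer_trans: "finer a b \<Longrightarrow> finer b c \<Longrightarrow> finer a c"
  unfolding finer_def by blast

lemma finer_refl: "finer a a"
  unfolding finer_def by blast

text \<open>The triple energy is at most \<open>t ^ 3\<close> and each splitting gains
  \<open>\<epsilon>\<^sup>2\<close>; the second premise says that fewer than \<open>M\<close>
  splittings remain.\<close>

lemma hyper_regularize_aux:
  assumes Y: "\<And>i. i < t \<Longrightarrow> finite (Y i) \<and> card (Y i) = s" and s: "s > 0" and eps: "\<epsilon> > 0"
    and h: "\<And>e. 0 \<le> h e \<and> h e \<le> 1"
  shows "(\<And>e. \<chi> e < K) \<Longrightarrow> real t ^ 3 - real M * \<epsilon>\<^sup>2 < triple_energy t s Y \<chi> h \<Longrightarrow>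
    \<exists>\<chi>'. finer \<chi>' \<chi> \<and> (\<forall>e. \<chi>' e < 2 ^ M * K) \<and> hyper_regular t s \<epsilon> Y \<chi>' h"
proof (induction M arbitrary: \<chi> K)
  case 0
  have "triple_energy t s Y \<chi> h \<le> real t ^ 3" by (rule triple_energy_bounds(2)) (use Y s h in auto)
  thus ?case using 0 by simp
next
  case (Suc M)
  show ?case
  proof (cases "hyper_regular t s \<epsilon> Y \<chi> h")
    case True
    have "\<chi> e < 2 ^ Suc M * K" for e
    proof -
      have "1 * K \<le> 2 ^ Suc M * K" by (rule mult_right_mono) auto
      thus ?thesis using Suc.prems(1)[of e] by linarith
    qed
    thus ?thesis using True finer_refl by blast
  next
    case False
    from colour_step[OF Y s eps False Suc.prems(1)] obtain \<chi>1 where 1: "finer \<chi>1 \<chi>"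
      "\<And>e. \<chi>1 e < 2 * K" "triple_energy t s Y \<chi> h + \<epsilon>\<^sup>2 \<le> triple_energy t s Y \<chi>1 h" by blast
    have "real (Suc M) * \<epsilon>\<^sup>2 = real M * \<epsilon>\<^sup>2 + \<epsilon>\<^sup>2" by (simp add: distrib_right)
    hence "real t ^ 3 - real M * \<epsilon>\<^sup>2 < triple_energy t s Y \<chi>1 h" using 1(3) Suc.prems(2) by linarith
    from Suc.IH[OF 1(2) this] show ?thesis using finer_trans[OF _ 1(1)] by (auto simp: mult_ac)
  qed
qed

lemma hyper_regularize:
  assumes Y: "\<And>i. i < t \<Longrightarrow> finite (Y i) \<and> card (Y i) = s" and s: "s > 0" and eps: "\<epsilon> > 0"
    and h: "\<And>e. 0 \<le> h e \<and> h e \<le> 1" and \<chi>: "\<And>e. \<chi> e < K" and M: "real t ^ 3 < real M * \<epsilon>\<^sup>2"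
  shows "\<exists>\<chi>'. finer \<chi>' \<chi> \<and> (\<forall>e. \<chi>' e < 2 ^ M * K) \<and> hyper_regular t s \<epsilon> Y \<chi>' h"
proof (rule hyper_regularize_aux[OF Y s eps h \<chi>])
  show "real t ^ 3 - real M * \<epsilon>\<^sup>2 < triple_energy t s Y \<chi> h"
  proof -
    have "0 \<le> triple_energy t s Y \<chi> h" by (rule triple_energy_bounds(1)) (use Y s h in auto)
    thus ?thesis using M by linarith
  qed
qed

section \<open>Alternating between graph and hypergraph regularity\<close>

definition shrink :: "(nat \<Rightarrow> nat) \<Rightarrow> (nat \<Rightarrow> nat) \<Rightarrow> nat \<Rightarrow> nat \<Rightarrow> nat" where
  "shrink q L r d = (\<Prod>i<d. q (r + i) ^ L (r + i))"

lemma shrink_Suc: "shrink q L r (Suc d) = q r ^ L r * shrink q L (Suc r) d"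
  unfolding shrink_def by (subst prod.lessThan_Suc_shift) simp

text \<open>A strong regularity pair: graph regularity is asked of the coarse colouring, hypergraph
  regularity of the fine one, and the gap \<open>g\<close> bounds in mean square how far their
  averages are apart.\<close>

definition good_system :: "nat \<Rightarrow> nat \<Rightarrow> real \<Rightarrow> real \<Rightarrow> nat \<Rightarrow> (nat \<Rightarrow> 'a set) \<Rightarrow>
    ('a set \<Rightarrow> nat) \<Rightarrow> ('a set \<Rightarrow> nat) \<Rightarrow> ('a set \<Rightarrow> real) \<Rightarrow> bool" where
  "good_system t s \<epsilon> g K Y \<chi> \<chi>' h \<longleftrightarrow>
     (\<forall>e. \<chi> e < K) \<and> regular_system t \<epsilon> Y \<chi> K \<and> finer \<chi>' \<chi> \<and> hyper_regular t s \<epsilon> Y \<chi>' h \<and>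
     triple_energy t s Y \<chi>' h - triple_energy t s Y \<chi> h \<le> g"

text \<open>A round first makes \<open>\<chi>\<close> regular, at a loss of at most
  \<open>g / 2\<close> in triple energy, and then refines it to \<open>\<chi>'\<close>. If the
  refinement gains more than \<open>g\<close>, the net gain exceeds \<open>g / 2\<close> and
  \<open>\<chi>'\<close> becomes the coarse colouring of the next round. The premise on the energy
  leaves room for fewer than \<open>d\<close> such rounds.\<close>

lemma good_system_exists_aux:
  fixes \<epsilon> \<theta> :: "nat \<Rightarrow> real"
  assumes h: "\<And>e. 0 \<le> h e \<and> h e \<le> 1"
    and eps: "\<And>r. \<epsilon> r > 0" "\<And>r. real (q r) * \<epsilon> r \<ge> 4"
    and th: "\<And>r. \<theta> r > 0" "\<And>r. \<theta> r * (real t ^ 2 * real (K r)) \<le> g / 2"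
    and L: "\<And>r. real t ^ 3 + \<theta> r * (real t ^ 2 * real (K r)) < real (L r) * (\<theta> r * (\<epsilon> r)\<^sup>2 / 4)"
    and M: "\<And>r. real t ^ 3 < real (M r) * (\<epsilon> r)\<^sup>2"
    and K: "\<And>r. 2 ^ M r * K r \<le> K (Suc r)"
  shows "s0 > 0 \<Longrightarrow> (\<And>i. i < t \<Longrightarrow> finite (Y i) \<and> card (Y i) = shrink q L r d * s0) \<Longrightarrow>
     (\<And>e. \<chi> e < K r) \<Longrightarrow>
     real t ^ 3 - real d * (g / 2) < triple_energy t (shrink q L r d * s0) Y \<chi> h \<Longrightarrow>
     \<exists>r' Y' s \<chi>1 \<chi>2. r' < r + d \<and> s0 \<le> s \<and> (\<forall>i<t. Y' i \<subseteq> Y i \<and> card (Y' i) = s) \<and>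
        good_system t s (\<epsilon> r') g (K r') Y' \<chi>1 \<chi>2 h"
proof (induction d arbitrary: r Y s0 \<chi>)
  case 0
  have "triple_energy t s0 Y \<chi> h \<le> real t ^ 3"
    by (rule triple_energy_bounds(2)) (use 0 h in \<open>auto simp: shrink_def\<close>)
  thus ?case using 0 by (simp add: shrink_def)
next
  case (Suc d)
  have q: "q r > 0" for r using eps(2)[of r] by (cases "q r") auto
  have sh: "shrink q L r d > 0" for r d using q by (auto simp: shrink_def)
  let ?s = "shrink q L (Suc r) d * s0"
  have sS: "shrink q L r (Suc d) * s0 = q r ^ L r * ?s" by (simp add: shrink_Suc)
  have s: "?s > 0" using sh Suc.prems(1) by simp
  have cY: "finite (Y i) \<and> card (Y i) = q r ^ L r * ?s" if "i < t" for i
    using Suc.prems(2)[OF that] by (simp only: sS)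
  have "\<exists>Y' l. l \<le> L r \<and> (\<forall>i<t. Y' i \<subseteq> Y i \<and> card (Y' i) = q r ^ l * ?s) \<and>
    regular_system t (\<epsilon> r) Y' \<chi> (K r) \<and>
    triple_energy t (q r ^ L r * ?s) Y \<chi> h - \<theta> r * (real t ^ 2 * real (K r))
       \<le> triple_energy t (q r ^ l * ?s) Y' \<chi> h"
    by (rule regularize[OF s eps(1,2) th(1)]) (use h cY L in auto)
  then obtain Y1 l where Y1: "l \<le> L r \<and> (\<forall>i<t. Y1 i \<subseteq> Y i \<and> card (Y1 i) = q r ^ l * ?s) \<and>
    regular_system t (\<epsilon> r) Y1 \<chi> (K r) \<and>
    triple_energy t (q r ^ L r * ?s) Y \<chi> h - \<theta> r * (real t ^ 2 * real (K r))
       \<le> triple_energy t (q r ^ l * ?s) Y1 \<chi> h"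
    by (elim exE)
  note Y1 = Y1[THEN conjunct1] Y1[THEN conjunct2, THEN conjunct1]
    Y1[THEN conjunct2, THEN conjunct2, THEN conjunct1] Y1[THEN conjunct2, THEN conjunct2, THEN conjunct2]
  let ?s1 = "q r ^ l * ?s"
  have fY1: "finite (Y1 i) \<and> card (Y1 i) = ?s1" if "i < t" for i
    using Y1(2) Suc.prems(2) that finite_subset by blast
  have s1: "?s1 > 0" using s q by simp
  have "\<exists>\<chi>'. finer \<chi>' \<chi> \<and> (\<forall>e. \<chi>' e < 2 ^ M r * K r) \<and> hyper_regular t ?s1 (\<epsilon> r) Y1 \<chi>' h"
    by (rule hyper_regularize[OF _ s1 eps(1)]) (use fY1 h Suc.prems(3) M in auto)
  then obtain \<chi>' where \<chi>': "finer \<chi>' \<chi>" "\<forall>e. \<chi>' e < 2 ^ M r * K r"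
    "hyper_regular t ?s1 (\<epsilon> r) Y1 \<chi>' h" by (elim exE conjE)
  show ?case
  proof (cases "triple_energy t ?s1 Y1 \<chi>' h - triple_energy t ?s1 Y1 \<chi> h \<le> g")
    case True
    hence "good_system t ?s1 (\<epsilon> r) g (K r) Y1 \<chi> \<chi>' h"
      using Y1 \<chi>' Suc.prems(3) by (simp add: good_system_def)
    moreover have "1 * 1 * s0 \<le> q r ^ l * shrink q L (Suc r) d * s0"
      using q[of r] sh[of "Suc r" d] by (intro mult_mono) (auto simp: Suc_le_eq)
    hence "s0 \<le> ?s1" by (simp add: mult.assoc)
    ultimately show ?thesis using Y1(2)
      by (intro exI[of _ r] exI[of _ Y1] exI[of _ ?s1] exI[of _ \<chi>] exI[of _ \<chi>']) auto
  next
    case False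
    \<comment> \<open>Graph regularity may be reached before all \<open>L r\<close> cuts are spent.
      The unspent factor \<open>q r ^ l\<close> is moved into the base size, so that the part size
      has the form required by the induction hypothesis.\<close>
    have s1': "?s1 = shrink q L (Suc r) d * (q r ^ l * s0)" by simp
    have s0': "q r ^ l * s0 > 0" using q Suc.prems(1) by simp
    have \<chi>'K: "\<chi>' e < K (Suc r)" for e using \<chi>'(2) K[of r] by (meson order_less_le_trans)
    have "real (Suc d) * (g / 2) = real d * (g / 2) + g / 2" by (simp add: distrib_right)
    hence en: "real t ^ 3 - real d * (g / 2) < triple_energy t ?s1 Y1 \<chi>' h"
      using False Y1(4) th(2)[of r] Suc.prems(4) unfolding sS by linarith
    have "\<exists>r' Y' s \<chi>1 \<chi>2. r' < Suc r + d \<and> q r ^ l * s0 \<le> s \<and>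
      (\<forall>i<t. Y' i \<subseteq> Y1 i \<and> card (Y' i) = s) \<and> good_system t s (\<epsilon> r') g (K r') Y' \<chi>1 \<chi>2 h"
      by (rule Suc.IH[OF s0' _ \<chi>'K en[unfolded s1']]) (use fY1 s1' in auto)
    then obtain r' Y' s \<chi>1 \<chi>2 where 1: "r' < Suc r + d" "q r ^ l * s0 \<le> s"
      "\<forall>i<t. Y' i \<subseteq> Y1 i \<and> card (Y' i) = s" "good_system t s (\<epsilon> r') g (K r') Y' \<chi>1 \<chi>2 h"
      by (elim exE conjE)
    have "1 * s0 \<le> q r ^ l * s0" using q[of r] by (intro mult_right_mono) (auto simp: Suc_le_eq)
    hence "s0 \<le> s" using 1(2) by linarith
    moreover have "\<forall>i<t. Y' i \<subseteq> Y i \<and> card (Y' i) = s" using 1(3) Y1(2) by blast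
    moreover have "r' < r + Suc d" using 1(1) by simp
    ultimately show ?thesis using 1(4)
      by (intro exI[of _ r'] exI[of _ Y'] exI[of _ s] exI[of _ \<chi>1] exI[of _ \<chi>2] conjI)
  qed
qed

lemma good_system_exists:
  fixes \<epsilon> \<theta> :: "nat \<Rightarrow> real"
  assumes h: "\<And>e. 0 \<le> h e \<and> h e \<le> 1"
    and eps: "\<And>r. \<epsilon> r > 0" "\<And>r. real (q r) * \<epsilon> r \<ge> 4"
    and th: "\<And>r. \<theta> r > 0" "\<And>r. \<theta> r * (real t ^ 2 * real (K r)) \<le> g / 2"
    and L: "\<And>r. real t ^ 3 + \<theta> r * (real t ^ 2 * real (K r)) < real (L r) * (\<theta> r * (\<epsilon> r)\<^sup>2 / 4)"
    and M: "\<And>r. real t ^ 3 < real (M r) * (\<epsilon> r)\<^sup>2"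
    and K: "\<And>r. 2 ^ M r * K r \<le> K (Suc r)" and K0: "K 0 > 0"
    and R: "real t ^ 3 < real R * (g / 2)" and s0: "s0 > 0"
    and Y: "\<And>i. i < t \<Longrightarrow> finite (Y i) \<and> card (Y i) = shrink q L 0 R * s0"
  shows "\<exists>r Y' s \<chi> \<chi>'. r < R \<and> s0 \<le> s \<and> (\<forall>i<t. Y' i \<subseteq> Y i \<and> card (Y' i) = s) \<and>
        good_system t s (\<epsilon> r) g (K r) Y' \<chi> \<chi>' h"
proof -
  have q: "q r > 0" for r using eps(2)[of r] by (cases "q r") auto
  have sh: "shrink q L 0 R * s0 > 0" using q s0 by (auto simp: shrink_def)
  \<comment> \<open>The iteration starts from the colouring with a single colour.\<close>
  have "real t ^ 3 - real R * (g / 2) < triple_energy t (shrink q L 0 R * s0) Y (\<lambda>_. 0) h"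
  proof -
    have "0 \<le> triple_energy t (shrink q L 0 R * s0) Y (\<lambda>_. 0) h"
      by (rule triple_energy_bounds(1)[OF Y sh h])
    thus ?thesis using R by linarith
  qed
  note en = this
  have "\<exists>r' Y' s \<chi>1 \<chi>2. r' < 0 + R \<and> s0 \<le> s \<and> (\<forall>i<t. Y' i \<subseteq> Y i \<and> card (Y' i) = s) \<and>
        good_system t s (\<epsilon> r') g (K r') Y' \<chi>1 \<chi>2 h"
    by (rule good_system_exists_aux[where K=K and \<theta>=\<theta> and M=M, OF h eps th L M K s0 Y _ en])
      (use K0 in auto)
  thus ?thesis by simp
qed

section \<open>Ramsey bound for triples\<close>

lemma pigeonhole_fibre:
  fixes f :: "'b \<Rightarrow> 'c"
  assumes fin: "finite C" and f: "f ` W \<subseteq> C" and C: "card C \<le> B" and W: "B * X \<le> card W" and X: "X > 0"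
    and finW: "finite W" and ne: "C \<noteq> {}"
  shows "\<exists>c\<in>C. X \<le> card {w\<in>W. f w = c}"
proof (rule ccontr)
  assume a: "\<not> ?thesis"
  have "W = (\<Union>c\<in>C. {w\<in>W. f w = c})" using f by auto
  hence "card W \<le> (\<Sum>c\<in>C. card {w\<in>W. f w = c})" using card_UN_le[OF fin] by metis
  also have "\<dots> < (\<Sum>c\<in>C. X)" using a by (intro sum_strict_mono fin ne) (auto simp: not_le)
  also have "\<dots> = card C * X" by simp
  also have "\<dots> \<le> B * X" using C by (rule mult_right_mono) simp
  finally show False using W by simp
qed

text \<open>The argument of Erdos and Szekeres: \<open>S\<close> holds vertices whose colour
  \<open>f i\<close> towards everything later is settled, and \<open>W\<close> is the pool of later
  candidates. The least element of \<open>W\<close> moves to \<open>S\<close>, and the pool shrinks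
  to a most frequent colour. The \<open>+ 1\<close> in the base pays for the moved vertex.\<close>

lemma end_homogeneous_pairs:
  fixes c :: "nat \<Rightarrow> nat \<Rightarrow> nat"
  assumes c: "\<And>i j. c i j < \<kappa>" 
  shows "finite S \<Longrightarrow> finite W \<Longrightarrow> \<forall>i\<in>S. \<forall>w\<in>W. i < w \<Longrightarrow> (\<kappa> + 1) ^ r \<le> card W \<Longrightarrow>
    \<forall>i\<in>S. \<forall>j\<in>S \<union> W. i < j \<longrightarrow> c i j = f i \<Longrightarrow> \<forall>i. f i < \<kappa> \<Longrightarrow>
    \<exists>S' f. S \<subseteq> S' \<and> S' \<subseteq> S \<union> W \<and> card S' = card S + r \<and> (\<forall>i. f i < \<kappa>) \<and>
       (\<forall>i\<in>S'. \<forall>j\<in>S'. i < j \<longrightarrow> c i j = f i)"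
proof (induction r arbitrary: S W f)
  case 0
  thus ?case by (intro exI[of _ S] exI[of _ f]) auto
next
  case (Suc r)
  have k: "\<kappa> > 0" using c[of 0 0] by simp
  let ?X = "(\<kappa> + 1) ^ r"
  have "W \<noteq> {}" using Suc.prems(4) by auto
  define v where "v = Min W"
  have v: "v \<in> W" "\<And>w. w \<in> W \<Longrightarrow> v \<le> w" using \<open>W \<noteq> {}\<close> Suc.prems(2) by (auto simp: v_def)
  have "\<kappa> * ?X + ?X \<le> card W" using Suc.prems(4) by (simp add: algebra_simps)
  moreover have "?X > 0" by simp
  moreover have "card (W - {v}) = card W - 1" using v Suc.prems(2) by simp
  ultimately have W: "\<kappa> * ?X \<le> card (W - {v})" by linarith
  have "\<exists>a\<in>{..<\<kappa>}. ?X \<le> card {w\<in>W - {v}. c v w = a}"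
    by (rule pigeonhole_fibre[where B=\<kappa>]) (use c k W Suc.prems(2) in \<open>auto simp: lessThan_empty_iff\<close>)
  then obtain a where a: "a < \<kappa>" "?X \<le> card {w\<in>W - {v}. c v w = a}" by auto
  let ?W = "{w\<in>W - {v}. c v w = a}" and ?S = "insert v S" and ?f = "f(v := a)"
  have vS: "v \<notin> S" using Suc.prems(3) v(1) by auto
  have "\<exists>S' f. ?S \<subseteq> S' \<and> S' \<subseteq> ?S \<union> ?W \<and> card S' = card ?S + r \<and> (\<forall>i. f i < \<kappa>) \<and>
       (\<forall>i\<in>S'. \<forall>j\<in>S'. i < j \<longrightarrow> c i j = f i)"
  proof (rule Suc.IH[where f="?f"])
    show "\<forall>i\<in>?S. \<forall>w\<in>?W. i < w" using Suc.prems(3) v by (auto simp: order.not_eq_order_implies_strict)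
    show "\<forall>i\<in>?S. \<forall>j\<in>?S \<union> ?W. i < j \<longrightarrow> c i j = ?f i"
      using Suc.prems(3,5) v vS by (auto dest: less_asym)
    show "\<forall>i. ?f i < \<kappa>" using a Suc.prems(6) by auto
  qed (use Suc.prems a in auto)
  then obtain S' f' where "?S \<subseteq> S'" "S' \<subseteq> ?S \<union> ?W" "card S' = card ?S + r" "\<forall>i. f' i < \<kappa>"
       "\<forall>i\<in>S'. \<forall>j\<in>S'. i < j \<longrightarrow> c i j = f' i" by blast
  thus ?case using v(1) vS Suc.prems(1) by (intro exI[of _ S'] exI[of _ f']) auto
qed

text \<open>Among \<open>\<kappa> * m\<close> end-homogeneous vertices some \<open>m\<close> share
  their settled colour.\<close>

lemma ramsey_pairs:
  fixes c :: "nat \<Rightarrow> nat \<Rightarrow> nat"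
  assumes c: "\<And>i j. c i j < \<kappa>" and W: "finite W" "(\<kappa> + 1) ^ (\<kappa> * m) \<le> card W"
  shows "\<exists>I a. I \<subseteq> W \<and> card I = m \<and> (\<forall>i\<in>I. \<forall>j\<in>I. i < j \<longrightarrow> c i j = a)"
proof (cases "m = 0")
  case True thus ?thesis by (intro exI[of _ "{}"]) auto
next
  case False
  have k: "\<kappa> > 0" using c[of 0 0] by simp
  have "\<exists>S' f. {} \<subseteq> S' \<and> S' \<subseteq> {} \<union> W \<and> card S' = card ({} :: nat set) + \<kappa> * m \<and>
     (\<forall>i. f i < \<kappa>) \<and> (\<forall>i\<in>S'. \<forall>j\<in>S'. i < j \<longrightarrow> c i j = f i)"
    by (rule end_homogeneous_pairs[where f="\<lambda>_. 0", OF c]) (use W k in simp_all)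
  then obtain S f where S: "S \<subseteq> W" "card S = \<kappa> * m" "\<forall>i. f i < \<kappa>"
    "\<forall>i\<in>S. \<forall>j\<in>S. i < j \<longrightarrow> c i j = f i" by (simp only: Un_empty_left card.empty add_0) blast
  have "\<exists>a\<in>{..<\<kappa>}. m \<le> card {i\<in>S. f i = a}"
    by (rule pigeonhole_fibre[where B=\<kappa>]) (use S W False k finite_subset in \<open>auto simp: lessThan_empty_iff\<close>)
  then obtain a where "m \<le> card {i\<in>S. f i = a}" by auto
  then obtain I where "I \<subseteq> {i\<in>S. f i = a}" "card I = m" by (meson obtain_subset_with_card_n)
  thus ?thesis using S by (intro exI[of _ I] exI[of _ a]) blast
qed

text \<open>One dimension up, after Erdos and Rado: the colour of a triple is settled by its two
  smaller elements. Admitting \<open>v\<close> means that the vector of all colours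
  \<open>c i v w\<close> with \<open>i\<close> in \<open>S\<close> must be the same for every
  \<open>w\<close> left in the pool; there are at most \<open>\<kappa> ^ s\<close> vectors, where
  \<open>s\<close> is the final size of \<open>S\<close>.\<close>

lemma end_homogeneous_triples:
  fixes c :: "nat \<Rightarrow> nat \<Rightarrow> nat \<Rightarrow> nat"
  assumes c: "\<And>i j k. c i j k < \<kappa>" and k: "\<kappa> > 0"
  shows "finite S \<Longrightarrow> finite W \<Longrightarrow> \<forall>i\<in>S. \<forall>w\<in>W. i < w \<Longrightarrow> (\<kappa> ^ s + 1) ^ r \<le> card W \<Longrightarrow>
    card S + r = s \<Longrightarrow>
    \<forall>i\<in>S. \<forall>j\<in>S. \<forall>k\<in>S \<union> W. i < j \<longrightarrow> j < k \<longrightarrow> c i j k = f i j \<Longrightarrow> \<forall>i j. f i j < \<kappa> \<Longrightarrow>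
    \<exists>S' f. S' \<subseteq> S \<union> W \<and> card S' = s \<and> (\<forall>i j. f i j < \<kappa>) \<and>
       (\<forall>i\<in>S'. \<forall>j\<in>S'. \<forall>k\<in>S'. i < j \<longrightarrow> j < k \<longrightarrow> c i j k = f i j)"
proof (induction r arbitrary: S W f)
  case 0
  thus ?case by (intro exI[of _ S] exI[of _ f]) auto
next
  case (Suc r)
  let ?B = "\<kappa> ^ s"
  let ?X = "(?B + 1) ^ r"
  have "W \<noteq> {}" using Suc.prems(4) by auto
  define v where "v = Min W"
  have v: "v \<in> W" "\<And>w. w \<in> W \<Longrightarrow> v \<le> w" using \<open>W \<noteq> {}\<close> Suc.prems(2) by (auto simp: v_def)
  have "?B * ?X + ?X \<le> card W" using Suc.prems(4) by (simp add: algebra_simps)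
  moreover have "?X > 0" by simp
  moreover have "card (W - {v}) = card W - 1" using v Suc.prems(2) by simp
  ultimately have W: "?B * ?X \<le> card (W - {v})" by linarith
  let ?g = "\<lambda>w. restrict (\<lambda>i. c i v w) S"
  have "\<exists>a\<in>Pi\<^sub>E S (\<lambda>_. {..<\<kappa>}). ?X \<le> card {w\<in>W - {v}. ?g w = a}"
  proof (rule pigeonhole_fibre[where B="?B"])
    show "finite (Pi\<^sub>E S (\<lambda>_. {..<\<kappa>}))" using Suc.prems(1) by (intro finite_PiE) auto
    have "card (Pi\<^sub>E S (\<lambda>_. {..<\<kappa>})) = \<kappa> ^ card S" using Suc.prems(1) by (simp add: card_PiE)
    also have "\<dots> \<le> \<kappa> ^ s" using k Suc.prems(5) by (intro power_increasing) auto
    finally show "card (Pi\<^sub>E S (\<lambda>_. {..<\<kappa>})) \<le> ?B" .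
    show "Pi\<^sub>E S (\<lambda>_. {..<\<kappa>}) \<noteq> {}" using k by (auto simp: PiE_eq_empty_iff lessThan_empty_iff)
  qed (use c W Suc.prems(2) in auto)
  then obtain a where a: "a \<in> Pi\<^sub>E S (\<lambda>_. {..<\<kappa>})" "?X \<le> card {w\<in>W - {v}. ?g w = a}" by blast
  let ?W = "{w\<in>W - {v}. ?g w = a}" and ?S = "insert v S"
  let ?f = "\<lambda>i j. if j = v \<and> i \<in> S then a i else f i j"
  have vS: "v \<notin> S" using Suc.prems(3) v(1) by auto
  have aw: "c i v w = a i" if "w \<in> ?W" "i \<in> S" for w i
    using that by (metis (mono_tags, lifting) mem_Collect_eq restrict_apply')
  have "\<exists>S' f. S' \<subseteq> ?S \<union> ?W \<and> card S' = s \<and> (\<forall>i j. f i j < \<kappa>) \<and>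
       (\<forall>i\<in>S'. \<forall>j\<in>S'. \<forall>k\<in>S'. i < j \<longrightarrow> j < k \<longrightarrow> c i j k = f i j)"
  proof (rule Suc.IH[where f="?f"])
    show "\<forall>i\<in>?S. \<forall>w\<in>?W. i < w" using Suc.prems(3) v by (auto simp: order.not_eq_order_implies_strict)
    show "\<forall>i\<in>?S. \<forall>j\<in>?S. \<forall>k\<in>?S \<union> ?W. i < j \<longrightarrow> j < k \<longrightarrow> c i j k = ?f i j"
    proof (intro ballI impI)
      fix i j k assume ijk: "i \<in> ?S" "j \<in> ?S" "k \<in> ?S \<union> ?W" "i < j" "j < k"
      have Sv: "x < v" if "x \<in> S" for x using Suc.prems(3) v(1) that by blast
      have "j \<le> v" if "j \<in> ?S" for j using that Sv by (auto intro: less_imp_le)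
      hence "i < v" using ijk(2,4) by fastforce
      hence i: "i \<in> S" using ijk(1) by auto
      show "c i j k = ?f i j"
      proof (cases "j = v")
        case True
        have "k \<notin> ?S" using True ijk(5) Sv[of k] by auto
        hence "k \<in> ?W" using ijk(3) by blast
        thus ?thesis using aw[OF _ i] True i by simp
      next
        case False
        thus ?thesis using i ijk v(1) Suc.prems(6) by auto
      qed
    qed
    show "\<forall>i j. ?f i j < \<kappa>" using a Suc.prems(7) by auto
    show "card ?S + r = s" using Suc.prems(1,5) vS by simp
  qed (use Suc.prems a in auto)
  then obtain S' f' where "S' \<subseteq> ?S \<union> ?W" "card S' = s" "\<forall>i j. f' i j < \<kappa>"
       "\<forall>i\<in>S'. \<forall>j\<in>S'. \<forall>k\<in>S'. i < j \<longrightarrow> j < k \<longrightarrow> c i j k = f' i j" by blast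
  thus ?case using v(1) by (intro exI[of _ S'] exI[of _ f']) auto
qed

text \<open>\<open>s\<close> vertices are enough for the settled colours, which form a colouring of
  pairs; the outer power is the cost of reaching \<open>s\<close> vertices that are end-homogeneous
  for triples. The result is doubly exponential in \<open>\<kappa> * m\<close>, up to a
  logarithm.\<close>

definition ramsey_bound :: "nat \<Rightarrow> nat \<Rightarrow> nat" where
  "ramsey_bound \<kappa> m = (let s = (\<kappa> + 1) ^ (\<kappa> * m) in (\<kappa> ^ s + 1) ^ s)"

lemma ramsey_triples:
  fixes c :: "nat \<Rightarrow> nat \<Rightarrow> nat \<Rightarrow> nat"
  assumes c: "\<And>i j k. c i j k < \<kappa>"
  shows "\<exists>I a. I \<subseteq> {..<ramsey_bound \<kappa> m} \<and> card I = m \<and>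
     (\<forall>i\<in>I. \<forall>j\<in>I. \<forall>k\<in>I. i < j \<longrightarrow> j < k \<longrightarrow> c i j k = a)"
proof -
  have k: "\<kappa> > 0" using c[of 0 0 0] by simp
  define s where "s = (\<kappa> + 1) ^ (\<kappa> * m)"
  have rb: "ramsey_bound \<kappa> m = (\<kappa> ^ s + 1) ^ s" by (simp add: ramsey_bound_def s_def Let_def)
  have "\<exists>S' f. S' \<subseteq> {} \<union> {..<ramsey_bound \<kappa> m} \<and> card S' = s \<and> (\<forall>i j. f i j < \<kappa>) \<and>
       (\<forall>i\<in>S'. \<forall>j\<in>S'. \<forall>k\<in>S'. i < j \<longrightarrow> j < k \<longrightarrow> c i j k = f i j)"
    by (rule end_homogeneous_triples[where f="\<lambda>_ _. 0" and r=s, OF c k]) (use k rb in simp_all)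
  then obtain S f where S: "S \<subseteq> {..<ramsey_bound \<kappa> m}" "card S = s" "\<forall>i j. f i j < \<kappa>"
    "\<forall>i\<in>S. \<forall>j\<in>S. \<forall>k\<in>S. i < j \<longrightarrow> j < k \<longrightarrow> c i j k = f i j"
    by (simp only: Un_empty_left) blast
  have "finite S" using S(1) finite_subset by blast
  have "\<exists>I a. I \<subseteq> S \<and> card I = m \<and> (\<forall>i\<in>I. \<forall>j\<in>I. i < j \<longrightarrow> f i j = a)"
    by (rule ramsey_pairs[where \<kappa>=\<kappa>]) (use \<open>finite S\<close> S(2,3) in \<open>simp_all add: s_def\<close>)
  then obtain I a where I: "I \<subseteq> S \<and> card I = m \<and> (\<forall>i\<in>I. \<forall>j\<in>I. i < j \<longrightarrow> f i j = a)"
    by (elim exE)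
  have "c i j k = a" if "i \<in> I" "j \<in> I" "k \<in> I" "i < j" "j < k" for i j k
  proof -
    have "i \<in> S" "j \<in> S" "k \<in> S" using that I by auto
    thus ?thesis using that I S(4) by simp
  qed
  thus ?thesis using I S(1) by (intro exI[of _ I] exI[of _ a]) auto
qed

section \<open>Rounding a weighted graph\<close>

text \<open>Affine in each coordinate separately, as the expectation under independent rounding
  requires. Stating it one coordinate at a time replaces the probability space.\<close>

definition multiaffine :: "(('e \<Rightarrow> real) \<Rightarrow> real) \<Rightarrow> bool" where
  "multiaffine F \<longleftrightarrow> (\<forall>a e. F a = (1 - a e) * F (a(e := 0)) + a e * F (a(e := 1)))"

lemma multiaffine_add: "multiaffine F \<Longrightarrow> multiaffine G \<Longrightarrow> multiaffine (\<lambda>a. F a + G a)"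
  unfolding multiaffine_def
proof (intro allI)
  fix a :: "'a \<Rightarrow> real" and e
  assume F: "\<forall>a e. F a = (1 - a e) * F (a(e := 0)) + a e * F (a(e := 1))"
    and G: "\<forall>a e. G a = (1 - a e) * G (a(e := 0)) + a e * G (a(e := 1))"
  show "F a + G a = (1 - a e) * (F (a(e := 0)) + G (a(e := 0))) + a e * (F (a(e := 1)) + G (a(e := 1)))"
    unfolding distrib_left using F[rule_format, of a e] G[rule_format, of a e] by linarith
qed

lemma multiaffine_cmult: "multiaffine F \<Longrightarrow> multiaffine (\<lambda>a. c * F a)"
  unfolding multiaffine_def
proof (intro allI)
  fix a :: "'a \<Rightarrow> real" and e
  assume F: "\<forall>a e. F a = (1 - a e) * F (a(e := 0)) + a e * F (a(e := 1))"
  have "c * F a = c * ((1 - a e) * F (a(e := 0)) + a e * F (a(e := 1)))"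
    using F[rule_format, of a e] by simp
  thus "c * F a = (1 - a e) * (c * F (a(e := 0))) + a e * (c * F (a(e := 1)))"
    by (simp add: algebra_simps)
qed

lemma multiaffine_sum:
  assumes "\<And>i. i \<in> I \<Longrightarrow> multiaffine (F i)"
  shows "multiaffine (\<lambda>a. \<Sum>i\<in>I. F i a)"
proof (cases "finite I")
  case False
  thus ?thesis by (simp add: multiaffine_def)
next
  case True
  thus ?thesis using assms
  proof (induction I)
    case empty thus ?case by (simp add: multiaffine_def)
  next
    case (insert x I)
    thus ?case by (simp add: multiaffine_add)
  qed
qed

text \<open>The product runs over a set, so each coordinate occurs in at most one factor; with a
  repeated edge the statement would fail.\<close>

lemma multiaffine_prod:
  assumes "finite S"
  shows "multiaffine (\<lambda>a. \<Prod>e\<in>S. a e - b e)"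
  unfolding multiaffine_def
proof (intro allI)
  fix a :: "'a \<Rightarrow> real" and e
  show "(\<Prod>e\<in>S. a e - b e) = (1 - a e) * (\<Prod>x\<in>S. (a(e := 0)) x - b x)
     + a e * (\<Prod>x\<in>S. (a(e := 1)) x - b x)"
  proof (cases "e \<in> S")
    case False
    have "(\<Prod>x\<in>S. (a(e := v)) x - b x) = (\<Prod>e\<in>S. a e - b e)" for v
      by (rule prod.cong) (use False in auto)
    thus ?thesis by (simp add: algebra_simps)
  next
    case True
    have h: "(\<Prod>x\<in>S. (a(e := v)) x - b x) = (v - b e) * (\<Prod>x\<in>S - {e}. a x - b x)" for v
    proof -
      have "(\<Prod>x\<in>S. (a(e := v)) x - b x) = ((a(e := v)) e - b e) * (\<Prod>x\<in>S - {e}. (a(e := v)) x - b x)"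
        by (rule prod.remove[OF assms True])
      also have "(\<Prod>x\<in>S - {e}. (a(e := v)) x - b x) = (\<Prod>x\<in>S - {e}. a x - b x)"
        by (rule prod.cong) auto
      finally show ?thesis by simp
    qed
    have "(\<Prod>x\<in>S. a x - b x) = (a e - b e) * (\<Prod>x\<in>S - {e}. a x - b x)"
      using h[of "a e"] by simp
    thus ?thesis unfolding h by (simp add: algebra_simps)
  qed
qed

text \<open>The first-moment method: \<open>F w\<close> is the expectation of \<open>F\<close> under independent rounding with
  probabilities \<open>w\<close>.\<close>

lemma multiaffine_vertex:
  assumes F: "multiaffine F" and "finite E" and w: "\<And>e. 0 \<le> w e \<and> w e \<le> 1"
  shows "\<exists>a. (\<forall>e\<in>E. a e \<in> {0, 1} \<and> (w e = 0 \<longrightarrow> a e = 0)) \<and> (\<forall>e. e \<notin> E \<longrightarrow> a e = w e) \<and> F a \<le> F w"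
  using \<open>finite E\<close>
proof (induction E)
  case empty
  thus ?case by (intro exI[of _ w]) auto
next
  case (insert e E)
  then obtain a where a: "\<And>e. e \<in> E \<Longrightarrow> a e \<in> {0, 1} \<and> (w e = 0 \<longrightarrow> a e = 0)"
    "\<And>e. e \<notin> E \<Longrightarrow> a e = w e" "F a \<le> F w" by blast
  have ae: "a e = w e" using a(2) insert.hyps by blast
  have aff: "F a = (1 - w e) * F (a(e := 0)) + w e * F (a(e := 1))"
    using F[unfolded multiaffine_def, rule_format, of a e] ae by simp
  have "\<exists>v\<in>{0, 1}. (w e = 0 \<longrightarrow> v = 0) \<and> F (a(e := v)) \<le> F a"
  proof (cases "w e = 0")
    case True
    thus ?thesis using aff by auto
  next
    case False
    show ?thesis
    proof (rule ccontr)
      assume "\<not> ?thesis"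
      hence gt: "F (a(e := 0)) > F a" "F (a(e := 1)) > F a" using False by (auto simp: not_le)
      have "w e > 0" "1 - w e \<ge> 0" using w[of e] False by auto
      hence "(1 - w e) * F a + w e * F a < (1 - w e) * F (a(e := 0)) + w e * F (a(e := 1))"
        using gt by (intro add_le_less_mono mult_left_mono mult_strict_left_mono) auto
      thus False using aff by (simp add: algebra_simps)
    qed
  qed
  then obtain v where v: "v \<in> {0, 1}" "w e = 0 \<longrightarrow> v = 0" "F (a(e := v)) \<le> F a" by blast
  have "F (a(e := v)) \<le> F w" using v(3) a(3) by linarith
  moreover have "\<forall>x\<in>insert e E. (a(e := v)) x \<in> {0, 1} \<and> (w x = 0 \<longrightarrow> (a(e := v)) x = 0)"
    using v(1,2) a(1) by auto
  moreover have "\<forall>x. x \<notin> insert e E \<longrightarrow> (a(e := v)) x = w x" using a(2) by auto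
  ultimately show ?case by blast
qed

lemma sum_square_le: "(\<Sum>x\<in>P. f x)\<^sup>2 \<le> real (card P) * (\<Sum>x\<in>P. (f x)\<^sup>2)" for f :: "'b \<Rightarrow> real"
  using Cauchy_Schwarz_ineq_sum[of "\<lambda>_. 1" f P] by simp

abbreviation four_cycles :: "'a set \<Rightarrow> 'b set \<Rightarrow> ('a \<Rightarrow> 'b \<Rightarrow> real) \<Rightarrow> real" where
  "four_cycles X Y B \<equiv> \<Sum>x\<in>X. \<Sum>x'\<in>X. \<Sum>y\<in>Y. \<Sum>y'\<in>Y. B x y * B x' y * B x y' * B x' y'"

text \<open>The box norm dominates the cut norm: Cauchy-Schwarz once in \<open>x\<close> and once in
  the pair \<open>y\<close>, \<open>y'\<close>. After each application the summands are squares, so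
  the sums may be extended from \<open>P\<close> and \<open>Q\<close> to \<open>X\<close> and
  \<open>Y\<close>.\<close>

lemma cut_le_four_cycles:
  fixes B :: "'a \<Rightarrow> 'b \<Rightarrow> real"
  assumes fin: "finite X" "finite Y" and PQ: "P \<subseteq> X" "Q \<subseteq> Y"
  shows "(\<Sum>x\<in>P. \<Sum>y\<in>Q. B x y) ^ 4 \<le> real (card X) ^ 2 * real (card Y) ^ 2 *
     four_cycles X Y B"
proof -
  have cP: "real (card P) \<le> real (card X)" "real (card Q) \<le> real (card Y)"
    using fin PQ by (auto intro: card_mono)
  define C where "C y y' = (\<Sum>x\<in>X. B x y * B x y')" for y y'
  have "(\<Sum>x\<in>P. \<Sum>y\<in>Q. B x y)\<^sup>2 \<le> real (card P) * (\<Sum>x\<in>P. (\<Sum>y\<in>Q. B x y)\<^sup>2)"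
    by (rule sum_square_le)
  also have "\<dots> \<le> real (card X) * (\<Sum>x\<in>X. (\<Sum>y\<in>Q. B x y)\<^sup>2)"
    by (intro mult_mono cP sum_mono2 fin PQ sum_nonneg) auto
  also have "(\<Sum>x\<in>X. (\<Sum>y\<in>Q. B x y)\<^sup>2) = (\<Sum>x\<in>X. \<Sum>p\<in>Q \<times> Q. B x (fst p) * B x (snd p))"
    by (simp add: power2_eq_square sum_product sum.cartesian_product case_prod_unfold)
  also have "\<dots> = (\<Sum>p\<in>Q \<times> Q. C (fst p) (snd p))"
    unfolding C_def by (rule sum.swap)
  finally have 1: "(\<Sum>x\<in>P. \<Sum>y\<in>Q. B x y)\<^sup>2 \<le> real (card X) * (\<Sum>p\<in>Q \<times> Q. C (fst p) (snd p))" .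
  have "(\<Sum>p\<in>Q \<times> Q. C (fst p) (snd p))\<^sup>2 \<le> real (card (Q \<times> Q)) * (\<Sum>p\<in>Q \<times> Q. (C (fst p) (snd p))\<^sup>2)"
    by (rule sum_square_le)
  also have "\<dots> \<le> real (card Y) ^ 2 * (\<Sum>p\<in>Y \<times> Y. (C (fst p) (snd p))\<^sup>2)"
  proof (intro mult_mono sum_mono2 sum_nonneg)
    show "real (card (Q \<times> Q)) \<le> real (card Y) ^ 2"
      using cP(2) by (auto simp: card_cartesian_product power2_eq_square intro: mult_mono)
  qed (use fin PQ in auto)
  also have "(\<Sum>p\<in>Y \<times> Y. (C (fst p) (snd p))\<^sup>2)
     = (\<Sum>p\<in>Y \<times> Y. \<Sum>r\<in>X \<times> X. B (fst r) (fst p) * B (snd r) (fst p) * B (fst r) (snd p) * B (snd r) (snd p))"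
    unfolding C_def
    by (simp add: power2_eq_square sum_product sum.cartesian_product case_prod_unfold mult_ac)
  also have "\<dots> = (\<Sum>r\<in>X \<times> X. \<Sum>p\<in>Y \<times> Y. B (fst r) (fst p) * B (snd r) (fst p) * B (fst r) (snd p) * B (snd r) (snd p))"
    by (rule sum.swap)
  also have "\<dots> = (\<Sum>r\<in>X \<times> X. \<Sum>y\<in>Y. \<Sum>y'\<in>Y. B (fst r) y * B (snd r) y * B (fst r) y' * B (snd r) y')"
    by (rule sum.cong[OF refl]) (simp add: sum.cartesian_product case_prod_unfold)
  also have "\<dots> = four_cycles X Y B"
    by (subst sum.cartesian_product[of "\<lambda>x x'. \<Sum>y\<in>Y. \<Sum>y'\<in>Y. B x y * B x' y * B x y' * B x' y'" X X])
      (simp only: case_prod_unfold)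
  finally have 2: "(\<Sum>p\<in>Q \<times> Q. C (fst p) (snd p))\<^sup>2 \<le> real (card Y) ^ 2 *
     four_cycles X Y B" .
  have "(\<Sum>x\<in>P. \<Sum>y\<in>Q. B x y) ^ 4 = ((\<Sum>x\<in>P. \<Sum>y\<in>Q. B x y)\<^sup>2)\<^sup>2"
    by (simp flip: power_mult)
  also have "\<dots> \<le> (real (card X) * (\<Sum>p\<in>Q \<times> Q. C (fst p) (snd p)))\<^sup>2"
    by (rule power_mono[OF 1]) simp
  also have "\<dots> = real (card X) ^ 2 * (\<Sum>p\<in>Q \<times> Q. C (fst p) (snd p))\<^sup>2"
    by (simp add: power_mult_distrib)
  also have "\<dots> \<le> real (card X) ^ 2 * (real (card Y) ^ 2 *
     four_cycles X Y B)"
    by (rule mult_left_mono[OF 2]) simp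
  finally show ?thesis by (simp add: mult.assoc)
qed

text \<open>Each of the six possible coincidences leaves three free vertices.\<close>

lemma sum_nondistinct4_le:
  assumes fin: "finite U" and n: "card U = n"
  shows "(\<Sum>x\<in>U. \<Sum>x'\<in>U. \<Sum>y\<in>U. \<Sum>y'\<in>U. of_bool (\<not> distinct [x, x', y, y']) :: real) \<le> 6 * real n ^ 3"
proof -
  have d: "(\<Sum>v\<in>U. of_bool (u = v) :: real) = 1" "(\<Sum>v\<in>U. of_bool (v = u) :: real) = 1" if "u \<in> U" for u
    using that fin by (simp_all add: of_bool_def)
  have "(\<Sum>x\<in>U. \<Sum>x'\<in>U. \<Sum>y\<in>U. \<Sum>y'\<in>U. of_bool (\<not> distinct [x, x', y, y']) :: real)
    \<le> (\<Sum>x\<in>U. \<Sum>x'\<in>U. \<Sum>y\<in>U. \<Sum>y'\<in>U. of_bool (x = x') + of_bool (x = y) + of_bool (x' = y)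
         + of_bool (x = y') + of_bool (x' = y') + of_bool (y = y'))"
  proof (intro sum_mono)
    fix x x' y y'
    show "of_bool (\<not> distinct [x, x', y, y']) \<le> (of_bool (x = x') + of_bool (x = y) + of_bool (x' = y)
         + of_bool (x = y') + of_bool (x' = y') + of_bool (y = y') :: real)"
    proof (cases "distinct [x, x', y, y']")
      case False
      then consider "x = x'" | "x = y" | "x' = y" | "x = y'" | "x' = y'" | "y = y'" by auto
      thus ?thesis by cases (simp_all only: of_bool_eq, (simp add: add_nonneg_nonneg)+)
    qed simp
  qed
  also have "\<dots> = 6 * real n ^ 3"
  proof -
    have "(\<Sum>x\<in>U. \<Sum>x'\<in>U. \<Sum>y\<in>U. \<Sum>y'\<in>U. of_bool (x = x') :: real) = real n ^ 3"
    using n by (simp add: d power3_eq_cube flip: sum_distrib_left cong: sum.cong)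
    moreover have "(\<Sum>x\<in>U. \<Sum>x'\<in>U. \<Sum>y\<in>U. \<Sum>y'\<in>U. of_bool (x = y) :: real) = real n ^ 3"
    using n by (simp add: d power3_eq_cube flip: sum_distrib_left cong: sum.cong)
    moreover have "(\<Sum>x\<in>U. \<Sum>x'\<in>U. \<Sum>y\<in>U. \<Sum>y'\<in>U. of_bool (x' = y) :: real) = real n ^ 3"
    using n by (simp add: d power3_eq_cube flip: sum_distrib_left cong: sum.cong)
    moreover have "(\<Sum>x\<in>U. \<Sum>x'\<in>U. \<Sum>y\<in>U. \<Sum>y'\<in>U. of_bool (x = y') :: real) = real n ^ 3"
    using n by (simp add: d power3_eq_cube flip: sum_distrib_left cong: sum.cong)
    moreover have "(\<Sum>x\<in>U. \<Sum>x'\<in>U. \<Sum>y\<in>U. \<Sum>y'\<in>U. of_bool (x' = y') :: real) = real n ^ 3"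
    using n by (simp add: d power3_eq_cube flip: sum_distrib_left cong: sum.cong)
    moreover have "(\<Sum>x\<in>U. \<Sum>x'\<in>U. \<Sum>y\<in>U. \<Sum>y'\<in>U. of_bool (y = y') :: real) = real n ^ 3"
    using n by (simp add: d power3_eq_cube flip: sum_distrib_left cong: sum.cong)
    ultimately show ?thesis by (simp only: sum.distrib)
  qed
  finally show ?thesis .
qed

text \<open>Over quadruples of distinct vertices, the four-cycle sum of \<open>a - w\<close> is multiaffine in \<open>a\<close> and
  vanishes at \<open>w\<close>. Adding \<open>1 / \<epsilon>\<close> times the \<open>G\<close>-sum controls both quantities with one inequality.\<close>

lemma random_rounding:
  fixes w :: "'a set \<Rightarrow> real" and G :: "'a \<Rightarrow> 'a \<Rightarrow> 'a \<Rightarrow> real"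
  assumes fin: "finite U" and n: "card U = n" and w: "\<And>e. 0 \<le> w e \<and> w e \<le> 1"
    and G: "\<And>x y z. 0 \<le> G x y z \<and> G x y z \<le> 1"
    and Gd: "\<And>x y z. x \<in> U \<Longrightarrow> y \<in> U \<Longrightarrow> z \<in> U \<Longrightarrow> G x y z \<noteq> 0 \<Longrightarrow> x \<noteq> y \<and> y \<noteq> z \<and> x \<noteq> z"
    and eps: "0 < \<epsilon>" "\<epsilon> \<le> 1" and big: "real n \<ge> 7 / \<epsilon> ^ 5"
  shows "\<exists>a. (\<forall>x\<in>U. \<forall>y\<in>U. x \<noteq> y \<longrightarrow> a {x, y} \<in> {0, 1::real} \<and> (w {x, y} = 0 \<longrightarrow> a {x, y} = 0)) \<and>
     (\<forall>P\<subseteq>U. \<forall>Q\<subseteq>U. \<bar>\<Sum>x\<in>P. \<Sum>y\<in>Q. of_bool (x \<noteq> y) * (a {x, y} - w {x, y})\<bar> \<le> \<epsilon> * real n ^ 2) \<and>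
     (\<Sum>x\<in>U. \<Sum>y\<in>U. \<Sum>z\<in>U. G x y z * (a {x, y} * a {y, z} * a {x, z}))
       \<le> (\<Sum>x\<in>U. \<Sum>y\<in>U. \<Sum>z\<in>U. G x y z * (w {x, y} * w {y, z} * w {x, z})) + 6 * \<epsilon> * real n ^ 3"
proof -
  define E where "E = {e. e \<subseteq> U \<and> card e = 2}"
  have finE: "finite E" using fin by (simp add: E_def)
  define F1 where "F1 a = (\<Sum>x\<in>U. \<Sum>x'\<in>U. \<Sum>y\<in>U. \<Sum>y'\<in>U. of_bool (distinct [x, x', y, y']) *
     (\<Prod>e\<in>{{x, y}, {x', y}, {x, y'}, {x', y'}}. a e - w e))" for a
  define F2 where "F2 a = (\<Sum>x\<in>U. \<Sum>y\<in>U. \<Sum>z\<in>U. G x y z * (\<Prod>e\<in>{{x, y}, {y, z}, {x, z}}. a e - 0))"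
    for a :: "'a set \<Rightarrow> real"
  have maff: "multiaffine (\<lambda>a. F1 a + 1 / \<epsilon> * F2 a)"
  proof (rule multiaffine_add)
    show "multiaffine F1" unfolding F1_def
      by (rule multiaffine_sum)+ (rule multiaffine_cmult, rule multiaffine_prod, simp)
    have "multiaffine F2" unfolding F2_def
      by (rule multiaffine_sum)+ (rule multiaffine_cmult, rule multiaffine_prod, simp)
    thus "multiaffine (\<lambda>a. 1 / \<epsilon> * F2 a)" by (rule multiaffine_cmult)
  qed
  obtain a where a: "\<And>e. e \<in> E \<Longrightarrow> a e \<in> {0, 1} \<and> (w e = 0 \<longrightarrow> a e = 0)"
    and Fa: "F1 a + 1 / \<epsilon> * F2 a \<le> F1 w + 1 / \<epsilon> * F2 w"
    using multiaffine_vertex[where w=w, OF maff finE w] by blast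
  have aE: "a {x, y} \<in> {0, 1} \<and> (w {x, y} = 0 \<longrightarrow> a {x, y} = 0)" if "x \<in> U" "y \<in> U" "x \<noteq> y" for x y
    by (rule a) (use that in \<open>auto simp: E_def\<close>)
  have F1w: "F1 w = 0"
    unfolding F1_def by (intro sum.neutral ballI) (simp add: card_gt_0_iff)
  \<comment> \<open>For distinct vertices the three sides are three different sets, so the product
    over the set of sides has three factors; \<open>Gd\<close> removes all other triples.\<close>
  have F2eq: "F2 b = (\<Sum>x\<in>U. \<Sum>y\<in>U. \<Sum>z\<in>U. G x y z * (b {x, y} * b {y, z} * b {x, z}))" for b
    unfolding F2_def
  proof (intro sum.cong refl)
    fix x y z assume xyz: "x \<in> U" "y \<in> U" "z \<in> U"
    show "G x y z * (\<Prod>e\<in>{{x, y}, {y, z}, {x, z}}. b e - 0) = G x y z * (b {x, y} * b {y, z} * b {x, z})"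
    proof (cases "G x y z = 0")
      case False
      hence "x \<noteq> y" "y \<noteq> z" "x \<noteq> z" using Gd xyz by auto
      hence "{x, y} \<noteq> {y, z}" "{x, y} \<noteq> {x, z}" "{y, z} \<noteq> {x, z}" by (auto simp: doubleton_eq_iff)
      thus ?thesis by simp
    qed simp
  qed
  define B where "B x y = of_bool (x \<noteq> y) * (a {x, y} - w {x, y})" for x y
  have B: "\<bar>B x y\<bar> \<le> 1" if "x \<in> U" "y \<in> U" for x y
    using aE[OF that] w[of "{x, y}"] by (auto simp: B_def abs_if)
  define C4 where "C4 = four_cycles U U B"
  \<comment> \<open>\<open>C4\<close> also contains the quadruples with a coincidence, where an edge
    may repeat; their number is only cubic.\<close>
  have C4F: "\<bar>C4 - F1 a\<bar> \<le> 6 * real n ^ 3"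
  proof -
    have "C4 - F1 a = (\<Sum>x\<in>U. \<Sum>x'\<in>U. \<Sum>y\<in>U. \<Sum>y'\<in>U.
       of_bool (\<not> distinct [x, x', y, y']) * (B x y * B x' y * B x y' * B x' y'))"
      unfolding C4_def F1_def sum_subtractf[symmetric]
    proof (intro sum.cong refl)
      fix x x' y y'
      show "B x y * B x' y * B x y' * B x' y' - of_bool (distinct [x, x', y, y']) *
         (\<Prod>e\<in>{{x, y}, {x', y}, {x, y'}, {x', y'}}. a e - w e)
        = of_bool (\<not> distinct [x, x', y, y']) * (B x y * B x' y * B x y' * B x' y')"
      proof (cases "distinct [x, x', y, y']")
        case True
        hence "{x, y} \<noteq> {x', y}" "{x, y} \<noteq> {x, y'}" "{x, y} \<noteq> {x', y'}" "{x', y} \<noteq> {x, y'}"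
          "{x', y} \<noteq> {x', y'}" "{x, y'} \<noteq> {x', y'}" by (auto simp: doubleton_eq_iff)
        moreover have "x \<noteq> y" "x' \<noteq> y" "x \<noteq> y'" "x' \<noteq> y'" using True by auto
        ultimately show ?thesis using True by (simp add: B_def)
      next
        case False
        thus ?thesis by (simp del: distinct.simps)
      qed
    qed
    also have "\<bar>\<dots>\<bar> \<le> (\<Sum>x\<in>U. \<Sum>x'\<in>U. \<Sum>y\<in>U. \<Sum>y'\<in>U. of_bool (\<not> distinct [x, x', y, y']))"
    proof (rule order_trans[OF sum_abs], rule sum_mono, rule order_trans[OF sum_abs], rule sum_mono,
        rule order_trans[OF sum_abs], rule sum_mono, rule order_trans[OF sum_abs], rule sum_mono)
      fix x x' y y' assume "x \<in> U" "x' \<in> U" "y \<in> U" "y' \<in> U"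
      hence "\<bar>B x y\<bar> * \<bar>B x' y\<bar> * \<bar>B x y'\<bar> * \<bar>B x' y'\<bar> \<le> 1 * 1 * 1 * 1"
        by (intro mult_mono B) auto
      hence "\<bar>B x y * B x' y * B x y' * B x' y'\<bar> \<le> 1" by (simp add: abs_mult)
      thus "\<bar>of_bool (\<not> distinct [x, x', y, y']) * (B x y * B x' y * B x y' * B x' y')\<bar>
         \<le> of_bool (\<not> distinct [x, x', y, y'])"
        by (cases "distinct [x, x', y, y']") (simp_all del: distinct.simps)
    qed
    also have "\<dots> \<le> 6 * real n ^ 3" by (rule sum_nondistinct4_le[OF fin n])
    finally show ?thesis .
  qed
  have F2nn: "0 \<le> F2 a" unfolding F2eq
  proof (intro sum_nonneg)
    fix x y z assume xyz: "x \<in> U" "y \<in> U" "z \<in> U"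
    show "0 \<le> G x y z * (a {x, y} * a {y, z} * a {x, z})"
    proof (cases "G x y z = 0")
      case False
      hence "x \<noteq> y" "y \<noteq> z" "x \<noteq> z" using Gd xyz by auto
      hence "0 \<le> a {x, y}" "0 \<le> a {y, z}" "0 \<le> a {x, z}" using aE xyz by fastforce+
      thus ?thesis using G by simp
    qed simp
  qed
  have F2w: "F2 w \<le> real n ^ 3"
  proof -
    have "F2 w \<le> (\<Sum>x\<in>U. \<Sum>y\<in>U. \<Sum>z\<in>U. 1)" unfolding F2eq
    proof (intro sum_mono)
      fix x y z
      have "G x y z * (w {x, y} * w {y, z} * w {x, z}) \<le> 1 * (1 * 1 * 1)"
        using G w by (intro mult_mono) auto
      thus "G x y z * (w {x, y} * w {y, z} * w {x, z}) \<le> 1" by simp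
    qed
    thus ?thesis using n by (simp add: power3_eq_cube)
  qed
  have cut: "(\<Sum>x\<in>P. \<Sum>y\<in>Q. B x y) ^ 4 \<le> real n ^ 4 * C4" if "P \<subseteq> U" "Q \<subseteq> U" for P Q
    using cut_le_four_cycles[OF fin fin that, of B] n by (simp add: C4_def flip: power_add)
  have C4nn: "0 \<le> C4 \<or> n = 0"
  proof (cases "n = 0")
    case False
    have "0 \<le> (\<Sum>x\<in>U. \<Sum>y\<in>U. B x y) ^ 4" by (intro zero_le_even_power) simp
    also have "\<dots> \<le> real n ^ 4 * C4" by (rule cut) auto
    finally show ?thesis using False by (simp add: zero_le_mult_iff)
  qed simp
  have n0: "real n > 0" using big eps by (smt (verit) divide_pos_pos zero_less_power)
  hence C4nn: "0 \<le> C4" using C4nn by simp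
  have main: "F1 a + F2 a / \<epsilon> \<le> F2 w / \<epsilon>" using Fa F1w by simp
  \<comment> \<open>As a box norm \<open>C4\<close> is nonnegative, so \<open>F1 a\<close> is at
    least \<open>- 6 * n ^ 3\<close> and cannot compensate for a large \<open>F2 a\<close>.\<close>
  have A2: "F2 a \<le> F2 w + 6 * \<epsilon> * real n ^ 3"
  proof -
    have "F2 a / \<epsilon> \<le> F2 w / \<epsilon> + 6 * real n ^ 3" using main C4F C4nn by linarith
    hence "\<epsilon> * (F2 a / \<epsilon>) \<le> \<epsilon> * (F2 w / \<epsilon> + 6 * real n ^ 3)" using eps by (intro mult_left_mono) auto
    thus ?thesis using eps by (simp add: algebra_simps)
  qed
  \<comment> \<open>Conversely \<open>F2 a\<close> is nonnegative. In
    \<open>7 / \<epsilon> ^ 5\<close> the constant is 6 for the degenerate quadruples plus 1 for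
    \<open>F2 w\<close>, and the exponent is 4 for the fourth root taken in \<open>A3\<close> plus 1
    for the weight \<open>1 / \<epsilon>\<close>.\<close>
  have A1: "C4 \<le> \<epsilon> ^ 4 * real n ^ 4"
  proof -
    have "F2 w / \<epsilon> \<le> real n ^ 3 / \<epsilon>" using F2w eps by (intro divide_right_mono) auto
    moreover have "6 * real n ^ 3 \<le> 6 * (real n ^ 3 / \<epsilon>)"
    proof -
      have "real n ^ 3 * \<epsilon> \<le> real n ^ 3 * 1" using eps by (intro mult_left_mono) auto
      thus ?thesis using eps by (simp add: pos_le_divide_eq)
    qed
    moreover have "0 \<le> F2 a / \<epsilon>" using F2nn eps by simp
    ultimately have "C4 \<le> 7 * (real n ^ 3 / \<epsilon>)" using main C4F by linarith
    also have "\<dots> = \<epsilon> ^ 4 * real n ^ 3 * (7 / \<epsilon> ^ 5)" using eps by (simp add: field_simps eval_nat_numeral)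
    also have "\<dots> \<le> \<epsilon> ^ 4 * real n ^ 3 * real n" using big eps by (intro mult_left_mono) auto
    finally show ?thesis by (simp add: eval_nat_numeral mult_ac)
  qed
  have A3: "\<bar>\<Sum>x\<in>P. \<Sum>y\<in>Q. B x y\<bar> \<le> \<epsilon> * real n ^ 2" if "P \<subseteq> U" "Q \<subseteq> U" for P Q
  proof -
    have "\<bar>\<Sum>x\<in>P. \<Sum>y\<in>Q. B x y\<bar> ^ 4 \<le> real n ^ 4 * C4" using cut[OF that] by simp
    also have "\<dots> \<le> real n ^ 4 * (\<epsilon> ^ 4 * real n ^ 4)" by (rule mult_left_mono[OF A1]) simp
    also have "\<dots> = (\<epsilon> * real n ^ 2) ^ 4" by (simp add: power_mult_distrib flip: power_mult power_add)
    finally show ?thesis using eps by (subst (asm) power_mono_iff) auto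
  qed
  show ?thesis
    by (intro exI[of _ a] conjI ballI allI impI)
      (use aE A3 A2 in \<open>auto simp: B_def F2eq\<close>)
qed

section \<open>Counting with a cut-regular graph\<close>

lemma linear_le_subset:
  fixes u c :: "'b \<Rightarrow> real"
  assumes "finite X" "\<And>x. x \<in> X \<Longrightarrow> 0 \<le> u x \<and> u x \<le> 1"
  shows "\<exists>P\<subseteq>X. (\<Sum>x\<in>X. u x * c x) \<le> (\<Sum>x\<in>P. c x)"
proof (intro exI conjI)
  show "{x\<in>X. c x > 0} \<subseteq> X" by auto
  have "(\<Sum>x\<in>X. u x * c x) \<le> (\<Sum>x\<in>X. if c x > 0 then c x else 0)"
  proof (rule sum_mono)
    fix x assume "x \<in> X"
    thus "u x * c x \<le> (if c x > 0 then c x else 0)"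
      using assms(2)[of x] by (auto simp: mult_left_le_one_le mult_nonneg_nonpos)
  qed
  also have "\<dots> = (\<Sum>x\<in>{x\<in>X. c x > 0}. c x)" by (rule sum.inter_filter[symmetric, OF assms(1)])
  finally show "(\<Sum>x\<in>X. u x * c x) \<le> (\<Sum>x\<in>{x\<in>X. c x > 0}. c x)" .
qed

text \<open>A bilinear form on unit cubes is maximal at 0/1 vectors, reached one argument after the
  other.\<close>

lemma bilinear_le_cut:
  fixes B :: "'b \<Rightarrow> 'c \<Rightarrow> real"
  assumes fin: "finite X" "finite Y"
    and u: "\<And>x. x \<in> X \<Longrightarrow> 0 \<le> u x \<and> u x \<le> 1" and v: "\<And>y. y \<in> Y \<Longrightarrow> 0 \<le> v y \<and> v y \<le> 1"
    and cut: "\<And>P Q. P \<subseteq> X \<Longrightarrow> Q \<subseteq> Y \<Longrightarrow> (\<Sum>x\<in>P. \<Sum>y\<in>Q. B x y) \<le> c"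
  shows "(\<Sum>x\<in>X. \<Sum>y\<in>Y. B x y * u x * v y) \<le> c"
proof -
  have "\<exists>P\<subseteq>X. (\<Sum>x\<in>X. u x * (\<Sum>y\<in>Y. B x y * v y)) \<le> (\<Sum>x\<in>P. \<Sum>y\<in>Y. B x y * v y)"
    by (rule linear_le_subset[OF fin(1) u])
  then obtain P where P: "P \<subseteq> X" "(\<Sum>x\<in>X. u x * (\<Sum>y\<in>Y. B x y * v y)) \<le> (\<Sum>x\<in>P. \<Sum>y\<in>Y. B x y * v y)"
    by blast
  have "\<exists>Q\<subseteq>Y. (\<Sum>y\<in>Y. v y * (\<Sum>x\<in>P. B x y)) \<le> (\<Sum>y\<in>Q. \<Sum>x\<in>P. B x y)"
    by (rule linear_le_subset[OF fin(2) v])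
  then obtain Q where Q: "Q \<subseteq> Y" "(\<Sum>y\<in>Y. v y * (\<Sum>x\<in>P. B x y)) \<le> (\<Sum>y\<in>Q. \<Sum>x\<in>P. B x y)"
    by blast
  have "(\<Sum>x\<in>X. \<Sum>y\<in>Y. B x y * u x * v y) = (\<Sum>x\<in>X. u x * (\<Sum>y\<in>Y. B x y * v y))"
    by (simp add: sum_distrib_left mult_ac)
  also note P(2)
  also have "(\<Sum>x\<in>P. \<Sum>y\<in>Y. B x y * v y) = (\<Sum>y\<in>Y. v y * (\<Sum>x\<in>P. B x y))"
    by (subst sum.swap) (simp add: sum_distrib_left mult_ac)
  also note Q(2)
  also have "(\<Sum>y\<in>Q. \<Sum>x\<in>P. B x y) = (\<Sum>x\<in>P. \<Sum>y\<in>Q. B x y)" by (rule sum.swap)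
  also have "\<dots> \<le> c" by (rule cut[OF P(1) Q(1)])
  finally show ?thesis .
qed

lemma abs_bilinear_le_cut:
  fixes B :: "'b \<Rightarrow> 'c \<Rightarrow> real"
  assumes fin: "finite X" "finite Y"
    and u: "\<And>x. x \<in> X \<Longrightarrow> 0 \<le> u x \<and> u x \<le> 1" and v: "\<And>y. y \<in> Y \<Longrightarrow> 0 \<le> v y \<and> v y \<le> 1"
    and cut: "\<And>P Q. P \<subseteq> X \<Longrightarrow> Q \<subseteq> Y \<Longrightarrow> \<bar>\<Sum>x\<in>P. \<Sum>y\<in>Q. B x y\<bar> \<le> c"
  shows "\<bar>\<Sum>x\<in>X. \<Sum>y\<in>Y. B x y * u x * v y\<bar> \<le> c"
proof -
  have 1: "(\<Sum>x\<in>X. \<Sum>y\<in>Y. B x y * u x * v y) \<le> c"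
    by (rule bilinear_le_cut[OF fin u v]) (use cut in \<open>auto simp: abs_le_iff\<close>)
  have "(\<Sum>x\<in>X. \<Sum>y\<in>Y. - B x y * u x * v y) \<le> c"
    by (rule bilinear_le_cut[OF fin u v]) (use cut in \<open>auto simp: abs_le_iff sum_negf\<close>)
  thus ?thesis using 1 by (simp add: sum_negf abs_le_iff)
qed

text \<open>Positive and negative parts of both vectors give four forms, hence the factor 4.\<close>

lemma abs_bilinear_signed_le_cut:
  fixes B :: "'b \<Rightarrow> 'c \<Rightarrow> real"
  assumes fin: "finite X" "finite Y"
    and u: "\<And>x. x \<in> X \<Longrightarrow> \<bar>u x\<bar> \<le> 1" and v: "\<And>y. y \<in> Y \<Longrightarrow> \<bar>v y\<bar> \<le> 1"
    and cut: "\<And>P Q. P \<subseteq> X \<Longrightarrow> Q \<subseteq> Y \<Longrightarrow> \<bar>\<Sum>x\<in>P. \<Sum>y\<in>Q. B x y\<bar> \<le> c"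
  shows "\<bar>\<Sum>x\<in>X. \<Sum>y\<in>Y. B x y * u x * v y\<bar> \<le> 4 * c"
proof -
  define up where "up x = max (u x) 0" for x
  define un where "un x = max (- u x) 0" for x
  define vp where "vp x = max (v x) 0" for x
  define vn where "vn x = max (- v x) 0" for x
  have e: "u x = up x - un x" "v y = vp y - vn y" for x y by (auto simp: up_def un_def vp_def vn_def max_def)
  have b: "0 \<le> up x \<and> up x \<le> 1" "0 \<le> un x \<and> un x \<le> 1" if "x \<in> X" for x
    using u[OF that] by (auto simp: up_def un_def)
  have b': "0 \<le> vp x \<and> vp x \<le> 1" "0 \<le> vn x \<and> vn x \<le> 1" if "x \<in> Y" for x
    using v[OF that] by (auto simp: vp_def vn_def)
  have "(\<Sum>x\<in>X. \<Sum>y\<in>Y. B x y * u x * v y)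
     = (\<Sum>x\<in>X. \<Sum>y\<in>Y. B x y * up x * vp y) - (\<Sum>x\<in>X. \<Sum>y\<in>Y. B x y * up x * vn y)
      - (\<Sum>x\<in>X. \<Sum>y\<in>Y. B x y * un x * vp y) + (\<Sum>x\<in>X. \<Sum>y\<in>Y. B x y * un x * vn y)"
    unfolding e by (simp add: algebra_simps sum.distrib sum_subtractf)
  moreover have "\<bar>\<Sum>x\<in>X. \<Sum>y\<in>Y. B x y * up x * vp y\<bar> \<le> c" "\<bar>\<Sum>x\<in>X. \<Sum>y\<in>Y. B x y * up x * vn y\<bar> \<le> c"
    "\<bar>\<Sum>x\<in>X. \<Sum>y\<in>Y. B x y * un x * vp y\<bar> \<le> c" "\<bar>\<Sum>x\<in>X. \<Sum>y\<in>Y. B x y * un x * vn y\<bar> \<le> c"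
    by (rule abs_bilinear_le_cut[OF fin _ _ cut], erule b, erule b', assumption+)+
  ultimately show ?thesis by linarith
qed

text \<open>\<open>F\<close> does not depend on coordinate \<open>i\<close>; no probability is
  meant.\<close>

definition indep :: "(('i \<Rightarrow> 'x) \<Rightarrow> real) \<Rightarrow> 'i \<Rightarrow> bool" where
  "indep F i \<longleftrightarrow> (\<forall>\<phi> a. F (\<phi>(i := a)) = F \<phi>)"

text \<open>With all coordinates except \<open>i\<close> and \<open>j\<close> frozen,
  \<open>u\<close> is a function of coordinate \<open>i\<close> and \<open>v\<close> one of
  coordinate \<open>j\<close>, so the inner sum is a bilinear form in the balanced
  \<open>A\<close>.\<close>

lemma sum_PiE_replace_edge:
  fixes A :: "'a \<Rightarrow> 'a \<Rightarrow> real" and u v :: "('i \<Rightarrow> 'a) \<Rightarrow> real"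
  assumes fin: "finite U" "finite I" and n: "card U = n" and ij: "i \<in> I" "j \<in> I" "i \<noteq> j"
    and cut: "\<And>P Q. P \<subseteq> U \<Longrightarrow> Q \<subseteq> U \<Longrightarrow> \<bar>\<Sum>x\<in>P. \<Sum>y\<in>Q. A x y - d\<bar> \<le> \<epsilon> * real n ^ 2"
    and u: "indep u j" "\<And>\<phi>. 0 \<le> u \<phi> \<and> u \<phi> \<le> 1"
    and v: "indep v i" "\<And>\<phi>. 0 \<le> v \<phi> \<and> v \<phi> \<le> 1"
  shows "\<bar>(\<Sum>\<phi>\<in>I \<rightarrow>\<^sub>E U. A (\<phi> i) (\<phi> j) * (u \<phi> * v \<phi>)) - d * (\<Sum>\<phi>\<in>I \<rightarrow>\<^sub>E U. u \<phi> * v \<phi>)\<bar>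
     \<le> \<epsilon> * real n ^ card I"
proof -
  let ?J = "I - {i} - {j}"
  have cJ: "card (?J \<rightarrow>\<^sub>E U) = n ^ (card I - 2)"
    using fin ij n by (subst card_PiE_const) (auto simp: card_Diff_singleton_if numeral_2_eq_2)
  have "card {i, j} \<le> card I" by (rule card_mono) (use fin ij in auto)
  hence I: "card I = 2 + (card I - 2)" using ij by simp
  have "(\<Sum>\<phi>\<in>I \<rightarrow>\<^sub>E U. A (\<phi> i) (\<phi> j) * (u \<phi> * v \<phi>)) - d * (\<Sum>\<phi>\<in>I \<rightarrow>\<^sub>E U. u \<phi> * v \<phi>)
     = (\<Sum>\<phi>\<in>I \<rightarrow>\<^sub>E U. (A (\<phi> i) (\<phi> j) - d) * u \<phi> * v \<phi>)"
    by (simp add: sum_distrib_left sum_subtractf[symmetric] algebra_simps)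
  also have "\<dots> = (\<Sum>a\<in>U. \<Sum>\<phi>\<in>(I - {i}) \<rightarrow>\<^sub>E U. (A a (\<phi> j) - d) * u (\<phi>(i := a)) * v \<phi>)"
    using ij fin v(1) by (subst sum_PiE_split[of I i]) (auto simp: indep_def)
  also have "\<dots> = (\<Sum>a\<in>U. \<Sum>b\<in>U. \<Sum>\<psi>\<in>?J \<rightarrow>\<^sub>E U. (A a b - d) * u (\<psi>(i := a)) * v (\<psi>(j := b)))"
  proof (rule sum.cong[OF refl])
    fix a
    have "u (\<psi>(j := b, i := a)) = u (\<psi>(i := a))" for \<psi> b
      using u(1) ij(3) unfolding indep_def by (metis fun_upd_twist)
    thus "(\<Sum>\<phi>\<in>(I - {i}) \<rightarrow>\<^sub>E U. (A a (\<phi> j) - d) * u (\<phi>(i := a)) * v \<phi>)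
      = (\<Sum>b\<in>U. \<Sum>\<psi>\<in>?J \<rightarrow>\<^sub>E U. (A a b - d) * u (\<psi>(i := a)) * v (\<psi>(j := b)))"
      using ij fin by (subst sum_PiE_split[of "I - {i}" j]) auto
  qed
  also have "\<dots> = (\<Sum>a\<in>U. \<Sum>\<psi>\<in>?J \<rightarrow>\<^sub>E U. \<Sum>b\<in>U. (A a b - d) * u (\<psi>(i := a)) * v (\<psi>(j := b)))"
    by (rule sum.cong[OF refl], rule sum.swap)
  also have "\<dots> = (\<Sum>\<psi>\<in>?J \<rightarrow>\<^sub>E U. \<Sum>a\<in>U. \<Sum>b\<in>U. (A a b - d) * u (\<psi>(i := a)) * v (\<psi>(j := b)))"
    by (rule sum.swap)
  also have "\<bar>\<dots>\<bar> \<le> (\<Sum>\<psi>\<in>?J \<rightarrow>\<^sub>E U. \<epsilon> * real n ^ 2)"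
    by (rule order_trans[OF sum_abs], rule sum_mono, rule abs_bilinear_le_cut[OF fin(1) fin(1) u(2) v(2) cut])
  also have "\<dots> = \<epsilon> * (real n ^ 2 * real n ^ (card I - 2))" by (simp add: cJ)
  also have "real n ^ 2 * real n ^ (card I - 2) = real n ^ card I"
    using I by (metis power_add)
  finally show ?thesis .
qed

text \<open>The counting lemma, one edge at a time. To replace the edge \<open>i\<close>,
  \<open>j\<close> by \<open>d\<close>, the rest must split into a factor blind to \<open>j\<close>
  and a factor blind to \<open>i\<close>. No other listed edge joins \<open>i\<close> and
  \<open>j\<close>, so each is blind to one of them, and \<open>G\<close> is so by
  assumption.\<close>

lemma count_edges:
  fixes A :: "'a \<Rightarrow> 'a \<Rightarrow> real" and G :: "('i \<Rightarrow> 'a) \<Rightarrow> real"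
  assumes fin: "finite U" "finite I" and n: "card U = n"
    and A: "\<And>x y. 0 \<le> A x y \<and> A x y \<le> 1" and d: "0 \<le> d" "d \<le> 1" and eps: "\<epsilon> \<ge> 0"
    and cut: "\<And>P Q. P \<subseteq> U \<Longrightarrow> Q \<subseteq> U \<Longrightarrow> \<bar>\<Sum>x\<in>P. \<Sum>y\<in>Q. A x y - d\<bar> \<le> \<epsilon> * real n ^ 2"
    and G: "\<And>\<phi>. 0 \<le> G \<phi> \<and> G \<phi> \<le> 1"
  shows "distinct (map (\<lambda>(i, j). {i, j}) es) \<Longrightarrow>
    \<forall>(i, j)\<in>set es. i \<in> I \<and> j \<in> I \<and> i \<noteq> j \<and> (indep G i \<or> indep G j) \<Longrightarrow>
    \<bar>(\<Sum>\<phi>\<in>I \<rightarrow>\<^sub>E U. G \<phi> * (\<Prod>(i, j)\<leftarrow>es. A (\<phi> i) (\<phi> j))) - d ^ length es * (\<Sum>\<phi>\<in>I \<rightarrow>\<^sub>E U. G \<phi>)\<bar>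
      \<le> real (length es) * \<epsilon> * real n ^ card I"
proof (induction es)
  case Nil
  thus ?case by simp
next
  case (Cons e es)
  obtain i j where e: "e = (i, j)" by (cases e)
  have ij: "i \<in> I" "j \<in> I" "i \<noteq> j" "indep G i \<or> indep G j" using Cons.prems(2) e by auto
  define pr where "pr xs \<phi> = (\<Prod>(i, j)\<leftarrow>xs. A (\<phi> i) (\<phi> j))"
    for xs :: "('i \<times> 'i) list" and \<phi>
  have pr01: "0 \<le> pr xs \<phi> \<and> pr xs \<phi> \<le> 1" for xs \<phi>
    unfolding pr_def by (induction xs) (use A in \<open>auto simp: mult_le_one\<close>)
  have ind_pr: "indep (pr xs) k" if "\<forall>(a, b)\<in>set xs. a \<noteq> k \<and> b \<noteq> k" for xs k
    using that unfolding indep_def pr_def by (induction xs) auto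
  have split: "pr es \<phi> = pr (filter P es) \<phi> * pr (filter (\<lambda>e. \<not> P e) es) \<phi>" for P \<phi>
    unfolding pr_def by (induction es) (auto simp: mult_ac)
  have edge: "\<not> ((a = i \<or> b = i) \<and> (a = j \<or> b = j))" if "(a, b) \<in> set es" for a b
  proof
    assume "(a = i \<or> b = i) \<and> (a = j \<or> b = j)"
    hence "{a, b} = {i, j}" using ij(3) by auto
    moreover have "(\<lambda>(i, j). {i, j}) (a, b) \<in> (\<lambda>(i, j). {i, j}) ` set es" by (rule imageI[OF that])
    ultimately have "{i, j} \<in> (\<lambda>(i, j). {i, j}) ` set es" by simp
    thus False using Cons.prems(1) e by simp
  qed
  have indmult: "indep (\<lambda>\<phi>. F \<phi> * H \<phi>) k" if "indep F k" "indep H k" for F H and k :: 'i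
    using that by (simp add: indep_def)
  have "\<exists>u v. indep u j \<and> indep v i \<and> (\<forall>\<phi>. 0 \<le> u \<phi> \<and> u \<phi> \<le> 1) \<and> (\<forall>\<phi>. 0 \<le> v \<phi> \<and> v \<phi> \<le> 1) \<and>
     (\<forall>\<phi>. G \<phi> * pr es \<phi> = u \<phi> * v \<phi>)"
  proof (cases "indep G j")
    case True
    \<comment> \<open>\<open>G\<close> goes with the edges that avoid \<open>j\<close>; the edges
      through \<open>j\<close> all avoid \<open>i\<close>.\<close>
    let ?P = "\<lambda>(a, b). a \<noteq> j \<and> b \<noteq> j"
    let ?u = "\<lambda>\<phi>. G \<phi> * pr (filter ?P es) \<phi>" and ?v = "pr (filter (\<lambda>e. \<not> ?P e) es)"
    have "indep ?u j" by (rule indmult[OF True ind_pr]) auto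
    moreover have "indep ?v i" by (rule ind_pr) (use edge in fastforce)
    ultimately show ?thesis using G pr01 split[where P="?P"]
      by (intro exI[of _ ?u] exI[of _ ?v]) (auto simp: mult_le_one mult.assoc)
  next
    case False
    hence Gi: "indep G i" using ij by blast
    let ?P = "\<lambda>(a, b). a \<noteq> i \<and> b \<noteq> i"
    let ?v = "\<lambda>\<phi>. G \<phi> * pr (filter ?P es) \<phi>" and ?u = "pr (filter (\<lambda>e. \<not> ?P e) es)"
    have "indep ?v i" by (rule indmult[OF Gi ind_pr]) auto
    moreover have "indep ?u j" by (rule ind_pr) (use edge in fastforce)
    ultimately show ?thesis using G pr01 split[where P="?P"]
      by (intro exI[of _ ?u] exI[of _ ?v]) (auto simp: mult_le_one mult_ac)
  qed
  then obtain u v where uv: "indep u j" "indep v i" "\<And>\<phi>. 0 \<le> u \<phi> \<and> u \<phi> \<le> 1"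
    "\<And>\<phi>. 0 \<le> v \<phi> \<and> v \<phi> \<le> 1" "\<And>\<phi>. G \<phi> * pr es \<phi> = u \<phi> * v \<phi>" by blast
  let ?N = "\<epsilon> * real n ^ card I"
  let ?S = "\<Sum>\<phi>\<in>I \<rightarrow>\<^sub>E U. G \<phi> * pr es \<phi>" and ?T = "d ^ length es * (\<Sum>\<phi>\<in>I \<rightarrow>\<^sub>E U. G \<phi>)"
  have "\<bar>(\<Sum>\<phi>\<in>I \<rightarrow>\<^sub>E U. A (\<phi> i) (\<phi> j) * (u \<phi> * v \<phi>)) - d * (\<Sum>\<phi>\<in>I \<rightarrow>\<^sub>E U. u \<phi> * v \<phi>)\<bar> \<le> ?N"
    by (rule sum_PiE_replace_edge[OF fin n ij(1,2,3) cut uv(1,3,2,4)])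
  hence 1: "\<bar>(\<Sum>\<phi>\<in>I \<rightarrow>\<^sub>E U. G \<phi> * pr (e # es) \<phi>) - d * ?S\<bar> \<le> ?N"
    unfolding uv(5)[symmetric] by (simp add: pr_def e mult_ac)
  have "\<bar>?S - ?T\<bar> \<le> real (length es) * ?N"
    using Cons.IH Cons.prems by (simp add: pr_def mult.assoc)
  hence "d * \<bar>?S - ?T\<bar> \<le> 1 * (real (length es) * ?N)"
    using d eps by (intro mult_mono) auto
  hence 2: "\<bar>d * ?S - d * ?T\<bar> \<le> real (length es) * ?N"
    using d by (simp add: abs_mult flip: right_diff_distrib)
  have "\<bar>(\<Sum>\<phi>\<in>I \<rightarrow>\<^sub>E U. G \<phi> * pr (e # es) \<phi>) - d * ?T\<bar> \<le> ?N + real (length es) * ?N"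
    using 1 2 by linarith
  thus ?case by (simp add: pr_def algebra_simps)
qed

section \<open>From cut norms to four-cycles and octahedra\<close>

lemma sum_PiE_Suc:
  fixes F :: "(nat \<Rightarrow> 'a) \<Rightarrow> real"
  assumes "finite U"
  shows "(\<Sum>\<phi>\<in>{..<Suc k} \<rightarrow>\<^sub>E U. F \<phi>) = (\<Sum>\<phi>\<in>{..<k} \<rightarrow>\<^sub>E U. \<Sum>a\<in>U. F (\<phi>(k := a)))"
proof -
  have "{..<Suc k} - {k} = {..<k}" by auto
  hence "(\<Sum>\<phi>\<in>{..<Suc k} \<rightarrow>\<^sub>E U. F \<phi>) = (\<Sum>a\<in>U. \<Sum>\<phi>\<in>{..<k} \<rightarrow>\<^sub>E U. F (\<phi>(k := a)))"
    using sum_PiE_split[of "{..<Suc k}" k "\<lambda>_. U" F] assms by simp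
  thus ?thesis using sum.swap[of "\<lambda>a \<phi>. F (\<phi>(k := a))" "{..<k} \<rightarrow>\<^sub>E U" U] by simp
qed

lemma sum_PiE3:
  assumes "finite U"
  shows "(\<Sum>\<phi>\<in>{..<3::nat} \<rightarrow>\<^sub>E U. F (\<phi> 0) (\<phi> 1) (\<phi> 2)) = (\<Sum>x\<in>U. \<Sum>y\<in>U. \<Sum>z\<in>U. F x y z :: real)"
  by (simp add: eval_nat_numeral sum_PiE_Suc[OF assms])

lemma sum_PiE6:
  assumes "finite U"
  shows "(\<Sum>\<phi>\<in>{..<6::nat} \<rightarrow>\<^sub>E U. F (\<phi> 0) (\<phi> 1) (\<phi> 2) (\<phi> 3) (\<phi> 4) (\<phi> 5))
     = (\<Sum>a\<in>U. \<Sum>b\<in>U. \<Sum>c\<in>U. \<Sum>d\<in>U. \<Sum>e\<in>U. \<Sum>f\<in>U. F a b c d e f :: real)"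
  by (simp add: eval_nat_numeral sum_PiE_Suc[OF assms])

text \<open>In the application \<open>\<pi>\<close> projects a triple to one of its sides. Grouping
  by the value of \<open>\<pi>\<close> turns the sum into a linear form in \<open>u\<close>, which
  is extremal at indicators; the factor 2 accounts for the sign of \<open>u\<close>.\<close>

lemma signed_le_cut:
  fixes g :: "'b \<Rightarrow> real" and u :: "'p \<Rightarrow> real"
  assumes fin: "finite \<Omega>" and cut: "\<And>P. \<bar>\<Sum>\<omega>\<in>\<Omega>. of_bool (\<pi> \<omega> \<in> P) * g \<omega>\<bar> \<le> c"
    and u: "\<And>p. \<bar>u p\<bar> \<le> 1"
  shows "\<bar>\<Sum>\<omega>\<in>\<Omega>. u (\<pi> \<omega>) * g \<omega>\<bar> \<le> 2 * c"
proof -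
  have pos: "(\<Sum>\<omega>\<in>\<Omega>. v (\<pi> \<omega>) * g' \<omega>) \<le> c"
    if v: "\<And>p. 0 \<le> v p \<and> v p \<le> 1" and c': "\<And>P. (\<Sum>\<omega>\<in>\<Omega>. of_bool (\<pi> \<omega> \<in> P) * g' \<omega>) \<le> c"
    for v :: "'p \<Rightarrow> real" and g'
  proof -
    let ?s = "\<lambda>p. \<Sum>\<omega>\<in>{\<omega>\<in>\<Omega>. \<pi> \<omega> = p}. g' \<omega>"
    have grp: "(\<Sum>p\<in>\<pi> ` \<Omega>. v p * ?s p) = (\<Sum>\<omega>\<in>\<Omega>. v (\<pi> \<omega>) * g' \<omega>)" for v :: "'p \<Rightarrow> real"
    proof -
      have "(\<Sum>p\<in>\<pi> ` \<Omega>. v p * ?s p) = (\<Sum>p\<in>\<pi> ` \<Omega>. \<Sum>\<omega>\<in>{\<omega>\<in>\<Omega>. \<pi> \<omega> = p}. v (\<pi> \<omega>) * g' \<omega>)"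
        by (simp add: sum_distrib_left)
      also have "\<dots> = (\<Sum>\<omega>\<in>\<Omega>. v (\<pi> \<omega>) * g' \<omega>)" by (rule sum.group) (use fin in auto)
      finally show ?thesis .
    qed
    have "\<exists>P\<subseteq>\<pi> ` \<Omega>. (\<Sum>p\<in>\<pi> ` \<Omega>. v p * ?s p) \<le> (\<Sum>p\<in>P. ?s p)"
      by (rule linear_le_subset) (use fin v in auto)
    then obtain P where P: "P \<subseteq> \<pi> ` \<Omega>" "(\<Sum>p\<in>\<pi> ` \<Omega>. v p * ?s p) \<le> (\<Sum>p\<in>P. ?s p)" by blast
    have "(\<Sum>p\<in>P. ?s p) = (\<Sum>p\<in>\<pi> ` \<Omega>. of_bool (p \<in> P) * ?s p)"
    proof -
      have "(\<Sum>p\<in>\<pi> ` \<Omega>. of_bool (p \<in> P) * ?s p) = (\<Sum>p\<in>\<pi> ` \<Omega>. if p \<in> P then ?s p else 0)"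
        by (rule sum.cong) auto
      also have "\<dots> = (\<Sum>p\<in>\<pi> ` \<Omega> \<inter> P. ?s p)" using fin by (intro sum.inter_restrict[symmetric]) auto
      also have "\<pi> ` \<Omega> \<inter> P = P" using P by auto
      finally show ?thesis by simp
    qed
    also have "\<dots> \<le> c" unfolding grp by (rule c')
    finally show ?thesis using P(2) unfolding grp by simp
  qed
  define up where "up x = max (u x) 0" for x
  define un where "un x = max (- u x) 0" for x
  have b: "0 \<le> up x \<and> up x \<le> 1" "0 \<le> un x \<and> un x \<le> 1" for x
    using u[of x] by (auto simp: up_def un_def)
  have c1: "(\<Sum>\<omega>\<in>\<Omega>. of_bool (\<pi> \<omega> \<in> P) * g \<omega>) \<le> c" "(\<Sum>\<omega>\<in>\<Omega>. of_bool (\<pi> \<omega> \<in> P) * - g \<omega>) \<le> c" for P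
    using cut[of P] by (auto simp: abs_le_iff sum_negf)
  have e: "u x = up x - un x" for x by (auto simp: up_def un_def max_def)
  have "(\<Sum>\<omega>\<in>\<Omega>. u (\<pi> \<omega>) * g \<omega>) = (\<Sum>\<omega>\<in>\<Omega>. up (\<pi> \<omega>) * g \<omega>) - (\<Sum>\<omega>\<in>\<Omega>. un (\<pi> \<omega>) * g \<omega>)"
    unfolding e by (simp add: left_diff_distrib sum_subtractf)
  moreover have "(\<Sum>\<omega>\<in>\<Omega>. up (\<pi> \<omega>) * g \<omega>) \<le> c" by (rule pos[OF b(1) c1(1)])
  moreover have "(\<Sum>\<omega>\<in>\<Omega>. un (\<pi> \<omega>) * g \<omega>) \<le> c" by (rule pos[OF b(2) c1(1)])
  moreover have "(\<Sum>\<omega>\<in>\<Omega>. up (\<pi> \<omega>) * - g \<omega>) \<le> c" by (rule pos[OF b(1) c1(2)])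
  moreover have "(\<Sum>\<omega>\<in>\<Omega>. un (\<pi> \<omega>) * - g \<omega>) \<le> c" by (rule pos[OF b(2) c1(2)])
  ultimately show ?thesis by (simp add: sum_negf abs_le_iff)
qed

text \<open>The indicators on the three sides are exchanged for bounded functions in turn, and each
  exchange costs a factor 2.\<close>

lemma trilinear_le_cut:
  fixes g :: "'a \<Rightarrow> 'b \<Rightarrow> 'c \<Rightarrow> real"
  assumes fin: "finite X" "finite Y" "finite Z"
    and cut: "\<And>P Q R. \<bar>\<Sum>x\<in>X. \<Sum>y\<in>Y. \<Sum>z\<in>Z. of_bool ((x, y) \<in> P \<and> (y, z) \<in> Q \<and> (x, z) \<in> R) * g x y z\<bar> \<le> c"
    and u: "\<And>x y. \<bar>u x y\<bar> \<le> 1" and v: "\<And>y z. \<bar>v y z\<bar> \<le> 1" and w: "\<And>x z. \<bar>w x z\<bar> \<le> 1"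
  shows "\<bar>\<Sum>x\<in>X. \<Sum>y\<in>Y. \<Sum>z\<in>Z. g x y z * u x y * v y z * w x z\<bar> \<le> 8 * c"
proof -
  let ?\<Omega> = "X \<times> Y \<times> Z"
  let ?xy = "\<lambda>(x, y, z). (x, y)" and ?yz = "\<lambda>(x, y, z). (y, z)" and ?xz = "\<lambda>(x, y, z). (x, z)"
  let ?g = "\<lambda>(x, y, z). g x y z"
  have f: "finite ?\<Omega>" using fin by auto
  have 0: "\<bar>\<Sum>\<omega>\<in>?\<Omega>. of_bool (?xz \<omega> \<in> R) * (of_bool (?yz \<omega> \<in> Q) * (of_bool (?xy \<omega> \<in> P) * ?g \<omega>))\<bar> \<le> c" for P Q R
    using cut[of P Q R] by (simp add: sum.cartesian_product case_prod_unfold of_bool_conj mult_ac)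
  have 1: "\<bar>\<Sum>\<omega>\<in>?\<Omega>. case_prod w (?xz \<omega>) * (of_bool (?yz \<omega> \<in> Q) * (of_bool (?xy \<omega> \<in> P) * ?g \<omega>))\<bar> \<le> 2 * c" for P Q
    by (rule signed_le_cut[OF f 0]) (use w in auto)
  have one': "\<bar>\<Sum>\<omega>\<in>?\<Omega>. of_bool (?yz \<omega> \<in> Q) * (case_prod w (?xz \<omega>) * (of_bool (?xy \<omega> \<in> P) * ?g \<omega>))\<bar> \<le> 2 * c" for P Q
    using 1[of Q P] by (simp add: mult_ac)
  have 2: "\<bar>\<Sum>\<omega>\<in>?\<Omega>. case_prod v (?yz \<omega>) * (case_prod w (?xz \<omega>) * (of_bool (?xy \<omega> \<in> P) * ?g \<omega>))\<bar> \<le> 2 * (2 * c)" for P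
    by (rule signed_le_cut[OF f one']) (use v in auto)
  have two': "\<bar>\<Sum>\<omega>\<in>?\<Omega>. of_bool (?xy \<omega> \<in> P) * (case_prod v (?yz \<omega>) * (case_prod w (?xz \<omega>) * ?g \<omega>))\<bar> \<le> 2 * (2 * c)" for P
    using 2[of P] by (simp add: mult_ac)
  have "\<bar>\<Sum>\<omega>\<in>?\<Omega>. case_prod u (?xy \<omega>) * (case_prod v (?yz \<omega>) * (case_prod w (?xz \<omega>) * ?g \<omega>))\<bar> \<le> 2 * (2 * (2 * c))"
    by (rule signed_le_cut[OF f two']) (use u in auto)
  thus ?thesis by (simp add: sum.cartesian_product case_prod_unfold mult_ac)
qed

text \<open>For fixed \<open>x'\<close> and \<open>y'\<close> the factors other than
  \<open>f x y\<close> are a function of \<open>x\<close>, a function of \<open>y\<close> and a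
  constant. This is the converse of \<open>cut_le_four_cycles\<close>, and the way in which
  cut-regularity reaches the definition of a quasirandom pair.\<close>

lemma four_cycles_le_cut:
  fixes f :: "'a \<Rightarrow> 'b \<Rightarrow> real"
  assumes fin: "finite X" "finite Y" and f: "\<And>x y. x \<in> X \<Longrightarrow> y \<in> Y \<Longrightarrow> \<bar>f x y\<bar> \<le> 1"
    and cut: "\<And>P Q. P \<subseteq> X \<Longrightarrow> Q \<subseteq> Y \<Longrightarrow> \<bar>\<Sum>x\<in>P. \<Sum>y\<in>Q. f x y\<bar> \<le> c"
  shows "four_cycles X Y f
     \<le> 4 * c * real (card X) * real (card Y)"
proof -
  have "four_cycles X Y f
      = (\<Sum>x'\<in>X. \<Sum>y'\<in>Y. \<Sum>x\<in>X. \<Sum>y\<in>Y. f x y * f x' y * f x y' * f x' y')"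
    unfolding sum.cartesian_product
    by (rule sum.reindex_bij_witness[where i="\<lambda>(x', y', x, y). (x, x', y, y')" and j="\<lambda>(x, x', y, y'). (x', y', x, y)"])
      auto
  also have "\<dots> \<le> (\<Sum>x'\<in>X. \<Sum>y'\<in>Y. 4 * c)"
  proof (intro sum_mono)
    fix x' y' assume xy: "x' \<in> X" "y' \<in> Y"
    have c0: "0 \<le> c" using cut[of "{}" "{}"] by simp
    have "\<bar>\<Sum>x\<in>X. \<Sum>y\<in>Y. f x y * f x y' * f x' y\<bar> \<le> 4 * c"
      by (rule abs_bilinear_signed_le_cut[OF fin _ _ cut]) (use f xy in auto)
    hence "\<bar>\<Sum>x\<in>X. \<Sum>y\<in>Y. f x y * f x y' * f x' y\<bar> * \<bar>f x' y'\<bar> \<le> (4 * c) * 1"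
      using f[OF xy] c0 by (intro mult_mono) auto
    moreover have "(\<Sum>x\<in>X. \<Sum>y\<in>Y. f x y * f x' y * f x y' * f x' y')
       = (\<Sum>x\<in>X. \<Sum>y\<in>Y. f x y * f x y' * f x' y) * f x' y'"
      by (simp add: sum_distrib_left sum_distrib_right mult_ac)
    ultimately show "(\<Sum>x\<in>X. \<Sum>y\<in>Y. f x y * f x' y * f x y' * f x' y') \<le> 4 * c"
      by (simp flip: abs_mult)
  qed
  finally show ?thesis by (simp add: mult_ac)
qed

abbreviation octahedra :: "'a set \<Rightarrow> ('a \<Rightarrow> 'a \<Rightarrow> 'a \<Rightarrow> real) \<Rightarrow> real" where
  "octahedra U f \<equiv> \<Sum>x\<in>U. \<Sum>x'\<in>U. \<Sum>y\<in>U. \<Sum>y'\<in>U. \<Sum>z\<in>U. \<Sum>z'\<in>U.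
     f x y z * f x y z' * f x y' z * f x y' z' * f x' y z * f x' y z' * f x' y' z * f x' y' z'"

text \<open>Splitting only the first factor of the octahedron as \<open>e0 + (D - d) T + g T\<close> suffices. The other
  seven factors are bounded by the product \<open>N9\<close> of the nine edges outside \<open>xyz\<close>, and for fixed
  \<open>x'\<close>, \<open>y'\<close>, \<open>z'\<close> they form a product of functions of two variables.\<close>

lemma octahedron_bound:
  fixes A :: "'a \<Rightarrow> 'a \<Rightarrow> real" and h e0 er g :: "'a \<Rightarrow> 'a \<Rightarrow> 'a \<Rightarrow> real"
  defines "T \<equiv> (\<lambda>x y z. A x y * A y z * A x z)"
  assumes fin: "finite U" and n: "card U = n"
    and A: "\<And>x y. A x y \<in> {0, 1}" and sym: "\<And>x y. A x y = A y x"
    and p: "0 \<le> p" "p \<le> 1" and eps: "\<epsilon> \<ge> 0"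
    and cut: "\<And>P Q. P \<subseteq> U \<Longrightarrow> Q \<subseteq> U \<Longrightarrow> \<bar>\<Sum>x\<in>P. \<Sum>y\<in>Q. A x y - p\<bar> \<le> \<epsilon> * real n ^ 2"
    and h: "\<And>x y z. 0 \<le> h x y z \<and> h x y z \<le> 1" and D: "0 \<le> D" "D \<le> 1"
    and dec: "\<And>x y z. x \<in> U \<Longrightarrow> y \<in> U \<Longrightarrow> z \<in> U \<Longrightarrow>
        (h x y z - D) * T x y z = e0 x y z + g x y z * T x y z"
    and e0: "\<And>x y z. x \<in> U \<Longrightarrow> y \<in> U \<Longrightarrow> z \<in> U \<Longrightarrow> \<bar>e0 x y z\<bar> \<le> er x y z"
    and er: "\<And>x y z. 0 \<le> er x y z \<and> er x y z \<le> 2"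
    and er_sum: "(\<Sum>x\<in>U. \<Sum>y\<in>U. \<Sum>z\<in>U. er x y z) \<le> \<kappa> * real n ^ 3"
    and g: "\<And>u v w. (\<And>x y. \<bar>u x y\<bar> \<le> 1) \<Longrightarrow> (\<And>x y. \<bar>v x y\<bar> \<le> 1) \<Longrightarrow> (\<And>x y. \<bar>w x y\<bar> \<le> 1) \<Longrightarrow>
        \<bar>\<Sum>x\<in>U. \<Sum>y\<in>U. \<Sum>z\<in>U. g x y z * u x y * v y z * w x z\<bar> \<le> \<beta> * real n ^ 3"
    and d: "d = (\<Sum>x\<in>U. \<Sum>y\<in>U. \<Sum>z\<in>U. h x y z * T x y z) / (\<Sum>x\<in>U. \<Sum>y\<in>U. \<Sum>z\<in>U. T x y z)"
    and f: "\<And>x y z. x \<in> U \<Longrightarrow> y \<in> U \<Longrightarrow> z \<in> U \<Longrightarrow> f x y z = (h x y z - d) * T x y z"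
  shows "octahedra U f
     \<le> (p ^ 9 * (2 * \<kappa> + \<beta>) + 27 * \<epsilon> + \<beta>) * real n ^ 6"
proof -
  have A01: "0 \<le> A x y \<and> A x y \<le> 1" for x y using A[of x y] by auto
  have T01: "0 \<le> T x y z \<and> T x y z \<le> 1" for x y z
    unfolding T_def using A01 by (auto intro!: mult_le_one)
  define \<tau> where "\<tau> = (\<Sum>x\<in>U. \<Sum>y\<in>U. \<Sum>z\<in>U. T x y z)"
  have \<tau>: "\<tau> \<ge> 0" unfolding \<tau>_def by (intro sum_nonneg) (use T01 in auto)
  have d01: "0 \<le> d \<and> d \<le> 1"
  proof -
    have "(\<Sum>x\<in>U. \<Sum>y\<in>U. \<Sum>z\<in>U. h x y z * T x y z) \<le> \<tau>"
      unfolding \<tau>_def by (intro sum_mono) (use h T01 in \<open>auto intro: mult_left_le_one_le\<close>)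
    moreover have "0 \<le> (\<Sum>x\<in>U. \<Sum>y\<in>U. \<Sum>z\<in>U. h x y z * T x y z)"
      by (intro sum_nonneg) (use h T01 in auto)
    ultimately show ?thesis unfolding d \<tau>_def[symmetric] using \<tau>
      by (auto simp: divide_le_eq)
  qed
  define \<delta> where "\<delta> = \<bar>D - d\<bar>"
  have \<delta>: "0 \<le> \<delta>" "\<delta> \<le> 1" using d01 D by (auto simp: \<delta>_def abs_if)
  \<comment> \<open>\<open>D\<close> is the constant built into the decomposition, \<open>d\<close>
    the true relative density. Summing the decomposition over all triangles bounds their difference
    by the average error; here \<open>g\<close> is tested against \<open>A\<close> itself.\<close>
  have \<delta>\<tau>: "\<delta> * \<tau> \<le> (\<kappa> + \<beta>) * real n ^ 3"
  proof (cases "\<tau> = 0")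
    case True
    have "0 \<le> \<kappa> * real n ^ 3" by (rule order_trans[OF _ er_sum], intro sum_nonneg) (use er in auto)
    moreover have "0 \<le> \<beta> * real n ^ 3"
      by (rule order_trans[OF abs_ge_zero g[of "\<lambda>_ _. 0" "\<lambda>_ _. 0" "\<lambda>_ _. 0"]]) auto
    ultimately show ?thesis using True by (simp add: distrib_right)
  next
    case False
    have "d * \<tau> = (\<Sum>x\<in>U. \<Sum>y\<in>U. \<Sum>z\<in>U. h x y z * T x y z)"
      using False by (simp add: d \<tau>_def)
    hence "(d - D) * \<tau> = (\<Sum>x\<in>U. \<Sum>y\<in>U. \<Sum>z\<in>U. (h x y z - D) * T x y z)"
      by (simp add: left_diff_distrib sum_subtractf \<tau>_def sum_distrib_left)
    also have "\<dots> = (\<Sum>x\<in>U. \<Sum>y\<in>U. \<Sum>z\<in>U. e0 x y z + g x y z * A x y * A y z * A x z)"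
      by (intro sum.cong refl) (simp add: dec, simp add: T_def mult.assoc)
    also have "\<dots> = (\<Sum>x\<in>U. \<Sum>y\<in>U. \<Sum>z\<in>U. e0 x y z) + (\<Sum>x\<in>U. \<Sum>y\<in>U. \<Sum>z\<in>U. g x y z * A x y * A y z * A x z)"
      by (simp add: sum.distrib)
    finally have "\<bar>(d - D) * \<tau>\<bar> \<le> \<bar>\<Sum>x\<in>U. \<Sum>y\<in>U. \<Sum>z\<in>U. e0 x y z\<bar>
        + \<bar>\<Sum>x\<in>U. \<Sum>y\<in>U. \<Sum>z\<in>U. g x y z * A x y * A y z * A x z\<bar>" by simp
    also have "\<bar>\<Sum>x\<in>U. \<Sum>y\<in>U. \<Sum>z\<in>U. e0 x y z\<bar> \<le> (\<Sum>x\<in>U. \<Sum>y\<in>U. \<Sum>z\<in>U. er x y z)"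
      by (rule order_trans[OF sum_abs], rule sum_mono, rule order_trans[OF sum_abs], rule sum_mono,
          rule order_trans[OF sum_abs], rule sum_mono, rule e0)
    also have "\<bar>\<Sum>x\<in>U. \<Sum>y\<in>U. \<Sum>z\<in>U. g x y z * A x y * A y z * A x z\<bar> \<le> \<beta> * real n ^ 3"
      by (rule g) (use A01 in \<open>auto simp: abs_le_iff intro: order_trans\<close>)
    finally have "\<bar>(d - D) * \<tau>\<bar> \<le> \<kappa> * real n ^ 3 + \<beta> * real n ^ 3" using er_sum by linarith
    thus ?thesis using \<tau> by (simp add: \<delta>_def abs_mult distrib_right abs_minus_commute)
  qed
  have fT: "\<bar>f x y z\<bar> \<le> T x y z" if "x \<in> U" "y \<in> U" "z \<in> U" for x y z
  proof -
    have "\<bar>h x y z - d\<bar> \<le> 1" using h[of x y z] d01 by (auto simp: abs_le_iff)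
    hence "\<bar>h x y z - d\<bar> * T x y z \<le> 1 * T x y z" by (rule mult_right_mono) (use T01 in auto)
    thus ?thesis using f[OF that] T01[of x y z] by (simp add: abs_mult)
  qed
  have f1: "\<bar>f x y z\<bar> \<le> 1" if "x \<in> U" "y \<in> U" "z \<in> U" for x y z
    using fT[OF that] T01[of x y z] by linarith
  define S where "S x x' y y' z z' = f x y z' * f x y' z * f x y' z' *
          f x' y z * f x' y z' * f x' y' z * f x' y' z'" for x x' y y' z z'
  define N9 where "N9 x x' y y' z z' = A x' y' * A x' z' * A y' z' * A x y' * A x z' * A y x' * A y z' * A z x' * A z y'"
    for x x' y y' z z'
  have N9: "0 \<le> N9 x x' y y' z z'" for x x' y y' z z' unfolding N9_def using A01 by simp
  \<comment> \<open>Four of the seven faces already cover the nine edges; the other three are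
    bounded by 1.\<close>
  have SN: "\<bar>S x x' y y' z z'\<bar> \<le> N9 x x' y y' z z'"
    if m: "x \<in> U" "x' \<in> U" "y \<in> U" "y' \<in> U" "z \<in> U" "z' \<in> U" for x x' y y' z z'
  proof -
    have t1: "\<bar>f x y z'\<bar> \<le> A y z' * A x z'"
      using fT[OF m(1,3,6)] mult_right_mono[of "A x y" 1 "A y z' * A x z'"] A01 by (simp add: T_def mult.assoc)
    have t2: "\<bar>f x y' z\<bar> \<le> A x y' * A y' z"
      using fT[OF m(1,4,5)] mult_left_mono[of "A x z" 1 "A x y' * A y' z"] A01 by (simp add: T_def mult.assoc)
    have t3: "\<bar>f x' y z\<bar> \<le> A x' y * A x' z"
      using fT[OF m(2,3,5)] mult_left_mono[of "A y z" 1 "A x' y * A x' z"] A01 by (simp add: T_def mult_ac)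
    have t4: "\<bar>f x' y' z'\<bar> \<le> A x' y' * A y' z' * A x' z'"
      using fT[OF m(2,4,6)] by (simp add: T_def)
    have "\<bar>S x x' y y' z z'\<bar> = \<bar>f x y z'\<bar> * \<bar>f x y' z\<bar> * \<bar>f x y' z'\<bar> *
          \<bar>f x' y z\<bar> * \<bar>f x' y z'\<bar> * \<bar>f x' y' z\<bar> * \<bar>f x' y' z'\<bar>" by (simp add: S_def abs_mult)
    also have "\<dots> \<le> (A y z' * A x z') * (A x y' * A y' z) * 1 * (A x' y * A x' z) * 1 * 1 * (A x' y' * A y' z' * A x' z')"
      by (intro mult_mono t1 t2 t3 t4 f1 m) (use A01 in auto)
    also have "\<dots> = N9 x x' y y' z z'" unfolding N9_def using sym by (simp add: mult_ac)
    finally show ?thesis .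
  qed
  let ?b = "\<lambda>x y z. er x y z + \<delta> * T x y z"
  have b03: "0 \<le> ?b x y z \<and> ?b x y z \<le> 3" for x y z
  proof -
    have "\<delta> * T x y z \<le> 1 * 1" using \<delta> T01[of x y z] by (intro mult_mono) auto
    thus ?thesis using er[of x y z] \<delta> T01[of x y z] by auto
  qed
  have count: "(\<Sum>x\<in>U. \<Sum>x'\<in>U. \<Sum>y\<in>U. \<Sum>y'\<in>U. \<Sum>z\<in>U. \<Sum>z'\<in>U. ?b x y z * N9 x x' y y' z z')
     \<le> (p ^ 9 * (2 * \<kappa> + \<beta>) + 27 * \<epsilon>) * real n ^ 6"
  proof -
    \<comment> \<open>The weight sees only coordinates 0, 2 and 4, that is \<open>x\<close>,
      \<open>y\<close>, \<open>z\<close>, and each of the nine edges has a primed end at an odd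
      coordinate. Division by 3 brings \<open>?b\<close> into the unit interval, which turns the
      error \<open>9 * \<epsilon>\<close> into \<open>27 * \<epsilon>\<close>.\<close>
    define G where "G \<phi> = ?b (\<phi> 0) (\<phi> 2) (\<phi> 4) / 3" for \<phi> :: "nat \<Rightarrow> 'a"
    define es where "es = [(1::nat,3::nat),(1,5),(3,5),(0,3),(0,5),(2,1),(2,5),(4,1),(4,3)]"
    have len: "length es = 9" by (simp add: es_def)
    have k1: "\<bar>(\<Sum>\<phi>\<in>{..<6} \<rightarrow>\<^sub>E U. G \<phi> * (\<Prod>(i, j)\<leftarrow>es. A (\<phi> i) (\<phi> j)))
        - p ^ length es * (\<Sum>\<phi>\<in>{..<6} \<rightarrow>\<^sub>E U. G \<phi>)\<bar> \<le> real (length es) * \<epsilon> * real n ^ card {..<6::nat}"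
    proof (rule count_edges[OF fin _ n A01 p eps cut])
      show "0 \<le> G \<phi> \<and> G \<phi> \<le> 1" for \<phi> using b03 by (simp add: G_def)
      show "distinct (map (\<lambda>(i, j). {i, j}) es)" by (simp add: es_def doubleton_eq_iff)
      show "\<forall>(i, j)\<in>set es. i \<in> {..<6} \<and> j \<in> {..<6} \<and> i \<noteq> j \<and> (indep G i \<or> indep G j)"
        by (simp add: es_def indep_def G_def)
    qed auto
    have k2: "(\<Sum>\<phi>\<in>{..<6} \<rightarrow>\<^sub>E U. G \<phi> * (\<Prod>(i, j)\<leftarrow>es. A (\<phi> i) (\<phi> j)))
       = (\<Sum>x\<in>U. \<Sum>x'\<in>U. \<Sum>y\<in>U. \<Sum>y'\<in>U. \<Sum>z\<in>U. \<Sum>z'\<in>U. ?b x y z / 3 * N9 x x' y y' z z')"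
      using sum_PiE6[OF fin, of "\<lambda>x x' y y' z z'. ?b x y z / 3 * N9 x x' y y' z z'"]
      by (simp add: G_def es_def N9_def mult.assoc)
    have k3: "(\<Sum>\<phi>\<in>{..<6} \<rightarrow>\<^sub>E U. G \<phi>)
       = real n ^ 3 * (\<Sum>x\<in>U. \<Sum>y\<in>U. \<Sum>z\<in>U. ?b x y z / 3)"
      using sum_PiE6[OF fin, of "\<lambda>x x' y y' z z'. ?b x y z / 3"] n
      by (simp add: G_def power3_eq_cube sum_distrib_left mult_ac)
    have "(\<Sum>x\<in>U. \<Sum>x'\<in>U. \<Sum>y\<in>U. \<Sum>y'\<in>U. \<Sum>z\<in>U. \<Sum>z'\<in>U. ?b x y z / 3 * N9 x x' y y' z z')
       \<le> p ^ 9 * (real n ^ 3 * (\<Sum>x\<in>U. \<Sum>y\<in>U. \<Sum>z\<in>U. ?b x y z / 3)) + 9 * \<epsilon> * real n ^ 6"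
      using k1 unfolding k2 k3 len card_lessThan of_nat_numeral by linarith
    hence "(\<Sum>x\<in>U. \<Sum>x'\<in>U. \<Sum>y\<in>U. \<Sum>y'\<in>U. \<Sum>z\<in>U. \<Sum>z'\<in>U. ?b x y z * N9 x x' y y' z z') / 3
       \<le> p ^ 9 * (real n ^ 3 * ((\<Sum>x\<in>U. \<Sum>y\<in>U. \<Sum>z\<in>U. ?b x y z) / 3)) + 9 * \<epsilon> * real n ^ 6"
      by (simp only: sum_divide_distrib times_divide_eq_left)
    hence "(\<Sum>x\<in>U. \<Sum>x'\<in>U. \<Sum>y\<in>U. \<Sum>y'\<in>U. \<Sum>z\<in>U. \<Sum>z'\<in>U. ?b x y z * N9 x x' y y' z z')
       \<le> p ^ 9 * (real n ^ 3 * (\<Sum>x\<in>U. \<Sum>y\<in>U. \<Sum>z\<in>U. ?b x y z)) + 27 * \<epsilon> * real n ^ 6" by simp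
    also have "(\<Sum>x\<in>U. \<Sum>y\<in>U. \<Sum>z\<in>U. ?b x y z) = (\<Sum>x\<in>U. \<Sum>y\<in>U. \<Sum>z\<in>U. er x y z) + \<delta> * \<tau>"
      by (simp add: sum.distrib \<tau>_def sum_distrib_left)
    also have "\<dots> \<le> (2 * \<kappa> + \<beta>) * real n ^ 3"
      using er_sum \<delta>\<tau> by (simp add: algebra_simps)
    finally have "(\<Sum>x\<in>U. \<Sum>x'\<in>U. \<Sum>y\<in>U. \<Sum>y'\<in>U. \<Sum>z\<in>U. \<Sum>z'\<in>U. ?b x y z * N9 x x' y y' z z')
       \<le> p ^ 9 * (real n ^ 3 * ((2 * \<kappa> + \<beta>) * real n ^ 3)) + 27 * \<epsilon> * real n ^ 6"
      using p by (simp add: mult_left_mono)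
    also have "\<dots> = (p ^ 9 * (2 * \<kappa> + \<beta>) + 27 * \<epsilon>) * real n ^ 6"
      by (simp add: algebra_simps flip: power_add)
    finally show ?thesis .
  qed
  have glin: "(\<Sum>x\<in>U. \<Sum>x'\<in>U. \<Sum>y\<in>U. \<Sum>y'\<in>U. \<Sum>z\<in>U. \<Sum>z'\<in>U. g x y z * T x y z * S x x' y y' z z')
     \<le> \<beta> * real n ^ 6"
  proof -
    have "(\<Sum>x\<in>U. \<Sum>x'\<in>U. \<Sum>y\<in>U. \<Sum>y'\<in>U. \<Sum>z\<in>U. \<Sum>z'\<in>U. g x y z * T x y z * S x x' y y' z z')
       = (\<Sum>x'\<in>U. \<Sum>y'\<in>U. \<Sum>z'\<in>U. \<Sum>x\<in>U. \<Sum>y\<in>U. \<Sum>z\<in>U. g x y z * T x y z * S x x' y y' z z')"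
      unfolding sum.cartesian_product
      by (rule sum.reindex_bij_witness[where i="\<lambda>(x', y', z', x, y, z). (x, x', y, y', z, z')"
            and j="\<lambda>(x, x', y, y', z, z'). (x', y', z', x, y, z)"]) auto
    also have "\<dots> \<le> (\<Sum>x'\<in>U. \<Sum>y'\<in>U. \<Sum>z'\<in>U. \<beta> * real n ^ 3)"
    proof (intro sum_mono)
      fix x' y' z' assume m: "x' \<in> U" "y' \<in> U" "z' \<in> U"
      \<comment> \<open>\<open>g\<close> takes test functions that are bounded everywhere, but
        \<open>f\<close> is controlled on \<open>U\<close> only; arguments outside \<open>U\<close>
        are sent to \<open>x'\<close>.\<close>
      let ?cl = "\<lambda>x. if x \<in> U then x else x'"
      \<comment> \<open>Each of the seven faces contains a primed vertex, so it depends on at most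
        two of \<open>x\<close>, \<open>y\<close>, \<open>z\<close> and can be assigned to a
        side.\<close>
      define u where "u x y = A x y * (f (?cl x) (?cl y) z' * f (?cl x) y' z' * f x' y' z')" for x y
      define v where "v y z = A y z * (f x' (?cl y) (?cl z) * f x' (?cl y) z')" for y z
      define w where "w x z = A x z * (f (?cl x) y' (?cl z) * f x' y' (?cl z))" for x z
      have cl: "?cl x \<in> U" for x using m by simp
      have "\<bar>\<Sum>x\<in>U. \<Sum>y\<in>U. \<Sum>z\<in>U. g x y z * u x y * v y z * w x z\<bar> \<le> \<beta> * real n ^ 3"
      proof (rule g)
        have abs1: "\<bar>a * b\<bar> \<le> 1" if "\<bar>a\<bar> \<le> 1" "\<bar>b\<bar> \<le> (1::real)" for a b
          using that by (simp add: abs_mult mult_le_one)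
        have A1: "\<bar>A x y\<bar> \<le> 1" for x y using A01[of x y] by (simp add: abs_le_iff)
        show "\<bar>u x y\<bar> \<le> 1" for x y unfolding u_def by (intro abs1 A1 f1 cl m)
        show "\<bar>v x y\<bar> \<le> 1" for x y unfolding v_def by (intro abs1 A1 f1 cl m)
        show "\<bar>w x y\<bar> \<le> 1" for x y unfolding w_def by (intro abs1 A1 f1 cl m)
      qed
      moreover have "(\<Sum>x\<in>U. \<Sum>y\<in>U. \<Sum>z\<in>U. g x y z * T x y z * S x x' y y' z z')
         = (\<Sum>x\<in>U. \<Sum>y\<in>U. \<Sum>z\<in>U. g x y z * u x y * v y z * w x z)"
        by (intro sum.cong refl) (simp add: u_def v_def w_def T_def S_def mult_ac)
      ultimately show "(\<Sum>x\<in>U. \<Sum>y\<in>U. \<Sum>z\<in>U. g x y z * T x y z * S x x' y y' z z') \<le> \<beta> * real n ^ 3"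
        by linarith
    qed
    also have "\<dots> = \<beta> * real n ^ 6" by (simp add: n flip: power_add power_Suc)
    finally show ?thesis .
  qed
  have "octahedra U f
     \<le> (\<Sum>x\<in>U. \<Sum>x'\<in>U. \<Sum>y\<in>U. \<Sum>y'\<in>U. \<Sum>z\<in>U. \<Sum>z'\<in>U.
          ?b x y z * N9 x x' y y' z z' + g x y z * T x y z * S x x' y y' z z')"
  proof (intro sum_mono)
    fix x x' y y' z z' assume m: "x \<in> U" "x' \<in> U" "y \<in> U" "y' \<in> U" "z \<in> U" "z' \<in> U"
    have "f x y z = e0 x y z + (D - d) * T x y z + g x y z * T x y z"
      using f[OF m(1,3,5)] dec[OF m(1,3,5)] by (simp add: algebra_simps)
    hence "f x y z * S x x' y y' z z' = (e0 x y z + (D - d) * T x y z) * S x x' y y' z z'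
        + g x y z * T x y z * S x x' y y' z z'" by (simp add: distrib_right)
    moreover have "\<bar>e0 x y z + (D - d) * T x y z\<bar> \<le> ?b x y z"
    proof -
      have "\<bar>(D - d) * T x y z\<bar> = \<delta> * T x y z" using T01[of x y z] by (simp add: abs_mult \<delta>_def)
      thus ?thesis using e0[OF m(1,3,5)] by linarith
    qed
    hence "\<bar>e0 x y z + (D - d) * T x y z\<bar> * \<bar>S x x' y y' z z'\<bar> \<le> ?b x y z * N9 x x' y y' z z'"
      using SN[OF m] b03[of x y z] by (intro mult_mono) auto
    hence "(e0 x y z + (D - d) * T x y z) * S x x' y y' z z' \<le> ?b x y z * N9 x x' y y' z z'"
      by (simp add: abs_mult[symmetric] abs_le_iff)
    moreover have "f x y z * f x y z' * f x y' z * f x y' z' *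
          f x' y z * f x' y z' * f x' y' z * f x' y' z' = f x y z * S x x' y y' z z'"
      by (simp add: S_def mult_ac)
    ultimately show "f x y z * f x y z' * f x y' z * f x y' z' *
          f x' y z * f x' y z' * f x' y' z * f x' y' z'
       \<le> ?b x y z * N9 x x' y y' z z' + g x y z * T x y z * S x x' y y' z z'" by linarith
  qed
  also have "\<dots> = (\<Sum>x\<in>U. \<Sum>x'\<in>U. \<Sum>y\<in>U. \<Sum>y'\<in>U. \<Sum>z\<in>U. \<Sum>z'\<in>U. ?b x y z * N9 x x' y y' z z')
     + (\<Sum>x\<in>U. \<Sum>x'\<in>U. \<Sum>y\<in>U. \<Sum>y'\<in>U. \<Sum>z\<in>U. \<Sum>z'\<in>U. g x y z * T x y z * S x x' y y' z z')"
    by (simp only: sum.distrib)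
  also have "\<dots> \<le> (p ^ 9 * (2 * \<kappa> + \<beta>) + 27 * \<epsilon>) * real n ^ 6 + \<beta> * real n ^ 6"
    by (rule add_mono[OF count glin])
  finally show ?thesis by (simp add: algebra_simps)
qed

section \<open>Choosing colours\<close>

text \<open>\<open>f1\<close> and \<open>f2\<close> are replaced by their densities, each at a cost
  of \<open>\<epsilon> * s ^ 3\<close>; the remaining sum of \<open>f3\<close> is exact.\<close>

lemma regular_triangle_count:
  fixes f1 f2 f3 :: "'a \<Rightarrow> 'a \<Rightarrow> real"
  assumes fin: "finite A" "finite B" "finite C" and c: "card A = s" "card B = s" "card C = s"
    and f1: "\<And>x y. 0 \<le> f1 x y \<and> f1 x y \<le> 1" and f2: "\<And>x y. 0 \<le> f2 x y \<and> f2 x y \<le> 1"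
    and f3: "\<And>x y. 0 \<le> f3 x y \<and> f3 x y \<le> 1" and s: "s > 0"
    and cut1: "cut_small \<epsilon> (\<lambda>x y. f1 x y - dens f1 A B) A B"
    and cut2: "cut_small \<epsilon> (\<lambda>x y. f2 x y - dens f2 B C) B C"
  shows "(\<Sum>x\<in>A. \<Sum>y\<in>B. \<Sum>z\<in>C. f1 x y * f2 y z * f3 x z)
     \<le> (dens f1 A B * dens f2 B C * dens f3 A C + 2 * \<epsilon>) * real s ^ 3"
proof -
  let ?d1 = "dens f1 A B" and ?d2 = "dens f2 B C" and ?d3 = "dens f3 A C"
  have d01: "0 \<le> ?d1" "?d1 \<le> 1"
  proof -
    have "(\<Sum>x\<in>A. \<Sum>y\<in>B. f1 x y) \<le> (\<Sum>x\<in>A. \<Sum>y\<in>B. 1)" by (intro sum_mono) (use f1 in auto)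
    thus "?d1 \<le> 1" using s c by (simp add: dens_def)
    show "0 \<le> ?d1" unfolding dens_def by (intro divide_nonneg_nonneg sum_nonneg) (use f1 in auto)
  qed
  have 1: "(\<Sum>x\<in>A. \<Sum>y\<in>B. (f1 x y - ?d1) * f3 x z * f2 y z) \<le> \<epsilon> * real s ^ 2" for z
    by (rule bilinear_le_cut) (use fin f2 f3 cut1 c in \<open>auto simp: cut_small_def power2_eq_square mult.assoc abs_le_iff\<close>)
  have 2: "(\<Sum>y\<in>B. \<Sum>z\<in>C. (f2 y z - ?d2) * 1 * f3 x z) \<le> \<epsilon> * real s ^ 2" for x
    by (rule bilinear_le_cut) (use fin f3 cut2 c in \<open>auto simp: cut_small_def power2_eq_square mult.assoc abs_le_iff\<close>)
  have e1: "(\<Sum>x\<in>A. \<Sum>y\<in>B. \<Sum>z\<in>C. f1 x y * f2 y z * f3 x z)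
     = (\<Sum>z\<in>C. \<Sum>x\<in>A. \<Sum>y\<in>B. (f1 x y - ?d1) * f3 x z * f2 y z) + ?d1 * (\<Sum>x\<in>A. \<Sum>y\<in>B. \<Sum>z\<in>C. f2 y z * f3 x z)"
  proof -
    have "(\<Sum>z\<in>C. \<Sum>x\<in>A. \<Sum>y\<in>B. (f1 x y - ?d1) * f3 x z * f2 y z)
        = (\<Sum>x\<in>A. \<Sum>z\<in>C. \<Sum>y\<in>B. (f1 x y - ?d1) * f3 x z * f2 y z)" by (rule sum.swap)
    also have "\<dots> = (\<Sum>x\<in>A. \<Sum>y\<in>B. \<Sum>z\<in>C. (f1 x y - ?d1) * f3 x z * f2 y z)"
      by (rule sum.cong[OF refl], rule sum.swap)
    also have "\<dots> = (\<Sum>x\<in>A. \<Sum>y\<in>B. \<Sum>z\<in>C. f1 x y * f2 y z * f3 x z - ?d1 * (f2 y z * f3 x z))"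
      by (intro sum.cong refl) (simp add: algebra_simps)
    also have "\<dots> = (\<Sum>x\<in>A. \<Sum>y\<in>B. \<Sum>z\<in>C. f1 x y * f2 y z * f3 x z)
       - ?d1 * (\<Sum>x\<in>A. \<Sum>y\<in>B. \<Sum>z\<in>C. f2 y z * f3 x z)"
      by (simp only: sum_subtractf sum_distrib_left)
    finally show ?thesis by simp
  qed
  have e2: "(\<Sum>x\<in>A. \<Sum>y\<in>B. \<Sum>z\<in>C. f2 y z * f3 x z)
     = (\<Sum>x\<in>A. \<Sum>y\<in>B. \<Sum>z\<in>C. (f2 y z - ?d2) * 1 * f3 x z) + ?d2 * (?d3 * real s ^ 3)"
  proof -
    have "(\<Sum>x\<in>A. \<Sum>y\<in>B. \<Sum>z\<in>C. (f2 y z - ?d2) * 1 * f3 x z)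
       = (\<Sum>x\<in>A. \<Sum>y\<in>B. \<Sum>z\<in>C. f2 y z * f3 x z) - ?d2 * (\<Sum>x\<in>A. \<Sum>y\<in>B. \<Sum>z\<in>C. f3 x z)"
      by (simp only: left_diff_distrib sum_subtractf sum_distrib_left mult_1_right)
    moreover have "(\<Sum>x\<in>A. \<Sum>y\<in>B. \<Sum>z\<in>C. f3 x z) = ?d3 * real s ^ 3"
    proof -
      have "(\<Sum>x\<in>A. \<Sum>y\<in>B. \<Sum>z\<in>C. f3 x z) = real s * (\<Sum>x\<in>A. \<Sum>z\<in>C. f3 x z)"
        using c by (simp add: sum_distrib_left)
      thus ?thesis using s c by (simp add: dens_def power3_eq_cube)
    qed
    ultimately show ?thesis by simp
  qed
  have b2: "(\<Sum>x\<in>A. \<Sum>y\<in>B. \<Sum>z\<in>C. (f2 y z - ?d2) * 1 * f3 x z) \<le> \<epsilon> * real s ^ 3"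
  proof -
    have "(\<Sum>x\<in>A. \<Sum>y\<in>B. \<Sum>z\<in>C. (f2 y z - ?d2) * 1 * f3 x z) \<le> (\<Sum>x\<in>A. \<epsilon> * real s ^ 2)"
      by (rule sum_mono) (rule 2)
    thus ?thesis using c by (simp add: power2_eq_square power3_eq_cube mult_ac)
  qed
  have b1: "(\<Sum>z\<in>C. \<Sum>x\<in>A. \<Sum>y\<in>B. (f1 x y - ?d1) * f3 x z * f2 y z) \<le> \<epsilon> * real s ^ 3"
  proof -
    have "(\<Sum>z\<in>C. \<Sum>x\<in>A. \<Sum>y\<in>B. (f1 x y - ?d1) * f3 x z * f2 y z) \<le> (\<Sum>z\<in>C. \<epsilon> * real s ^ 2)"
      by (rule sum_mono) (rule 1)
    thus ?thesis using c by (simp add: power2_eq_square power3_eq_cube mult_ac)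
  qed
  have eps: "0 \<le> \<epsilon> * real s ^ 3"
  proof -
    have "0 \<le> \<epsilon> * real (card A) * real (card B)"
      using cut1 unfolding cut_small_def by (metis abs_ge_zero empty_subsetI order_trans)
    hence "0 \<le> \<epsilon>" using c s by (simp add: zero_le_mult_iff)
    thus ?thesis by simp
  qed
  have "?d1 * (\<Sum>x\<in>A. \<Sum>y\<in>B. \<Sum>z\<in>C. f2 y z * f3 x z) \<le> ?d1 * (\<epsilon> * real s ^ 3 + ?d2 * (?d3 * real s ^ 3))"
    unfolding e2 using b2 d01 by (intro mult_left_mono add_right_mono)
  also have "\<dots> = ?d1 * (\<epsilon> * real s ^ 3) + ?d1 * ?d2 * ?d3 * real s ^ 3" by (simp add: algebra_simps)
  also have "?d1 * (\<epsilon> * real s ^ 3) \<le> \<epsilon> * real s ^ 3" using d01 eps by (rule_tac mult_left_le_one_le)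
  finally show ?thesis unfolding e1 using b1 by (simp add: algebra_simps)
qed

lemma cavg_bij:
  assumes "bij_betw \<sigma> \<Omega> \<Omega>'" and "\<And>v w. v \<in> \<Omega> \<Longrightarrow> w \<in> \<Omega> \<Longrightarrow> (key' (\<sigma> v) = key' (\<sigma> w)) = (key v = key w)"
    and "\<And>v. v \<in> \<Omega> \<Longrightarrow> f' (\<sigma> v) = f v" and "\<omega> \<in> \<Omega>"
  shows "cavg \<Omega>' key' f' (\<sigma> \<omega>) = cavg \<Omega> key f \<omega>"
proof -
  let ?C = "{w\<in>\<Omega>. key w = key \<omega>}" and ?C' = "{w\<in>\<Omega>'. key' w = key' (\<sigma> \<omega>)}"
  have im: "\<sigma> ` ?C = ?C'" using assms(1,2,4) by (auto simp: bij_betw_def)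
  have inj: "inj_on \<sigma> ?C" using assms(1) by (rule_tac inj_on_subset[of _ \<Omega>]) (auto simp: bij_betw_def)
  have "(\<Sum>w\<in>?C'. f' w) = (\<Sum>w\<in>?C. f' (\<sigma> w))" unfolding im[symmetric] by (simp add: sum.reindex[OF inj])
  also have "\<dots> = (\<Sum>w\<in>?C. f w)" by (rule sum.cong) (use assms(3) in auto)
  finally show ?thesis unfolding cavg_def using im card_image[OF inj] by simp
qed

text \<open>The Ramsey conclusion concerns increasing triples of indices, whereas the blocks are
  needed in every order. This transposition and the next one generate all orders.\<close>

lemma cavg_triple_swap12:
  assumes "x \<in> A" "y \<in> B" "z \<in> C"
  shows "cavg (B \<times> A \<times> C) (key3 \<chi>) (tri h) (y, x, z) = cavg (A \<times> B \<times> C) (key3 \<chi>) (tri h) (x, y, z)"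
proof -
  have "cavg (B \<times> A \<times> C) (key3 \<chi>) (tri h) ((\<lambda>(x, y, z). (y, x, z)) (x, y, z))
     = cavg (A \<times> B \<times> C) (key3 \<chi>) (tri h) (x, y, z)"
  proof (rule cavg_bij)
    show "bij_betw (\<lambda>(x, y, z). (y, x, z)) (A \<times> B \<times> C) (B \<times> A \<times> C)"
      by (rule bij_betwI[where g="\<lambda>(y, x, z). (x, y, z)"]) auto
  qed (use assms in \<open>auto simp: key3_def tri_def insert_commute\<close>)
  thus ?thesis by simp
qed

lemma cavg_triple_swap23:
  assumes "x \<in> A" "y \<in> B" "z \<in> C"
  shows "cavg (A \<times> C \<times> B) (key3 \<chi>) (tri h) (x, z, y) = cavg (A \<times> B \<times> C) (key3 \<chi>) (tri h) (x, y, z)"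
proof -
  have "cavg (A \<times> C \<times> B) (key3 \<chi>) (tri h) ((\<lambda>(x, y, z). (x, z, y)) (x, y, z))
     = cavg (A \<times> B \<times> C) (key3 \<chi>) (tri h) (x, y, z)"
  proof (rule cavg_bij)
    show "bij_betw (\<lambda>(x, y, z). (x, z, y)) (A \<times> B \<times> C) (A \<times> C \<times> B)"
      by (rule bij_betwI[where g="\<lambda>(x, z, y). (x, y, z)"]) auto
  qed (use assms in \<open>auto simp: key3_def tri_def insert_commute\<close>)
  thus ?thesis by simp
qed

text \<open>\<open>\<gamma>\<close> is the least admissible density of a chosen colour and
  \<open>\<zeta>\<close> the largest admissible average of \<open>\<bar>h2\<bar>\<close> on a chosen
  cell. The two bounds \<open>1 / 4\<close> limit the failure probabilities in
  \<open>selection\<close>. The last assumption makes the counting error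
  \<open>2 * \<epsilon>\<close> at most the product of three chosen densities.\<close>

locale colour_system =
  fixes t s K :: nat and Y :: "nat \<Rightarrow> 'a set" and \<chi> \<chi>' :: "'a set \<Rightarrow> nat" and h :: "'a set \<Rightarrow> real"
    and \<epsilon> g \<gamma> \<zeta> :: real
  assumes Y: "\<And>i. i < t \<Longrightarrow> finite (Y i) \<and> card (Y i) = s"
    and disj: "\<And>i j. i < t \<Longrightarrow> j < t \<Longrightarrow> i \<noteq> j \<Longrightarrow> Y i \<inter> Y j = {}"
    and s: "s > 0" and h: "\<And>e. 0 \<le> h e \<and> h e \<le> 1"
    and good: "good_system t s \<epsilon> g K Y \<chi> \<chi>' h"
    and \<gamma>: "\<gamma> > 0" "real t ^ 2 * (real K * \<gamma>) \<le> 1 / 4"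
    and \<zeta>: "\<zeta> > 0" "real t ^ 3 * (sqrt g / \<zeta>) \<le> 1 / 4" and g: "g \<ge> 0"
    and \<epsilon>: "\<epsilon> > 0" "2 * \<epsilon> \<le> \<gamma> ^ 3"
begin

definition block :: "nat \<Rightarrow> nat \<Rightarrow> nat \<Rightarrow> ('a \<times> 'a \<times> 'a) set" where
  "block i j k = Y i \<times> Y j \<times> Y k"

definition h1 where "h1 i j k = cavg (block i j k) (key3 \<chi>) (tri h)"

definition h2 where
  "h2 i j k \<omega> = cavg (block i j k) (key3 \<chi>') (tri h) \<omega> - cavg (block i j k) (key3 \<chi>) (tri h) \<omega>"

definition h3 where "h3 i j k \<omega> = tri h \<omega> - cavg (block i j k) (key3 \<chi>') (tri h) \<omega>"

lemma tri01: "0 \<le> tri h \<omega> \<and> tri h \<omega> \<le> 1"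
  using h by (simp add: tri_def case_prod_unfold)

lemma h1_bounds: "0 \<le> h1 i j k \<omega> \<and> h1 i j k \<omega> \<le> 1"
  unfolding h1_def using cavg_bounds[of "block i j k" "tri h" "key3 \<chi>" \<omega>] tri01 by blast

lemma h2_bounds: "\<bar>h2 i j k \<omega>\<bar> \<le> 1"
proof -
  have "0 \<le> cavg (block i j k) key (tri h) \<omega> \<and> cavg (block i j k) key (tri h) \<omega> \<le> 1" for key :: "_ \<Rightarrow> nat \<times> nat \<times> nat"
    using cavg_bounds[of "block i j k" "tri h" key \<omega>] tri01 by blast
  from this[of "key3 \<chi>"] this[of "key3 \<chi>'"] show ?thesis by (simp add: h2_def abs_le_iff)
qed

lemma h_decomp: "tri h \<omega> = h1 i j k \<omega> + h2 i j k \<omega> + h3 i j k \<omega>"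
  by (simp add: h1_def h2_def h3_def)

lemma \<chi>K: "\<chi> e < K" and regular: "regular_system t \<epsilon> Y \<chi> K" and fin_er: "finer \<chi>' \<chi>"
  and hyper: "hyper_regular t s \<epsilon> Y \<chi>' h"
  and en: "triple_energy t s Y \<chi>' h - triple_energy t s Y \<chi> h \<le> g"
  using good unfolding good_system_def by blast+

lemma finite_block: "(i, j, k) \<in> triples t \<Longrightarrow> finite (block i j k)"
  and card_block: "(i, j, k) \<in> triples t \<Longrightarrow> card (block i j k) = s ^ 3"
  using Y by (auto simp: block_def triples_def card_cartesian_product power3_eq_cube)

text \<open>The energy gap is a sum of nonnegative terms over the triples of parts, so one term is
  at most the total; Cauchy-Schwarz then passes from mean square to mean.\<close>

lemma sum_h2_le:
  assumes ijk: "(i, j, k) \<in> triples t"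
  shows "(\<Sum>\<omega>\<in>block i j k. \<bar>h2 i j k \<omega>\<bar>) \<le> sqrt g * real s ^ 3"
proof -
  let ?e = "\<lambda>\<chi> p. case p of (i, j, k) \<Rightarrow> energy (Y i \<times> Y j \<times> Y k) (key3 \<chi>) (tri h)"
  have "(\<Sum>p\<in>{(i, j, k)}. ?e \<chi>' p - ?e \<chi> p) \<le> (\<Sum>p\<in>triples t. ?e \<chi>' p - ?e \<chi> p)"
  proof (rule sum_mono2[OF finite_triples])
    show "0 \<le> ?e \<chi>' p - ?e \<chi> p" if "p \<in> triples t - {(i, j, k)}" for p
    proof -
      obtain a b c where p: "p = (a, b, c)" by (cases p) auto
      have "finite (block a b c)" using that p by (intro finite_block) auto
      hence "energy (block a b c) (key3 \<chi>) (tri h) \<le> energy (block a b c) (key3 \<chi>') (tri h)"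
        by (rule energy_mono) (rule finer_refines[OF fin_er])
      thus ?thesis by (simp add: p block_def)
    qed
  qed (use ijk in auto)
  also have "\<dots> \<le> g * real s ^ 3"
    using en s by (simp add: triple_energy_def sum_subtractf field_simps flip: diff_divide_distrib)
  finally have "energy (block i j k) (key3 \<chi>') (tri h) - energy (block i j k) (key3 \<chi>) (tri h) \<le> g * real s ^ 3"
    by (simp add: block_def)
  hence sq: "(\<Sum>\<omega>\<in>block i j k. (h2 i j k \<omega>)\<^sup>2) \<le> g * real s ^ 3"
    unfolding h2_def using energy_pythagoras[OF finite_block[OF ijk] finer_refines[OF fin_er]] by simp
  have "(\<Sum>\<omega>\<in>block i j k. \<bar>h2 i j k \<omega>\<bar>)\<^sup>2 \<le> real (card (block i j k)) * (\<Sum>\<omega>\<in>block i j k. \<bar>h2 i j k \<omega>\<bar>\<^sup>2)"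
    by (rule sum_square_le)
  also have "\<dots> \<le> real s ^ 3 * (g * real s ^ 3)"
    using sq card_block[OF ijk] by (simp add: mult_left_mono)
  also have "\<dots> = (sqrt g * real s ^ 3)\<^sup>2" using g by (simp add: power_mult_distrib power2_eq_square)
  finally show ?thesis by (rule power2_le_imp_le) (use g in simp)
qed

definition pdens where "pdens i j c = dens (col \<chi> c) (Y i) (Y j)"

text \<open>The colours are those of a random tuple \<open>v\<close>. A triple of colours is thus chosen with probability
  proportional to the number of triangles so coloured, which turns the average of \<open>\<bar>h2\<bar>\<close> over
  such a random choice into its average over all triangles.\<close>

lemma selection:
  "\<exists>v. (\<forall>i<t. v i \<in> Y i) \<and>
     (\<forall>(i, j)\<in>pairs t. \<gamma> \<le> pdens i j (\<chi> {v i, v j})) \<and>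
     (\<forall>(i, j, k)\<in>triples t. cavg (block i j k) (key3 \<chi>) (\<lambda>\<omega>. \<bar>h2 i j k \<omega>\<bar>) (v i, v j, v k) \<le> \<zeta>)"
proof -
  define B2 where "B2 i j a b = (of_bool (pdens i j (\<chi> {a, b}) < \<gamma>) :: real)" for i j a b
  define B3 where "B3 i j k a b c =
    (of_bool (cavg (block i j k) (key3 \<chi>) (\<lambda>\<omega>. \<bar>h2 i j k \<omega>\<bar>) (a, b, c) > \<zeta>) :: real)" for i j k a b c
  \<comment> \<open>There are at most \<open>K\<close> rare colours, each on at most
    \<open>\<gamma> * s ^ 2\<close> pairs.\<close>
  have B2: "(\<Sum>a\<in>Y i. \<Sum>b\<in>Y j. B2 i j a b) \<le> real K * \<gamma> * real s ^ 2" if ij: "(i, j) \<in> pairs t" for i j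
  proof -
    have "(\<Sum>a\<in>Y i. \<Sum>b\<in>Y j. B2 i j a b) \<le> (\<Sum>a\<in>Y i. \<Sum>b\<in>Y j. \<Sum>c<K. of_bool (pdens i j c < \<gamma>) * col \<chi> c a b)"
    proof (intro sum_mono)
      fix a b
      have "B2 i j a b = (\<Sum>c\<in>{\<chi> {a, b}}. of_bool (pdens i j c < \<gamma>) * col \<chi> c a b)"
        by (simp add: B2_def col_def)
      also have "\<dots> \<le> (\<Sum>c<K. of_bool (pdens i j c < \<gamma>) * col \<chi> c a b)"
        by (rule sum_mono2) (use \<chi>K in \<open>auto simp: col_def\<close>)
      finally show "B2 i j a b \<le> (\<Sum>c<K. of_bool (pdens i j c < \<gamma>) * col \<chi> c a b)" .
    qed
    also have "\<dots> = (\<Sum>c<K. of_bool (pdens i j c < \<gamma>) * (\<Sum>a\<in>Y i. \<Sum>b\<in>Y j. col \<chi> c a b))"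
    proof -
      have "(\<Sum>a\<in>Y i. \<Sum>b\<in>Y j. \<Sum>c<K. of_bool (pdens i j c < \<gamma>) * col \<chi> c a b)
         = (\<Sum>a\<in>Y i. \<Sum>c<K. \<Sum>b\<in>Y j. of_bool (pdens i j c < \<gamma>) * col \<chi> c a b)"
        by (rule sum.cong[OF refl], rule sum.swap)
      also have "\<dots> = (\<Sum>c<K. \<Sum>a\<in>Y i. \<Sum>b\<in>Y j. of_bool (pdens i j c < \<gamma>) * col \<chi> c a b)" by (rule sum.swap)
      finally show ?thesis by (simp add: sum_distrib_left)
    qed
    also have "\<dots> \<le> (\<Sum>c<K. \<gamma> * real s ^ 2)"
    proof (rule sum_mono)
      fix c
      have "(\<Sum>a\<in>Y i. \<Sum>b\<in>Y j. col \<chi> c a b) = pdens i j c * real s ^ 2"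
        using ij Y s by (simp add: pdens_def dens_def pairs_def power2_eq_square)
      thus "of_bool (pdens i j c < \<gamma>) * (\<Sum>a\<in>Y i. \<Sum>b\<in>Y j. col \<chi> c a b) \<le> \<gamma> * real s ^ 2"
        using \<gamma> by (auto intro: mult_right_mono)
    qed
    finally show ?thesis by (simp add: mult.assoc)
  qed
  \<comment> \<open>Markov's inequality for the cell average, whose mean over the block is the mean
    of \<open>\<bar>h2\<bar>\<close>.\<close>
  have B3: "(\<Sum>a\<in>Y i. \<Sum>b\<in>Y j. \<Sum>c\<in>Y k. B3 i j k a b c) \<le> sqrt g / \<zeta> * real s ^ 3"
    if ijk: "(i, j, k) \<in> triples t" for i j k
  proof -
    let ?F = "\<lambda>\<omega>. \<bar>h2 i j k \<omega>\<bar>"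
    let ?c = "cavg (block i j k) (key3 \<chi>) ?F"
    have "0 \<le> ?c \<omega>" for \<omega> by (rule cavg_bounds) (use h2_bounds in auto)
    hence "of_bool (?c \<omega> > \<zeta>) \<le> ?c \<omega> * (1 / \<zeta>)" for \<omega>
      using \<zeta>(1) by (auto simp: pos_le_divide_eq)
    hence "(\<Sum>\<omega>\<in>block i j k. of_bool (?c \<omega> > \<zeta>)) \<le> (\<Sum>\<omega>\<in>block i j k. ?c \<omega> * (1 / \<zeta>))" by (intro sum_mono)
    also have "\<dots> = (\<Sum>\<omega>\<in>block i j k. ?F \<omega> * (1 / \<zeta>))"
      by (rule cavg_project[OF finite_block[OF ijk]]) simp
    also have "\<dots> = (\<Sum>\<omega>\<in>block i j k. ?F \<omega>) / \<zeta>" by (simp add: sum_divide_distrib)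
    also have "\<dots> \<le> sqrt g * real s ^ 3 / \<zeta>" by (rule divide_right_mono[OF sum_h2_le[OF ijk]]) (use \<zeta> in simp)
    finally show ?thesis by (simp add: B3_def block_def sum.cartesian_product case_prod_unfold)
  qed
  let ?P = "Pi\<^sub>E {..<t} Y"
  let ?w = "real s ^ t"
  have cP: "real (card ?P) = ?w" using Y by (subst card_PiE_const[where s=s]) auto
  have finP: "finite ?P" using Y by (intro finite_PiE) auto
  \<comment> \<open>\<open>tot v\<close> counts the failures of the tuple \<open>v\<close>. Its mean
    is at most 1/2, so some tuple has less than one failure, that is, none.\<close>
  define tot where "tot v = (\<Sum>(i, j)\<in>pairs t. B2 i j (v i) (v j)) + (\<Sum>(i, j, k)\<in>triples t. B3 i j k (v i) (v j) (v k))"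
    for v :: "nat \<Rightarrow> 'a"
  have e2: "(\<Sum>v\<in>?P. B2 i j (v i) (v j)) \<le> ?w * (real K * \<gamma>)" if ij: "(i, j) \<in> pairs t" for i j
  proof -
    have "real s ^ 2 * (\<Sum>v\<in>?P. B2 i j (v i) (v j)) = real s ^ card {..<t} * (\<Sum>a\<in>Y i. \<Sum>b\<in>Y j. B2 i j a b)"
      by (rule sum_PiE_marginal2) (use ij Y in \<open>auto simp: pairs_def\<close>)
    also have "\<dots> \<le> ?w * (real K * \<gamma> * real s ^ 2)" using B2[OF ij] by (simp add: mult_left_mono)
    finally have "real s ^ 2 * (\<Sum>v\<in>?P. B2 i j (v i) (v j)) \<le> real s ^ 2 * (?w * (real K * \<gamma>))" by (simp add: mult_ac)
    thus ?thesis by (rule mult_left_le_imp_le) (use s in simp)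
  qed
  have e3: "(\<Sum>v\<in>?P. B3 i j k (v i) (v j) (v k)) \<le> ?w * (sqrt g / \<zeta>)" if ijk: "(i, j, k) \<in> triples t" for i j k
  proof -
    have "real s ^ 3 * (\<Sum>v\<in>?P. B3 i j k (v i) (v j) (v k))
       = real s ^ card {..<t} * (\<Sum>a\<in>Y i. \<Sum>b\<in>Y j. \<Sum>c\<in>Y k. B3 i j k a b c)"
      by (rule sum_PiE_marginal3) (use ijk Y in \<open>auto simp: triples_def\<close>)
    also have "\<dots> \<le> real s ^ card {..<t} * (sqrt g / \<zeta> * real s ^ 3)" by (rule mult_left_mono[OF B3[OF ijk]]) simp
    finally have "real s ^ 3 * (\<Sum>v\<in>?P. B3 i j k (v i) (v j) (v k)) \<le> real s ^ 3 * (?w * (sqrt g / \<zeta>))"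
      by (simp add: mult_ac)
    thus ?thesis by (rule mult_left_le_imp_le) (use s in simp)
  qed
  have "(\<Sum>v\<in>?P. tot v) = (\<Sum>p\<in>pairs t. \<Sum>v\<in>?P. case p of (i, j) \<Rightarrow> B2 i j (v i) (v j))
     + (\<Sum>p\<in>triples t. \<Sum>v\<in>?P. case p of (i, j, k) \<Rightarrow> B3 i j k (v i) (v j) (v k))"
    unfolding tot_def sum.distrib by (intro arg_cong2[where f="(+)"] sum.swap)
  also have "\<dots> \<le> (\<Sum>p\<in>pairs t. ?w * (real K * \<gamma>)) + (\<Sum>p\<in>triples t. ?w * (sqrt g / \<zeta>))"
    by (intro add_mono sum_mono) (use e2 e3 in auto)
  also have "\<dots> = ?w * (real (card (pairs t)) * (real K * \<gamma>) + real (card (triples t)) * (sqrt g / \<zeta>))"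
    by (simp add: algebra_simps)
  also have "\<dots> \<le> ?w * (real (t ^ 2) * (real K * \<gamma>) + real (t ^ 3) * (sqrt g / \<zeta>))"
    by (intro mult_left_mono add_mono mult_right_mono of_nat_mono card_pairs_le card_triples_le) (use \<gamma> \<zeta> g in auto)
  also have "\<dots> \<le> ?w * (1 / 2)"
    by (intro mult_left_mono, unfold of_nat_power) (use \<gamma>(2) \<zeta>(2) in linarith, simp)
  finally have lt: "(\<Sum>v\<in>?P. tot v) < (\<Sum>v\<in>?P. 1)"
  proof -
    assume "(\<Sum>v\<in>?P. tot v) \<le> ?w * (1 / 2)"
    moreover have "(\<Sum>v\<in>?P. 1 :: real) = ?w" using cP by simp
    moreover have "0 < ?w" using s by simp
    ultimately show ?thesis by linarith
  qed
  obtain v where v: "v \<in> ?P" "tot v < 1"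
  proof -
    have "\<exists>v\<in>?P. tot v < 1"
    proof (rule ccontr)
      assume "\<not> ?thesis"
      hence "(\<Sum>v\<in>?P. 1) \<le> (\<Sum>v\<in>?P. tot v)" by (intro sum_mono) (auto simp: not_less)
      thus False using lt by simp
    qed
    thus ?thesis using that by blast
  qed
  have nn: "0 \<le> (\<Sum>(i, j)\<in>pairs t. B2 i j (v i) (v j))" "0 \<le> (\<Sum>(i, j, k)\<in>triples t. B3 i j k (v i) (v j) (v k))"
    by (auto intro!: sum_nonneg simp: B2_def B3_def)
  have lt2: "B2 i j (v i) (v j) < 1" if "(i, j) \<in> pairs t" for i j
  proof -
    have "(case (i, j) of (i, j) \<Rightarrow> B2 i j (v i) (v j)) \<le> (\<Sum>(i, j)\<in>pairs t. B2 i j (v i) (v j))"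
      by (rule member_le_sum[OF that]) (auto simp: B2_def finite_pairs)
    thus ?thesis using v(2) nn unfolding tot_def by simp
  qed
  have 1: "\<gamma> \<le> pdens i j (\<chi> {v i, v j})" if "(i, j) \<in> pairs t" for i j
    using lt2[OF that] by (simp add: B2_def not_less of_bool_def split: if_splits)
  have lt3: "B3 i j k (v i) (v j) (v k) < 1" if "(i, j, k) \<in> triples t" for i j k
  proof -
    have "(case (i, j, k) of (i, j, k) \<Rightarrow> B3 i j k (v i) (v j) (v k)) \<le> (\<Sum>(i, j, k)\<in>triples t. B3 i j k (v i) (v j) (v k))"
      by (rule member_le_sum[OF that]) (auto simp: B3_def finite_triples)
    thus ?thesis using v(2) nn unfolding tot_def by simp
  qed
  have 2: "cavg (block i j k) (key3 \<chi>) (\<lambda>\<omega>. \<bar>h2 i j k \<omega>\<bar>) (v i, v j, v k) \<le> \<zeta>" if "(i, j, k) \<in> triples t" for i j k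
    using lt3[OF that] by (simp add: B3_def not_less of_bool_def split: if_splits)
  show ?thesis
    by (intro exI[of _ v]) (use v(1) 1 2 in auto)
qed

end

section \<open>The weighted graph on the chosen parts and its rounding\<close>

locale chosen_parts = colour_system t s K Y \<chi> \<chi>' h \<epsilon> g \<gamma> \<zeta>
  for t s K :: nat and Y :: "nat \<Rightarrow> 'a set" and \<chi> \<chi>' :: "'a set \<Rightarrow> nat" and h :: "'a set \<Rightarrow> real"
    and \<epsilon> g \<gamma> \<zeta> :: real +
  fixes v :: "nat \<Rightarrow> 'a" and I :: "nat set" and D \<rho> :: real and m :: nat
  assumes vY: "\<And>i. i < t \<Longrightarrow> v i \<in> Y i"
    and v2: "\<And>i j. (i, j) \<in> pairs t \<Longrightarrow> \<gamma> \<le> pdens i j (\<chi> {v i, v j})"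
    and v3: "\<And>i j k. (i, j, k) \<in> triples t \<Longrightarrow>
       cavg (block i j k) (key3 \<chi>) (\<lambda>\<omega>. \<bar>h2 i j k \<omega>\<bar>) (v i, v j, v k) \<le> \<zeta>"
    and I: "I \<subseteq> {..<t}" and cI: "card I = m" and m: "m > 0"
    and D: "0 \<le> D" "D \<le> 1"
    and near: "\<And>i j k. i \<in> I \<Longrightarrow> j \<in> I \<Longrightarrow> k \<in> I \<Longrightarrow> i \<noteq> j \<Longrightarrow> j \<noteq> k \<Longrightarrow> i \<noteq> k \<Longrightarrow>
       \<bar>h1 i j k (v i, v j, v k) - D\<bar> \<le> \<rho>"
    and \<rho>: "0 \<le> \<rho>" "\<rho> \<le> 1" and eps1: "\<epsilon> \<le> 1" and \<gamma>1: "\<gamma> \<le> 1"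
    and big: "real (m * s) \<ge> 7 / \<epsilon> ^ 5"
begin

definition U where "U = (\<Union>i\<in>I. Y i)"
definition part where "part x = (THE i. i \<in> I \<and> x \<in> Y i)"
definition n where "n = m * s"
text \<open>As \<open>\<gamma> \<le> 1\<close>, the half keeps \<open>p\<close> at most 1/2. Hence
  the density of the rounded graph stays below 3/4 and its cube below 1/2, where
  \<open>\<psi>\<close> is bounded from below.\<close>

definition p where "p = \<gamma> / 2"
definition cd where "cd i j = pdens i j (\<chi> {v i, v j})"
text \<open>The blocks on the diagonal get density \<open>p\<close> too: empty ones would contribute about \<open>p\<^sup>4 / m\<^sup>3\<close> to
  the four-cycle deviation, which may exceed the value of \<open>\<psi>\<close>.\<close>

definition W where "W x y = (if x \<in> U \<and> y \<in> U then
    (if part x = part y then p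
     else p / cd (part x) (part y) * col \<chi> (\<chi> {v (part x), v (part y)}) x y) else 0)"
definition T3 where "T3 x y z \<longleftrightarrow> part x \<noteq> part y \<and> part y \<noteq> part z \<and> part x \<noteq> part z"

lemma It: "i \<in> I \<Longrightarrow> i < t" using I by auto

lemma finI: "finite I" using I finite_subset by blast

lemma YI: "i \<in> I \<Longrightarrow> finite (Y i) \<and> card (Y i) = s" using Y It by blast

lemma finU: "finite U" unfolding U_def using finI YI by blast

lemma YU: "i \<in> I \<Longrightarrow> x \<in> Y i \<Longrightarrow> x \<in> U" unfolding U_def by blast

lemma part_eq: "i \<in> I \<Longrightarrow> x \<in> Y i \<Longrightarrow> part x = i"
  unfolding part_def by (rule the_equality) (use disj It in blast)+

lemma part_mem: "x \<in> U \<Longrightarrow> part x \<in> I \<and> x \<in> Y (part x)"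
  unfolding U_def using part_eq by auto

lemma sum_sub:
  fixes F :: "'a \<Rightarrow> real"
  assumes "P \<subseteq> U"
  shows "(\<Sum>x\<in>P. F x) = (\<Sum>i\<in>I. \<Sum>x\<in>P \<inter> Y i. F x)"
proof -
  have "P = (\<Union>i\<in>I. P \<inter> Y i)" using assms by (auto simp: U_def)
  hence "(\<Sum>x\<in>P. F x) = (\<Sum>x\<in>(\<Union>i\<in>I. P \<inter> Y i). F x)" by simp
  also have "\<dots> = (\<Sum>i\<in>I. \<Sum>x\<in>P \<inter> Y i. F x)"
  proof (rule sum.UNION_disjoint)
    show "\<forall>i\<in>I. \<forall>j\<in>I. i \<noteq> j \<longrightarrow> P \<inter> Y i \<inter> (P \<inter> Y j) = {}"
    proof (intro ballI impI)
      fix i j assume "i \<in> I" "j \<in> I" "i \<noteq> j"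
      hence "Y i \<inter> Y j = {}" using disj It by simp
      thus "P \<inter> Y i \<inter> (P \<inter> Y j) = {}" by blast
    qed
  qed (use finI YI in auto)
  finally show ?thesis .
qed

lemma sum_U:
  fixes F :: "'a \<Rightarrow> real"
  shows "(\<Sum>x\<in>U. F x) = (\<Sum>i\<in>I. \<Sum>x\<in>Y i. F x)"
proof -
  have "U \<inter> Y i = Y i" if "i \<in> I" for i using YU[OF that] by auto
  thus ?thesis using sum_sub[of U F] by simp
qed

lemma cardU: "card U = n"
proof -
  have "real (card U) = (\<Sum>x\<in>U. 1)" by simp
  also have "\<dots> = (\<Sum>i\<in>I. real s)" unfolding sum_U using YI by (intro sum.cong) auto
  finally show ?thesis using cI by (simp add: n_def flip: of_nat_mult)
qed

lemma npos: "n > 0" using m s by (simp add: n_def)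

lemma inv_eps_le_n: "1 / \<epsilon> \<le> real n"
proof -
  have "\<epsilon> ^ 5 \<le> \<epsilon> ^ 1" using \<epsilon> eps1 by (intro power_decreasing) auto
  hence "\<epsilon> ^ 5 \<le> 7 * \<epsilon>" using \<epsilon> by simp
  hence "1 / \<epsilon> \<le> 7 / \<epsilon> ^ 5" using \<epsilon> by (simp add: field_simps)
  thus ?thesis using big by (simp add: n_def)
qed

lemma p01: "0 < p" "p \<le> 1" "p \<le> \<gamma>" using \<gamma> \<gamma>1 by (auto simp: p_def)

lemma cd_ge: "i \<in> I \<Longrightarrow> j \<in> I \<Longrightarrow> i \<noteq> j \<Longrightarrow> \<gamma> \<le> cd i j"
  unfolding cd_def by (rule v2) (use It in \<open>auto simp: pairs_def\<close>)

lemma cd_sym: "cd i j = cd j i"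
proof -
  have "(\<Sum>x\<in>Y i. \<Sum>y\<in>Y j. col \<chi> c x y) = (\<Sum>y\<in>Y j. \<Sum>x\<in>Y i. col \<chi> c y x)" for c
    by (subst sum.swap) (simp add: col_def insert_commute)
  thus ?thesis by (simp add: cd_def pdens_def dens_def insert_commute mult.commute)
qed

lemma col01: "0 \<le> col \<chi> c x y \<and> col \<chi> c x y \<le> 1" by (simp add: col_def)

lemma W01: "0 \<le> W x y \<and> W x y \<le> 1"
proof (cases "x \<in> U \<and> y \<in> U \<and> part x \<noteq> part y")
  case True
  hence g: "\<gamma> \<le> cd (part x) (part y)" using part_mem by (intro cd_ge) auto
  hence "p / cd (part x) (part y) \<le> 1" "0 \<le> p / cd (part x) (part y)"
    using p01 \<gamma> by (auto simp: divide_le_eq)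
  thus ?thesis using True by (auto simp: W_def col_def)
next
  case False
  thus ?thesis using p01 by (auto simp: W_def)
qed

lemma W_sym: "W x y = W y x"
  using cd_sym by (auto simp: W_def col_def insert_commute)

text \<open>\<open>random_rounding\<close> acts on weights of sets, whereas \<open>W\<close> lives
  on ordered pairs. \<open>SOME\<close> picks an order, and by \<open>W_sym\<close> the choice is
  immaterial.\<close>

definition w where "w e = (let q = (SOME q. e = {fst q, snd q}) in W (fst q) (snd q))"

lemma w_eq: "w {x, y} = W x y"
proof -
  define q where "q = (SOME q. {x, y} = {fst q, snd q})"
  have "{x, y} = {fst q, snd q}" unfolding q_def by (rule someI[of _ "(x, y)"]) simp
  hence "(fst q = x \<and> snd q = y) \<or> (fst q = y \<and> snd q = x)" by (auto simp: doubleton_eq_iff)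
  thus ?thesis unfolding w_def Let_def q_def[symmetric] using W_sym by auto
qed

lemma w01: "0 \<le> w e \<and> w e \<le> 1"
  unfolding w_def Let_def by (rule W01)

text \<open>On the diagonal \<open>W\<close> is the constant \<open>p\<close>. Elsewhere it is a
  regular colour class times \<open>p / cd i j\<close>; this factor makes the density exactly
  \<open>p\<close> and, being at most 1, does not increase the error.\<close>

lemma cut_block:
  assumes ij: "i \<in> I" "j \<in> I" and PQ: "P \<subseteq> Y i" "Q \<subseteq> Y j"
  shows "\<bar>\<Sum>x\<in>P. \<Sum>y\<in>Q. W x y - p\<bar> \<le> \<epsilon> * real s ^ 2"
proof (cases "i = j")
  case True
  have "(\<Sum>x\<in>P. \<Sum>y\<in>Q. W x y - p) = (\<Sum>x\<in>P. \<Sum>y\<in>Q. 0)"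
  proof (intro sum.cong refl)
    fix x y assume "x \<in> P" "y \<in> Q"
    hence "x \<in> Y i" "y \<in> Y i" using PQ True by auto
    hence "part x = i" "part y = i" "x \<in> U" "y \<in> U" using ij part_eq YU by auto
    thus "W x y - p = 0" by (simp add: W_def)
  qed
  thus ?thesis using \<epsilon> by simp
next
  case False
  let ?c = "\<chi> {v i, v j}"
  have g: "\<gamma> \<le> cd i j" by (rule cd_ge[OF ij False])
  have W: "W x y - p = p / cd i j * (col \<chi> ?c x y - cd i j)" if "x \<in> P" "y \<in> Q" for x y
  proof -
    have "part x = i" "part y = j" "x \<in> U" "y \<in> U" using that PQ ij part_eq YU by auto
    moreover have "cd i j \<noteq> 0" using g \<gamma> by auto
    ultimately show ?thesis using False by (simp add: W_def field_simps)
  qed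
  have "(\<Sum>x\<in>P. \<Sum>y\<in>Q. W x y - p) = (\<Sum>x\<in>P. \<Sum>y\<in>Q. p / cd i j * (col \<chi> ?c x y - cd i j))"
    by (intro sum.cong refl W)
  also have "\<dots> = p / cd i j * (\<Sum>x\<in>P. \<Sum>y\<in>Q. col \<chi> ?c x y - cd i j)" by (simp only: sum_distrib_left)
  finally have e: "(\<Sum>x\<in>P. \<Sum>y\<in>Q. W x y - p) = p / cd i j * (\<Sum>x\<in>P. \<Sum>y\<in>Q. col \<chi> ?c x y - cd i j)" .
  have "(i, j) \<in> pairs t" using ij It False by (auto simp: pairs_def)
  hence "cut_small \<epsilon> (\<lambda>x y. col \<chi> ?c x y - dens (col \<chi> ?c) (Y i) (Y j)) (Y i) (Y j)"
    using regular \<chi>K unfolding regular_system_def by blast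
  hence "\<bar>\<Sum>x\<in>P. \<Sum>y\<in>Q. col \<chi> ?c x y - cd i j\<bar> \<le> \<epsilon> * real s * real s"
    using PQ YI ij unfolding cut_small_def cd_def pdens_def by metis
  moreover have "0 \<le> p / cd i j" "p / cd i j \<le> 1" using g p01 \<gamma> by (auto simp: divide_le_eq)
  ultimately have "(p / cd i j) * \<bar>\<Sum>x\<in>P. \<Sum>y\<in>Q. col \<chi> ?c x y - cd i j\<bar> \<le> 1 * (\<epsilon> * real s * real s)"
    by (intro mult_mono) auto
  moreover have "\<bar>p / cd i j\<bar> = p / cd i j" using \<open>0 \<le> p / cd i j\<close> by (rule abs_of_nonneg)
  ultimately show ?thesis unfolding e abs_mult[of "p / cd i j"] by (simp only: power2_eq_square mult.assoc mult_1_left)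
qed

lemma cut_W:
  assumes PQ: "P \<subseteq> U" "Q \<subseteq> U"
  shows "\<bar>\<Sum>x\<in>P. \<Sum>y\<in>Q. W x y - p\<bar> \<le> \<epsilon> * real n ^ 2"
proof -
  have "(\<Sum>x\<in>P. \<Sum>y\<in>Q. W x y - p) = (\<Sum>i\<in>I. \<Sum>x\<in>P \<inter> Y i. \<Sum>j\<in>I. \<Sum>y\<in>Q \<inter> Y j. W x y - p)"
    by (simp only: sum_sub[OF PQ(1)] sum_sub[OF PQ(2)])
  also have "\<dots> = (\<Sum>i\<in>I. \<Sum>j\<in>I. \<Sum>x\<in>P \<inter> Y i. \<Sum>y\<in>Q \<inter> Y j. W x y - p)"
    by (rule sum.cong[OF refl], rule sum.swap)
  also have "\<bar>\<dots>\<bar> \<le> (\<Sum>i\<in>I. \<Sum>j\<in>I. \<epsilon> * real s ^ 2)"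
  proof (rule order_trans[OF sum_abs], rule sum_mono, rule order_trans[OF sum_abs], rule sum_mono)
    fix i j assume "i \<in> I" "j \<in> I"
    thus "\<bar>\<Sum>x\<in>P \<inter> Y i. \<Sum>y\<in>Q \<inter> Y j. W x y - p\<bar> \<le> \<epsilon> * real s ^ 2"
      by (rule cut_block) auto
  qed
  also have "\<dots> = \<epsilon> * real n ^ 2" using cI by (simp add: n_def power2_eq_square)
  finally show ?thesis .
qed

text \<open>The weight handed to the rounding: it prevents the triangles of the rounded graph from
  concentrating where \<open>h2\<close> is large.\<close>

definition G where "G x y z = (if x \<in> U \<and> y \<in> U \<and> z \<in> U \<and> T3 x y z
    then \<bar>h2 (part x) (part y) (part z) (x, y, z)\<bar> else 0)"

lemma G01: "0 \<le> G x y z \<and> G x y z \<le> 1"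
  using h2_bounds by (simp add: G_def)

lemma triplesI: "i \<in> I \<Longrightarrow> j \<in> I \<Longrightarrow> k \<in> I \<Longrightarrow> i \<noteq> j \<Longrightarrow> j \<noteq> k \<Longrightarrow> i \<noteq> k \<Longrightarrow> (i, j, k) \<in> triples t"
  using It by (auto simp: triples_def)

text \<open>A triangle of \<open>W\<close> in a crossing block lies in the chosen cell and has
  weight \<open>p ^ 3 / ?d\<close>, with \<open>?d\<close> the product of the three colour
  densities. The cell has at most \<open>2 * ?d * s ^ 3\<close> members, on which
  \<open>\<bar>h2\<bar>\<close> is at most \<open>\<zeta>\<close> on average, and \<open>?d\<close>
  cancels.\<close>

lemma G_block:
  assumes ijk: "i \<in> I" "j \<in> I" "k \<in> I"
  shows "(\<Sum>x\<in>Y i. \<Sum>y\<in>Y j. \<Sum>z\<in>Y k. G x y z * (W x y * W y z * W x z)) \<le> 2 * \<zeta> * p ^ 3 * real s ^ 3"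
proof (cases "i \<noteq> j \<and> j \<noteq> k \<and> i \<noteq> k")
  case False
  have "(\<Sum>x\<in>Y i. \<Sum>y\<in>Y j. \<Sum>z\<in>Y k. G x y z * (W x y * W y z * W x z)) = 0"
  proof (intro sum.neutral ballI)
    fix x y z assume "x \<in> Y i" "y \<in> Y j" "z \<in> Y k"
    hence "part x = i" "part y = j" "part z = k" using ijk part_eq by auto
    hence "G x y z = 0" using False by (auto simp: G_def T3_def)
    thus "G x y z * (W x y * W y z * W x z) = 0" by simp
  qed
  thus ?thesis using \<zeta> p01 by simp
next
  case True
  have tr: "(i, j, k) \<in> triples t" using True ijk by (intro triplesI) auto
  let ?\<omega> = "(v i, v j, v k)" and ?F = "\<lambda>\<omega>. \<bar>h2 i j k \<omega>\<bar>"
  let ?C = "{\<omega>\<in>block i j k. key3 \<chi> \<omega> = key3 \<chi> ?\<omega>}"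
  let ?d = "cd i j * cd j k * cd i k"
  have g: "\<gamma> \<le> cd i j" "\<gamma> \<le> cd j k" "\<gamma> \<le> cd i k" using True ijk by (auto intro: cd_ge)
  have "\<gamma> * \<gamma> * \<gamma> \<le> ?d" using g \<gamma> by (intro mult_mono) auto
  hence g3: "\<gamma> ^ 3 \<le> ?d" by (simp add: power3_eq_cube)
  have dpos: "0 < ?d" using g \<gamma> by (intro mult_pos_pos) auto
  have finb: "finite (block i j k)" by (rule finite_block[OF tr])
  have inC: "?\<omega> \<in> ?C" using ijk It vY by (auto simp: block_def)
  have cardC: "real (card ?C) = (\<Sum>x\<in>Y i. \<Sum>y\<in>Y j. \<Sum>z\<in>Y k.
      col \<chi> (\<chi> {v i, v j}) x y * col \<chi> (\<chi> {v j, v k}) y z * col \<chi> (\<chi> {v i, v k}) x z)"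
  proof -
    have "real (card ?C) = (\<Sum>\<omega>\<in>?C. 1)" by simp
    also have "\<dots> = (\<Sum>\<omega>\<in>block i j k. if key3 \<chi> \<omega> = key3 \<chi> ?\<omega> then 1 else 0)"
      by (rule sum.inter_filter[OF finb])
    also have "\<dots> = (\<Sum>x\<in>Y i. \<Sum>y\<in>Y j. \<Sum>z\<in>Y k.
      col \<chi> (\<chi> {v i, v j}) x y * col \<chi> (\<chi> {v j, v k}) y z * col \<chi> (\<chi> {v i, v k}) x z)"
      unfolding block_def sum.cartesian_product
      by (rule sum.cong[OF refl]) (auto simp: key3_def col_def)
    finally show ?thesis .
  qed
  have "real (card ?C) \<le> (?d + 2 * \<epsilon>) * real s ^ 3"
    unfolding cardC cd_def pdens_def
  proof (rule regular_triangle_count)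
    show "cut_small \<epsilon> (\<lambda>x y. col \<chi> (\<chi> {v i, v j}) x y - dens (col \<chi> (\<chi> {v i, v j})) (Y i) (Y j)) (Y i) (Y j)"
      using regular \<chi>K tr unfolding regular_system_def by (auto simp: pairs_def triples_def)
    show "cut_small \<epsilon> (\<lambda>x y. col \<chi> (\<chi> {v j, v k}) x y - dens (col \<chi> (\<chi> {v j, v k})) (Y j) (Y k)) (Y j) (Y k)"
      using regular \<chi>K tr unfolding regular_system_def by (auto simp: pairs_def triples_def)
  qed (use YI ijk s col01 in auto)
  also have "\<dots> \<le> (2 * ?d) * real s ^ 3"   proof (rule mult_right_mono)
    show "?d + 2 * \<epsilon> \<le> 2 * ?d" using g3 \<epsilon> by linarith
  qed simp
  finally have C2: "real (card ?C) \<le> 2 * ?d * real s ^ 3" by (simp add: mult.assoc)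
  have Cpos: "real (card ?C) > 0" using inC finb by (simp add: card_gt_0_iff) blast
  have "(\<Sum>\<omega>\<in>?C. ?F \<omega>) = cavg (block i j k) (key3 \<chi>) ?F ?\<omega> * real (card ?C)"
    using Cpos by (simp add: cavg_def)
  also have "\<dots> \<le> \<zeta> * (2 * ?d * real s ^ 3)"
    by (intro mult_mono v3[OF tr] C2) (use \<zeta> in auto)
  finally have FC: "(\<Sum>\<omega>\<in>?C. ?F \<omega>) \<le> \<zeta> * (2 * ?d * real s ^ 3)" .
  have "(\<Sum>x\<in>Y i. \<Sum>y\<in>Y j. \<Sum>z\<in>Y k. G x y z * (W x y * W y z * W x z))
     = (\<Sum>\<omega>\<in>block i j k. if key3 \<chi> \<omega> = key3 \<chi> ?\<omega> then ?F \<omega> * (p ^ 3 / ?d) else 0)"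
    unfolding block_def sum.cartesian_product
  proof (rule sum.cong[OF refl], clarify)
    fix x y z assume x: "x \<in> Y i" "y \<in> Y j" "z \<in> Y k"
    hence pt: "part x = i" "part y = j" "part z = k" "x \<in> U" "y \<in> U" "z \<in> U" using ijk part_eq YU by auto
    show "G x y z * (W x y * W y z * W x z)
       = (if key3 \<chi> (x, y, z) = key3 \<chi> (v i, v j, v k) then \<bar>h2 i j k (x, y, z)\<bar> * (p ^ 3 / ?d) else 0)"
      using pt True by (simp add: G_def W_def T3_def key3_def col_def power3_eq_cube)
  qed
  also have "\<dots> = (\<Sum>\<omega>\<in>?C. ?F \<omega> * (p ^ 3 / ?d))" by (rule sum.inter_filter[OF finb, symmetric])
  also have "\<dots> = (\<Sum>\<omega>\<in>?C. ?F \<omega>) * (p ^ 3 / ?d)" by (simp only: sum_distrib_right)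
  also have "\<dots> \<le> \<zeta> * (2 * ?d * real s ^ 3) * (p ^ 3 / ?d)"
    by (rule mult_right_mono[OF FC]) (use p01 dpos in auto)
  also have "\<dots> = 2 * \<zeta> * p ^ 3 * real s ^ 3"
  proof -
    have "cd i j \<noteq> 0" "cd j k \<noteq> 0" "cd i k \<noteq> 0" using g \<gamma> by auto
    thus ?thesis by (simp add: field_simps)
  qed
  finally show ?thesis .
qed

lemma sum_U3:
  fixes F :: "'a \<Rightarrow> 'a \<Rightarrow> 'a \<Rightarrow> real"
  shows "(\<Sum>x\<in>U. \<Sum>y\<in>U. \<Sum>z\<in>U. F x y z) = (\<Sum>i\<in>I. \<Sum>j\<in>I. \<Sum>k\<in>I. \<Sum>x\<in>Y i. \<Sum>y\<in>Y j. \<Sum>z\<in>Y k. F x y z)"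
proof -
  have "(\<Sum>x\<in>U. \<Sum>y\<in>U. \<Sum>z\<in>U. F x y z)
     = (\<Sum>i\<in>I. \<Sum>x\<in>Y i. \<Sum>j\<in>I. \<Sum>y\<in>Y j. \<Sum>k\<in>I. \<Sum>z\<in>Y k. F x y z)" by (simp only: sum_U)
  also have "\<dots> = (\<Sum>i\<in>I. \<Sum>j\<in>I. \<Sum>x\<in>Y i. \<Sum>y\<in>Y j. \<Sum>k\<in>I. \<Sum>z\<in>Y k. F x y z)"
    by (rule sum.cong[OF refl], rule sum.swap)
  also have "\<dots> = (\<Sum>i\<in>I. \<Sum>j\<in>I. \<Sum>x\<in>Y i. \<Sum>k\<in>I. \<Sum>y\<in>Y j. \<Sum>z\<in>Y k. F x y z)"
    by (rule sum.cong[OF refl], rule sum.cong[OF refl], rule sum.cong[OF refl], rule sum.swap)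
  also have "\<dots> = (\<Sum>i\<in>I. \<Sum>j\<in>I. \<Sum>k\<in>I. \<Sum>x\<in>Y i. \<Sum>y\<in>Y j. \<Sum>z\<in>Y k. F x y z)"
    by (rule sum.cong[OF refl], rule sum.cong[OF refl], rule sum.swap)
  finally show ?thesis .
qed

lemma G_sum: "(\<Sum>x\<in>U. \<Sum>y\<in>U. \<Sum>z\<in>U. G x y z * (W x y * W y z * W x z)) \<le> 2 * \<zeta> * p ^ 3 * real n ^ 3"
proof -
  have "(\<Sum>x\<in>U. \<Sum>y\<in>U. \<Sum>z\<in>U. G x y z * (W x y * W y z * W x z))
     \<le> (\<Sum>i\<in>I. \<Sum>j\<in>I. \<Sum>k\<in>I. 2 * \<zeta> * p ^ 3 * real s ^ 3)"
    unfolding sum_U3 by (intro sum_mono G_block)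
  also have "\<dots> = 2 * \<zeta> * p ^ 3 * real n ^ 3" using cI by (simp add: n_def power3_eq_cube)
  finally show ?thesis .
qed

end

context chosen_parts
begin

lemma h3_cut:
  fixes a b c :: "'a \<Rightarrow> 'a \<Rightarrow> real"
  assumes a: "\<And>x y. \<bar>a x y\<bar> \<le> 1" and b: "\<And>x y. \<bar>b x y\<bar> \<le> 1" and c: "\<And>x y. \<bar>c x y\<bar> \<le> 1"
    and ijk: "i \<in> I" "j \<in> I" "k \<in> I" "i \<noteq> j" "j \<noteq> k" "i \<noteq> k"
  shows "\<bar>\<Sum>x\<in>Y i. \<Sum>y\<in>Y j. \<Sum>z\<in>Y k. h3 i j k (x, y, z) * a x y * b y z * c x z\<bar> \<le> 8 * (\<epsilon> * real s ^ 3)"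
proof (rule trilinear_le_cut[OF _ _ _ _ a b c])
  fix P Q R :: "('a \<times> 'a) set"
  have dj: "Y i \<inter> Y j = {}" "Y j \<inter> Y k = {}" "Y i \<inter> Y k = {}" using ijk It disj by auto
  define S where "S = {{x, y} | x y. x \<in> Y i \<and> y \<in> Y j \<and> (x, y) \<in> P} \<union>
     {{y, z} | y z. y \<in> Y j \<and> z \<in> Y k \<and> (y, z) \<in> Q} \<union> {{x, z} | x z. x \<in> Y i \<and> z \<in> Y k \<and> (x, z) \<in> R}"
  have S: "{x, y} \<in> S \<longleftrightarrow> (x, y) \<in> P" "{y, z} \<in> S \<longleftrightarrow> (y, z) \<in> Q" "{x, z} \<in> S \<longleftrightarrow> (x, z) \<in> R"
    if "x \<in> Y i" "y \<in> Y j" "z \<in> Y k" for x y z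
    using that dj unfolding S_def by (auto simp: doubleton_eq_iff)
  have "(\<Sum>x\<in>Y i. \<Sum>y\<in>Y j. \<Sum>z\<in>Y k. of_bool ((x, y) \<in> P \<and> (y, z) \<in> Q \<and> (x, z) \<in> R) * h3 i j k (x, y, z))
     = (\<Sum>\<omega>\<in>block i j k. h3 i j k \<omega> * ind3 S \<omega>)"
    unfolding block_def sum.cartesian_product
  proof (rule sum.cong[OF refl], clarify)
    fix x y z assume "x \<in> Y i" "y \<in> Y j" "z \<in> Y k"
    from S[OF this] show "of_bool ((x, y) \<in> P \<and> (y, z) \<in> Q \<and> (x, z) \<in> R) * h3 i j k (x, y, z)
       = h3 i j k (x, y, z) * ind3 S (x, y, z)" by (simp add: ind3_def)
  qed
  moreover have "\<bar>\<Sum>\<omega>\<in>block i j k. h3 i j k \<omega> * ind3 S \<omega>\<bar> \<le> \<epsilon> * real s ^ 3"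
    using hyper triplesI[OF ijk] unfolding hyper_regular_def h3_def block_def by blast
  ultimately show "\<bar>\<Sum>x\<in>Y i. \<Sum>y\<in>Y j. \<Sum>z\<in>Y k. of_bool ((x, y) \<in> P \<and> (y, z) \<in> Q \<and> (x, z) \<in> R) * h3 i j k (x, y, z)\<bar>
     \<le> \<epsilon> * real s ^ 3" by simp
qed (use YI ijk in auto)

text \<open>The part of \<open>h\<close> with small cut norm. On triples that meet a part twice it
  is 0, and there the error term \<open>e0\<close> takes over all of \<open>h - D\<close>.\<close>

definition gg where "gg x y z = (if T3 x y z then h3 (part x) (part y) (part z) (x, y, z) else 0)"

lemma gg_cut:
  fixes a b c :: "'a \<Rightarrow> 'a \<Rightarrow> real"
  assumes a: "\<And>x y. \<bar>a x y\<bar> \<le> 1" and b: "\<And>x y. \<bar>b x y\<bar> \<le> 1" and c: "\<And>x y. \<bar>c x y\<bar> \<le> 1"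
  shows "\<bar>\<Sum>x\<in>U. \<Sum>y\<in>U. \<Sum>z\<in>U. gg x y z * a x y * b y z * c x z\<bar> \<le> 8 * \<epsilon> * real n ^ 3"
proof -
  have bl: "\<bar>\<Sum>x\<in>Y i. \<Sum>y\<in>Y j. \<Sum>z\<in>Y k. gg x y z * a x y * b y z * c x z\<bar> \<le> 8 * (\<epsilon> * real s ^ 3)"
    if ijk: "i \<in> I" "j \<in> I" "k \<in> I" for i j k
  proof (cases "i \<noteq> j \<and> j \<noteq> k \<and> i \<noteq> k")
    case True
    have "(\<Sum>x\<in>Y i. \<Sum>y\<in>Y j. \<Sum>z\<in>Y k. gg x y z * a x y * b y z * c x z)
       = (\<Sum>x\<in>Y i. \<Sum>y\<in>Y j. \<Sum>z\<in>Y k. h3 i j k (x, y, z) * a x y * b y z * c x z)"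
    proof (intro sum.cong refl)
      fix x y z assume "x \<in> Y i" "y \<in> Y j" "z \<in> Y k"
      hence "part x = i" "part y = j" "part z = k" using ijk part_eq by auto
      thus "gg x y z * a x y * b y z * c x z = h3 i j k (x, y, z) * a x y * b y z * c x z"
        using True by (simp add: gg_def T3_def)
    qed
    thus ?thesis using h3_cut[OF a b c ijk] True by simp
  next
    case False
    have "(\<Sum>x\<in>Y i. \<Sum>y\<in>Y j. \<Sum>z\<in>Y k. gg x y z * a x y * b y z * c x z) = 0"
    proof (intro sum.neutral ballI)
      fix x y z assume "x \<in> Y i" "y \<in> Y j" "z \<in> Y k"
      hence "part x = i" "part y = j" "part z = k" using ijk part_eq by auto
      hence "gg x y z = 0" using False by (auto simp: gg_def T3_def)
      thus "gg x y z * a x y * b y z * c x z = 0" by simp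
    qed
    thus ?thesis using \<epsilon> by simp
  qed
  have "\<bar>\<Sum>x\<in>U. \<Sum>y\<in>U. \<Sum>z\<in>U. gg x y z * a x y * b y z * c x z\<bar>
     \<le> (\<Sum>i\<in>I. \<Sum>j\<in>I. \<Sum>k\<in>I. 8 * (\<epsilon> * real s ^ 3))"
    unfolding sum_U3
    by (rule order_trans[OF sum_abs], rule sum_mono, rule order_trans[OF sum_abs], rule sum_mono,
        rule order_trans[OF sum_abs], rule sum_mono, rule bl)
  also have "\<dots> = 8 * \<epsilon> * real n ^ 3" using cI by (simp add: n_def power3_eq_cube)
  finally show ?thesis .
qed

text \<open>The \<open>3 * \<epsilon>\<close> collects the rounding error, the irregularity of
  \<open>W\<close> and the missing diagonal. Support inside that of \<open>W\<close> keeps every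
  edge between different parts in the chosen colour.\<close>

definition rounded :: "('a \<Rightarrow> 'a \<Rightarrow> real) \<Rightarrow> bool" where
  "rounded A \<longleftrightarrow> (\<forall>x y. A x y \<in> {0, 1} \<and> A x y = A y x \<and> (A x y \<noteq> 0 \<longrightarrow> x \<in> U \<and> y \<in> U \<and> x \<noteq> y \<and> W x y \<noteq> 0)) \<and>
     (\<forall>P\<subseteq>U. \<forall>Q\<subseteq>U. \<bar>\<Sum>x\<in>P. \<Sum>y\<in>Q. A x y - p\<bar> \<le> 3 * \<epsilon> * real n ^ 2) \<and>
     (\<Sum>x\<in>U. \<Sum>y\<in>U. \<Sum>z\<in>U. G x y z * (A x y * A y z * A x z)) \<le> (2 * \<zeta> * p ^ 3 + 6 * \<epsilon>) * real n ^ 3"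

lemma rounded_exists: "\<exists>A. rounded A"
proof -
  have Gd: "x \<noteq> y \<and> y \<noteq> z \<and> x \<noteq> z" if "x \<in> U" "y \<in> U" "z \<in> U" "G x y z \<noteq> 0" for x y z
    using that by (auto simp: G_def T3_def split: if_splits)
  have big': "real n \<ge> 7 / \<epsilon> ^ 5" using big by (simp add: n_def)
  have ex: "\<exists>a. (\<forall>x\<in>U. \<forall>y\<in>U. x \<noteq> y \<longrightarrow> a {x, y} \<in> {0, 1::real} \<and> (w {x, y} = 0 \<longrightarrow> a {x, y} = 0)) \<and>
     (\<forall>P\<subseteq>U. \<forall>Q\<subseteq>U. \<bar>\<Sum>x\<in>P. \<Sum>y\<in>Q. of_bool (x \<noteq> y) * (a {x, y} - w {x, y})\<bar> \<le> \<epsilon> * real n ^ 2) \<and>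
     (\<Sum>x\<in>U. \<Sum>y\<in>U. \<Sum>z\<in>U. G x y z * (a {x, y} * a {y, z} * a {x, z}))
       \<le> (\<Sum>x\<in>U. \<Sum>y\<in>U. \<Sum>z\<in>U. G x y z * (w {x, y} * w {y, z} * w {x, z})) + 6 * \<epsilon> * real n ^ 3"
    by (rule random_rounding) (fact finU cardU w01 G01 Gd \<epsilon>(1) eps1 big')+
  obtain a where a: "\<forall>x\<in>U. \<forall>y\<in>U. x \<noteq> y \<longrightarrow> a {x, y} \<in> {0, 1::real} \<and> (w {x, y} = 0 \<longrightarrow> a {x, y} = 0)"
    and cut: "\<forall>P\<subseteq>U. \<forall>Q\<subseteq>U. \<bar>\<Sum>x\<in>P. \<Sum>y\<in>Q. of_bool (x \<noteq> y) * (a {x, y} - w {x, y})\<bar> \<le> \<epsilon> * real n ^ 2"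
    and Gs: "(\<Sum>x\<in>U. \<Sum>y\<in>U. \<Sum>z\<in>U. G x y z * (a {x, y} * a {y, z} * a {x, z}))
       \<le> (\<Sum>x\<in>U. \<Sum>y\<in>U. \<Sum>z\<in>U. G x y z * (w {x, y} * w {y, z} * w {x, z})) + 6 * \<epsilon> * real n ^ 3"
    using ex by (elim exE conjE)
  define A where "A x y = (if x \<in> U \<and> y \<in> U \<and> x \<noteq> y then a {x, y} else 0)" for x y
  have 1: "A x y \<in> {0, 1} \<and> A x y = A y x \<and> (A x y \<noteq> 0 \<longrightarrow> x \<in> U \<and> y \<in> U \<and> x \<noteq> y \<and> W x y \<noteq> 0)" for x y
  proof (cases "x \<in> U \<and> y \<in> U \<and> x \<noteq> y")
    case True
    hence "a {x, y} \<in> {0, 1} \<and> (w {x, y} = 0 \<longrightarrow> a {x, y} = 0)" using a by blast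
    thus ?thesis using True by (auto simp: A_def insert_commute w_eq)
  next
    case False
    hence "A x y = 0" "A y x = 0" by (auto simp: A_def)
    thus ?thesis by simp
  qed
  have 2: "\<bar>\<Sum>x\<in>P. \<Sum>y\<in>Q. A x y - p\<bar> \<le> 3 * \<epsilon> * real n ^ 2" if PQ: "P \<subseteq> U" "Q \<subseteq> U" for P Q
  proof -
    have fP: "finite P" "finite Q" using PQ finU finite_subset by auto
    have "(\<Sum>x\<in>P. \<Sum>y\<in>Q. A x y - p) = (\<Sum>x\<in>P. \<Sum>y\<in>Q. of_bool (x \<noteq> y) * (a {x, y} - w {x, y}) + (W x y - p)
        - (if x = y then W x y else 0))"
      by (intro sum.cong refl) (use PQ in \<open>auto simp: A_def w_eq\<close>)
    also have "\<dots> = (\<Sum>x\<in>P. \<Sum>y\<in>Q. of_bool (x \<noteq> y) * (a {x, y} - w {x, y})) + (\<Sum>x\<in>P. \<Sum>y\<in>Q. W x y - p)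
        - (\<Sum>x\<in>P. \<Sum>y\<in>Q. if x = y then W x y else 0)"
      by (simp only: sum.distrib sum_subtractf)
    finally have e: "(\<Sum>x\<in>P. \<Sum>y\<in>Q. A x y - p) = \<dots>" .
    \<comment> \<open>\<open>A\<close> has no loops but \<open>W\<close> does; the diagonal has at
      most \<open>n\<close> entries, and \<open>1 \<le> \<epsilon> * n\<close>.\<close>
    have dg: "\<bar>\<Sum>x\<in>P. \<Sum>y\<in>Q. if x = y then W x y else 0\<bar> \<le> \<epsilon> * real n ^ 2"
    proof -
      have "(\<Sum>x\<in>P. \<Sum>y\<in>Q. if x = y then W x y else 0) = (\<Sum>x\<in>P. if x \<in> Q then W x x else 0)"
        by (rule sum.cong[OF refl]) (use fP in simp)
      moreover have "\<bar>\<Sum>x\<in>P. if x \<in> Q then W x x else 0\<bar> \<le> (\<Sum>x\<in>P. 1)"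
        by (rule order_trans[OF sum_abs], rule sum_mono) (use W01 in \<open>auto simp: abs_le_iff intro: order_trans[of _ 0]\<close>)
      moreover have "card P \<le> n" using PQ cardU card_mono[OF finU] by metis
      moreover have "real n * 1 \<le> real n * (\<epsilon> * real n)"
        by (rule mult_left_mono) (use inv_eps_le_n \<epsilon> in \<open>auto simp: field_simps\<close>)
      ultimately show ?thesis by (simp add: power2_eq_square mult_ac)
    qed
    have "\<bar>\<Sum>x\<in>P. \<Sum>y\<in>Q. of_bool (x \<noteq> y) * (a {x, y} - w {x, y})\<bar> \<le> \<epsilon> * real n ^ 2" using cut PQ by blast
    thus ?thesis unfolding e using dg cut_W[OF PQ] by linarith
  qed
  have "(\<Sum>x\<in>U. \<Sum>y\<in>U. \<Sum>z\<in>U. G x y z * (A x y * A y z * A x z))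
     = (\<Sum>x\<in>U. \<Sum>y\<in>U. \<Sum>z\<in>U. G x y z * (a {x, y} * a {y, z} * a {x, z}))"
  proof (intro sum.cong refl)
    fix x y z assume "x \<in> U" "y \<in> U" "z \<in> U"
    thus "G x y z * (A x y * A y z * A x z) = G x y z * (a {x, y} * a {y, z} * a {x, z})"
      using Gd[of x y z] by (cases "G x y z = 0") (auto simp: A_def)
  qed
  also have "\<dots> \<le> (2 * \<zeta> * p ^ 3 + 6 * \<epsilon>) * real n ^ 3"
    using Gs G_sum unfolding w_eq distrib_right by linarith
  finally have 3: "(\<Sum>x\<in>U. \<Sum>y\<in>U. \<Sum>z\<in>U. G x y z * (A x y * A y z * A x z)) \<le> (2 * \<zeta> * p ^ 3 + 6 * \<epsilon>) * real n ^ 3" .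
  show ?thesis
    unfolding rounded_def
  proof (intro exI[of _ A] conjI)
    show "\<forall>x y. A x y \<in> {0, 1} \<and> A x y = A y x \<and> (A x y \<noteq> 0 \<longrightarrow> x \<in> U \<and> y \<in> U \<and> x \<noteq> y \<and> W x y \<noteq> 0)"
      by (intro allI 1)
    show "\<forall>P\<subseteq>U. \<forall>Q\<subseteq>U. \<bar>\<Sum>x\<in>P. \<Sum>y\<in>Q. A x y - p\<bar> \<le> 3 * \<epsilon> * real n ^ 2"
      by (intro allI impI 2)
  qed (rule 3)
qed

text \<open>The edge inside a part is kept as a weight and the other two edges are counted by
  \<open>count_edges\<close>. Pairs inside a part have density about \<open>p / m\<close>; the error
  \<open>3 * \<epsilon>\<close> arises once for each of the \<open>m\<close> parts.\<close>

lemma same_part_count: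
  assumes A: "rounded A"
  shows "(\<Sum>x\<in>U. \<Sum>y\<in>U. \<Sum>z\<in>U. of_bool (part x = part y) * (A x y * A y z * A x z))
     \<le> (p ^ 3 / real m + (3 * real m + 6) * \<epsilon>) * real n ^ 3"
proof -
  have A01: "0 \<le> A x y \<and> A x y \<le> 1" for x y
  proof -
    have "A x y \<in> {0, 1}" using A unfolding rounded_def by blast
    thus ?thesis by auto
  qed
  have cut: "\<bar>\<Sum>x\<in>P. \<Sum>y\<in>Q. A x y - p\<bar> \<le> 3 * \<epsilon> * real n ^ 2" if "P \<subseteq> U" "Q \<subseteq> U" for P Q
    using A that unfolding rounded_def by blast
  define F where "F \<phi> = of_bool (part (\<phi> 0) = part (\<phi> 1)) * A (\<phi> 0) (\<phi> 1)" for \<phi> :: "nat \<Rightarrow> 'a"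
  define es where "es = [(1::nat,2::nat),(0,2)]"
  have k1: "\<bar>(\<Sum>\<phi>\<in>{..<3} \<rightarrow>\<^sub>E U. F \<phi> * (\<Prod>(i, j)\<leftarrow>es. A (\<phi> i) (\<phi> j)))
        - p ^ length es * (\<Sum>\<phi>\<in>{..<3} \<rightarrow>\<^sub>E U. F \<phi>)\<bar> \<le> real (length es) * (3 * \<epsilon>) * real n ^ card {..<3::nat}"
  proof (rule count_edges[OF finU _ cardU A01 _ _ _ cut])
    show "0 \<le> F \<phi> \<and> F \<phi> \<le> 1" for \<phi> using A01 by (simp add: F_def)
    show "distinct (map (\<lambda>(i, j). {i, j}) es)" by (simp add: es_def doubleton_eq_iff)
    show "\<forall>(i, j)\<in>set es. i \<in> {..<3} \<and> j \<in> {..<3} \<and> i \<noteq> j \<and> (indep F i \<or> indep F j)"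
      by (simp add: es_def indep_def F_def)
  qed (use p01 \<epsilon> in auto)
  have k2: "(\<Sum>\<phi>\<in>{..<3} \<rightarrow>\<^sub>E U. F \<phi> * (\<Prod>(i, j)\<leftarrow>es. A (\<phi> i) (\<phi> j)))
     = (\<Sum>x\<in>U. \<Sum>y\<in>U. \<Sum>z\<in>U. of_bool (part x = part y) * (A x y * A y z * A x z))"
    using sum_PiE3[OF finU, of "\<lambda>x y z. of_bool (part x = part y) * (A x y * A y z * A x z)"]
    by (simp add: F_def es_def mult.assoc)
  have k3: "(\<Sum>\<phi>\<in>{..<3} \<rightarrow>\<^sub>E U. F \<phi>) = real n * (\<Sum>x\<in>U. \<Sum>y\<in>U. of_bool (part x = part y) * A x y)"
  proof -
    have "(\<Sum>\<phi>\<in>{..<3} \<rightarrow>\<^sub>E U. F \<phi>) = (\<Sum>x\<in>U. \<Sum>y\<in>U. \<Sum>z\<in>U. of_bool (part x = part y) * A x y)"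
      unfolding F_def by (rule sum_PiE3[OF finU])
    thus ?thesis using cardU by (simp add: sum_distrib_left)
  qed
  have k4: "(\<Sum>x\<in>U. \<Sum>y\<in>U. of_bool (part x = part y) * A x y) \<le> (p / real m + real m * (3 * \<epsilon>)) * real n ^ 2"
  proof -
    have "(\<Sum>x\<in>U. \<Sum>y\<in>U. of_bool (part x = part y) * A x y) = (\<Sum>i\<in>I. \<Sum>x\<in>Y i. \<Sum>y\<in>Y i. A x y)"
      unfolding sum_U[of "\<lambda>x. \<Sum>y\<in>U. of_bool (part x = part y) * A x y"]
    proof (rule sum.cong[OF refl], rule sum.cong[OF refl])
      fix i x assume i: "i \<in> I" "x \<in> Y i"
      have "(\<Sum>y\<in>U. of_bool (part x = part y) * A x y) = (\<Sum>y\<in>U. if y \<in> Y i then A x y else 0)"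
      proof (rule sum.cong[OF refl])
        fix y assume y: "y \<in> U"
        have "part x = i" using i part_eq by auto
        moreover have "part y = i \<longleftrightarrow> y \<in> Y i" using part_eq[OF i(1), of y] part_mem[OF y] by auto
        ultimately show "of_bool (part x = part y) * A x y = (if y \<in> Y i then A x y else 0)" by auto
      qed
      also have "\<dots> = (\<Sum>y\<in>U \<inter> Y i. A x y)" by (rule sum.inter_restrict[symmetric, OF finU])
      also have "U \<inter> Y i = Y i" using i YU by auto
      finally show "(\<Sum>y\<in>U. of_bool (part x = part y) * A x y) = (\<Sum>y\<in>Y i. A x y)" .
    qed
    also have "\<dots> \<le> (\<Sum>i\<in>I. p * real s ^ 2 + 3 * \<epsilon> * real n ^ 2)"
    proof (rule sum_mono)
      fix i assume i: "i \<in> I"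
      have "\<bar>\<Sum>x\<in>Y i. \<Sum>y\<in>Y i. A x y - p\<bar> \<le> 3 * \<epsilon> * real n ^ 2" by (rule cut) (use i YU in auto)
      moreover have "(\<Sum>x\<in>Y i. \<Sum>y\<in>Y i. A x y - p) = (\<Sum>x\<in>Y i. \<Sum>y\<in>Y i. A x y) - p * real s ^ 2"
        using YI[OF i] by (simp add: sum_subtractf power2_eq_square)
      ultimately show "(\<Sum>x\<in>Y i. \<Sum>y\<in>Y i. A x y) \<le> p * real s ^ 2 + 3 * \<epsilon> * real n ^ 2" by linarith
    qed
    also have "\<dots> = (p / real m + real m * (3 * \<epsilon>)) * real n ^ 2"
      using m cI by (simp add: n_def field_simps power2_eq_square)
    finally show ?thesis .
  qed
  have len: "length es = 2" by (simp add: es_def)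
  have "(\<Sum>x\<in>U. \<Sum>y\<in>U. \<Sum>z\<in>U. of_bool (part x = part y) * (A x y * A y z * A x z))
     \<le> p ^ 2 * (real n * (\<Sum>x\<in>U. \<Sum>y\<in>U. of_bool (part x = part y) * A x y)) + 2 * (3 * \<epsilon>) * real n ^ 3"
    using k1 unfolding k2 k3 len card_lessThan of_nat_numeral by linarith
  also have "\<dots> \<le> p ^ 2 * (real n * ((p / real m + real m * (3 * \<epsilon>)) * real n ^ 2)) + 2 * (3 * \<epsilon>) * real n ^ 3"
    using k4 by (intro add_right_mono mult_left_mono) auto
  also have "\<dots> = (p ^ 3 / real m + p ^ 2 * (3 * real m * \<epsilon>) + 6 * \<epsilon>) * real n ^ 3"
    by (simp add: algebra_simps power2_eq_square power3_eq_cube)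
  also have "\<dots> \<le> (p ^ 3 / real m + 1 * (3 * real m * \<epsilon>) + 6 * \<epsilon>) * real n ^ 3"
  proof (intro mult_right_mono add_right_mono add_left_mono)
    show "p ^ 2 \<le> 1" using p01 by (simp add: power_le_one)
  qed (use \<epsilon> in auto)
  finally show ?thesis by (simp add: algebra_simps)
qed

lemma triangle_count_approx:
  assumes A: "rounded A"
  shows "\<bar>(\<Sum>x\<in>U. \<Sum>y\<in>U. \<Sum>z\<in>U. A x y * A y z * A x z) - p ^ 3 * real n ^ 3\<bar> \<le> 9 * \<epsilon> * real n ^ 3"
proof -
  have A01: "0 \<le> A x y \<and> A x y \<le> 1" for x y
  proof -
    have "A x y \<in> {0, 1}" using A unfolding rounded_def by blast
    thus ?thesis by auto
  qed
  have cut: "\<bar>\<Sum>x\<in>P. \<Sum>y\<in>Q. A x y - p\<bar> \<le> 3 * \<epsilon> * real n ^ 2" if "P \<subseteq> U" "Q \<subseteq> U" for P Q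
    using A that unfolding rounded_def by blast
  define F where "F = (\<lambda>\<phi> :: nat \<Rightarrow> 'a. 1 :: real)"
  define es where "es = [(0::nat,1::nat),(1,2),(0,2)]"
  have len: "length es = 3" by (simp add: es_def)
  have k1: "\<bar>(\<Sum>\<phi>\<in>{..<3} \<rightarrow>\<^sub>E U. F \<phi> * (\<Prod>(i, j)\<leftarrow>es. A (\<phi> i) (\<phi> j)))
        - p ^ length es * (\<Sum>\<phi>\<in>{..<3} \<rightarrow>\<^sub>E U. F \<phi>)\<bar> \<le> real (length es) * (3 * \<epsilon>) * real n ^ card {..<3::nat}"
  proof (rule count_edges[OF finU _ cardU A01 _ _ _ cut])
    show "0 \<le> F \<phi> \<and> F \<phi> \<le> 1" for \<phi> by (simp add: F_def)
    show "distinct (map (\<lambda>(i, j). {i, j}) es)" by (simp add: es_def doubleton_eq_iff)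
    show "\<forall>(i, j)\<in>set es. i \<in> {..<3} \<and> j \<in> {..<3} \<and> i \<noteq> j \<and> (indep F i \<or> indep F j)"
      by (simp add: es_def indep_def F_def)
  qed (use p01 \<epsilon> in auto)
  have k2: "(\<Sum>\<phi>\<in>{..<3} \<rightarrow>\<^sub>E U. F \<phi> * (\<Prod>(i, j)\<leftarrow>es. A (\<phi> i) (\<phi> j)))
     = (\<Sum>x\<in>U. \<Sum>y\<in>U. \<Sum>z\<in>U. A x y * A y z * A x z)"
    using sum_PiE3[OF finU, of "\<lambda>x y z. A x y * A y z * A x z"] by (simp add: F_def es_def mult.assoc)
  have k3: "(\<Sum>\<phi>\<in>{..<3::nat} \<rightarrow>\<^sub>E U. F \<phi>) = real n ^ 3"
    using cardU by (simp add: F_def card_PiE)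
  show ?thesis using k1 unfolding k2 k3 len card_lessThan by (simp add: mult.assoc)
qed

text \<open>The relative error on triangles has three sources: \<open>\<rho>\<close> for the spread
  of the block constants, \<open>2 * \<zeta>\<close> for \<open>h2\<close>, and \<open>3 / m\<close>
  for the three ways in which two vertices can share a part. The term
  \<open>(9 * m + 33) * \<epsilon>\<close> adds up the counting and rounding errors.\<close>

lemma octahedron_rounded:
  assumes A: "rounded A" and d: "d = (\<Sum>x\<in>U. \<Sum>y\<in>U. \<Sum>z\<in>U. h {x, y, z} * (A x y * A y z * A x z)) /
       (\<Sum>x\<in>U. \<Sum>y\<in>U. \<Sum>z\<in>U. A x y * A y z * A x z)"
    and f: "\<And>x y z. x \<in> U \<Longrightarrow> y \<in> U \<Longrightarrow> z \<in> U \<Longrightarrow> f x y z = (h {x, y, z} - d) * (A x y * A y z * A x z)"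
  shows "octahedra U f
     \<le> (p ^ 9 * (2 * (p ^ 3 * (\<rho> + 2 * \<zeta> + 3 / real m) + (9 * real m + 33) * \<epsilon>) + 8 * \<epsilon>)
         + 27 * (3 * \<epsilon>) + 8 * \<epsilon>) * real n ^ 6"
proof -
  let ?T = "\<lambda>x y z. A x y * A y z * A x z"
  have Ab: "A x y \<in> {0, 1}" "A x y = A y x" "A x y \<noteq> 0 \<Longrightarrow> x \<in> U \<and> y \<in> U \<and> x \<noteq> y \<and> W x y \<noteq> 0" for x y
    using A unfolding rounded_def by blast+
  have A01: "0 \<le> A x y \<and> A x y \<le> 1" for x y using Ab(1)[of x y] by auto
  have T01: "0 \<le> ?T x y z \<and> ?T x y z \<le> 1" for x y z
    using A01 by (auto intro!: mult_le_one)
  have cut: "\<bar>\<Sum>x\<in>P. \<Sum>y\<in>Q. A x y - p\<bar> \<le> 3 * \<epsilon> * real n ^ 2" if "P \<subseteq> U" "Q \<subseteq> U" for P Q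
    using A that unfolding rounded_def by blast
  have Aabs: "\<bar>A x y\<bar> = A x y" for x y using A01[of x y] by simp
  define e0 where "e0 x y z = (if T3 x y z
      then (h1 (part x) (part y) (part z) (x, y, z) - D + h2 (part x) (part y) (part z) (x, y, z)) * ?T x y z
      else (h {x, y, z} - D) * ?T x y z)" for x y z
  define er where "er x y z = (if T3 x y z then (\<rho> + G x y z) * ?T x y z else ?T x y z)" for x y z
  have er01: "0 \<le> er x y z \<and> er x y z \<le> 2" for x y z
  proof -
    have "(\<rho> + G x y z) * ?T x y z \<le> 2 * 1" using \<rho> G01[of x y z] T01[of x y z] by (intro mult_mono) auto
    thus ?thesis using \<rho> G01[of x y z] T01[of x y z] by (auto simp: er_def)
  qed
  have dec: "(h {x, y, z} - D) * ?T x y z = e0 x y z + gg x y z * ?T x y z" for x y z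
  proof (cases "T3 x y z")
    case True
    have "h {x, y, z} = h1 (part x) (part y) (part z) (x, y, z) + h2 (part x) (part y) (part z) (x, y, z)
       + h3 (part x) (part y) (part z) (x, y, z)"
      using h_decomp[of "(x, y, z)" "part x" "part y" "part z"] by (simp add: tri_def)
    thus ?thesis using True by (simp add: e0_def gg_def algebra_simps)
  qed (simp add: e0_def gg_def)
  have e0er: "\<bar>e0 x y z\<bar> \<le> er x y z" if m: "x \<in> U" "y \<in> U" "z \<in> U" for x y z
  proof (cases "?T x y z = 0")
    case True
    show ?thesis by (simp only: True e0_def er_def mult_zero_right if_cancel abs_zero order_refl)
  next
    case False
    show ?thesis
    proof (cases "T3 x y z")
      case False
      have "\<bar>h {x, y, z} - D\<bar> \<le> 1" using h[of "{x, y, z}"] D by (auto simp: abs_le_iff)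
      hence "\<bar>h {x, y, z} - D\<bar> * ?T x y z \<le> 1 * ?T x y z" by (rule mult_right_mono) (use T01 in blast)
      thus ?thesis using False by (simp add: e0_def er_def abs_mult Aabs)
    next
      case True
      let ?i = "part x" and ?j = "part y" and ?k = "part z"
      have I3: "?i \<in> I" "?j \<in> I" "?k \<in> I" using m part_mem by auto
      have dist: "?i \<noteq> ?j" "?j \<noteq> ?k" "?i \<noteq> ?k" using True by (auto simp: T3_def)
      \<comment> \<open>All sides of the triangle have the chosen colours, so it lies in the cell of
        \<open>(v ?i, v ?j, v ?k)\<close>, on which \<open>h1\<close> is constant and close to
        \<open>D\<close>.\<close>
      have "W x y \<noteq> 0" "W y z \<noteq> 0" "W x z \<noteq> 0" using False Ab(3) by auto
      hence "key3 \<chi> (x, y, z) = key3 \<chi> (v ?i, v ?j, v ?k)"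
        using dist m by (auto simp: W_def key3_def col_def split: if_splits)
      hence "h1 ?i ?j ?k (x, y, z) = h1 ?i ?j ?k (v ?i, v ?j, v ?k)" unfolding h1_def by (rule cavg_cong)
      hence "\<bar>h1 ?i ?j ?k (x, y, z) - D\<bar> \<le> \<rho>" using near[OF I3 dist] by simp
      moreover have "\<bar>h2 ?i ?j ?k (x, y, z)\<bar> = G x y z" using m True by (simp add: G_def)
      ultimately have "\<bar>h1 ?i ?j ?k (x, y, z) - D + h2 ?i ?j ?k (x, y, z)\<bar> \<le> \<rho> + G x y z" by linarith
      hence "\<bar>h1 ?i ?j ?k (x, y, z) - D + h2 ?i ?j ?k (x, y, z)\<bar> * ?T x y z \<le> (\<rho> + G x y z) * ?T x y z"
        by (rule mult_right_mono) (use T01 in blast)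
      thus ?thesis using True by (simp add: e0_def er_def abs_mult Aabs)
    qed
  qed
  let ?s = "\<lambda>F. \<Sum>x\<in>U. \<Sum>y\<in>U. \<Sum>z\<in>U. F x y z"
  have Tsym: "?T x y z = ?T y z x" for x y z using Ab(2) by (simp add: mult_ac)
  let ?S1 = "?s (\<lambda>x y z. of_bool (part x = part y) * ?T x y z)"
  have S2: "?s (\<lambda>x y z. of_bool (part y = part z) * ?T x y z) = ?S1"
  proof -
    have "?s (\<lambda>x y z. of_bool (part y = part z) * ?T x y z) = (\<Sum>y\<in>U. \<Sum>x\<in>U. \<Sum>z\<in>U. of_bool (part y = part z) * ?T x y z)"
      by (rule sum.swap)
    also have "\<dots> = (\<Sum>y\<in>U. \<Sum>z\<in>U. \<Sum>x\<in>U. of_bool (part y = part z) * ?T x y z)"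
      by (rule sum.cong[OF refl], rule sum.swap)
    also have "\<dots> = ?S1"
    proof (intro sum.cong refl)
      fix y z x
      show "of_bool (part y = part z) * ?T x y z = of_bool (part y = part z) * ?T y z x" using Tsym[of x y z] by simp
    qed
    finally show ?thesis .
  qed
  have S3: "?s (\<lambda>x y z. of_bool (part x = part z) * ?T x y z) = ?S1"
  proof -
    have "?s (\<lambda>x y z. of_bool (part x = part z) * ?T x y z) = (\<Sum>x\<in>U. \<Sum>z\<in>U. \<Sum>y\<in>U. of_bool (part x = part z) * ?T x y z)"
      by (rule sum.cong[OF refl], rule sum.swap)
    also have "\<dots> = ?S1"
    proof (intro sum.cong refl)
      fix x z y
      show "of_bool (part x = part z) * ?T x y z = of_bool (part x = part z) * ?T x z y"
        using Ab(2)[of y z] by (simp add: mult_ac)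
    qed
    finally show ?thesis .
  qed
  have "?s er \<le> ?s (\<lambda>x y z. \<rho> * ?T x y z + G x y z * ?T x y z + of_bool (part x = part y) * ?T x y z
     + of_bool (part y = part z) * ?T x y z + of_bool (part x = part z) * ?T x y z)"
  proof (intro sum_mono)
    fix x y z
    define q where "q = ?T x y z"
    have q: "0 \<le> q" "0 \<le> \<rho> * q" "0 \<le> G x y z * q" using \<rho> G01[of x y z] T01[of x y z] by (auto simp: q_def)
    thus "er x y z \<le> \<rho> * ?T x y z + G x y z * ?T x y z + of_bool (part x = part y) * ?T x y z
     + of_bool (part y = part z) * ?T x y z + of_bool (part x = part z) * ?T x y z"
      unfolding er_def q_def[symmetric] T3_def using q by (auto simp: distrib_right)
  qed
  also have "\<dots> = \<rho> * ?s ?T + ?s (\<lambda>x y z. G x y z * ?T x y z) + ?S1 + ?S1 + ?S1"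
    by (simp only: sum.distrib S2 S3 sum_distrib_left)
  also have "\<dots> \<le> (p ^ 3 * \<rho> + 9 * \<epsilon>) * real n ^ 3 + (2 * \<zeta> * p ^ 3 + 6 * \<epsilon>) * real n ^ 3
     + 3 * ((p ^ 3 / real m + (3 * real m + 6) * \<epsilon>) * real n ^ 3)"
  proof -
    have "\<rho> * ?s ?T \<le> \<rho> * (p ^ 3 * real n ^ 3 + 9 * \<epsilon> * real n ^ 3)"
      using triangle_count_approx[OF A] \<rho> by (intro mult_left_mono) (auto simp: abs_le_iff)
    also have "\<dots> = p ^ 3 * \<rho> * real n ^ 3 + \<rho> * (9 * \<epsilon> * real n ^ 3)" by (simp add: algebra_simps)
    also have "\<rho> * (9 * \<epsilon> * real n ^ 3) \<le> 1 * (9 * \<epsilon> * real n ^ 3)" using \<rho> \<epsilon> by (intro mult_right_mono) auto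
    finally have "\<rho> * ?s ?T \<le> (p ^ 3 * \<rho> + 9 * \<epsilon>) * real n ^ 3" by (simp add: distrib_right)
    moreover have "?s (\<lambda>x y z. G x y z * ?T x y z) \<le> (2 * \<zeta> * p ^ 3 + 6 * \<epsilon>) * real n ^ 3"
      using A unfolding rounded_def by blast
    ultimately show ?thesis using same_part_count[OF A] by linarith
  qed
  also have "\<dots> = (p ^ 3 * (\<rho> + 2 * \<zeta> + 3 / real m) + (9 * real m + 33) * \<epsilon>) * real n ^ 3"
    by (simp add: algebra_simps)
  finally have ersum: "?s er \<le> (p ^ 3 * (\<rho> + 2 * \<zeta> + 3 / real m) + (9 * real m + 33) * \<epsilon>) * real n ^ 3" .
  show ?thesis
  proof (rule octahedron_bound[OF finU cardU Ab(1) Ab(2) _ p01(2) _ cut _ D dec e0er er01 ersum gg_cut d f])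
  qed (use p01 \<epsilon> h in auto)
qed

end

section \<open>Three copies of an indicator graph\<close>

definition graph_of :: "'a set \<Rightarrow> ('a \<Rightarrow> 'a \<Rightarrow> real) \<Rightarrow> 'a hgraph" where
  "graph_of U A = \<lparr>vertices = U, edges = {{x, y} | x y. A x y = 1}\<rparr>"

lemma vertices_graph_of [simp]: "vertices (graph_of U A) = U"
  by (simp add: graph_of_def)

lemma sum_copy: "(\<Sum>x\<in>copy U a. F x) = (\<Sum>x\<in>U. F (x, a))"
proof -
  have "copy U a = (\<lambda>x. (x, a)) ` U" by (auto simp: copy_def)
  moreover have "inj_on (\<lambda>x. (x, a)) U" by (auto simp: inj_on_def)
  ultimately show ?thesis by (simp add: sum.reindex)
qed

lemma card_copy: "card (copy U a) = card U"
  by (simp add: copy_def card_cartesian_product)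

locale indicator_graph =
  fixes U :: "'a set" and A :: "'a \<Rightarrow> 'a \<Rightarrow> real"
  assumes finU: "finite U" and A01: "A x y \<in> {0, 1}" and A_sym: "A x y = A y x"
    and A_supp: "A x y \<noteq> 0 \<Longrightarrow> x \<in> U \<and> y \<in> U \<and> x \<noteq> y"
begin

abbreviation Gr where "Gr \<equiv> graph_of U A"

lemma A_bool: "A x y = of_bool (A x y = 1)"
  using A01[of x y] by auto

lemma edge_iff: "{x, y} \<in> edges Gr \<longleftrightarrow> A x y = 1"
  using A_sym by (auto simp: graph_of_def doubleton_eq_iff)

lemma A_one: "A x y = 1 \<Longrightarrow> x \<in> U \<and> y \<in> U \<and> x \<noteq> y"
  by (rule A_supp) simp

lemma simple: "simple_graph Gr"
  unfolding uniform_hgraph_def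
proof (intro conjI ballI)
  show "finite (vertices Gr)" using finU by simp
  fix e assume "e \<in> edges Gr"
  then obtain x y where e: "e = {x, y}" "A x y = 1" by (auto simp: graph_of_def)
  hence "x \<in> U" "y \<in> U" "x \<noteq> y" using A_supp[of x y] by auto
  thus "e \<subseteq> vertices Gr" "card e = 2" using e by auto
qed

lemma copies_edge_iff:
  assumes "a \<in> {1, 2, 3}" "b \<in> {1, 2, 3}" "a \<noteq> b"
  shows "{(x, a), (y, b)} \<in> edges (copies_graph Gr) \<longleftrightarrow> A x y = 1"
proof
  assume "{(x, a), (y, b)} \<in> edges (copies_graph Gr)"
  then obtain x' y' a' b' where "{(x, a), (y, b)} = {(x', a'), (y', b')}" "{x', y'} \<in> edges Gr"
    by (auto simp: copies_graph_def)
  hence "A x' y' = 1" "(x = x' \<and> y = y') \<or> (x = y' \<and> y = x')"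
    using edge_iff by (auto simp: doubleton_eq_iff)
  thus "A x y = 1" using A_sym by auto
next
  assume "A x y = 1"
  hence "{x, y} \<in> edges Gr" using edge_iff by simp
  thus "{(x, a), (y, b)} \<in> edges (copies_graph Gr)"
    using assms unfolding copies_graph_def by simp blast
qed

definition \<rho> where "\<rho> = (\<Sum>x\<in>U. \<Sum>y\<in>U. A x y) / (real (card U) * real (card U))"

lemma card_pairs_sum:
  assumes "finite X" "finite Y"
  shows "real (card {(x, y). x \<in> X \<and> y \<in> Y \<and> P x y}) = (\<Sum>x\<in>X. \<Sum>y\<in>Y. of_bool (P x y))"
proof -
  have "{(x, y). x \<in> X \<and> y \<in> Y \<and> P x y} = {q \<in> X \<times> Y. P (fst q) (snd q)}" by auto
  hence "real (card {(x, y). x \<in> X \<and> y \<in> Y \<and> P x y}) = (\<Sum>q\<in>{q \<in> X \<times> Y. P (fst q) (snd q)}. 1)" by simp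
  also have "\<dots> = (\<Sum>q\<in>X \<times> Y. if P (fst q) (snd q) then 1 else 0)"
    by (rule sum.inter_filter) (use assms in auto)
  finally show ?thesis by (simp add: sum.cartesian_product case_prod_unfold of_bool_def)
qed

lemma density_copies:
  assumes "a \<in> {1, 2, 3}" "b \<in> {1, 2, 3}" "a \<noteq> b"
  shows "density (copies_graph Gr) (copy U a) (copy U b) = \<rho>"
proof -
  have fc: "finite (copy U a)" for a using finU by (simp add: copy_def)
  have "real (card {(x, y). x \<in> copy U a \<and> y \<in> copy U b \<and> {x, y} \<in> edges (copies_graph Gr)})
     = (\<Sum>x\<in>U. \<Sum>y\<in>U. of_bool ({(x, a), (y, b)} \<in> edges (copies_graph Gr)))"
    by (simp only: card_pairs_sum[OF fc fc] sum_copy)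
  also have "\<dots> = (\<Sum>x\<in>U. \<Sum>y\<in>U. A x y)"
    by (simp only: copies_edge_iff[OF assms] A_bool[symmetric])
  finally show ?thesis by (simp only: density_def \<rho>_def card_copy)
qed

text \<open>Each edge comes from at most two ordered pairs; this links the density
  \<open>\<rho>\<close> to the required number of edges.\<close>

lemma edges_ge: "(\<Sum>x\<in>U. \<Sum>y\<in>U. A x y) \<le> 2 * real (card (edges Gr))"
proof -
  have finE: "finite (edges Gr)"
  proof (rule finite_subset)
    show "edges Gr \<subseteq> Pow U" using simple by (auto simp: uniform_hgraph_def)
  qed (use finU in simp)
  have "(\<Sum>x\<in>U. \<Sum>y\<in>U. A x y) = real (card {(x, y). x \<in> U \<and> y \<in> U \<and> A x y = 1})"
    by (simp only: card_pairs_sum[OF finU finU] A_bool[symmetric])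
  also have "\<dots> \<le> real (card (\<Union>e\<in>edges Gr. {q. e = {fst q, snd q}}))"
  proof (intro of_nat_mono card_mono)
    have "finite {q. e = {fst q, snd q}}" for e :: "'a set"
    proof (cases "\<exists>x y. e = {x, y}")
      case True
      then obtain x y where "e = {x, y}" by blast
      hence "{q. e = {fst q, snd q}} \<subseteq> {(x, y), (y, x)}" by (auto simp: doubleton_eq_iff prod_eq_iff)
      thus ?thesis by (rule finite_subset) simp
    next
      case False
      hence "{q. e = {fst q, snd q}} = {}" by blast
      thus ?thesis by (simp only: finite.emptyI)
    qed
    thus "finite (\<Union>e\<in>edges Gr. {q. e = {fst q, snd q}})" using finE by blast
    show "{(x, y). x \<in> U \<and> y \<in> U \<and> A x y = 1} \<subseteq> (\<Union>e\<in>edges Gr. {q. e = {fst q, snd q}})"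
      using edge_iff by auto
  qed
  also have "\<dots> \<le> real (\<Sum>e\<in>edges Gr. card {q. e = {fst q, snd q}})"
    by (intro of_nat_mono card_UN_le finE)
  also have "\<dots> \<le> real (\<Sum>e\<in>edges Gr. 2)"
  proof (intro of_nat_mono sum_mono)
    fix e assume "e \<in> edges Gr"
    then obtain x y where "e = {x, y}" by (auto simp: graph_of_def)
    hence "{q. e = {fst q, snd q}} \<subseteq> {(x, y), (y, x)}" by (auto simp: doubleton_eq_iff prod_eq_iff)
    hence "card {q. e = {fst q, snd q}} \<le> card {(x, y), (y, x)}" by (rule card_mono[rotated]) simp
    also have "\<dots> \<le> 2" using card_insert_le_m1[of 2 "{(y, x)}" "(x, y)"] by simp
    finally show "card {q. e = {fst q, snd q}} \<le> 2" .
  qed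
  finally show ?thesis by simp
qed

text \<open>Between any two copies the bipartite graph is given by \<open>A\<close>, and the factor
  4 is that of \<open>four_cycles_le_cut\<close>.\<close>

lemma quasirandom_pair_copies:
  assumes ab: "a \<in> {1, 2, 3}" "b \<in> {1, 2, 3}" "a \<noteq> b"
    and cut: "\<And>P Q. P \<subseteq> U \<Longrightarrow> Q \<subseteq> U \<Longrightarrow> \<bar>\<Sum>x\<in>P. \<Sum>y\<in>Q. A x y - \<rho>\<bar> \<le> c * real (card U) ^ 2"
    and \<rho>01: "0 \<le> \<rho>" "\<rho> \<le> 1" and c: "4 * c \<le> \<alpha>"
  shows "quasirandom_pair \<alpha> (copies_graph Gr) (copy U a) (copy U b)"
proof -
  let ?f = "\<lambda>x y. A x y - \<rho>"
  have "(\<Sum>x\<in>U. \<Sum>x'\<in>U. \<Sum>y\<in>U. \<Sum>y'\<in>U. ?f x y * ?f x' y * ?f x y' * ?f x' y')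
     \<le> 4 * (c * real (card U) ^ 2) * real (card U) * real (card U)"
  proof (rule four_cycles_le_cut[OF finU finU _ cut])
    show "\<bar>A x y - \<rho>\<bar> \<le> 1" for x y using A01[of x y] \<rho>01 by auto
  qed
  also have "\<dots> = (4 * c) * (real (card U) ^ 2 * real (card U) ^ 2)" by (simp add: power2_eq_square)
  also have "\<dots> \<le> \<alpha> * (real (card U) ^ 2 * real (card U) ^ 2)" by (rule mult_right_mono[OF c]) simp
  finally show ?thesis
    unfolding quasirandom_pair_def quasirandom_fun_def density_copies[OF ab] sum_copy card_copy
      copies_edge_iff[OF ab] A_bool[symmetric] by (simp only: mult.assoc)
qed

abbreviation tp :: "'a \<times> 'a \<times> 'a \<Rightarrow> ('a \<times> nat) set" where
  "tp \<equiv> \<lambda>(x, y, z). {(x, 1), (y, 2), (z, 3)}"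

lemma tp_inj: "inj tp"
proof (rule injI)
  fix q q' :: "'a \<times> 'a \<times> 'a" assume eq: "tp q = tp q'"
  obtain x y z x' y' z' where q: "q = (x, y, z)" "q' = (x', y', z')" by (metis prod_cases3)
  have e: "{(x, 1::nat), (y, 2), (z, 3)} = {(x', 1), (y', 2), (z', 3)}" using eq q by (simp only: prod.case)
  have "(x, 1) \<in> {(x', 1::nat), (y', 2), (z', 3)}" "(y, 2) \<in> {(x', 1::nat), (y', 2), (z', 3)}"
    "(z, 3) \<in> {(x', 1::nat), (y', 2), (z', 3)}" unfolding e[symmetric] by simp_all
  thus "q = q'" using q by simp
qed

lemma triangle_iff: "{(x, 1), (y, 2), (z, 3)} \<in> triangles (copies_graph Gr) \<longleftrightarrow>
   A x y = 1 \<and> A y z = 1 \<and> A x z = 1"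
proof
  assume t: "{(x, 1), (y, 2), (z, 3)} \<in> triangles (copies_graph Gr)"
  have e: "{(u, a), (w, b)} \<in> edges (copies_graph Gr)"
    if "(u, a) \<in> {(x, 1::nat), (y, 2), (z, 3)}" "(w, b) \<in> {(x, 1), (y, 2), (z, 3)}" "a \<noteq> b" for u w a b
    using t that unfolding triangles_def by blast
  show "A x y = 1 \<and> A y z = 1 \<and> A x z = 1"
    using e[of x 1 y 2] e[of y 2 z 3] e[of x 1 z 3] copies_edge_iff[of 1 2 x y] copies_edge_iff[of 2 3 y z]
      copies_edge_iff[of 1 3 x z] by simp
next
  assume a: "A x y = 1 \<and> A y z = 1 \<and> A x z = 1"
  hence U: "x \<in> U" "y \<in> U" "z \<in> U" using A_one[of x y] A_one[of y z] by simp_all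
  have "{(x, 1::nat), (y, 2)} \<in> edges (copies_graph Gr)" "{(y, 2::nat), (z, 3)} \<in> edges (copies_graph Gr)"
    "{(x, 1::nat), (z, 3)} \<in> edges (copies_graph Gr)"
    using a by (simp_all add: copies_edge_iff)
  thus "{(x, 1), (y, 2), (z, 3)} \<in> triangles (copies_graph Gr)"
    using U unfolding triangles_def
    by (auto simp: copies_graph_def copy_def insert_commute)
qed

text \<open>Edges join different copies, so the copy index is injective on a triangle and takes each
  of its three values once. Triangles therefore correspond to ordered triples of vertices.\<close>

lemma triangles_copies: "triangles (copies_graph Gr) = tp ` {(x, y, z). A x y = 1 \<and> A y z = 1 \<and> A x z = 1}"
proof
  show "tp ` {(x, y, z). A x y = 1 \<and> A y z = 1 \<and> A x z = 1} \<subseteq> triangles (copies_graph Gr)"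
    using triangle_iff by auto
  show "triangles (copies_graph Gr) \<subseteq> tp ` {(x, y, z). A x y = 1 \<and> A y z = 1 \<and> A x z = 1}"
  proof
    fix T assume T: "T \<in> triangles (copies_graph Gr)"
    have inj: "inj_on snd T"
    proof (rule inj_onI, rule ccontr)
      fix u w assume uw: "u \<in> T" "w \<in> T" "snd u = snd w" "u \<noteq> w"
      hence "{u, w} \<in> edges (copies_graph Gr)" using T unfolding triangles_def by blast
      then obtain x y a b where "{u, w} = {(x, a), (y, b)}" "a \<noteq> (b::nat)" by (auto simp: copies_graph_def)
      thus False using uw(3) by (auto simp: doubleton_eq_iff)
    qed
    have "snd ` T \<subseteq> {1, 2, 3}" using T unfolding triangles_def copies_graph_def copy_def by auto
    moreover have "card (snd ` T) = 3" using inj T by (simp add: card_image triangles_def)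
    ultimately have "snd ` T = {1, 2, 3}" by (intro card_subset_eq) auto
    hence "1 \<in> snd ` T" "2 \<in> snd ` T" "3 \<in> snd ` T" by simp_all
    then obtain u w r where m: "u \<in> T" "snd u = 1" "w \<in> T" "snd w = 2" "r \<in> T" "snd r = 3"
      by (elim imageE) simp
    have "{u, w, r} = T"
    proof (rule card_subset_eq)
      show "finite T" using T unfolding triangles_def by (auto intro: card_ge_0_finite)
      have "u \<noteq> w" "w \<noteq> r" "u \<noteq> r" using m by auto
      thus "card {u, w, r} = card T" using T by (simp add: triangles_def)
    qed (use m in auto)
    moreover have "u = (fst u, 1)" "w = (fst w, 2)" "r = (fst r, 3)" using m by (auto simp: prod_eq_iff)
    ultimately have "T = tp (fst u, fst w, fst r)" by auto
    moreover have "A (fst u) (fst w) = 1 \<and> A (fst w) (fst r) = 1 \<and> A (fst u) (fst r) = 1"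
      using T calculation triangle_iff by auto
    ultimately show "T \<in> tp ` {(x, y, z). A x y = 1 \<and> A y z = 1 \<and> A x z = 1}" by blast
  qed
qed

lemma hyperedge_iff:
  assumes T: "A x y = 1 \<and> A y z = 1 \<and> A x z = 1"
  shows "{(x, 1), (y, 2), (z, 3)} \<in> edges (copies_three_graph (restrict_to H U Gr)) \<longleftrightarrow> {x, y, z} \<in> edges H"
proof -
  have d: "x \<noteq> y" "y \<noteq> z" "x \<noteq> z" "x \<in> U" "y \<in> U" "z \<in> U"
    using A_one[of x y] A_one[of y z] A_one[of x z] T by simp_all
  have tri: "{x, y, z} \<in> triangles Gr"
    using T d A_sym[of y x] A_sym[of z y] A_sym[of z x] unfolding triangles_def by (auto simp: edge_iff)
  have "{(x, 1), (y, 2), (z, 3)} \<in> edges (copies_three_graph (restrict_to H U Gr)) \<longleftrightarrow>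
     (\<exists>x' y' z'. tp (x, y, z) = tp (x', y', z') \<and> {x', y', z'} \<in> edges H \<inter> triangles Gr)"
    by (simp add: copies_three_graph_def restrict_to_def)
  also have "\<dots> \<longleftrightarrow> {x, y, z} \<in> edges H \<inter> triangles Gr"
    unfolding inj_eq[OF tp_inj] prod.inject by blast
  finally show ?thesis using tri by simp
qed

lemma hyperedges_copies: "edges (copies_three_graph (restrict_to H U Gr))
   = tp ` {(x, y, z). (A x y = 1 \<and> A y z = 1 \<and> A x z = 1) \<and> {x, y, z} \<in> edges H}"
proof
  have "edges (copies_three_graph (restrict_to H U Gr)) \<subseteq> triangles (copies_graph Gr)"
    using tripartite_chain_copies[OF simple vertices_graph_of, of H] by (simp add: tripartite_chain_def)
  note sub = this
  show "edges (copies_three_graph (restrict_to H U Gr))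
     \<subseteq> tp ` {(x, y, z). (A x y = 1 \<and> A y z = 1 \<and> A x z = 1) \<and> {x, y, z} \<in> edges H}"
  proof
    fix T assume T: "T \<in> edges (copies_three_graph (restrict_to H U Gr))"
    hence "T \<in> tp ` {(x, y, z). A x y = 1 \<and> A y z = 1 \<and> A x z = 1}"
      using sub unfolding triangles_copies by (rule_tac subsetD)
    then obtain x y z where xyz: "T = {(x, 1), (y, 2), (z, 3)}" "A x y = 1 \<and> A y z = 1 \<and> A x z = 1"
      by (elim imageE) (simp split: prod.splits)
    hence "{x, y, z} \<in> edges H" using T hyperedge_iff[OF xyz(2), of H] by simp
    thus "T \<in> tp ` {(x, y, z). (A x y = 1 \<and> A y z = 1 \<and> A x z = 1) \<and> {x, y, z} \<in> edges H}"
      using xyz by (intro image_eqI[of _ _ "(x, y, z)"]) simp_all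
  qed
next
  show "tp ` {(x, y, z). (A x y = 1 \<and> A y z = 1 \<and> A x z = 1) \<and> {x, y, z} \<in> edges H}
     \<subseteq> edges (copies_three_graph (restrict_to H U Gr))"
  proof (rule image_subsetI, clarify)
    fix x y z assume "{x, y, z} \<in> edges H" "A x y = 1" "A y z = 1" "A x z = 1"
    thus "{(x, 1), (y, 2), (z, 3)} \<in> edges (copies_three_graph (restrict_to H U Gr))"
      using hyperedge_iff[of x y z H] by simp
  qed
qed

lemma card_triples_sum:
  assumes P: "\<And>x y z. P x y z \<Longrightarrow> x \<in> U \<and> y \<in> U \<and> z \<in> U"
  shows "real (card (tp ` {(x, y, z). P x y z})) = (\<Sum>x\<in>U. \<Sum>y\<in>U. \<Sum>z\<in>U. of_bool (P x y z))"
proof -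
  have "real (card (tp ` {(x, y, z). P x y z})) = real (card {(x, y, z). P x y z})"
    using card_image[OF inj_on_subset[OF tp_inj subset_UNIV]] by metis
  also have "\<dots> = real (card {q \<in> U \<times> U \<times> U. case q of (x, y, z) \<Rightarrow> P x y z})"
    by (intro arg_cong[where f="\<lambda>S. real (card S)"]) (use P in auto)
  also have "\<dots> = (\<Sum>q\<in>{q \<in> U \<times> U \<times> U. case q of (x, y, z) \<Rightarrow> P x y z}. 1)" by simp
  also have "\<dots> = (\<Sum>q\<in>U \<times> U \<times> U. if (case q of (x, y, z) \<Rightarrow> P x y z) then 1 else 0)"
    by (rule sum.inter_filter) (use finU in auto)
  also have "\<dots> = (\<Sum>x\<in>U. \<Sum>y\<in>U. \<Sum>z\<in>U. of_bool (P x y z))"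
    unfolding sum.cartesian_product by (rule sum.cong[OF refl]) (auto simp: of_bool_def)
  finally show ?thesis .
qed

lemma T_bool: "A x y * A y z * A x z = of_bool (A x y = 1 \<and> A y z = 1 \<and> A x z = 1)"
  using A01[of x y] A01[of y z] A01[of x z] by auto

lemma rel_density_copies:
  "rel_density (copies_three_graph (restrict_to H U Gr)) (copies_graph Gr)
   = (\<Sum>x\<in>U. \<Sum>y\<in>U. \<Sum>z\<in>U. of_bool ({x, y, z} \<in> edges H) * (A x y * A y z * A x z)) /
     (\<Sum>x\<in>U. \<Sum>y\<in>U. \<Sum>z\<in>U. A x y * A y z * A x z)"
proof -
  have s: "x \<in> U \<and> y \<in> U \<and> z \<in> U" if "A x y = 1 \<and> A y z = 1 \<and> A x z = 1" for x y z
    using that A_one[of x y] A_one[of y z] by simp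
  have "real (card (edges (copies_three_graph (restrict_to H U Gr))))
     = (\<Sum>x\<in>U. \<Sum>y\<in>U. \<Sum>z\<in>U. of_bool ((A x y = 1 \<and> A y z = 1 \<and> A x z = 1) \<and> {x, y, z} \<in> edges H))"
    unfolding hyperedges_copies by (rule card_triples_sum) (use s in blast)
  moreover have "real (card (triangles (copies_graph Gr)))
     = (\<Sum>x\<in>U. \<Sum>y\<in>U. \<Sum>z\<in>U. of_bool (A x y = 1 \<and> A y z = 1 \<and> A x z = 1))"
    unfolding triangles_copies by (rule card_triples_sum) (use s in blast)
  ultimately show ?thesis unfolding rel_density_def T_bool
    by (simp only: of_bool_conj mult_ac)
qed

text \<open>Brings the definition on three copies back to sums over \<open>U\<close>. All three
  densities equal \<open>\<rho>\<close>, so the product density is \<open>\<rho> ^ 3\<close> and its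
  fourth power \<open>\<rho> ^ 12\<close>.\<close>

lemma quasirandom_restrictionI:
  assumes cut: "\<And>P Q. P \<subseteq> U \<Longrightarrow> Q \<subseteq> U \<Longrightarrow> \<bar>\<Sum>x\<in>P. \<Sum>y\<in>Q. A x y - \<rho>\<bar> \<le> c * real (card U) ^ 2"
    and \<rho>01: "0 \<le> \<rho>" "\<rho> \<le> 1" and c: "4 * c \<le> \<psi> (\<rho> ^ 3)"
    and oct: "\<And>d f. d = (\<Sum>x\<in>U. \<Sum>y\<in>U. \<Sum>z\<in>U. of_bool ({x, y, z} \<in> edges H) * (A x y * A y z * A x z)) /
         (\<Sum>x\<in>U. \<Sum>y\<in>U. \<Sum>z\<in>U. A x y * A y z * A x z) \<Longrightarrow>
       (\<And>x y z. f x y z = (of_bool ({x, y, z} \<in> edges H) - d) * (A x y * A y z * A x z)) \<Longrightarrow>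
       octahedra U f \<le> \<eta> * \<rho> ^ 12 * real (card U) ^ 6"
  shows "quasirandom_restriction \<eta> \<psi> H U Gr"
proof -
  let ?H = "copies_three_graph (restrict_to H U Gr)" and ?G = "copies_graph Gr"
  define d where "d = rel_density ?H ?G"
  define f where "f x y z = (of_bool ({x, y, z} \<in> edges H) - d) * (A x y * A y z * A x z)" for x y z
  have bal: "rel_balanced ?H ?G (x, 1) (y, 2) (z, 3) = f x y z" for x y z
  proof (cases "A x y = 1 \<and> A y z = 1 \<and> A x z = 1")
    case True
    thus ?thesis using hyperedge_iff[OF True, of H] triangle_iff[of x y z]
      by (simp add: rel_balanced_def f_def d_def)
  next
    case False
    hence "A x y * A y z * A x z = 0" unfolding T_bool by simp
    moreover have "{(x, 1), (y, 2), (z, 3)} \<notin> triangles ?G" using False triangle_iff by blast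
    ultimately show ?thesis by (simp add: rel_balanced_def f_def)
  qed
  have pd: "product_density ?G (copy U 1) (copy U 2) (copy U 3) = \<rho> ^ 3"
    by (simp add: product_density_def density_copies power3_eq_cube)
  have "rel_quasirandom \<eta> ?H ?G (copy U 1) (copy U 2) (copy U 3)"
    unfolding rel_quasirandom_def Let_def sum_copy card_copy bal pd
  proof -
    have "octahedra U f \<le> \<eta> * \<rho> ^ 12 * real (card U) ^ 6"
      by (rule oct[of d]) (simp_all only: d_def rel_density_copies f_def)
    also have "\<dots> = \<eta> * (\<rho> ^ 3) ^ 4 * (real (card U))\<^sup>2 * (real (card U))\<^sup>2 * (real (card U))\<^sup>2"
      by (simp add: mult.assoc flip: power_mult power_add)
    finally show "octahedra U f
       \<le> \<eta> * (\<rho> ^ 3) ^ 4 * (real (card U))\<^sup>2 * (real (card U))\<^sup>2 * (real (card U))\<^sup>2" .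
  qed
  moreover have "quasirandom_tripartite (\<psi> (\<rho> ^ 3)) ?G (copy U 1) (copy U 2) (copy U 3)"
    unfolding quasirandom_tripartite_def
    by (intro conjI quasirandom_pair_copies[OF _ _ _ cut \<rho>01 c]) auto
  ultimately show ?thesis
    unfolding quasirandom_restriction_def quasirandom_chain_def pd
    using tripartite_chain_copies[OF simple vertices_graph_of] by blast
qed

end

text \<open>The block constants, rounded down to multiples of \<open>1 / L\<close>, colour the
  triples of parts with \<open>L + 1\<close> colours; the last colour is for the value 1. On a
  monochromatic set they lie in an interval of length \<open>1 / L\<close>.\<close>

lemma (in colour_system) choose_parts:
  assumes t: "t = ramsey_bound (L + 1) m" and L: "L > 0" and m: "m > 0"
    and e: "\<epsilon> \<le> 1" "\<gamma> \<le> 1" "real (m * s) \<ge> 7 / \<epsilon> ^ 5"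
  shows "\<exists>v I D. chosen_parts t s K Y \<chi> \<chi>' h \<epsilon> g \<gamma> \<zeta> v I D (1 / real L) m"
proof -
  obtain v where v: "\<forall>i<t. v i \<in> Y i" "\<forall>(i, j)\<in>pairs t. \<gamma> \<le> pdens i j (\<chi> {v i, v j})"
     "\<forall>(i, j, k)\<in>triples t. cavg (block i j k) (key3 \<chi>) (\<lambda>\<omega>. \<bar>h2 i j k \<omega>\<bar>) (v i, v j, v k) \<le> \<zeta>"
    using selection by (elim exE conjE)
  define H where "H i j k = h1 i j k (v i, v j, v k)" for i j k
  have H01: "0 \<le> H i j k \<and> H i j k \<le> 1" for i j k unfolding H_def by (rule h1_bounds)
  have H12: "H j i k = H i j k" if "i < t" "j < t" "k < t" for i j k
    unfolding H_def h1_def block_def by (rule cavg_triple_swap12) (use v(1) that in auto)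
  have H23: "H i k j = H i j k" if "i < t" "j < t" "k < t" for i j k
    unfolding H_def h1_def block_def by (rule cavg_triple_swap23) (use v(1) that in auto)
  define c where "c i j k = nat \<lfloor>real L * H i j k\<rfloor>" for i j k
  have cL: "c i j k < L + 1" for i j k
  proof -
    have "real L * H i j k \<le> real L * 1" using H01 by (intro mult_left_mono) auto
    hence "\<lfloor>real L * H i j k\<rfloor> \<le> int L" by linarith
    thus ?thesis by (simp add: c_def)
  qed
  have "\<exists>I a. I \<subseteq> {..<ramsey_bound (L + 1) m} \<and> card I = m \<and>
     (\<forall>i\<in>I. \<forall>j\<in>I. \<forall>k\<in>I. i < j \<longrightarrow> j < k \<longrightarrow> c i j k = a)"
    by (rule ramsey_triples[OF cL])
  then obtain I a where I: "I \<subseteq> {..<t}" "card I = m"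
    "\<forall>i\<in>I. \<forall>j\<in>I. \<forall>k\<in>I. i < j \<longrightarrow> j < k \<longrightarrow> c i j k = a" unfolding t by (elim exE conjE)
  \<comment> \<open>For \<open>m < 3\<close> no triple constrains \<open>a\<close>; the cap keeps
    \<open>D\<close> in the unit interval in every case.\<close>
  define D where "D = min 1 (real a / real L)"
  have near0: "\<bar>H i j k - D\<bar> \<le> 1 / real L" if m: "i \<in> I" "j \<in> I" "k \<in> I" "i < j" "j < k" for i j k
  proof -
    have "a = nat \<lfloor>real L * H i j k\<rfloor>" using I(3) m by (simp add: c_def)
    moreover have "0 \<le> real L * H i j k" using H01[of i j k] by simp
    ultimately have "real a \<le> real L * H i j k" "real L * H i j k < real a + 1" by linarith+
    hence "real a / real L \<le> H i j k" "H i j k < real a / real L + 1 / real L"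
      using L by (simp_all add: field_simps)
    thus ?thesis using H01[of i j k] by (auto simp: D_def min_def abs_le_iff)
  qed
  have near: "\<bar>H i j k - D\<bar> \<le> 1 / real L"
    if m: "i \<in> I" "j \<in> I" "k \<in> I" "i \<noteq> j" "j \<noteq> k" "i \<noteq> k" for i j k
  proof -
    have lt: "i < t" "j < t" "k < t" using m I(1) by auto
    consider "i < j" "j < k" | "i < k" "k < j" | "j < i" "i < k" | "j < k" "k < i" | "k < i" "i < j" | "k < j" "j < i"
      using m by linarith
    thus ?thesis
    proof cases
      case 1 thus ?thesis by (rule near0[OF m(1,2,3)])
    next
      case 2 thus ?thesis using near0[OF m(1,3,2)] H23[OF lt] by simp
    next
      case 3 thus ?thesis using near0[OF m(2,1,3)] H12[OF lt] by simp
    next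
      case 4 thus ?thesis using near0[OF m(2,3,1)] H12[OF lt] H23[OF lt(2,1,3)] by simp
    next
      case 5 thus ?thesis using near0[OF m(3,1,2)] H23[OF lt] H12[OF lt(1,3,2)] by simp
    next
      case 6 thus ?thesis using near0[OF m(3,2,1)] H12[OF lt] H23[OF lt(2,1,3)] H12[OF lt(2,3,1)] by simp
    qed
  qed
  have "chosen_parts t s K Y \<chi> \<chi>' h \<epsilon> g \<gamma> \<zeta> v I D (1 / real L) m"
  proof (intro chosen_parts.intro chosen_parts_axioms.intro colour_system_axioms)
    show "v i \<in> Y i" if "i < t" for i using v(1) that by blast
    show "\<gamma> \<le> pdens i j (\<chi> {v i, v j})" if "(i, j) \<in> pairs t" for i j using v(2) that by blast
    show "cavg (block i j k) (key3 \<chi>) (\<lambda>\<omega>. \<bar>h2 i j k \<omega>\<bar>) (v i, v j, v k) \<le> \<zeta>"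
      if "(i, j, k) \<in> triples t" for i j k using v(3) that by blast
    show "\<bar>h1 i j k (v i, v j, v k) - D\<bar> \<le> 1 / real L"
      if "i \<in> I" "j \<in> I" "k \<in> I" "i \<noteq> j" "j \<noteq> k" "i \<noteq> k" for i j k
      using near[OF that] by (simp add: H_def)
    show "1 / real L \<le> 1" using L by simp
  qed (use I m e in \<open>auto simp: D_def\<close>)
  thus ?thesis by blast
qed

text \<open>The true density of the rounded graph differs from \<open>p\<close> by at most
  \<open>3 * \<epsilon> \<le> p / 24\<close>. As \<open>(23 / 24) ^ 12\<close> is at least 1/2,
  passing from \<open>p ^ 12\<close> to its twelfth power costs the factor 2 in \<open>E3\<close>.
  \<open>E1\<close> ranges over an interval because the density is known only approximately.\<close>

lemma (in chosen_parts) quasirandom_subgraph: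
  assumes h: "h = (\<lambda>e. of_bool (e \<in> edges H))"
    and E1: "\<And>x. p / 2 \<le> x \<Longrightarrow> x \<le> 3 / 4 \<Longrightarrow> 24 * \<epsilon> \<le> \<psi> (x ^ 3)" and E2: "72 * \<epsilon> \<le> p"
    and E3: "2 * p ^ 12 * (\<rho> + 2 * \<zeta> + 3 / real m) + (18 * real m + 163) * \<epsilon> \<le> \<eta> * p ^ 12 / 2"
    and \<eta>: "\<eta> > 0"
  shows "\<exists>Gr. simple_graph Gr \<and> vertices Gr = U \<and> real (card (edges Gr)) \<ge> p / 4 * real (card U) ^ 2 \<and>
     quasirandom_restriction \<eta> \<psi> H U Gr"
proof -
  obtain A where A: "rounded A" using rounded_exists by blast
  have Ab: "A x y \<in> {0, 1}" "A x y = A y x" "A x y \<noteq> 0 \<Longrightarrow> x \<in> U \<and> y \<in> U \<and> x \<noteq> y" for x y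
    using A unfolding rounded_def by blast+
  interpret ig: indicator_graph U A
    by unfold_locales (use finU Ab in blast)+
  let ?r = "ig.\<rho>"
  have npos': "real n > 0" using npos by simp
  have cut: "\<bar>\<Sum>x\<in>P. \<Sum>y\<in>Q. A x y - p\<bar> \<le> 3 * \<epsilon> * real n ^ 2" if "P \<subseteq> U" "Q \<subseteq> U" for P Q
    using A that unfolding rounded_def by blast
  have rn: "(\<Sum>x\<in>U. \<Sum>y\<in>U. A x y) = ?r * real n ^ 2"
    using npos' by (simp add: ig.\<rho>_def cardU power2_eq_square)
  have rp: "\<bar>?r - p\<bar> \<le> 3 * \<epsilon>"
  proof -
    have "(\<Sum>x\<in>U. \<Sum>y\<in>U. A x y - p) = (?r - p) * real n ^ 2"
      using rn by (simp add: sum_subtractf cardU left_diff_distrib power2_eq_square)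
    hence "\<bar>?r - p\<bar> * real n ^ 2 \<le> 3 * \<epsilon> * real n ^ 2" using cut[of U U] by (simp add: abs_mult)
    thus ?thesis using npos' by simp
  qed
  have p2: "p \<le> 1 / 2" using \<gamma>1 by (simp add: p_def)
  have r_lo: "23 / 24 * p \<le> ?r" using rp E2 by (simp add: abs_le_iff)
  have r_hi: "?r \<le> 3 / 4" using rp E2 p2 by (simp add: abs_le_iff)
  have r01: "0 \<le> ?r" "?r \<le> 1" using r_lo r_hi p01 by auto
  have pr: "p ^ 12 / 2 \<le> ?r ^ 12"
  proof -
    have "p ^ 12 / 2 \<le> (23 / 24) ^ 12 * p ^ 12"
    proof -
      have "(1::real) / 2 \<le> (23 / 24) ^ 12" by (simp add: power_divide)
      hence "1 / 2 * p ^ 12 \<le> (23 / 24) ^ 12 * p ^ 12" by (rule mult_right_mono) (use p01 in simp)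
      thus ?thesis by simp
    qed
    also have "\<dots> = (23 / 24 * p) ^ 12" by (simp only: power_mult_distrib)
    also have "\<dots> \<le> ?r ^ 12" by (rule power_mono[OF r_lo]) (use p01 in simp)
    finally show ?thesis .
  qed
  have qr: "quasirandom_restriction \<eta> \<psi> H U ig.Gr"
  \<comment> \<open>\<open>3 * \<epsilon>\<close> for the cut error around \<open>p\<close> and
    another \<open>3 * \<epsilon>\<close> for replacing \<open>p\<close> by the true
    density.\<close>
  proof (rule ig.quasirandom_restrictionI[where c="6 * \<epsilon>"])
    show "\<bar>\<Sum>x\<in>P. \<Sum>y\<in>Q. A x y - ?r\<bar> \<le> 6 * \<epsilon> * real (card U) ^ 2" if PQ: "P \<subseteq> U" "Q \<subseteq> U" for P Q
    proof -
      have e: "(\<Sum>x\<in>P. \<Sum>y\<in>Q. A x y - ?r) = (\<Sum>x\<in>P. \<Sum>y\<in>Q. A x y - p) + (p - ?r) * (real (card P) * real (card Q))"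
        by (simp add: sum_subtractf algebra_simps)
      have "card P \<le> n" "card Q \<le> n" using PQ card_mono[OF finU] cardU by auto
      hence le: "real (card P) * real (card Q) \<le> real n * real n" by (intro mult_mono) auto
      have "\<bar>p - ?r\<bar> * (real (card P) * real (card Q)) \<le> 3 * \<epsilon> * (real n * real n)"
        by (rule mult_mono) (use rp \<epsilon> le in \<open>auto simp: abs_minus_commute\<close>)
      hence "\<bar>(p - ?r) * (real (card P) * real (card Q))\<bar> \<le> 3 * \<epsilon> * real n ^ 2"
        by (simp add: abs_mult power2_eq_square)
      thus ?thesis unfolding e cardU using cut[OF PQ] by linarith
    qed
    show "4 * (6 * \<epsilon>) \<le> \<psi> (?r ^ 3)" using E1[of ?r] r_lo r_hi p01 by simp
    fix d f
    assume d: "d = (\<Sum>x\<in>U. \<Sum>y\<in>U. \<Sum>z\<in>U. of_bool ({x, y, z} \<in> edges H) * (A x y * A y z * A x z)) /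
         (\<Sum>x\<in>U. \<Sum>y\<in>U. \<Sum>z\<in>U. A x y * A y z * A x z)"
      and f: "\<And>x y z. f x y z = (of_bool ({x, y, z} \<in> edges H) - d) * (A x y * A y z * A x z)"
    have "octahedra U f
     \<le> (p ^ 9 * (2 * (p ^ 3 * (\<rho> + 2 * \<zeta> + 3 / real m) + (9 * real m + 33) * \<epsilon>) + 8 * \<epsilon>)
         + 27 * (3 * \<epsilon>) + 8 * \<epsilon>) * real n ^ 6"
      by (rule octahedron_rounded[OF A, of d]) (simp_all add: d f h)
    also have "\<dots> \<le> (\<eta> * p ^ 12 / 2) * real n ^ 6"
    proof (rule mult_right_mono)
      have p9: "p ^ 9 \<le> 1" using p01 by (simp add: power_le_one)
      have "p ^ 9 * (2 * (p ^ 3 * (\<rho> + 2 * \<zeta> + 3 / real m) + (9 * real m + 33) * \<epsilon>) + 8 * \<epsilon>) + 27 * (3 * \<epsilon>) + 8 * \<epsilon>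
        = 2 * (p ^ 9 * p ^ 3) * (\<rho> + 2 * \<zeta> + 3 / real m) + p ^ 9 * ((18 * real m + 74) * \<epsilon>) + 89 * \<epsilon>"
        by (simp add: algebra_simps)
      also have "p ^ 9 * p ^ 3 = p ^ 12" by (simp flip: power_add)
      also have "p ^ 9 * ((18 * real m + 74) * \<epsilon>) \<le> 1 * ((18 * real m + 74) * \<epsilon>)"
        using p9 \<epsilon> by (intro mult_right_mono) auto
      finally show "p ^ 9 * (2 * (p ^ 3 * (\<rho> + 2 * \<zeta> + 3 / real m) + (9 * real m + 33) * \<epsilon>) + 8 * \<epsilon>) + 27 * (3 * \<epsilon>) + 8 * \<epsilon>
        \<le> \<eta> * p ^ 12 / 2" using E3 by (simp add: algebra_simps)
    qed simp
    also have "\<dots> \<le> (\<eta> * ?r ^ 12) * real n ^ 6"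
      using mult_left_mono[OF pr, of \<eta>] \<eta> by (intro mult_right_mono) auto
    finally show "octahedra U f \<le> \<eta> * ?r ^ 12 * real (card U) ^ 6"
      by (simp only: cardU)
  qed (use r01 in auto)
  have "p / 2 * real n ^ 2 \<le> ?r * real n ^ 2" using r_lo p01 by (intro mult_right_mono) auto
  hence "p / 4 * real (card U) ^ 2 \<le> real (card (edges ig.Gr))"
    using ig.edges_ge rn by (simp add: cardU)
  thus ?thesis using qr ig.simple by (intro exI[of _ ig.Gr]) simp
qed

section \<open>Parameters and tower bounds\<close>

text \<open>Divide out the zero at 0. The cofactor is positive on the interval from 0 to 1/2 and
  nonzero at 0, hence positive there by the intermediate value theorem, so it has a positive
  minimum. The interval stops at 1/2 because \<open>p\<close> may vanish at 1.\<close>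

lemma poly_lower_bound:
  fixes p :: "real poly"
  assumes pos: "\<And>x. 0 < x \<Longrightarrow> x < 1 \<Longrightarrow> poly p x > 0"
  shows "\<exists>c a. 0 < c \<and> c \<le> 1 \<and> (\<forall>x. 0 < x \<longrightarrow> x \<le> 1 / 2 \<longrightarrow> c * x ^ a \<le> poly p x)"
proof -
  have "p \<noteq> 0" using pos[of "1/2"] by auto
  then obtain q where q: "p = [:- 0, 1:] ^ order 0 p * q" "\<not> [:- 0, 1:] dvd q"
    using order_decomp by blast
  have q0: "poly q 0 \<noteq> 0" using q(2) by (simp add: poly_eq_0_iff_dvd)
  have pq: "poly p x = x ^ order 0 p * poly q x" for x
    by (subst q(1)) (simp add: poly_mult poly_power)
  have qpos: "poly q x > 0" if "0 < x" "x \<le> 1 / 2" for x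
    using pos[of x] that pq[of x] by (auto simp: zero_less_mult_iff)
  have q00: "poly q 0 > 0"
  proof (rule ccontr)
    assume "\<not> ?thesis"
    hence "poly q 0 < 0" using q0 by simp
    then obtain x where "0 < x" "x < 1/2" "poly q x = 0"
      using poly_IVT_pos[of 0 "1/2" q] qpos[of "1/2"] by auto
    thus False using qpos[of x] by simp
  qed
  have "\<exists>x\<in>{0..1/2}. \<forall>y\<in>{0..1/2}. poly q x \<le> poly q y"
    by (rule continuous_attains_inf) (auto intro!: continuous_intros)
  then obtain x0 where x0: "x0 \<in> {0..1/2}" "\<And>y. y \<in> {0..1/2} \<Longrightarrow> poly q x0 \<le> poly q y" by blast
  have c0: "poly q x0 > 0" using q00 qpos[of x0] x0(1) by (cases "x0 = 0") auto
  show ?thesis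
  proof (intro exI[of _ "min 1 (poly q x0)"] exI[of _ "order 0 p"] conjI allI impI)
    fix x :: real assume x: "0 < x" "x \<le> 1 / 2"
    have "min 1 (poly q x0) \<le> poly q x" using x0(2)[of x] x by simp
    hence "min 1 (poly q x0) * x ^ order 0 p \<le> poly q x * x ^ order 0 p"
      by (rule mult_right_mono) (use x in simp)
    thus "min 1 (poly q x0) * x ^ order 0 p \<le> poly p x" by (simp add: pq mult.commute)
  qed (use c0 in auto)
qed

section \<open>Growth of the parameters along the tower\<close>

lemma twr_nat_ge: "real n + 1 \<le> twr_nat n"
proof (induction n)
  case (Suc n)
  have "real n + 1 + 1 \<le> 2 ^ (n + 1)"
    using of_nat_mono[OF less_exp[of "n + 1", THEN Suc_leI], where 'a=real] by simp
  also have "\<dots> = 2 powr (real n + 1)" by (simp add: powr_add powr_realpow)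
  also have "\<dots> \<le> 2 powr twr_nat n" using Suc by simp
  finally show ?case by simp
qed simp

lemma twr_nat_Suc_ge: "twr_nat n \<le> twr_nat (Suc n)"
  by (induction n) simp_all

lemma twr_nat_mono: "m \<le> n \<Longrightarrow> twr_nat m \<le> twr_nat n"
  by (rule lift_Suc_mono_le[of twr_nat, OF twr_nat_Suc_ge])

lemma power_le_exp2: "\<exists>N. \<forall>y\<ge>N. y ^ C \<le> (2::nat) ^ y"
proof -
  have "((\<lambda>x::real. x ^ C / exp x) \<longlongrightarrow> 0) at_top" by (rule tendsto_power_div_exp_0)
  hence "eventually (\<lambda>x::real. x ^ C / exp x < (ln (2::real)) ^ C) at_top"
    by (rule order_tendstoD(2)) simp
  then obtain X where X: "\<And>x. x \<ge> X \<Longrightarrow> x ^ C / exp x < (ln (2::real)) ^ C"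
    unfolding eventually_at_top_linorder by blast
  show ?thesis
  proof (intro exI[of _ "nat \<lceil>X / ln 2\<rceil>"] allI impI)
    fix y assume "nat \<lceil>X / ln 2\<rceil> \<le> y"
    hence "X / ln 2 \<le> real y" by linarith
    hence "X \<le> real y * ln 2" by (simp add: divide_le_eq)
    from X[OF this] have "(real y * ln 2) ^ C < (ln 2) ^ C * exp (real y * ln 2)"
      by (simp add: divide_less_eq)
    also have "exp (real y * ln 2) = 2 ^ y" by (simp add: exp_of_nat_mult)
    finally have "real y ^ C < 2 ^ y" by (simp add: power_mult_distrib)
    hence "real (y ^ C) < real (2 ^ y)" by simp
    thus "y ^ C \<le> 2 ^ y" by linarith
  qed
qed

text \<open>The number that drives a round: it bounds the number of colours, and the other
  thresholds are powers of it up to constants. With the exponent used later, the next stage absorbs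
  both the new number of colours and the factor by which the parts shrink.\<close>

primrec stage :: "nat \<Rightarrow> nat \<Rightarrow> nat \<Rightarrow> nat" where
  "stage C y0 0 = y0"
| "stage C y0 (Suc r) = 2 ^ (stage C y0 r ^ C)"

lemma stage_mono:
  assumes "C > 0" "r \<le> r'"
  shows "stage C y0 r \<le> stage C y0 r'"
  using assms(2)
proof (induction r' rule: dec_induct)
  case (step n)
  have "stage C y0 n \<le> stage C y0 n ^ C" using assms(1) by (cases "stage C y0 n = 0") (auto simp: self_le_power)
  also have "\<dots> < 2 ^ (stage C y0 n ^ C)" by (rule less_exp)
  finally show ?case using step by simp
qed simp

text \<open>A round costs two levels: one for its exponential and one for
  \<open>y ^ C \<le> 2 ^ y\<close>.\<close>

lemma stage_le_twr:
  assumes "C > 0" and big: "\<And>y. y \<ge> y0 \<Longrightarrow> y ^ C \<le> (2::nat) ^ y"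
  shows "real (stage C y0 r) \<le> twr_nat (y0 + 2 * r)"
proof (induction r)
  case 0
  show ?case using twr_nat_ge[of y0] by simp
next
  case (Suc r)
  let ?y = "stage C y0 r"
  have "y0 \<le> ?y" using stage_mono[OF assms(1), of 0 r y0] by simp
  hence "?y ^ C \<le> 2 ^ ?y" by (rule big)
  hence "(2::nat) ^ (?y ^ C) \<le> 2 ^ (2 ^ ?y)" by (rule power_increasing) simp
  hence "real (stage C y0 (Suc r)) \<le> real (2 ^ (2 ^ ?y))" unfolding stage.simps by (rule of_nat_mono)
  also have "\<dots> = 2 powr (2 powr real ?y)" by (simp add: powr_realpow powr_realpow[of 2 "2 ^ ?y", simplified])
  also have "\<dots> \<le> 2 powr (2 powr twr_nat (y0 + 2 * r))" using Suc by simp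
  finally show ?case by simp
qed

text \<open>One round with \<open>y\<close> colours, where \<open>1 / z\<close> plays the role of
  \<open>\<eta>\<close>. As \<open>y\<close> dominates \<open>z\<close>, \<open>t\<close> and
  \<open>1 / c\<close>, every requirement reduces to comparing exponents of
  \<open>y\<close>.\<close>

locale parameters =
  fixes z t a :: nat and c :: real and y :: nat
  assumes z: "1 \<le> z" "z \<le> y" and t: "1 \<le> t" "t \<le> y" and y: "16 \<le> y" "15 * a + 55 \<le> y"
    and c: "0 < c" "1 / c \<le> real y"
begin

text \<open>\<open>15 * a\<close> is for \<open>\<psi>\<close>, which is evaluated at the cube of a
  density at least \<open>1 / y ^ 5\<close> and bounded below by an \<open>a\<close>-th power. The
  54 is for the octahedron: 48 since \<open>p ^ 12\<close> is at least \<open>1 / y ^ 48\<close>, 2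
  for \<open>z ^ 2\<close> and 4 for the numerical constant.\<close>

definition B where "B = 15 * a + 54"
definition eps :: real where "eps = 1 / real y ^ B"
text \<open>With \<open>\<zeta> = 1 / (48 * z)\<close>, the failure bound
  \<open>t ^ 3 * (sqrt gain / \<zeta>)\<close> is exactly 1/4.\<close>

definition gain :: real where "gain = (1 / (192 * real z * real t ^ 3))\<^sup>2"
definition lam :: real where "lam = gain / (2 * real y ^ 3)"
text \<open>With \<open>\<gamma> = 2 * pp\<close> and \<open>y\<close> colours the union bound over
  rare colours is exactly 1/4.\<close>

definition pp :: real where "pp = 1 / (8 * real t ^ 2 * real y)"

lemma ry: "real y \<ge> 16" "real y > 0" "1 \<le> real y" "1 \<le> real z" "real z \<le> real y" "1 \<le> real t" "real t \<le> real y"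
    "0 < real z" "0 < real t"
  using z t y by auto

lemma eps_pos: "0 < eps" "eps \<le> 1"
  using ry by (auto simp: eps_def one_le_power)

lemma gain_lower: "1 / real y ^ 12 \<le> gain" and gain_pos: "0 < gain" and gain_le: "gain \<le> 1"
proof -
  have "192 * real z * real t ^ 3 \<le> real y ^ 2 * real y * real y ^ 3"
  proof (intro mult_mono power_mono)
    have "(16::real) ^ 2 \<le> real y ^ 2" using ry by (intro power_mono) auto
    thus "192 \<le> real y ^ 2" by simp
  qed (use ry in auto)
  also have "\<dots> = real y ^ 6" by (simp add: eval_nat_numeral)
  finally have le: "192 * real z * real t ^ 3 \<le> real y ^ 6" .
  have "1 * 1 * 1 \<le> 192 * real z * real t ^ 3" using ry by (intro mult_mono) (auto simp: one_le_power)
  hence ge: "1 \<le> 192 * real z * real t ^ 3" by simp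
  have "1 / real y ^ 6 \<le> 1 / (192 * real z * real t ^ 3)" using le ge ry by (intro divide_left_mono) auto
  hence "(1 / real y ^ 6)\<^sup>2 \<le> gain" unfolding gain_def by (rule power_mono) simp
  thus "1 / real y ^ 12 \<le> gain" by (simp add: power_divide flip: power_mult)
  show "0 < gain" using ry by (simp add: gain_def zero_less_power2)
  have "1 / (192 * real z * real t ^ 3) \<le> 1" using ge by simp
  thus "gain \<le> 1" unfolding gain_def by (rule power_le_one[rotated]) simp
qed

lemma lam_pos: "0 < lam" using gain_pos ry by (simp add: lam_def)

lemma cond_q: "4 \<le> real (4 * y ^ B) * eps"
  using ry by (simp add: eps_def)

lemma cond_lam: "lam * (real t ^ 2 * real y) \<le> gain / 2"
proof -
  have "real t ^ 2 * real y \<le> real y ^ 2 * real y" using ry by (intro mult_right_mono power_mono) auto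
  hence "lam * (real t ^ 2 * real y) \<le> lam * real y ^ 3"
    using lam_pos by (intro mult_left_mono) (auto simp: power3_eq_cube power2_eq_square)
  also have "\<dots> = gain / 2" using ry by (simp add: lam_def)
  finally show ?thesis .
qed

text \<open>\<open>eps\<^sup>2\<close> costs \<open>2 * B\<close> powers of \<open>y\<close>,
  \<open>lam\<close> costs 15 and the energy bound 3; the last two pay for the constants.\<close>

lemma cond_L: "real t ^ 3 + lam * (real t ^ 2 * real y) < real (y ^ (2 * B + 20)) * (lam * eps\<^sup>2 / 4)"
proof -
  have t3: "real t ^ 3 \<le> real y ^ 3" using ry by (intro power_mono) auto
  have e: "real (y ^ (2 * B + 20)) * (lam * eps\<^sup>2 / 4) = real y ^ 17 * gain / 8"
    using ry by (simp add: lam_def eps_def power_add power_divide field_simps power_mult eval_nat_numeral)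
  have "real y ^ 17 * (1 / real y ^ 12) \<le> real y ^ 17 * gain" using gain_lower by (intro mult_left_mono) auto
  moreover have "real y ^ 17 * (1 / real y ^ 12) = real y ^ 5" using ry by (simp add: field_simps flip: power_add)
  ultimately have "real y ^ 5 \<le> real y ^ 17 * gain" by simp
  moreover have "8 * (2 * real y ^ 3) < real y ^ 5"
  proof -
    have "(16::real) ^ 2 \<le> real y ^ 2" using ry by (intro power_mono) auto
    hence "256 * real y ^ 3 \<le> real y ^ 2 * real y ^ 3" by (intro mult_right_mono) auto
    moreover have "real y ^ 2 * real y ^ 3 = real y ^ 5" by (simp flip: power_add)
    moreover have "0 < real y ^ 3" using ry by simp
    ultimately show ?thesis by linarith
  qed
  moreover have "1 \<le> real y ^ 3" using ry by (simp add: one_le_power)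
  ultimately show ?thesis unfolding e using t3 cond_lam gain_le by linarith
qed

lemma cond_M: "real t ^ 3 < real (y ^ (2 * B + 4)) * eps\<^sup>2"
proof -
  have e: "real (y ^ (2 * B + 4)) * eps\<^sup>2 = real y ^ 4"
    using ry by (simp add: eps_def power_add power_divide power_even_eq)
  have "real t ^ 3 \<le> real y ^ 3" using ry by (intro power_mono) auto
  also have "\<dots> < real y ^ 4" using ry by (intro power_strict_increasing) auto
  finally show ?thesis unfolding e .
qed

lemma cond_K: "2 ^ (y ^ (2 * B + 4)) * y \<le> 2 ^ (y ^ (2 * B + 22))"
proof -
  have "2 ^ (y ^ (2 * B + 4)) * y \<le> 2 ^ (y ^ (2 * B + 4)) * 2 ^ y"
    by (intro mult_left_mono) (auto intro: less_imp_le less_exp)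
  also have "\<dots> = 2 ^ (y ^ (2 * B + 4) + y)" by (simp add: power_add)
  also have "\<dots> \<le> 2 ^ (y ^ (2 * B + 22))"
  proof (rule power_increasing)
    have "y ^ 1 \<le> y ^ (2 * B + 4)" using y by (intro power_increasing) auto
    hence "y ^ (2 * B + 4) + y \<le> 2 * y ^ (2 * B + 4)" by simp
    also have "\<dots> \<le> y ^ 18 * y ^ (2 * B + 4)"
    proof (rule mult_right_mono)
      have "y ^ 1 \<le> y ^ 18" using y by (intro power_increasing) auto
      thus "2 \<le> y ^ 18" using y by simp
    qed simp
    also have "\<dots> = y ^ (2 * B + 22)" by (simp add: add.commute flip: power_add)
    finally show "y ^ (2 * B + 4) + y \<le> y ^ (2 * B + 22)" .
  qed simp
  finally show ?thesis .
qed

lemma cond_shrink: "(4 * y ^ B) ^ (y ^ (2 * B + 20)) \<le> 2 ^ (y ^ (2 * B + 22))"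
proof -
  have "4 * y ^ B \<le> y * y ^ B" using y by (intro mult_right_mono) auto
  also have "\<dots> = y ^ (B + 1)" by simp
  also have "\<dots> \<le> (2 ^ y) ^ (B + 1)" by (intro power_mono) (auto intro: less_imp_le less_exp)
  also have "\<dots> = 2 ^ (y * (B + 1))" by (rule power_mult[symmetric])
  also have "\<dots> \<le> 2 ^ (y * y)" using y by (intro power_increasing mult_left_mono) (auto simp: B_def)
  finally have "(4 * y ^ B) ^ (y ^ (2 * B + 20)) \<le> (2 ^ (y * y)) ^ (y ^ (2 * B + 20))" by (intro power_mono) auto
  also have "\<dots> = 2 ^ (y * y * y ^ (2 * B + 20))" by (rule power_mult[symmetric])
  also have "y * y * y ^ (2 * B + 20) = y ^ (2 * B + 22)" by (simp add: eval_nat_numeral)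
  finally show ?thesis .
qed

lemma pp_lower: "1 / real y ^ 4 \<le> pp" and pp_pos: "0 < pp" and pp_le: "2 * pp \<le> 1"
proof -
  have "8 * real t ^ 2 * real y \<le> real y * real y ^ 2 * real y" using ry by (intro mult_mono power_mono) auto
  also have "\<dots> = real y ^ 4" by (simp add: eval_nat_numeral)
  finally have le: "8 * real t ^ 2 * real y \<le> real y ^ 4" .
  have "8 * 1 * 1 \<le> 8 * real t ^ 2 * real y" using ry by (intro mult_mono) (auto simp: one_le_power)
  hence ge: "8 \<le> 8 * real t ^ 2 * real y" by simp
  show "1 / real y ^ 4 \<le> pp" unfolding pp_def using le ge ry by (intro divide_left_mono) auto
  show "0 < pp" unfolding pp_def using ry by simp
  have "1 / (8 * real t ^ 2 * real y) \<le> 1 / 8" using ge by (intro divide_left_mono) auto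
  thus "2 * pp \<le> 1" unfolding pp_def by linarith
qed

text \<open>Numerical constants are traded for powers of \<open>y\<close>, which is at least 16:
  \<open>j\<close> powers are spent on \<open>C\<close> and \<open>k\<close> are kept.\<close>

lemma eps_le_power:
  assumes "k + j \<le> B" "real C \<le> 16 ^ j"
  shows "real C * eps \<le> 1 / real y ^ k"
proof -
  have "(16::real) ^ j \<le> real y ^ j" using ry by (intro power_mono) auto
  hence "real C \<le> real y ^ j" using assms(2) by linarith
  hence "real C * real y ^ k \<le> real y ^ j * real y ^ k" by (intro mult_right_mono) auto
  also have "\<dots> \<le> real y ^ B" unfolding power_add[symmetric] using assms(1) ry by (intro power_increasing) auto
  finally show ?thesis using ry by (simp add: eps_def field_simps)
qed

lemma cond_gamma3: "2 * eps \<le> (2 * pp) ^ 3"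
proof -
  have "real 2 * eps \<le> 1 / real y ^ 12" by (rule eps_le_power[where j=1]) (auto simp: B_def)
  also have "\<dots> = (1 / real y ^ 4) ^ 3" by (simp add: power_divide flip: power_mult)
  also have "\<dots> \<le> (2 * pp) ^ 3" using pp_lower pp_pos by (intro power_mono) auto
  finally show ?thesis by simp
qed

lemma cond_density: "72 * eps \<le> pp"
proof -
  have "real 72 * eps \<le> 1 / real y ^ 4" by (rule eps_le_power[where j=2]) (auto simp: B_def)
  thus ?thesis using pp_lower by simp
qed

text \<open>The three main errors are balanced at \<open>1 / (24 * z)\<close> each and together use
  half of the right-hand side; the \<open>eps\<close> term receives the other half.\<close>

lemma cond_octahedron: "2 * pp ^ 12 * (1 / real (24 * z) + 2 * (1 / (48 * real z)) + 3 / real (72 * z)) + (18 * real (72 * z) + 163) * eps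
   \<le> 1 / real z * pp ^ 12 / 2"
proof -
  have "(18 * real (72 * z) + 163) * eps * (4 * real z) = (5184 * real z ^ 2 + 652 * real z) * eps"
    by (simp add: algebra_simps power2_eq_square)
  also have "\<dots> \<le> (5836 * real y ^ 2) * eps"
  proof (intro mult_right_mono)
    have "real z ^ 2 \<le> real y ^ 2" using ry by (intro power_mono) auto
    moreover have "real z * 1 \<le> real y * real y" using ry by (intro mult_mono) auto
    ultimately show "5184 * real z ^ 2 + 652 * real z \<le> 5836 * real y ^ 2" by (simp add: power2_eq_square)
  qed (use eps_pos in simp)
  also have "\<dots> = real y ^ 2 * (real 5836 * eps)" by simp
  also have "\<dots> \<le> real y ^ 2 * (1 / real y ^ 50)"
    by (intro mult_left_mono eps_le_power[where j=4]) (auto simp: B_def)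
  also have "\<dots> = (1 / real y ^ 4) ^ 12" using ry by (simp add: power_divide field_simps flip: power_mult power_add)
  also have "\<dots> \<le> pp ^ 12" using pp_lower by (intro power_mono) auto
  finally have 1: "(18 * real (72 * z) + 163) * eps \<le> pp ^ 12 / (4 * real z)"
    using ry by (simp add: pos_le_divide_eq)
  have e1: "2 * pp ^ 12 * (1 / real (24 * z) + 2 * (1 / (48 * real z)) + 3 / real (72 * z)) = pp ^ 12 / (4 * real z)"
    using ry by (simp add: field_simps)
  have e2: "1 / real z * pp ^ 12 / 2 = pp ^ 12 / (4 * real z) + pp ^ 12 / (4 * real z)"
    using ry by (simp add: field_simps)
  show ?thesis unfolding e1 e2 using 1 by (rule add_left_mono)
qed

lemma cond_psi:
  assumes \<psi>: "\<And>x. 0 < x \<Longrightarrow> x \<le> 1 / 2 \<Longrightarrow> c * x ^ a \<le> \<psi> x" and x: "pp / 2 \<le> x" "x \<le> 3 / 4"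
  shows "24 * eps \<le> \<psi> (x ^ 3)"
proof -
  have x0: "0 < x" using x pp_pos by linarith
  have "2 * real y ^ 4 \<le> real y * real y ^ 4" using ry by (intro mult_right_mono) auto
  hence "1 / real y ^ 5 \<le> 1 / (2 * real y ^ 4)" using ry by (intro divide_left_mono) (auto simp: eval_nat_numeral)
  also have "\<dots> \<le> x" using pp_lower x by simp
  finally have "(1 / real y ^ 5) ^ (3 * a) \<le> x ^ (3 * a)" using ry by (intro power_mono) auto
  hence xa: "1 / real y ^ (15 * a) \<le> (x ^ 3) ^ a" by (simp add: power_divide mult.assoc flip: power_mult)
  \<comment> \<open>\<open>x\<close> itself may exceed 1/2, but the lower bound for
    \<open>\<psi>\<close> is invoked at its cube only.\<close>
  have "x ^ 3 \<le> (3 / 4) ^ 3" using x x0 by (intro power_mono) auto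
  hence x3: "x ^ 3 \<le> 1 / 2" by (simp add: power_divide)
  have cy: "1 / real y \<le> c" using c ry by (simp add: field_simps)
  have "real 24 * eps \<le> 1 / real y ^ (15 * a + 1)" by (rule eps_le_power[where j=2]) (auto simp: B_def)
  also have "\<dots> = 1 / real y * (1 / real y ^ (15 * a))" by simp
  also have "\<dots> \<le> c * (x ^ 3) ^ a" using cy xa c ry by (intro mult_mono) auto
  also have "\<dots> \<le> \<psi> (x ^ 3)" by (rule \<psi>) (use x0 x3 in auto)
  finally show ?thesis by simp
qed

end

section \<open>Assembly and the size of the bound\<close>

lemma disjoint_subsets_exist:
  assumes fin: "finite V" and c: "t * w \<le> card V"
  shows "\<exists>Y :: nat \<Rightarrow> 'a set. (\<forall>i<t. Y i \<subseteq> V \<and> card (Y i) = w) \<and>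
     (\<forall>i<t. \<forall>j<t. i \<noteq> j \<longrightarrow> Y i \<inter> Y j = {})"
proof -
  obtain f where f: "bij_betw f {0..<card V} V" using ex_bij_betw_nat_finite[OF fin] by blast
  define J where "J i = {i * w..<i * w + w}" for i
  have J: "J i \<subseteq> {0..<card V}" if "i < t" for i
  proof -
    have "(i + 1) * w \<le> t * w" using that by (intro mult_right_mono) auto
    thus ?thesis using c by (auto simp: J_def)
  qed
  have inj: "inj_on f {0..<card V}" using f by (rule bij_betw_imp_inj_on)
  have Jd: "J i \<inter> J j = {}" if "i \<noteq> j" for i j
  proof -
    have "\<not> (x \<in> J i \<and> x \<in> J j)" if ij: "i < j" for x i j
    proof
      assume "x \<in> J i \<and> x \<in> J j"
      moreover have "(i + 1) * w \<le> j * w" using ij by (intro mult_right_mono) auto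
      ultimately show False by (auto simp: J_def)
    qed
    from this[of i j] this[of j i] show ?thesis using that by (cases "i < j") auto
  qed
  show ?thesis
  proof (intro exI[of _ "\<lambda>i. f ` J i"] conjI allI impI)
    fix i assume i: "i < t"
    show "f ` J i \<subseteq> V" using J[OF i] f by (auto simp: bij_betw_def)
    show "card (f ` J i) = w"
      using card_image[OF inj_on_subset[OF inj J[OF i]]] by (simp add: J_def)
    fix j assume j: "j < t" "i \<noteq> j"
    show "f ` J i \<inter> f ` J j = {}"
      using inj_on_image_Int[OF inj J[OF i] J[OF j(1)]] Jd[OF j(2)] by simp
  qed
qed

locale construction =
  fixes z a :: nat and c :: real and \<psi> :: "real \<Rightarrow> real" and y0 :: nat
  assumes z: "1 \<le> z" and c: "0 < c" and \<psi>: "\<And>x. 0 < x \<Longrightarrow> x \<le> 1 / 2 \<Longrightarrow> c * x ^ a \<le> \<psi> x"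
    and y0: "16 \<le> y0" "15 * a + 55 \<le> y0" "z \<le> y0" "1 / c \<le> real y0"
      "ramsey_bound (24 * z + 1) (72 * z) \<le> y0"
begin

definition t where "t = ramsey_bound (24 * z + 1) (72 * z)"
definition B where "B = 15 * a + 54"
definition C where "C = 2 * B + 22"
text \<open>Just above \<open>2 * t ^ 3 / gain\<close>: the triple energy is at most
  \<open>t ^ 3\<close>, and an unsuccessful round gains at least half of
  \<open>gain\<close>.\<close>

definition R where "R = 2 * 192 ^ 2 * z ^ 2 * t ^ 9 + 1"
definition Y where "Y r = stage C y0 r"
definition S where "S = shrink (\<lambda>r. 4 * Y r ^ B) (\<lambda>r. Y r ^ (2 * B + 20)) 0 R"
text \<open>The reciprocal of \<open>\<delta>\<close>. The factor \<open>t * S\<close> is lost by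
  splitting and shrinking; the power of \<open>Y R\<close> leaves the \<open>7 / eps ^ 5\<close>
  vertices that rounding asks for and dominates the reciprocal of the edge density.\<close>

definition N0 where "N0 = 448 * t * S * Y R ^ (5 * B + 3)"

lemma t_pos: "1 \<le> t"
  by (simp add: t_def ramsey_bound_def Let_def)

lemma Y_mono: "r \<le> r' \<Longrightarrow> Y r \<le> Y r'"
  unfolding Y_def by (rule stage_mono) (simp add: C_def)

lemma Y_ge: "y0 \<le> Y r"
  using Y_mono[of 0 r] by (simp add: Y_def)

lemma params: "parameters z t a c (Y r)"
proof
  have "real y0 \<le> real (Y r)" using Y_ge by simp
  thus "1 / c \<le> real (Y r)" using y0(4) by linarith
qed (use z c t_pos y0 Y_ge[of r] in \<open>auto simp: t_def\<close>)

lemma paramB: "parameters.B a = B"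
  using parameters.B_def[OF params] by (simp add: B_def)

lemma Y_Suc: "Y (Suc r) = 2 ^ (Y r ^ (2 * B + 22))"
  by (simp add: Y_def C_def)

lemma S_pos: "S > 0"
proof -
  have "Y r > 0" for r using Y_ge[of r] y0 by linarith
  thus ?thesis by (auto simp: S_def shrink_def)
qed

lemma R_cond: "real t ^ 3 < real R * (parameters.gain z t / 2)"
proof -
  have g: "parameters.gain z t = (1 / (192 * real z * real t ^ 3))\<^sup>2"
    using parameters.gain_def[OF params] .
  have "real R = 2 * 192 ^ 2 * real z ^ 2 * real t ^ 9 + 1" by (simp add: R_def)
  hence "real R * (parameters.gain z t / 2)
     = (2 * 192 ^ 2 * real z ^ 2 * real t ^ 9) * (parameters.gain z t / 2) + parameters.gain z t / 2"
    by (simp add: distrib_right)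
  also have "(2 * 192 ^ 2 * real z ^ 2 * real t ^ 9) * (parameters.gain z t / 2) = real t ^ 3"
    unfolding g using z t_pos by (simp add: power_divide power_mult_distrib field_simps flip: power_mult power_add)
  finally show ?thesis using parameters.gain_pos[OF params] by simp
qed

lemma quasirandom_subset_exists:
  fixes H :: "'a hgraph"
  assumes H: "three_graph H" and big: "N0 \<le> card (vertices H)"
  shows "\<exists>U G. U \<subseteq> vertices H \<and> simple_graph G \<and> vertices G = U \<and>
     real (card U) \<ge> 1 / real N0 * real (card (vertices H)) \<and>
     real (card (edges G)) \<ge> 1 / real N0 * real (card U) ^ 2 \<and>
     quasirandom_restriction (1 / real z) \<psi> H U G"
proof -
  let ?V = "vertices H" and ?h = "\<lambda>e. of_bool (e \<in> edges H) :: real"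
  have finV: "finite ?V" using H by (simp add: uniform_hgraph_def)
  have Yp: "1 \<le> Y r" for r using Y_ge[of r] y0 by linarith
  have YRp: "1 \<le> Y R ^ k" for k using Yp[of R] by (simp add: one_le_power)
  define w where "w = t * S"
  have w: "w > 0" using t_pos S_pos by (simp add: w_def)
  define s0 where "s0 = card ?V div w"
  have s0_lo: "448 * Y R ^ (5 * B + 3) \<le> s0"
  proof -
    have "448 * Y R ^ (5 * B + 3) * w \<le> card ?V" using big by (simp add: N0_def w_def mult_ac)
    thus ?thesis using w by (simp add: s0_def less_eq_div_iff_mult_less_eq)
  qed
  have s0_pos: "s0 > 0" using s0_lo YRp[of "5 * B + 3"] by linarith
  \<comment> \<open>Rounding the quotient down loses at most a factor 2.\<close>
  have Vs0: "card ?V \<le> 2 * s0 * w"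
  proof -
    have "card ?V = s0 * w + card ?V mod w" by (simp add: s0_def)
    moreover have "card ?V mod w < w" using w by simp
    moreover have "1 * w \<le> s0 * w" using s0_pos by (intro mult_right_mono) auto
    moreover have "2 * s0 * w = s0 * w + s0 * w" by simp
    ultimately show ?thesis by linarith
  qed
  have "t * (S * s0) \<le> card ?V" by (simp add: s0_def w_def[symmetric] flip: mult.assoc)
  from disjoint_subsets_exist[OF finV this] obtain X where
    X: "\<forall>i<t. X i \<subseteq> ?V \<and> card (X i) = S * s0" "\<forall>i<t. \<forall>j<t. i \<noteq> j \<longrightarrow> X i \<inter> X j = {}" by blast
  have "\<exists>r Y' s \<chi> \<chi>'. r < R \<and> s0 \<le> s \<and> (\<forall>i<t. Y' i \<subseteq> X i \<and> card (Y' i) = s) \<and>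
     good_system t s (parameters.eps a (Y r)) (parameters.gain z t) (Y r) Y' \<chi> \<chi>' ?h"
  proof (rule good_system_exists[where q="\<lambda>r. 4 * Y r ^ B" and L="\<lambda>r. Y r ^ (2 * B + 20)"
        and \<theta>="\<lambda>r. parameters.lam z t (Y r)" and M="\<lambda>r. Y r ^ (2 * B + 4)"])
    show "0 < parameters.eps a (Y r)" for r by (rule parameters.eps_pos(1)[OF params])
    show "4 \<le> real (4 * Y r ^ B) * parameters.eps a (Y r)" for r
      using parameters.cond_q[OF params, of r] unfolding paramB .
    show "0 < parameters.lam z t (Y r)" for r by (rule parameters.lam_pos[OF params])
    show "parameters.lam z t (Y r) * ((real t)\<^sup>2 * real (Y r)) \<le> parameters.gain z t / 2" for r
      by (rule parameters.cond_lam[OF params])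
    show "real t ^ 3 + parameters.lam z t (Y r) * ((real t)\<^sup>2 * real (Y r))
         < real (Y r ^ (2 * B + 20)) * (parameters.lam z t (Y r) * (parameters.eps a (Y r))\<^sup>2 / 4)" for r
      using parameters.cond_L[OF params, of r] unfolding paramB .
    show "real t ^ 3 < real (Y r ^ (2 * B + 4)) * (parameters.eps a (Y r))\<^sup>2" for r
      using parameters.cond_M[OF params, of r] unfolding paramB .
    show "2 ^ Y r ^ (2 * B + 4) * Y r \<le> Y (Suc r)" for r
      using parameters.cond_K[OF params, of r] unfolding paramB Y_Suc .
    show "0 < Y 0" using Yp[of 0] by simp
    show "real t ^ 3 < real R * (parameters.gain z t / 2)" by (rule R_cond)
    show "finite (X i) \<and> card (X i) = shrink (\<lambda>r. 4 * Y r ^ B) (\<lambda>r. Y r ^ (2 * B + 20)) 0 R * s0" if "i < t" for i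
      using X(1) that finV finite_subset unfolding S_def by blast
  qed (use s0_pos in auto)
  then obtain r Y' s \<chi> \<chi>' where r: "r < R" and s: "s0 \<le> s" and Y': "\<forall>i<t. Y' i \<subseteq> X i \<and> card (Y' i) = s"
    and good: "good_system t s (parameters.eps a (Y r)) (parameters.gain z t) (Y r) Y' \<chi> \<chi>' ?h"
    by (elim exE conjE)
  interpret pr: parameters z t a c "Y r" by (rule params)
  have Y'V: "Y' i \<subseteq> ?V" if "i < t" for i using Y' X(1) that by blast
  have sq: "sqrt (parameters.gain z t) = 1 / (192 * real z * real t ^ 3)"
    unfolding pr.gain_def by (rule real_sqrt_unique) auto
  interpret cs: colour_system t s "Y r" Y' \<chi> \<chi>' ?h "parameters.eps a (Y r)" "parameters.gain z t"
    "2 * parameters.pp t (Y r)" "1 / (48 * real z)"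
  proof
    show "finite (Y' i) \<and> card (Y' i) = s" if "i < t" for i
      using Y' Y'V[OF that] finV finite_subset that by blast
    show "Y' i \<inter> Y' j = {}" if "i < t" "j < t" "i \<noteq> j" for i j
    proof -
      have "X i \<inter> X j = {}" using X(2) that by blast
      moreover have "Y' i \<subseteq> X i" "Y' j \<subseteq> X j" using Y' that by auto
      ultimately show ?thesis by blast
    qed
    show "real t ^ 2 * (real (Y r) * (2 * parameters.pp t (Y r))) \<le> 1 / 4"
      unfolding pr.pp_def using pr.ry by (simp add: field_simps)
    show "real t ^ 3 * (sqrt (parameters.gain z t) / (1 / (48 * real z))) \<le> 1 / 4"
      unfolding sq using pr.ry by (simp add: field_simps)
    show "2 * parameters.eps a (Y r) \<le> (2 * parameters.pp t (Y r)) ^ 3" by (rule pr.cond_gamma3)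
  qed (use good s s0_pos pr.pp_pos pr.ry pr.gain_pos pr.eps_pos in auto)
  have YrR: "Y r \<le> Y R" using r by (intro Y_mono) simp
  have bigs: "7 / parameters.eps a (Y r) ^ 5 \<le> real (72 * z * s)"
  proof -
    have "7 / parameters.eps a (Y r) ^ 5 = 7 * real (Y r ^ (5 * B))"
      unfolding pr.eps_def paramB by (simp add: power_divide mult.commute flip: power_mult)
    also have "Y r ^ (5 * B) \<le> Y R ^ (5 * B)" by (rule power_mono[OF YrR]) simp
    also have "\<dots> \<le> Y R ^ (5 * B + 3)" using Yp[of R] by (intro power_increasing) auto
    also have "7 * real (Y R ^ (5 * B + 3)) \<le> real s"
    proof -
      have "7 * Y R ^ (5 * B + 3) \<le> s" using s0_lo s by linarith
      hence "real (7 * Y R ^ (5 * B + 3)) \<le> real s" by (rule of_nat_mono)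
      thus ?thesis by simp
    qed
    also have "real s \<le> real (72 * z * s)" using z by (intro of_nat_mono) (simp add: mult.assoc)
    finally show ?thesis by simp
  qed
  have "\<exists>v I D. chosen_parts t s (Y r) Y' \<chi> \<chi>' ?h (parameters.eps a (Y r)) (parameters.gain z t)
     (2 * parameters.pp t (Y r)) (1 / (48 * real z)) v I D (1 / real (24 * z)) (72 * z)"
    by (rule cs.choose_parts) (use z pr.eps_pos pr.pp_le bigs in \<open>auto simp: t_def\<close>)
  then obtain v I D where "chosen_parts t s (Y r) Y' \<chi> \<chi>' ?h (parameters.eps a (Y r)) (parameters.gain z t)
     (2 * parameters.pp t (Y r)) (1 / (48 * real z)) v I D (1 / real (24 * z)) (72 * z)" by (elim exE)
  then interpret cp: chosen_parts t s "Y r" Y' \<chi> \<chi>' ?h "parameters.eps a (Y r)" "parameters.gain z t"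
     "2 * parameters.pp t (Y r)" "1 / (48 * real z)" v I D "1 / real (24 * z)" "72 * z" .
  have cpp: "cp.p = parameters.pp t (Y r)" by (simp add: cp.p_def)
  have "\<exists>Gr. simple_graph Gr \<and> vertices Gr = cp.U \<and> real (card (edges Gr)) \<ge> cp.p / 4 * real (card cp.U) ^ 2 \<and>
     quasirandom_restriction (1 / real z) \<psi> H cp.U Gr"
  proof (rule cp.quasirandom_subgraph)
    show "24 * parameters.eps a (Y r) \<le> \<psi> (x ^ 3)" if "cp.p / 2 \<le> x" "x \<le> 3 / 4" for x
      by (rule pr.cond_psi[OF \<psi>]) (use that in \<open>auto simp: cpp\<close>)
    show "72 * parameters.eps a (Y r) \<le> cp.p" unfolding cpp by (rule pr.cond_density)
    show "2 * cp.p ^ 12 * (1 / real (24 * z) + 2 * (1 / (48 * real z)) + 3 / real (72 * z))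
        + (18 * real (72 * z) + 163) * parameters.eps a (Y r) \<le> 1 / real z * cp.p ^ 12 / 2"
      unfolding cpp by (rule pr.cond_octahedron)
  qed (use z in auto)
  then obtain Gr where Gr: "simple_graph Gr" "vertices Gr = cp.U"
    "real (card (edges Gr)) \<ge> cp.p / 4 * real (card cp.U) ^ 2"
    "quasirandom_restriction (1 / real z) \<psi> H cp.U Gr" by (elim exE conjE)
  have UV: "cp.U \<subseteq> ?V" unfolding cp.U_def using Y'V cp.It by blast
  have N0p: "N0 > 0" using t_pos S_pos Yp[of R] by (simp add: N0_def)
  have "real (card cp.U) \<ge> 1 / real N0 * real (card ?V)"
  proof -
    have "1 * s \<le> 72 * z * s" using z by (intro mult_right_mono) auto
    hence "s0 \<le> card cp.U" using s unfolding cp.cardU cp.n_def by linarith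
    hence "s0 * N0 \<le> card cp.U * N0" by (rule mult_right_mono) simp
    moreover have "2 * s0 * w \<le> s0 * N0"
    proof -
      have "2 * w \<le> 448 * Y R ^ (5 * B + 3) * w" using YRp[of "5 * B + 3"] by (intro mult_right_mono) auto
      hence "2 * w \<le> N0" by (simp add: N0_def w_def mult_ac)
      hence "s0 * (2 * w) \<le> s0 * N0" by (intro mult_left_mono) auto
      thus ?thesis by (simp add: mult_ac)
    qed
    ultimately have "card ?V \<le> card cp.U * N0" using Vs0 by linarith
    hence "real (card ?V) \<le> real (card cp.U * N0)" by (rule of_nat_mono)
    hence "real (card ?V) \<le> real (card cp.U) * real N0" by simp
    thus ?thesis using N0p by (simp add: divide_le_eq)
  qed
  moreover have "real (card (edges Gr)) \<ge> 1 / real N0 * real (card cp.U) ^ 2"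
  proof -
    have "4 * Y r ^ 4 \<le> N0"
    proof -
      have "Y r ^ 4 \<le> Y R ^ 4" by (rule power_mono[OF YrR]) simp
      also have "\<dots> \<le> Y R ^ (5 * B + 3)" using Yp[of R] by (intro power_increasing) (auto simp: B_def)
      finally have "4 * Y r ^ 4 \<le> 448 * 1 * Y R ^ (5 * B + 3)" by simp
      also have "\<dots> \<le> 448 * (t * S) * Y R ^ (5 * B + 3)"
        using w by (intro mult_right_mono mult_left_mono) (auto simp: w_def Suc_le_eq)
      finally show ?thesis by (simp add: N0_def mult.assoc)
    qed
    hence "real (4 * Y r ^ 4) \<le> real N0" by (rule of_nat_mono)
    hence "4 * real (Y r) ^ 4 \<le> real N0" by simp
    hence "1 / real N0 \<le> 1 / (4 * real (Y r) ^ 4)" using pr.ry N0p by (intro divide_left_mono) auto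
    also have "\<dots> \<le> cp.p / 4" using pr.pp_lower unfolding cpp by simp
    finally have "1 / real N0 * real (card cp.U) ^ 2 \<le> cp.p / 4 * real (card cp.U) ^ 2"
      by (rule mult_right_mono) simp
    thus ?thesis using Gr(3) by linarith
  qed
  ultimately show ?thesis using UV Gr by blast
qed

text \<open>Each of the \<open>R\<close> rounds shrinks the parts by at most the next stage, so
  \<open>S\<close> is at most \<open>Y R ^ R\<close>, and \<open>N0\<close> is at most a power of
  \<open>Y R\<close> with exponent at most \<open>Y R\<close>. This adds two levels to the last
  stage.\<close>

lemma N0_le_twr:
  assumes big: "\<And>y. y \<ge> y0 \<Longrightarrow> y ^ C \<le> (2::nat) ^ y" and y0R: "R + 5 * B + 7 \<le> y0"
  shows "real N0 \<le> twr_nat (y0 + 2 * R + 2)"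
proof -
  let ?y = "Y R"
  have y: "y0 \<le> ?y" by (rule Y_ge)
  have y16: "16 \<le> ?y" using y y0 by linarith
  have "S \<le> (\<Prod>i<R. ?y)"
    unfolding S_def shrink_def
  proof (rule prod_mono)
    fix i assume i: "i \<in> {..<R}"
    have "(4 * Y i ^ B) ^ Y i ^ (2 * B + 20) \<le> Y (Suc i)"
      using parameters.cond_shrink[OF params, of i] unfolding paramB Y_Suc .
    also have "\<dots> \<le> ?y" using i by (intro Y_mono) simp
    finally show "0 \<le> (4 * Y (0 + i) ^ B) ^ Y (0 + i) ^ (2 * B + 20) \<and>
        (4 * Y (0 + i) ^ B) ^ Y (0 + i) ^ (2 * B + 20) \<le> ?y" by simp
  qed
  hence S: "S \<le> ?y ^ R" by simp
  have "448 \<le> (16::nat) ^ 3" by simp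
  also have "(16::nat) ^ 3 \<le> ?y ^ 3" using y16 by (rule power_mono) simp
  finally have a: "448 \<le> ?y ^ 3" .
  have t: "t \<le> ?y ^ 1" using y y0 by (simp add: t_def)
  have "N0 \<le> ?y ^ 3 * ?y ^ 1 * ?y ^ R * ?y ^ (5 * B + 3)"
    unfolding N0_def using a t S by (intro mult_mono) auto
  also have "\<dots> = ?y ^ (R + 5 * B + 7)" by (simp add: add_ac eval_nat_numeral flip: power_add)
  also have "\<dots> \<le> ?y ^ ?y" using y y0R y16 by (intro power_increasing) auto
  also have "\<dots> \<le> (2 ^ ?y) ^ ?y" by (intro power_mono) (auto intro: less_imp_le less_exp)
  also have "\<dots> = 2 ^ (?y ^ 2)" by (simp add: power2_eq_square flip: power_mult)
  also have "\<dots> \<le> 2 ^ (2 ^ ?y)"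
  proof (rule power_increasing)
    have "?y ^ 2 \<le> ?y ^ C" using y16 by (intro power_increasing) (auto simp: C_def)
    thus "?y ^ 2 \<le> 2 ^ ?y" using big[OF y] by linarith
  qed simp
  finally have "real N0 \<le> real (2 ^ (2 ^ ?y))" by (rule of_nat_mono)
  also have "\<dots> = 2 powr (2 powr real ?y)" by (simp add: powr_realpow powr_realpow[of 2 "2 ^ ?y", simplified])
  also have "\<dots> \<le> 2 powr (2 powr twr_nat (y0 + 2 * R))"
  proof -
    have "real ?y \<le> twr_nat (y0 + 2 * R)"
      unfolding Y_def by (rule stage_le_twr[OF _ big]) (auto simp: C_def)
    thus ?thesis by simp
  qed
  also have "\<dots> = twr_nat (y0 + 2 * R + 2)" by simp
  finally show ?thesis .
qed

end

text \<open>The product of the number of colours and the size is quadratic in \<open>z\<close>, and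
  the logarithm of the base is crudely bounded by \<open>5 * z\<close>, hence the cube. The
  constants are \<open>9000 = 5 * 25 * 72\<close> and \<open>18003 = 2 * 9000 + 3\<close>.\<close>

lemma ramsey_bound_le:
  assumes z: "1 \<le> z"
  shows "ramsey_bound (24 * z + 1) (72 * z) \<le> 2 ^ (2 ^ (18003 * z ^ 3))"
proof -
  let ?k = "24 * z + 1"
  define s where "s = (?k + 1) ^ (?k * (72 * z))"
  have lin: "b * n \<le> b ^ n" if "1 \<le> n" "2 \<le> b" for b n :: nat
    using that(1)
  proof (induction n rule: dec_induct)
    case (step n)
    have "b * n + b \<le> b ^ n * b"
    proof -
      have "b * 1 \<le> b * n" using step by (intro mult_left_mono) auto
      hence "b * n + b \<le> (b * n) * 2" by simp
      also have "\<dots> \<le> b ^ n * b" using step that(2) by (intro mult_mono) auto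
      finally show ?thesis .
    qed
    thus ?case by (simp add: mult.commute)
  qed simp
  have k: "?k + 1 \<le> 2 ^ (5 * z)"
  proof -
    have "?k + 1 \<le> 32 * z" using z by simp
    also have "\<dots> \<le> 32 ^ z" by (rule lin) (use z in auto)
    also have "\<dots> = 2 ^ (5 * z)" by (simp add: power_mult)
    finally show ?thesis .
  qed
  have s: "s \<le> 2 ^ (9000 * z ^ 3)"
  proof -
    have "s \<le> (2 ^ (5 * z)) ^ (?k * (72 * z))" unfolding s_def by (rule power_mono[OF k]) simp
    also have "\<dots> = 2 ^ (5 * z * (?k * (72 * z)))" by (rule power_mult[symmetric])
    also have "\<dots> \<le> 2 ^ (5 * z * (25 * z * (72 * z)))"
      using z by (intro power_increasing mult_left_mono mult_right_mono) auto
    also have "5 * z * (25 * z * (72 * z)) = 9000 * z ^ 3" by (simp add: power3_eq_cube)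
    finally show ?thesis .
  qed
  have s0: "0 < s" by (simp add: s_def)
  have "?k ^ s < (?k + 1) ^ s" using s0 by (intro power_strict_mono) auto
  hence "(?k ^ s + 1) ^ s \<le> ((?k + 1) ^ s) ^ s" by (intro power_mono) auto
  also have "\<dots> \<le> ((2 ^ (5 * z)) ^ s) ^ s" by (intro power_mono k) auto
  also have "\<dots> = 2 ^ (5 * z * (s * s))" by (simp only: mult.assoc flip: power_mult)
  also have "\<dots> \<le> 2 ^ (2 ^ (3 * z) * (2 ^ (9000 * z ^ 3) * 2 ^ (9000 * z ^ 3)))"
  proof (intro power_increasing mult_mono s)
    have "5 * z \<le> 8 * z" by simp
    also have "\<dots> \<le> 8 ^ z" by (rule lin) (use z in auto)
    also have "\<dots> = 2 ^ (3 * z)" by (simp add: power_mult)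
    finally show "5 * z \<le> 2 ^ (3 * z)" .
  qed auto
  also have "\<dots> = 2 ^ (2 ^ (3 * z + (9000 * z ^ 3 + 9000 * z ^ 3)))" by (simp only: power_add)
  also have "\<dots> \<le> 2 ^ (2 ^ (18003 * z ^ 3))"
  proof (intro power_increasing)
    have "z ^ 1 \<le> z ^ 3" using z by (intro power_increasing) auto
    thus "3 * z + (9000 * z ^ 3 + 9000 * z ^ 3) \<le> 18003 * z ^ 3" by simp
  qed auto
  finally show ?thesis by (simp add: ramsey_bound_def Let_def s_def)
qed

text \<open>The height is a polynomial in \<open>z\<close> and \<open>t\<close>, and
  \<open>t\<close> is doubly exponential, so the height is as well. The main term is
  \<open>3 * R\<close>, which explains \<open>221184 = 3 * 2 * 192 ^ 2\<close>.\<close>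

lemma height_le:
  fixes k z t :: nat
  assumes z: "1 \<le> z" and t: "1 \<le> t" "t \<le> 2 ^ (2 ^ (18003 * z ^ 3))"
    and R: "R = 2 * 192 ^ 2 * z ^ 2 * t ^ 9 + 1"
  shows "(k + z + t + R) + 2 * R + 2 \<le> 2 ^ (2 ^ ((k + 300000) * z ^ 3))"
proof -
  let ?X = "18003 * z ^ 3" and ?w = "z ^ 2 * t ^ 9"
  have zz: "z \<le> z ^ 2" using z by (simp add: self_le_power)
  have tt: "t \<le> t ^ 9" using t by (simp add: self_le_power)
  have z1: "1 \<le> z ^ 2" and t1: "1 \<le> t ^ 9" using z t by (auto simp: one_le_power)
  have w1: "1 \<le> ?w" using mult_mono[OF z1 t1] by simp
  have wz: "z \<le> ?w" using mult_mono[OF zz t1] by simp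
  have wt: "t \<le> ?w" using mult_mono[OF z1 tt] by simp
  have wk: "k * 1 \<le> k * ?w" by (rule mult_left_mono[OF w1]) simp
  have "(k + z + t + R) + 2 * R + 2 \<le> (k + 2 + 221184 + 5) * ?w"
  proof -
    have "R = 73728 * ?w + 1" using R by (simp add: mult.assoc)
    hence "(k + z + t + R) + 2 * R + 2 = k * 1 + z + t + 221184 * ?w + 5" by simp
    also have "\<dots> \<le> k * ?w + 221191 * ?w" using w1 wz wt wk by linarith
    also have "\<dots> = (k + 2 + 221184 + 5) * ?w" by (simp add: add_mult_distrib)
    finally show ?thesis .
  qed
  also have "\<dots> \<le> 2 ^ (k + 221191) * ((2 ^ z) ^ 2 * (2 ^ (2 ^ ?X)) ^ 9)"
  proof (intro mult_mono power_mono t(2))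
    show "k + 2 + 221184 + 5 \<le> 2 ^ (k + 221191)" using less_exp[of "k + 221191"] by linarith
    show "z \<le> 2 ^ z" by (rule less_imp_le[OF less_exp])
  qed auto
  also have "\<dots> = 2 ^ (k + 221191 + (z * 2 + 2 ^ ?X * 9))"
    by (simp only: power_add power_mult)
  also have "\<dots> \<le> 2 ^ (2 ^ ((k + 300000) * z ^ 3))"
  proof (rule power_increasing)
    have "z ^ 1 \<le> z ^ 3" using z by (intro power_increasing) auto
    hence z3: "z \<le> ?X" "1 \<le> z ^ 3" using z by auto
    have "z \<le> 2 ^ ?X" using z3 less_exp[of ?X] by linarith
    moreover have "(k + 221191) * 1 \<le> (k + 221191) * 2 ^ ?X" by (rule mult_left_mono) auto
    ultimately have "k + 221191 + (z * 2 + 2 ^ ?X * 9) \<le> (k + 221202) * 2 ^ ?X" by (simp add: algebra_simps)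
    also have "\<dots> \<le> 2 ^ (k + 221202) * 2 ^ ?X"
      by (rule mult_right_mono[OF less_imp_le[OF less_exp]]) simp
    also have "\<dots> = 2 ^ (k + 221202 + ?X)" by (simp only: power_add)
    also have "\<dots> \<le> 2 ^ ((k + 300000) * z ^ 3)"
    proof (rule power_increasing)
      have "(k + 221202) * 1 \<le> (k + 221202) * z ^ 3" by (rule mult_left_mono[OF z3(2)]) simp
      thus "k + 221202 + ?X \<le> (k + 300000) * z ^ 3" by (simp add: algebra_simps)
    qed simp
    finally show "k + 221191 + (z * 2 + 2 ^ ?X * 9) \<le> 2 ^ ((k + 300000) * z ^ 3)" .
  qed simp
  finally show ?thesis .
qed

lemma rel_quasirandom_mono:
  assumes "rel_quasirandom \<eta> H G X Y Z" "\<eta> \<le> \<eta>'"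
  shows "rel_quasirandom \<eta>' H G X Y Z"
proof -
  have "0 \<le> product_density G X Y Z ^ 4" by (rule zero_le_even_power) simp
  hence "\<eta> * product_density G X Y Z ^ 4 * real (card X) ^ 2 * real (card Y) ^ 2 * real (card Z) ^ 2
     \<le> \<eta>' * product_density G X Y Z ^ 4 * real (card X) ^ 2 * real (card Y) ^ 2 * real (card Z) ^ 2"
    using assms(2) by (intro mult_right_mono) auto
  thus ?thesis using assms(1) unfolding rel_quasirandom_def Let_def by linarith
qed

lemma quasirandom_restriction_mono:
  "quasirandom_restriction \<eta> \<psi> H U G \<Longrightarrow> \<eta> \<le> \<eta>' \<Longrightarrow> quasirandom_restriction \<eta>' \<psi> H U G"
  unfolding quasirandom_restriction_def quasirandom_chain_def using rel_quasirandom_mono by blast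

text \<open>The number of vertices has to be bounded below: a graph on a single vertex has no edge,
  so no non-empty \<open>U\<close> in a one-vertex 3-graph could satisfy the edge bound. The
  polynomial \<open>P\<close> may depend on \<open>\<psi>\<close> and is fixed before
  \<open>\<eta>\<close>.\<close>

theorem theorem6p3:
  fixes \<psi> :: "real \<Rightarrow> real" and p :: "real poly"
  assumes "\<And>x. x \<in> {0<..<1} \<Longrightarrow> \<psi> x = poly p x"
    and "\<psi> \<in> {0<..<1} \<rightarrow> {0<..<1}"
  shows "\<exists>P :: real poly. \<forall>\<eta>>0. \<exists>\<delta>>0.
           1 / \<delta> \<le> twr (2 powr (2 powr (poly P (1 / \<eta>)))) \<and>
           (\<forall>H :: 'a hgraph. three_graph H \<and> real (card (vertices H)) \<ge> 1 / \<delta> \<longrightarrow>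
              (\<exists>U G. U \<subseteq> vertices H \<and> simple_graph G \<and> vertices G = U \<and>
                 real (card U) \<ge> \<delta> * real (card (vertices H)) \<and>
                 real (card (edges G)) \<ge> \<delta> * real (card U) ^ 2 \<and>
                 quasirandom_restriction \<eta> \<psi> H U G))"
proof -
  have "poly p x > 0" if "0 < x" "x < 1" for x
    using assms(1)[of x] assms(2) that by (auto simp: Pi_def)
  then obtain c a where c: "0 < c" and low: "\<And>x. 0 < x \<Longrightarrow> x \<le> 1 / 2 \<Longrightarrow> c * x ^ a \<le> poly p x"
    using poly_lower_bound by blast
  have \<psi>: "c * x ^ a \<le> \<psi> x" if "0 < x" "x \<le> 1 / 2" for x
    using low[OF that] assms(1)[of x] that by simp
  define C where "C = 2 * (15 * a + 54) + 22"
  obtain N where N: "\<And>y. y \<ge> N \<Longrightarrow> y ^ C \<le> (2::nat) ^ y" using power_le_exp2 by blast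
  \<comment> \<open>Collects every threshold that depends on \<open>\<psi>\<close> alone, through
    \<open>a\<close>, \<open>c\<close> and \<open>N\<close>.\<close>
  define k where "k = N + 16 + (15 * a + 55) + (5 * (15 * a + 54) + 7) + nat \<lceil>1 / c\<rceil>"
  \<comment> \<open>The linear factor bounds \<open>z\<close>, the integer above
    \<open>1 / \<eta>\<close>; the cube is that of \<open>height_le\<close>.\<close>
  define P :: "real poly" where "P = smult (real (k + 300000)) ([:2, 1:] ^ 3)"
  show ?thesis
  proof (intro exI[of _ P] allI impI)
    fix \<eta> :: real assume \<eta>: "0 < \<eta>"
    define z where "z = nat \<lceil>1 / \<eta>\<rceil>"
    have z_ge: "1 / \<eta> \<le> real z" by (simp add: z_def of_nat_ceiling)
    have z1: "1 \<le> z" using \<eta> by (simp add: z_def Suc_le_eq)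
    have z_le: "real z \<le> 2 + 1 / \<eta>"
    proof -
      have "0 < 1 / \<eta>" using \<eta> by simp
      hence "0 \<le> \<lceil>1 / \<eta>\<rceil>" unfolding zero_le_ceiling by linarith
      hence "real z = of_int \<lceil>1 / \<eta>\<rceil>" by (simp add: z_def)
      thus ?thesis using of_int_ceiling_le_add_one[of "1 / \<eta>"] by linarith
    qed
    define t where "t = ramsey_bound (24 * z + 1) (72 * z)"
    define R where "R = 2 * 192 ^ 2 * z ^ 2 * t ^ 9 + 1"
    \<comment> \<open>\<open>R\<close> is included because \<open>N0_le_twr\<close> absorbs
      \<open>R\<close> rounds into an exponent bounded by \<open>y0\<close>.\<close>
    define y0 where "y0 = k + z + t + R"
    interpret cn: construction z a c \<psi> y0
    proof
      have "1 / c \<le> real (nat \<lceil>1 / c\<rceil>)" by (rule of_nat_ceiling)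
      also have "\<dots> \<le> real y0" by (simp add: y0_def k_def)
      finally show "1 / c \<le> real y0" .
    qed (use z1 c \<psi> in \<open>auto simp: y0_def k_def t_def\<close>)
    have tR: "cn.t = t" "cn.R = R" by (simp_all add: cn.t_def cn.R_def t_def R_def)
    have t1: "1 \<le> t" using cn.t_pos by (simp add: tR)
    have t_le: "t \<le> 2 ^ (2 ^ (18003 * z ^ 3))" unfolding t_def by (rule ramsey_bound_le[OF z1])
    have ht: "y0 + 2 * R + 2 \<le> 2 ^ (2 ^ ((k + 300000) * z ^ 3))"
      unfolding y0_def by (rule height_le[OF z1 t1 t_le R_def])
    have "real cn.N0 \<le> twr_nat (y0 + 2 * cn.R + 2)"
    proof (rule cn.N0_le_twr)
      show "y ^ cn.C \<le> 2 ^ y" if "y0 \<le> y" for y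
        using N[of y] that by (simp add: cn.C_def cn.B_def C_def y0_def k_def)
      show "cn.R + 5 * cn.B + 7 \<le> y0" by (simp add: tR cn.B_def y0_def k_def)
    qed
    also have "\<dots> \<le> twr (2 powr (2 powr (poly P (1 / \<eta>))))"
      unfolding twr_def tR
    proof (rule twr_nat_mono)
      have "real ((k + 300000) * z ^ 3) \<le> poly P (1 / \<eta>)"
      proof -
        have "real z ^ 3 \<le> (2 + 1 / \<eta>) ^ 3" using z_le by (intro power_mono) auto
        hence "real (k + 300000) * real z ^ 3 \<le> real (k + 300000) * (2 + 1 / \<eta>) ^ 3"
          by (intro mult_left_mono) auto
        thus ?thesis by (simp add: P_def poly_power)
      qed
      hence "2 powr (2 powr real ((k + 300000) * z ^ 3)) \<le> 2 powr (2 powr (poly P (1 / \<eta>)))" by simp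
      moreover have "2 powr (2 powr real ((k + 300000) * z ^ 3)) = real (2 ^ (2 ^ ((k + 300000) * z ^ 3)))"
        by (simp only: powr_realpow powr_realpow[of 2 "2 ^ ((k + 300000) * z ^ 3)", simplified] of_nat_power of_nat_numeral zero_less_numeral)
      ultimately have "real (y0 + 2 * R + 2) \<le> 2 powr (2 powr (poly P (1 / \<eta>)))"
        using ht of_nat_mono[OF ht, where 'a=real] by linarith
      thus "y0 + 2 * R + 2 \<le> nat \<lceil>2 powr (2 powr (poly P (1 / \<eta>)))\<rceil>" by linarith
    qed
    finally have tw: "real cn.N0 \<le> twr (2 powr (2 powr (poly P (1 / \<eta>))))" .
    have "0 < cn.Y cn.R" using cn.Y_ge[of cn.R] cn.y0 by linarith
    hence N0: "0 < cn.N0" using cn.t_pos cn.S_pos by (simp add: cn.N0_def)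
    have zle: "1 / real z \<le> \<eta>" using z_ge \<eta> z1 by (simp add: field_simps)
    show "\<exists>\<delta>>0. 1 / \<delta> \<le> twr (2 powr (2 powr (poly P (1 / \<eta>)))) \<and>
           (\<forall>H :: 'a hgraph. three_graph H \<and> real (card (vertices H)) \<ge> 1 / \<delta> \<longrightarrow>
              (\<exists>U G. U \<subseteq> vertices H \<and> simple_graph G \<and> vertices G = U \<and>
                 real (card U) \<ge> \<delta> * real (card (vertices H)) \<and>
                 real (card (edges G)) \<ge> \<delta> * real (card U) ^ 2 \<and>
                 quasirandom_restriction \<eta> \<psi> H U G))"
    proof (intro exI[of _ "1 / real cn.N0"] conjI allI impI)
      show "0 < 1 / real cn.N0" using N0 by simp
      show "1 / (1 / real cn.N0) \<le> twr (2 powr (2 powr (poly P (1 / \<eta>))))" using tw by simp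
      fix H :: "'a hgraph"
      assume H: "three_graph H \<and> 1 / (1 / real cn.N0) \<le> real (card (vertices H))"
      hence "cn.N0 \<le> card (vertices H)" by simp
      then obtain U G where UG: "U \<subseteq> vertices H" "simple_graph G" "vertices G = U"
        "real (card U) \<ge> 1 / real cn.N0 * real (card (vertices H))"
        "real (card (edges G)) \<ge> 1 / real cn.N0 * real (card U) ^ 2"
        "quasirandom_restriction (1 / real z) \<psi> H U G"
        using cn.quasirandom_subset_exists[of H] H by blast
      thus "\<exists>U G. U \<subseteq> vertices H \<and> simple_graph G \<and> vertices G = U \<and>
                 real (card U) \<ge> 1 / real cn.N0 * real (card (vertices H)) \<and>
                 real (card (edges G)) \<ge> 1 / real cn.N0 * real (card U) ^ 2 \<and>
                 quasirandom_restriction \<eta> \<psi> H U G"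
        using quasirandom_restriction_mono[OF UG(6) zle] by blast
    qed
  qed
qed

end
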